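(* Let $d\ge 1$ and $A>0$. Identify the Heisenberg group $\mathsf{H}_d=\mathbb{C}^d\times\mathbb{R}$ with $\mathbb{R}^{2d+1}$, and for $\alpha>0$ and $R>0$ let $$B_R^{\alpha,A}=\{(z,t)\in\mathbb{C}^d\times\mathbb{R}=\mathbb{R}^{2d+1} : |z|^\alpha + A|t|^{\alpha/2}\le R^\alpha\},$$ with $|B_R^{\alpha,A}|$ its Lebesgue measure (which equals $R^{2d+2}|B_1^{\alpha,A}|$) and $\#(\mathbb{Z}^{2d+1}\cap B_R^{\alpha,A})$ the number of integer points in it. Then, as $R\to\infty$: (1) For $d\ge1$ and $\alpha=2$, $$\Big|\#(\mathbb{Z}^{2d+1}\cap B_R^{2,A})-|B_R^{2,A}|\Big|\lesssim R^{2d},$$ and this is best possible: it is not true that $\#(\mathbb{Z}^{2d+1}\cap B_R^{2,A})-|B_R^{2,A}|=o(R^{2d})$ as $R\to\infty$. (2) For $d=1$ and $\alpha>2$, $$\Big|\#(\mathbb{Z}^{3}\cap B_R^{\alpha,A})-|B_R^{\alpha,A}|\Big|\lesssim R^{2+\max\{0,\delta(\alpha)\}}\log R,\qquad \delta(\alpha)=\frac{1-\frac4\alpha}{\frac32-\frac2\alpha}$$ (so that $\max\{0,\delta(\alpha)\}=0$ for $2<\alpha\le4$). (3) For $d\ge2$ and $\alpha>0$, $$\Big|\#(\mathbb{Z}^{2d+1}\cap B_R^{\alpha,A})-|B_R^{\alpha,A}|\Big|\lesssim\begin{cases} R^4(\log R)^{2/3}, & d=2,\\ R^{2d}, & d\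ge3.\end{cases}$$
   Context: Here $|z|$ is the Euclidean norm of $z\in\mathbb{C}^d\cong\mathbb{R}^{2d}$. The notation $f\lesssim g$ means $f\le Cg$ for a constant $C$ independent of $R$ (for $R$ large), which may depend on $d,\alpha,A$.
   Formalization: The claim in (1) that the bound is best possible (the difference is not o(R^{2d})) is stated only for rational A>0; for irrational A it is false, since |z|^2/A is equidistributed mod 1 and the difference is o(R^{2d}). *)

theory Defs
  imports "HOL-Analysis.Analysis" "HOL-Library.Landau_Symbols"
begin

text \<open>The underlying space of the Heisenberg group with \<open>d = CARD('n)\<close>.  As a real Euclidean space it has
  dimension \<open>2 d + 1\<close>, so \<^const>\<open>norm\<close> on \<^typ>\<open>complex ^ 'n\<close> is the Euclidean norm of \<open>\<real>\<^sup>2\<^sup>d\<close> and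
  \<^const>\<open>lebesgue\<close> is the Lebesgue measure of \<open>\<real>\<^bsup>2d+1\<^esup>\<close>.\<close>

type_synonym 'n heisenberg = "(complex ^ 'n) \<times> real"

definition heis_ball :: "real \<Rightarrow> real \<Rightarrow> real \<Rightarrow> 'n::finite heisenberg set" where
  "heis_ball \<alpha> A R = {(z, t). norm z powr \<alpha> + A * \<bar>t\<bar> powr (\<alpha> / 2) \<le> R powr \<alpha>}"

definition integer_points :: "'n::finite heisenberg set" where
  "integer_points = {(z, t). (\<forall>i. Re (z $ i) \<in> \<int> \<and> Im (z $ i) \<in> \<int>) \<and> t \<in> \<int>}"

definition discrepancy :: "'n::finite heisenberg set \<Rightarrow> real" where
  "discrepancy B = real (card (integer_points \<inter> B)) - measure lebesgue B"

definition \<delta> :: "real \<Rightarrow> real" where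
  "\<delta> \<alpha> = (1 - 4 / \<alpha>) / (3 / 2 - 2 / \<alpha>)"

text \<open>For \<open>\<alpha> = 2\<close> the optimality of the exponent \<open>2 d\<close> depends on \<open>A\<close>.  If \<open>A\<close> is rational, the values of
  \<open>\<bar>z\<bar>\<^sup>2 + A \<bar>t\<bar>\<close> at integer points lie in a discrete set, and suitable spheres carry of the order of \<open>R\<^bsup>2d\<^esup>\<close>
  integer points.  If \<open>A\<close> is irrational, \<open>\<bar>z\<bar>\<^sup>2 / A\<close> is equidistributed modulo \<open>1\<close> and the discrepancy
  is \<open>o(R\<^bsup>2d\<^esup>)\<close>.  Optimality is therefore only claimed for rational \<open>A\<close>.\<close>

text \<open>The next two facts ensure that neither \<^const>\<open>card\<close> nor \<^const>\<open>measure\<close> takes its default value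
  for infinite arguments in \<^const>\<open>discrepancy\<close>.\<close>

lemma compact_heis_ball:
  fixes A \<alpha> R :: real
  assumes "A > 0" "\<alpha> > 0"
  shows "compact (heis_ball \<alpha> A R :: 'n::finite heisenberg set)"
proof -
  let ?B = "heis_ball \<alpha> A R :: 'n heisenberg set"
  have eq: "?B = {p. norm (fst p) powr \<alpha> + A * \<bar>snd p\<bar> powr (\<alpha> / 2) \<le> R powr \<alpha>}"
    by (auto simp: heis_ball_def)
  have "closed ?B"
    unfolding eq using assms
    by (intro closed_Collect_le continuous_intros continuous_on_powr') auto
  moreover have "bounded ?B"
  proof -
    define M where "M = (R powr \<alpha>) powr (1 / \<alpha>)"
    define N where "N = (R powr \<alpha> / A) powr (2 / \<alpha>)"
    have "?B \<subseteq> cball 0 M \<times> cball 0 N"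
    proof (clarsimp simp: heis_ball_def)
      fix z :: "complex ^ 'n" and t :: real
      assume h: "norm z powr \<alpha> + A * \<bar>t\<bar> powr (\<alpha> / 2) \<le> R powr \<alpha>"
      have "0 \<le> A * \<bar>t\<bar> powr (\<alpha> / 2)" "0 \<le> norm z powr \<alpha>"
        using assms by auto
      with h have 1: "norm z powr \<alpha> \<le> R powr \<alpha>" and "A * \<bar>t\<bar> powr (\<alpha> / 2) \<le> R powr \<alpha>"
        by linarith+
      then have 2: "\<bar>t\<bar> powr (\<alpha> / 2) \<le> R powr \<alpha> / A"
        using assms by (simp add: field_simps)
      have "(norm z powr \<alpha>) powr (1 / \<alpha>) \<le> M"
        unfolding M_def using assms by (intro powr_mono2[OF _ _ 1]) auto
      moreover have "(\<bar>t\<bar> powr (\<alpha> / 2)) powr (2 / \<alpha>) \<le> N"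
        unfolding N_def using assms by (intro powr_mono2[OF _ _ 2]) auto
      ultimately show "norm z \<le> M \<and> \<bar>t\<bar> \<le> N"
        using assms by (simp add: powr_powr)
    qed
    then show ?thesis
      by (rule bounded_subset[OF bounded_Times[OF bounded_cball bounded_cball]])
  qed
  ultimately show ?thesis
    by (simp add: compact_eq_bounded_closed)
qed

lemma finite_integer_points:
  fixes B :: "'n::finite heisenberg set"
  assumes "bounded B"
  shows "finite (integer_points \<inter> B)"
proof -
  obtain M where M: "\<And>p. p \<in> B \<Longrightarrow> norm p \<le> M"
    using assms by (auto simp: bounded_iff)
  define I where "I = {x \<in> \<int>. \<bar>x\<bar> \<le> M}"
  have finI: "finite I"
    unfolding I_def by (rule finite_abs_int_segment)
  define Z where "Z = (\<lambda>f::'n \<Rightarrow> real \<times> real. \<chi> i. Complex (fst (f i)) (snd (f i)))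
      ` (UNIV \<rightarrow>\<^sub>E I \<times> I)"
  have "finite Z"
    unfolding Z_def using finI by (intro finite_imageI finite_PiE) auto
  moreover have "integer_points \<inter> B \<subseteq> Z \<times> I"
  proof clarify
    fix z :: "complex ^ 'n" and t :: real
    assume "(z, t) \<in> integer_points" "(z, t) \<in> B"
    then have int: "\<And>i. Re (z $ i) \<in> \<int>" "\<And>i. Im (z $ i) \<in> \<int>" "t \<in> \<int>"
      and le: "norm z \<le> M" "\<bar>t\<bar> \<le> M"
      using M[of "(z, t)"] norm_fst_le[of z t] norm_snd_le[of t z]
      by (auto simp: integer_points_def)
    have "norm (z $ i) \<le> M" for i
      using Finite_Cartesian_Product.norm_nth_le[of z i] le by linarith
    then have "\<bar>Re (z $ i)\<bar> \<le> M" "\<bar>Im (z $ i)\<bar> \<le> M" for i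
      using abs_Re_le_cmod abs_Im_le_cmod order_trans by blast+
    then have "z \<in> Z"
      unfolding Z_def using int
      by (intro image_eqI[of _ _ "\<lambda>i. (Re (z $ i), Im (z $ i))"])
         (auto simp: vec_eq_iff I_def)
    then show "z \<in> Z \<and> t \<in> I"
      using int le by (simp add: I_def)
  qed
  ultimately show ?thesis
    using finI by (meson finite_SigmaI finite_subset)
qed

end

theory Submission
  imports Defs "HOL-Analysis.Analysis" "HOL-Real_Asymp.Real_Asymp"
begin

text \<open>Write \<open>X = R\<^sup>2\<close>, \<open>a = \<alpha>/2\<close> and \<open>g(s) = (X\<^sup>a - s\<^sup>a)\<^bsup>1/a\<^esup>\<close>. The ball is \<open>\<bar>t\<bar> \<le> A\<^bsup>-1/a\<^esup> g(\<bar>z\<bar>\<^sup>2)\<close>, so, counting \<open>t\<close>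
  first, its discrepancy is \<open>2 A\<^bsup>-1/a\<^esup>\<close> times the difference of the sum of \<open>g(\<bar>z\<bar>\<^sup>2)\<close> over \<open>\<int>\<^bsup>2d\<^esup>\<close> and its integral over
  \<open>\<real>\<^bsup>2d\<^esup>\<close>, up to an error of at most \<open>1\<close> for each of the \<open>O(R\<^bsup>2d\<^esup>)\<close> integer points \<open>z\<close>.

  For \<open>d \<ge> 2\<close>, Jacobi's four square theorem turns the sum over four coordinates into weighted sums over
  arithmetic progressions, which the second mean value theorem compares with integrals up to \<open>O(X\<^sup>2)\<close>. Integration
  over four coordinates makes \<open>g\<close> smooth enough for the midpoint rule in the remaining coordinates. This gives
  \<open>O(R\<^bsup>2d\<^esup>)\<close>, without a logarithm even for \<open>d = 2\<close>.

  For \<open>d = 1\<close> the difference is the integral of \<open>- g'(s) E(s)\<close>, where \<open>E(s)\<close> is the error in the circle problem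
  for the radius \<open>\<surd>s\<close>. Expanding Bernoulli functions into Fourier series and applying van der Corput's
  inequality, one finds that the primitive of \<open>E\<close> is \<open>O(X)\<close> on \<open>[0, X]\<close> and has increments \<open>O(\<surd>(X h))\<close> over intervals of
  length \<open>h \<ge> 1\<close>. For \<open>\<alpha> = 2\<close> one has \<open>g' = -1\<close>. For \<open>\<alpha> > 2\<close> a dyadic decomposition towards the
  singularity of \<open>g'\<close> at \<open>X\<close>, down to distance \<open>X\<^bsup>1/3\<^esup>\<close>, yields \<open>X\<^bsup>max(1, 4/3 - 2/(3a))\<^esup> log X\<close>.\<close>

section \<open>Jacobi's four square theorem\<close>

text \<open>The obstacle is the edge of g. For a > 1 its derivative grows like (X - s)^(1/a - 1)
  near X, and for a < 1 like s^(a - 1) near 0. Sums and integrals are therefore compared through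
  integrals against -g', in which only integrals of an oscillating factor over intervals are needed.
  For d = 1 the primitive of E is easier than E: its Fourier coefficients decay like 1/k^2, so the
  series converges absolutely and needs no truncation. The cut X^(1/3) is the length h at which the
  bound sqrt (X h) / h for averages of E equals h, the order of the drift that the monotone lattice
  count permits over that length; there E itself is O(h). For d \<ge> 2 a trivial estimate of the
  progression of step q costs X^2 / q, and summation over q up to X would produce a logarithm. The
  remainder is however a sawtooth of mean zero times monotone factors. This leaves X (X/q)^\<kappa>
  with \<kappa> < 1, which sums to O(X^2).\<close>

definition rep4 :: "int \<Rightarrow> (int \<times> int \<times> int \<times> int) set" where
  "rep4 n = {(x, y, z, w). x\<^sup>2 + y\<^sup>2 + z\<^sup>2 + w\<^sup>2 = n}"

definition rep5 :: "int \<Rightarrow> (int \<times> int \<times> int \<times> int \<times> int) set" where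
  "rep5 n = {(v, x, y, z, w). v\<^sup>2 + x\<^sup>2 + y\<^sup>2 + z\<^sup>2 + w\<^sup>2 = n}"

lemma abs_le_of_square_le:
  fixes x n :: int
  assumes "x\<^sup>2 \<le> n"
  shows "x \<in> {-n..n}"
proof -
  have "\<bar>x\<bar> \<le> \<bar>x\<bar>\<^sup>2"
    using self_le_power[of "\<bar>x\<bar>" 2] by (cases "x = 0") auto
  then show ?thesis
    using assms by auto
qed

lemma finite_rep4: "finite (rep4 n)"
proof (rule finite_subset)
  have "x \<in> {-n..n} \<and> y \<in> {-n..n} \<and> z \<in> {-n..n} \<and> w \<in> {-n..n}"
    if "x\<^sup>2 + y\<^sup>2 + z\<^sup>2 + w\<^sup>2 = n" for x y z w
    by (intro conjI abs_le_of_square_le)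
       (use that in \<open>smt (verit) zero_le_power2\<close>)+
  then show "rep4 n \<subseteq> {-n..n} \<times> {-n..n} \<times> {-n..n} \<times> {-n..n}"
    unfolding rep4_def by blast
qed auto

lemma rep4_neg: "n < 0 \<Longrightarrow> rep4 n = {}"
  unfolding rep4_def by (auto, smt (verit) zero_le_power2)

text \<open>The set is symmetric in its five coordinates, so each squared coordinate accounts for
  one fifth of the total.\<close>

lemma sum_rep5_first: "(\<Sum>(v,x,y,z,w)\<in>rep5 n. n - 5 * v\<^sup>2) = 0"
proof -
  have eq: "(\<Sum>(v,x,y,z,w)\<in>rep5 n. x\<^sup>2) = (\<Sum>(v,x,y,z,w)\<in>rep5 n. v\<^sup>2)"
       "(\<Sum>(v,x,y,z,w)\<in>rep5 n. y\<^sup>2) = (\<Sum>(v,x,y,z,w)\<in>rep5 n. v\<^sup>2)"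
       "(\<Sum>(v,x,y,z,w)\<in>rep5 n. z\<^sup>2) = (\<Sum>(v,x,y,z,w)\<in>rep5 n. v\<^sup>2)"
       "(\<Sum>(v,x,y,z,w)\<in>rep5 n. w\<^sup>2) = (\<Sum>(v,x,y,z,w)\<in>rep5 n. v\<^sup>2)"
    subgoal by (rule sum.reindex_bij_witness[of _ "\<lambda>(v,x,y,z,w). (x,v,y,z,w)" "\<lambda>(v,x,y,z,w). (x,v,y,z,w)"])
      (auto simp: rep5_def)
    subgoal by (rule sum.reindex_bij_witness[of _ "\<lambda>(v,x,y,z,w). (y,x,v,z,w)" "\<lambda>(v,x,y,z,w). (y,x,v,z,w)"])
      (auto simp: rep5_def)
    subgoal by (rule sum.reindex_bij_witness[of _ "\<lambda>(v,x,y,z,w). (z,x,y,v,w)" "\<lambda>(v,x,y,z,w). (z,x,y,v,w)"])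
      (auto simp: rep5_def)
    subgoal by (rule sum.reindex_bij_witness[of _ "\<lambda>(v,x,y,z,w). (w,x,y,z,v)" "\<lambda>(v,x,y,z,w). (w,x,y,z,v)"])
      (auto simp: rep5_def)
    done
  have "(\<Sum>(v,x,y,z,w)\<in>rep5 n. n) = (\<Sum>(v,x,y,z,w)\<in>rep5 n. v\<^sup>2 + x\<^sup>2 + y\<^sup>2 + z\<^sup>2 + w\<^sup>2)"
    by (rule sum.cong) (auto simp: rep5_def)
  also have "\<dots> = 5 * (\<Sum>(v,x,y,z,w)\<in>rep5 n. v\<^sup>2)"
    using eq by (simp add: sum.distrib split_def)
  finally show ?thesis
    by (simp add: sum_subtractf split_def sum_distrib_left)
qed

text \<open>This recurrence determines the number of representations from its value at \<open>0\<close>. Jacobi's divisor sum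
  satisfies it as well, by telescoping along the rivers below.\<close>

lemma rep4_recurrence: "(\<Sum>x\<in>{-n..n}. (n - 5 * x\<^sup>2) * int (card (rep4 (n - x\<^sup>2)))) = 0"
proof -
  have "rep5 n = Sigma {-n..n} (\<lambda>v. rep4 (n - v\<^sup>2))"
  proof -
    have "v \<in> {-n..n}" if "v\<^sup>2 + x\<^sup>2 + y\<^sup>2 + z\<^sup>2 + w\<^sup>2 = n" for v x y z w
      by (rule abs_le_of_square_le) (use that in \<open>smt (verit) zero_le_power2\<close>)
    then show ?thesis
      unfolding rep5_def rep4_def by (auto simp: algebra_simps)
  qed
  then have "(\<Sum>(v,x,y,z,w)\<in>rep5 n. n - 5 * v\<^sup>2) = (\<Sum>v\<in>{-n..n}. \<Sum>q\<in>rep4 (n - v\<^sup>2). n - 5 * v\<^sup>2)"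
    by (subst sum.Sigma) (simp_all add: finite_rep4 split_def)
  then show ?thesis
    using sum_rep5_first[of n] by (simp add: mult.commute)
qed

text \<open>The triples \<open>(d, x, e)\<close> are the indefinite forms \<open>d u\<^sup>2 + 2 x u v - e v\<^sup>2\<close> of determinant \<open>-n\<close>, that is, the
  edges of the rivers of Conway's topographs; \<open>river_next\<close> moves one edge downstream.\<close>

definition river :: "int \<Rightarrow> (int \<times> int \<times> int) set" where
  "river n = {(d, x, e). d > 0 \<and> e > 0 \<and> x\<^sup>2 + d * e = n}"

text \<open>The sign in Jacobi's divisor sum. A move replaces d or e by a number congruent to d + e
  modulo 2, so the sign is constant along a river.\<close>

definition river_sign :: "int \<times> int \<times> int \<Rightarrow> int" where
  "river_sign = (\<lambda>(d, x, e). if even d \<and> even e then -1 else 1)"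

text \<open>The form takes the value d + 2x - e at (1, 1). The sign of this value tells on which
  bank (1, 1) lies, and (1, 1) replaces the basis vector of the same bank: the substitution is u ->
  u + v or v -> u + v. \<open>river_prev\<close> does the same with (1, -1).\<close>

definition river_next :: "int \<times> int \<times> int \<Rightarrow> int \<times> int \<times> int" where
  "river_next = (\<lambda>(d, x, e). if e > d + 2 * x then (d, x + d, e - 2 * x - d) else (d + 2 * x - e, x - e, e))"

definition river_prev :: "int \<times> int \<times> int \<Rightarrow> int \<times> int \<times> int" where
  "river_prev = (\<lambda>(d, x, e). if e > d - 2 * x then (d, x - d, e + 2 * x - d) else (d - 2 * x - e, x + e, e))"

text \<open>On \<open>river n\<close>, where x^2 + d e = n, this is (d + e) (n - 5 x^2), the term
  that the divisor sum contributes to the recurrence.\<close>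

definition river_weight :: "int \<times> int \<times> int \<Rightarrow> int" where
  "river_weight = (\<lambda>(d, x, e). (d + e) * (d * e - 4 * x\<^sup>2))"

text \<open>Twice a discrete primitive of \<^const>\<open>river_weight\<close> along the river.\<close>

definition river_primitive :: "int \<times> int \<times> int \<Rightarrow> int" where
  "river_primitive = (\<lambda>(d, x, e). 4 * (d + e) * x\<^sup>2 - 2 * x * (d\<^sup>2 - e\<^sup>2) - d * e * (d + e))"

text \<open>Here the form vanishes at (1, 1), and \<open>river_next\<close> would leave
  \<open>river n\<close> with d = 0. On such an edge (x + d)^2 = n, so that n is a square.\<close>

definition river_end :: "(int \<times> int \<times> int) set" where
  "river_end = {(d, x, e). e = d + 2 * x}"

definition river_start :: "(int \<times> int \<times> int) set" where
  "river_start = {(d, x, e). e = d - 2 * x}"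

lemma finite_river: "finite (river n)"
proof (rule finite_subset)
  have "d \<in> {-n..n} \<and> x \<in> {-n..n} \<and> e \<in> {-n..n}" if "d > 0" "e > 0" "x\<^sup>2 + d * e = n" for d x e
  proof -
    have "d * 1 \<le> d * e" "1 * e \<le> d * e"
      using that by (intro mult_left_mono mult_right_mono; simp)+
    moreover have "x \<in> {-n..n}"
      using that mult_pos_pos[of d e] by (intro abs_le_of_square_le) auto
    ultimately show ?thesis
      using that by (auto, (smt (verit) zero_le_power2)+)
  qed
  then show "river n \<subseteq> {-n..n} \<times> {-n..n} \<times> {-n..n}"
    unfolding river_def by blast
qed auto

lemma river_next_primitive:
  "s \<notin> river_end \<Longrightarrow> river_primitive (river_next s) - river_primitive s = 2 * river_weight s"
  by (cases s)
     (auto simp: river_primitive_def river_next_def river_weight_def power2_eq_square algebra_simps)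

lemma river_next_sign: "river_sign (river_next s) = river_sign s"
  by (cases s) (auto simp: river_sign_def river_next_def)

text \<open>On the new edge the form takes at (1, -1) the value that was dropped, d or -e. Its sign
  identifies the branch, so \<open>river_prev\<close> inverts \<open>river_next\<close>.\<close>

lemma sum_river_next:
  "(\<Sum>s\<in>river n - river_end. f (river_next s)) = (\<Sum>s\<in>river n - river_start. f s)"
  by (rule sum.reindex_bij_witness[of _ river_prev river_next])
     (auto simp: river_def river_end_def river_start_def river_next_def river_prev_def
        power2_eq_square algebra_simps split: if_splits)

text \<open>Telescoping along the river cancels the inner edges. An end edge has no successor and
  keeps its weight; the factor 2 is that of \<open>river_primitive\<close>.\<close>

lemma river_sum:
  "2 * (\<Sum>s\<in>river n. river_sign s * river_weight s) =
     (\<Sum>s\<in>river n \<inter> river_end. river_sign s * (2 * river_weight s + river_primitive s))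
     - (\<Sum>s\<in>river n \<inter> river_start. river_sign s * river_primitive s)"
proof -
  let ?E = "river_end" and ?B = "river_start"
  have split: "(\<Sum>s\<in>river n. f s) = (\<Sum>s\<in>river n - E. f s) + (\<Sum>s\<in>river n \<inter> E. f s)"
    for f :: "_ \<Rightarrow> int" and E
    using sum.Int_Diff[OF finite_river, of f n E] by simp
  have "2 * (\<Sum>s\<in>river n - ?E. river_sign s * river_weight s)
      = (\<Sum>s\<in>river n - ?E. river_sign (river_next s) * river_primitive (river_next s) - river_sign s * river_primitive s)"
    unfolding sum_distrib_left
    by (intro sum.cong refl) (auto simp: river_next_sign right_diff_distrib[symmetric] river_next_primitive)
  also have "\<dots> = (\<Sum>s\<in>river n - ?B. river_sign s * river_primitive s) - (\<Sum>s\<in>river n - ?E. river_sign s * river_primitive s)"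
    by (simp add: sum_subtractf sum_river_next[of "\<lambda>s. river_sign s * river_primitive s"])
  also have "\<dots> = (\<Sum>s\<in>river n \<inter> ?E. river_sign s * river_primitive s) - (\<Sum>s\<in>river n \<inter> ?B. river_sign s * river_primitive s)"
    using split[of "\<lambda>s. river_sign s * river_primitive s" ?E] split[of "\<lambda>s. river_sign s * river_primitive s" ?B]
    by linarith
  finally show ?thesis
    using split[of "\<lambda>s. river_sign s * river_weight s" ?E]
    by (simp add: sum.distrib algebra_simps sum_distrib_left)
qed

text \<open>Evaluates the boundary terms that remain for n = k^2.\<close>

lemma alternating_sum:
  "(\<Sum>x\<in>{-int k<..<int k}. (if even (int k - x) then -1 else 1) * ((int k)\<^sup>2 - x\<^sup>2)) = int k"
proof -
  have s0: "(\<Sum>x\<in>{-int k..int k}. (if even x then 1 else -1)) = (if even k then 1 else -1 :: int)" for k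
  proof (induction k)
    case (Suc k)
    have "{-int (Suc k)..int (Suc k)} = insert (- int (Suc k)) (insert (int (Suc k)) {-int k..int k})" by auto
    then show ?case using Suc by auto
  qed auto
  have s2: "(\<Sum>x\<in>{-int k..int k}. (if even x then 1 else -1) * x\<^sup>2) = (if even k then 1 else -1 :: int) * (int k * (int k + 1))" for k
  proof (induction k)
    case (Suc k)
    have "{-int (Suc k)..int (Suc k)} = insert (- int (Suc k)) (insert (int (Suc k)) {-int k..int k})" by auto
    then show ?case using Suc by (auto simp: power2_eq_square algebra_simps)
  qed auto
  \<comment> \<open>The terms at x = k and x = -k vanish, so the closed interval may be used, for
    which \<open>s0\<close> and \<open>s2\<close> hold by induction.\<close>
  have "(\<Sum>x\<in>{-int k<..<int k}. (if even (int k - x) then -1 else 1) * ((int k)\<^sup>2 - x\<^sup>2)) =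
    (\<Sum>x\<in>{-int k..int k}. (if even (int k - x) then -1 else 1) * ((int k)\<^sup>2 - x\<^sup>2))"
  proof (rule sum.mono_neutral_left)
    have "x = int k \<or> x = - int k" if "x \<in> {-int k..int k} - {-int k<..<int k}" for x
      using that by auto
    then show "\<forall>x\<in>{-int k..int k} - {-int k<..<int k}.
        (if even (int k - x) then -1 else 1) * ((int k)\<^sup>2 - x\<^sup>2) = 0"
      by fastforce
  qed auto
  also have "\<dots> = (if even k then -1 else 1) * (\<Sum>x\<in>{-int k..int k}. (if even x then 1 else -1) * (int k)\<^sup>2 - (if even x then 1 else -1) * x\<^sup>2)"
    unfolding sum_distrib_left by (intro sum.cong refl) (auto simp: algebra_simps)
  also have "\<dots> = int k"
    unfolding sum_subtractf s2 sum_distrib_right[symmetric] s0 by (simp add: power2_eq_square algebra_simps)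
  finally show ?thesis .
qed

text \<open>An end edge satisfies (x + d)^2 = k^2 with x + d > 0, hence d = k - x and e = k + x with
  \<bar>x\<bar> < k; the starting edges are the mirror images. Both boundary sums reduce to
  \<open>alternating_sum\<close>.\<close>

lemma river_weight_sum_square:
  assumes "k > 0"
  shows "(\<Sum>s\<in>river ((int k)\<^sup>2). river_sign s * river_weight s) = 2 * (int k)\<^sup>2"
proof -
  let ?k = "int k"
  let ?I = "{-?k<..<?k}"
  have sq: "y = ?k" if "y\<^sup>2 = ?k\<^sup>2" "y > 0" for y :: int
    using that assms by (simp add: power2_eq_iff)
  have E: "river (?k\<^sup>2) \<inter> river_end = (\<lambda>x. (?k - x, x, ?k + x)) ` ?I"
  proof (intro equalityI subsetI)
    fix s assume "s \<in> river (?k\<^sup>2) \<inter> river_end"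
    then obtain d x e where s: "s = (d, x, e)" "d > 0" "e > 0" "x\<^sup>2 + d * e = ?k\<^sup>2" "e = d + 2 * x"
      by (auto simp: river_def river_end_def)
    then have "(x + d)\<^sup>2 = ?k\<^sup>2" "x + d > 0"
      by (auto simp: power2_eq_square algebra_simps)
    from sq[OF this] s show "s \<in> (\<lambda>x. (?k - x, x, ?k + x)) ` ?I"
      by (auto simp: image_iff)
  qed (auto simp: river_def river_end_def power2_eq_square algebra_simps)
  have B: "river (?k\<^sup>2) \<inter> river_start = (\<lambda>x. (?k + x, x, ?k - x)) ` ?I"
  proof (intro equalityI subsetI)
    fix s assume "s \<in> river (?k\<^sup>2) \<inter> river_start"
    then obtain d x e where s: "s = (d, x, e)" "d > 0" "e > 0" "x\<^sup>2 + d * e = ?k\<^sup>2" "e = d - 2 * x"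
      by (auto simp: river_def river_start_def)
    then have "(d - x)\<^sup>2 = ?k\<^sup>2" "d - x > 0"
      by (auto simp: power2_eq_square algebra_simps)
    from sq[OF this] s show "s \<in> (\<lambda>x. (?k + x, x, ?k - x)) ` ?I"
      by (auto simp: image_iff)
  qed (auto simp: river_def river_start_def power2_eq_square algebra_simps)
  have sgn1: "river_sign (?k - x, x, ?k + x) = (if even (?k - x) then -1 else 1)"
    and sgn2: "river_sign (?k + x, x, ?k - x) = (if even (?k - x) then -1 else 1)" for x
    by (auto simp: river_sign_def)
  have ends: "2 * river_weight (?k - x, x, ?k + x) + river_primitive (?k - x, x, ?k + x) = 2 * ?k * (?k\<^sup>2 - x\<^sup>2)"
    and starts: "river_primitive (?k + x, x, ?k - x) = -2 * ?k * (?k\<^sup>2 - x\<^sup>2)" for x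
    unfolding river_weight_def river_primitive_def prod.case by algebra+
  have "2 * (\<Sum>s\<in>river (?k\<^sup>2). river_sign s * river_weight s) =
     (\<Sum>x\<in>?I. (if even (?k - x) then -1 else 1) * (2 * ?k * (?k\<^sup>2 - x\<^sup>2)))
     - (\<Sum>x\<in>?I. (if even (?k - x) then -1 else 1) * (-2 * ?k * (?k\<^sup>2 - x\<^sup>2)))"
    unfolding river_sum E B
  proof (intro arg_cong2[where f = "(-)"])
    show "(\<Sum>s\<in>(\<lambda>x. (?k - x, x, ?k + x)) ` ?I. river_sign s * (2 * river_weight s + river_primitive s))
      = (\<Sum>x\<in>?I. (if even (?k - x) then -1 else 1) * (2 * ?k * (?k\<^sup>2 - x\<^sup>2)))"
      by (subst sum.reindex) (auto simp: inj_on_def sgn1 ends intro!: sum.cong)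
    show "(\<Sum>s\<in>(\<lambda>x. (?k + x, x, ?k - x)) ` ?I. river_sign s * river_primitive s)
      = (\<Sum>x\<in>?I. (if even (?k - x) then -1 else 1) * (-2 * ?k * (?k\<^sup>2 - x\<^sup>2)))"
      by (subst sum.reindex) (auto simp: inj_on_def sgn2 starts intro!: sum.cong)
  qed
  also have "\<dots> = 4 * ?k * (\<Sum>x\<in>?I. (if even (?k - x) then -1 else 1) * (?k\<^sup>2 - x\<^sup>2))"
    unfolding sum_distrib_left sum_subtractf[symmetric] by (intro sum.cong refl) (auto simp: algebra_simps)
  also have "\<dots> = 4 * ?k * ?k"
    by (simp only: alternating_sum)
  finally show ?thesis by (simp add: power2_eq_square)
qed

text \<open>Without ends and starts \<open>river_next\<close> permutes the edges, and nothing
  remains of the telescoping sum.\<close>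

lemma river_weight_sum_nonsquare:
  assumes "\<And>k::int. k\<^sup>2 \<noteq> n"
  shows "(\<Sum>s\<in>river n. river_sign s * river_weight s) = 0"
proof -
  have "river n \<inter> river_end = {}"
  proof -
    have False if "x\<^sup>2 + d * (d + 2 * x) = n" for x d
      using assms[of "x + d"] that by (simp add: power2_eq_square algebra_simps)
    then show ?thesis by (auto simp: river_def river_end_def)
  qed
  moreover have "river n \<inter> river_start = {}"
  proof -
    have False if "x\<^sup>2 + d * (d - 2 * x) = n" for x d
      using assms[of "d - x"] that by (simp add: power2_eq_square algebra_simps)
    then show ?thesis by (auto simp: river_def river_start_def)
  qed
  ultimately show ?thesis using river_sum[of n] by simp
qed

definition divpairs :: "int \<Rightarrow> (int \<times> int) set" where
  "divpairs n = {(d, e). d > 0 \<and> e > 0 \<and> d * e = n}"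

text \<open>For n > 0 this is 8 sigma(n) - 32 sigma(n/4), the second term being 0 unless 4 divides
  n; see \<open>jacobi4_eq\<close>. The form that is symmetric in d and e is the one that can be
  summed over rivers.\<close>

definition jacobi4 :: "int \<Rightarrow> int" where
  "jacobi4 n = (if n = 0 then 1 else \<Sum>(d,e)\<in>divpairs n. 4 * (if even d \<and> even e then -1 else 1) * (d + e))"

lemma finite_divpairs: "finite (divpairs n)"
proof (rule finite_subset)
  have "d \<in> {0..n} \<and> e \<in> {0..n}" if "d > 0" "e > 0" "d * e = n" for d e
    using that mult_left_mono[of 1 e d] mult_right_mono[of 1 d e] by auto
  then show "divpairs n \<subseteq> {0..n} \<times> {0..n}"
    unfolding divpairs_def by auto
qed auto

lemma divpairs_nonpos: "n \<le> 0 \<Longrightarrow> divpairs n = {}"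
  unfolding divpairs_def by (auto, smt (verit) mult_pos_pos)

text \<open>The divisor sums combine to 4 times the weighted sum over \<open>river n\<close>. For n
  = k^2 this is 8 n. It is cancelled by x = k and x = -k, which add -4 n each: there the divisor sum
  is empty but \<open>jacobi4 0\<close> is 1.\<close>

lemma jacobi4_recurrence:
  assumes "n > 0"
  shows "(\<Sum>x\<in>{-n..n}. (n - 5 * x\<^sup>2) * jacobi4 (n - x\<^sup>2)) = 0"
proof -
  let ?w = "\<lambda>d e. 4 * (if even d \<and> even e then -1 else 1) * (d + e) :: int"
  have bij: "(\<Sum>p\<in>Sigma {-n..n} (\<lambda>x. divpairs (n - x\<^sup>2)). (\<lambda>(x,d,e). (n - 5 * x\<^sup>2) * ?w d e) p)
      = (\<Sum>s\<in>river n. 4 * (river_sign s * river_weight s))"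
  proof (rule sum.reindex_bij_witness[of _ "\<lambda>(d,x,e). (x,d,e)" "\<lambda>(x,d,e). (d,x,e)"])
    fix s assume s: "s \<in> river n"
    obtain d x e where sd: "s = (d,x,e)" by (cases s)
    have "x \<in> {-n..n}"
      using s mult_pos_pos[of d e] unfolding sd river_def by (intro abs_le_of_square_le) auto
    then show "(case s of (d,x,e) \<Rightarrow> (x,d,e)) \<in> Sigma {-n..n} (\<lambda>x. divpairs (n - x\<^sup>2))"
      using s unfolding sd river_def divpairs_def by (auto simp: algebra_simps)
  next
    fix p assume p: "p \<in> Sigma {-n..n} (\<lambda>x. divpairs (n - x\<^sup>2))"
    obtain x d e where pd: "p = (x,d,e)" by (cases p)
    have n: "n = x\<^sup>2 + d * e" using p unfolding pd divpairs_def by auto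
    show "4 * (river_sign (case p of (x,d,e) \<Rightarrow> (d,x,e)) * river_weight (case p of (x,d,e) \<Rightarrow> (d,x,e)))
       = (case p of (x,d,e) \<Rightarrow> (n - 5 * x\<^sup>2) * ?w d e)"
      unfolding pd n by (auto simp: river_sign_def river_weight_def algebra_simps)
  qed (auto simp: river_def divpairs_def algebra_simps)
  define Z where "Z = {x\<in>{-n..n}. x\<^sup>2 = n}"
  have "(\<Sum>x\<in>{-n..n}. (n - 5 * x\<^sup>2) * jacobi4 (n - x\<^sup>2))
      = (\<Sum>x\<in>{-n..n}. (\<Sum>(d,e)\<in>divpairs (n - x\<^sup>2). (n - 5 * x\<^sup>2) * ?w d e) + (if x\<^sup>2 = n then - 4 * n else 0))"
    by (intro sum.cong refl) (auto simp: jacobi4_def divpairs_nonpos sum_distrib_left split_def)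
  also have "\<dots> = 4 * (\<Sum>s\<in>river n. river_sign s * river_weight s) - 4 * n * int (card Z)"
    unfolding sum.distrib sum_distrib_left bij[symmetric] Z_def
    by (subst sum.Sigma) (auto simp: finite_divpairs split_def sum.If_cases Int_def)
  also have "\<dots> = 0"
  proof (cases "\<exists>k::int. k\<^sup>2 = n")
    case True
    then obtain k0 :: int where "k0\<^sup>2 = n" by auto
    define k where "k = nat \<bar>k0\<bar>"
    have k: "(int k)\<^sup>2 = n" "k > 0" using \<open>k0\<^sup>2 = n\<close> assms by (auto simp: k_def)
    have "x\<^sup>2 = n \<longleftrightarrow> x = int k \<or> x = - int k" for x
      using k(1) by (metis power2_eq_iff)
    moreover have "int k \<in> {-n..n}" "- int k \<in> {-n..n}"
      using k(1) by (auto intro!: abs_le_of_square_le simp del: atLeastAtMost_iff)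
    ultimately have "Z = {int k, - int k}" unfolding Z_def by auto
    then have "card Z = 2" using k(2) by auto
    then show ?thesis using river_weight_sum_square[OF k(2)] k(1) by simp
  next
    case False
    then have "Z = {}" unfolding Z_def by auto
    then show ?thesis using river_weight_sum_nonsquare[of n] False by simp
  qed
  finally show ?thesis .
qed

theorem jacobi_four_squares: "n \<ge> 0 \<Longrightarrow> int (card (rep4 n)) = jacobi4 n"
proof (induction "nat n" arbitrary: n rule: less_induct)
  case less
  show ?case
  proof (cases "n = 0")
    case True
    have "rep4 0 = {(0,0,0,0)}"
      unfolding rep4_def by (auto, (smt (verit) zero_le_power2 power2_less_eq_zero_iff)+)
    then show ?thesis using True by (simp add: jacobi4_def)
  next
    case False
    then have n: "n > 0" using less.prems by simp
    have rest: "(\<Sum>x\<in>{-n..n} - {0}. (n - 5 * x\<^sup>2) * int (card (rep4 (n - x\<^sup>2))))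
      = (\<Sum>x\<in>{-n..n} - {0}. (n - 5 * x\<^sup>2) * jacobi4 (n - x\<^sup>2))"
    proof (intro sum.cong refl)
      fix x assume x: "x \<in> {-n..n} - {0}"
      then have "x\<^sup>2 > 0" by simp
      show "(n - 5 * x\<^sup>2) * int (card (rep4 (n - x\<^sup>2))) = (n - 5 * x\<^sup>2) * jacobi4 (n - x\<^sup>2)"
      proof (cases "n - x\<^sup>2 \<ge> 0")
        case True
        then show ?thesis using less.hyps[of "n - x\<^sup>2"] \<open>x\<^sup>2 > 0\<close> by simp
      next
        case False
        then show ?thesis by (simp add: rep4_neg jacobi4_def divpairs_nonpos)
      qed
    qed
    have "n * int (card (rep4 n)) + (\<Sum>x\<in>{-n..n} - {0}. (n - 5 * x\<^sup>2) * int (card (rep4 (n - x\<^sup>2)))) = 0"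
      using rep4_recurrence[of n] n
        sum.remove[of "{-n..n}" 0 "\<lambda>x. (n - 5 * x\<^sup>2) * int (card (rep4 (n - x\<^sup>2)))"] by simp
    moreover have "n * jacobi4 n + (\<Sum>x\<in>{-n..n} - {0}. (n - 5 * x\<^sup>2) * jacobi4 (n - x\<^sup>2)) = 0"
      using jacobi4_recurrence[OF n] n
        sum.remove[of "{-n..n}" 0 "\<lambda>x. (n - 5 * x\<^sup>2) * jacobi4 (n - x\<^sup>2)"] by simp
    ultimately have "n * int (card (rep4 n)) = n * jacobi4 n"
      using rest by linarith
    then show ?thesis using n by simp
  qed
qed

text \<open>Swapping d and e shows that both halves of the sum agree, and the pairs of even numbers
  are (2d, 2e) with 4 d e = n. Summed over n, each of the two terms runs over arithmetic
  progressions with weight d.\<close>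

lemma jacobi4_eq:
  assumes "n > 0"
  shows "jacobi4 n = 8 * (\<Sum>(d,e)\<in>divpairs n. d) - 32 * (\<Sum>(d,e)\<in>{(d, e). d > 0 \<and> e > 0 \<and> 4 * d * e = n}. d)"
proof -
  let ?s = "\<lambda>d e. if even d \<and> even e then -1 else 1 :: int"
  let ?D = "{(d, e). d > 0 \<and> e > 0 \<and> 4 * d * e = n}"
  have swap: "(\<Sum>(d,e)\<in>divpairs n. ?s d e * e) = (\<Sum>(d,e)\<in>divpairs n. ?s d e * d)"
    by (rule sum.reindex_bij_witness[of _ prod.swap prod.swap]) (auto simp: divpairs_def mult.commute)
  have "(\<Sum>(d,e)\<in>divpairs n. ?s d e * d)
      = (\<Sum>(d,e)\<in>divpairs n. d - 2 * (if even d \<and> even e then d else 0))"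
    by (rule sum.cong) auto
  also have "\<dots> = (\<Sum>(d,e)\<in>divpairs n. d) - 2 * (\<Sum>(d,e)\<in>divpairs n. if even d \<and> even e then d else 0)"
    by (simp add: sum_subtractf split_def sum_distrib_left)
  also have "(\<Sum>(d,e)\<in>divpairs n. if even d \<and> even e then d else 0)
      = (\<Sum>(d,e)\<in>{p\<in>divpairs n. even (fst p) \<and> even (snd p)}. d)"
    by (rule sum.mono_neutral_cong_right) (auto simp: finite_divpairs split: if_splits)
  also have "\<dots> = (\<Sum>(d,e)\<in>?D. 2 * d)"
    by (rule sum.reindex_bij_witness[of _ "\<lambda>(d,e). (2*d,2*e)" "\<lambda>(d,e). (d div 2,e div 2)"])
       (auto simp: divpairs_def elim!: evenE)
  finally have "(\<Sum>(d,e)\<in>divpairs n. ?s d e * d) = (\<Sum>(d,e)\<in>divpairs n. d) - 4 * (\<Sum>(d,e)\<in>?D. d)"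
    by (simp add: split_def sum_distrib_left)
  moreover have "jacobi4 n = 4 * ((\<Sum>(d,e)\<in>divpairs n. ?s d e * d) + (\<Sum>(d,e)\<in>divpairs n. ?s d e * e))"
    using assms by (simp add: jacobi4_def sum.distrib[symmetric] sum_distrib_left split_def distrib_left algebra_simps)
  ultimately show ?thesis unfolding swap by simp
qed

section \<open>Exponential sums over the circle\<close>

lemma cot_le_cot:
  fixes x y :: real
  assumes "0 < x" "x \<le> y" "y < pi"
  shows "cot y \<le> cot x"
proof -
  have pos: "sin x > 0" "sin y > 0"
    using assms by (auto intro!: sin_gt_zero)
  have "cot x - cot y = sin (y - x) / (sin x * sin y)"
    using pos by (simp add: cot_def sin_diff field_simps)
  moreover have "sin (y - x) \<ge> 0"
    using assms by (intro sin_ge_zero) auto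
  ultimately show ?thesis
    using pos by (smt (verit) divide_nonneg_pos mult_pos_pos)
qed

lemma cot_le_inverse:
  fixes x :: real
  assumes "0 < x" "x \<le> pi / 2"
  shows "cot x \<le> 1 / x"
proof -
  have "0 * cos 0 - sin 0 \<ge> x * cos x - sin x"
  proof (rule DERIV_nonpos_imp_nonincreasing[OF less_imp_le[OF assms(1)]])
    fix y assume y: "0 \<le> y" "y \<le> x"
    have "((\<lambda>y. y * cos y - sin y) has_real_derivative (- y * sin y)) (at y)"
      by (auto intro!: derivative_eq_intros)
    moreover have "- y * sin y \<le> 0"
      using y assms by (auto intro!: mult_nonneg_nonneg sin_ge_zero)
    ultimately show "\<exists>d. ((\<lambda>y. y * cos y - sin y) has_real_derivative d) (at y) \<and> d \<le> 0"
      by blast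
  qed
  moreover have "sin x > 0"
    using assms by (intro sin_gt_zero) auto
  ultimately show ?thesis
    using assms by (simp add: cot_def divide_simps mult.commute)
qed

lemma abs_cot_le:
  fixes t \<rho> :: real
  assumes "0 < \<rho>" "\<rho> \<le> t" "t \<le> 1 - \<rho>"
  shows "\<bar>cot (pi * t)\<bar> \<le> 1 / \<rho>"
proof -
  have d: "\<rho> \<le> 1/2" using assms by simp
  have "cot (pi * t) \<le> cot (pi * \<rho>)"
    using assms d by (intro cot_le_cot) auto
  moreover have "cot (pi * (1 - \<rho>)) \<le> cot (pi * t)"
    using assms d by (intro cot_le_cot) auto
  moreover have "cot (pi * (1 - \<rho>)) = - cot (pi * \<rho>)"
    by (simp add: cot_def right_diff_distrib cos_diff sin_diff)
  moreover have "cot (pi * \<rho>) \<le> 1 / (pi * \<rho>)"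
    using assms d by (intro cot_le_inverse) auto
  moreover have "1 / (pi * \<rho>) \<le> 1 / \<rho>"
    using assms pi_gt_zero pi_ge_two by (intro divide_left_mono) (auto simp: mult_le_cancel_right1)
  ultimately show ?thesis by linarith
qed

text \<open>This is 1 / (1 - cis (2\<theta>)) = (1 + i cot \<theta>) / 2. The real part is constant,
  so all variation sits in the cotangent, which is monotone.\<close>

lemma one_minus_cis_times_cot:
  assumes "sin \<theta> \<noteq> 0"
  shows "(1 - cis (2 * \<theta>)) * Complex (1/2) (cot \<theta> / 2) = 1"
proof -
  have "1 - cis (2 * \<theta>) = Complex (2 * (sin \<theta>)\<^sup>2) (- 2 * sin \<theta> * cos \<theta>)"
    by (simp add: complex_eq_iff cos_double_sin sin_double)
  moreover have "2 * (sin \<theta>)\<^sup>2 * (cos \<theta> / sin \<theta> / 2) = sin \<theta> * cos \<theta>"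
    and "2 * sin \<theta> * cos \<theta> * (cos \<theta> / sin \<theta> / 2) = (cos \<theta>)\<^sup>2"
    using assms by (simp_all add: power2_eq_square)
  ultimately show ?thesis
    by (simp add: complex_eq_iff cot_def)
qed

text \<open>Summation by parts. With the boundary term on the left-hand side, passing from q to
  \<open>Suc q\<close> adds the single term \<open>e (Suc q) * (c (Suc q) - c q)\<close>.\<close>

lemma norm_sum_by_parts_le:
  fixes e :: "nat \<Rightarrow> complex" and c :: "nat \<Rightarrow> real"
  assumes e: "\<And>n. norm (e n) \<le> 1"
    and c: "\<And>n. p \<le> n \<Longrightarrow> n < q \<Longrightarrow> c n \<le> c (Suc n)" and pq: "p \<le> q"
  shows "norm ((\<Sum>n=p..q. (e n - e (Suc n)) * of_real (c n)) + e (Suc q) * of_real (c q))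
     \<le> \<bar>c p\<bar> + (c q - c p)"
  using pq c
proof (induction q rule: dec_induct)
  case base
  have "norm (e p * of_real (c p)) \<le> 1 * \<bar>c p\<bar>"
    unfolding norm_mult using e by (intro mult_mono) auto
  then show ?case by (simp add: algebra_simps)
next
  case (step q)
  let ?T = "(\<Sum>n=p..q. (e n - e (Suc n)) * of_real (c n)) + e (Suc q) * of_real (c q)"
  have "c q \<le> c (Suc q)" using step by auto
  then have "norm (of_real (c (Suc q) - c q) :: complex) = c (Suc q) - c q"
    by (subst norm_of_real) simp
  then have "norm (e (Suc q) * of_real (c (Suc q) - c q)) \<le> 1 * (c (Suc q) - c q)"
    unfolding norm_mult using e \<open>c q \<le> c (Suc q)\<close> by (intro mult_mono) auto
  moreover have "norm ?T \<le> \<bar>c p\<bar> + (c q - c p)"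
    using step by auto
  moreover have "(\<Sum>n=p..Suc q. (e n - e (Suc n)) * of_real (c n)) + e (Suc (Suc q)) * of_real (c (Suc q))
      = ?T + e (Suc q) * of_real (c (Suc q) - c q)"
    using step by (simp add: algebra_simps)
  ultimately show ?case
    using norm_triangle_ineq[of ?T "e (Suc q) * of_real (c (Suc q) - c q)"] by simp
qed

text \<open>Each term is (e n - e (n + 1)) times (1 + i cot (\<pi> t)) / 2, where t is the
  difference of \<phi> minus m. The constant part telescopes. The differences decrease, so the
  cotangents increase; they are bounded by 1/\<rho>, and summation by parts does the rest.\<close>

lemma kusmin_landau:
  fixes \<phi> :: "nat \<Rightarrow> real" and \<rho> :: real and m :: int
  assumes \<rho>: "0 < \<rho>" "\<rho> \<le> 1"
    and range: "\<And>n. p \<le> n \<Longrightarrow> n < q \<Longrightarrow> m + \<rho> \<le> \<phi> (Suc n) - \<phi> n \<and> \<phi> (Suc n) - \<phi> n \<le> m + 1 - \<rho>"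
    and mono: "\<And>n. p \<le> n \<Longrightarrow> Suc n < q \<Longrightarrow> \<phi> (Suc (Suc n)) - \<phi> (Suc n) \<le> \<phi> (Suc n) - \<phi> n"
    and pq: "p \<le> q"
  shows "norm (\<Sum>n=p..q. cis (2 * pi * \<phi> n)) \<le> 4 / \<rho>"
proof (cases "p = q")
  case True
  then show ?thesis using \<rho> by simp
next
  case False
  then obtain r where r: "q = Suc r" "p \<le> r"
    using pq by (cases q) auto
  define e where "e n = cis (2 * pi * \<phi> n)" for n
  define t where "t n = \<phi> (Suc n) - \<phi> n - m" for n
  define c where "c n = cot (pi * t n)" for n
  have t: "\<rho> \<le> t n" "t n \<le> 1 - \<rho>" if "p \<le> n" "n \<le> r" for n
    using range[of n] that r by (auto simp: t_def)
  have e1: "norm (e n) \<le> 1" for n by (simp add: e_def)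
  have cb: "\<bar>c n\<bar> \<le> 1 / \<rho>" if "p \<le> n" "n \<le> r" for n
    unfolding c_def using t[OF that] \<rho> by (intro abs_cot_le) auto
  have cm: "c n \<le> c (Suc n)" if "p \<le> n" "n < r" for n
  proof -
    have "t (Suc n) \<le> t n" using mono[of n] that r by (simp add: t_def)
    moreover have "pi * t n < pi * 1"
      using t[of n] that \<rho> by (intro mult_strict_left_mono) auto
    moreover have "t (Suc n) > 0" using t[of "Suc n"] that \<rho> by auto
    ultimately show ?thesis
      unfolding c_def by (intro cot_le_cot) auto
  qed
  have step: "e n = (e n - e (Suc n)) * (1/2) + (\<i>/2) * ((e n - e (Suc n)) * of_real (c n))"
    if "p \<le> n" "n \<le> r" for n
  proof -
    have "sin (pi * t n) > 0"
      using t[OF that] \<rho> mult_strict_left_mono[of "t n" 1 pi] by (intro sin_gt_zero) auto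
    then have "(1 - cis (2 * (pi * t n))) * Complex (1/2) (c n / 2) = 1"
      unfolding c_def by (intro one_minus_cis_times_cot) simp
    moreover have "e (Suc n) = e n * cis (2 * (pi * t n))"
    proof -
      have "cis (2 * (pi * t n)) = cis (2 * pi * \<phi> (Suc n) - 2 * pi * \<phi> n - 2 * pi * of_int m)"
        by (simp add: t_def algebra_simps)
      also have "\<dots> = cis (2 * pi * \<phi> (Suc n)) / cis (2 * pi * \<phi> n)"
        by (simp add: cis_divide[symmetric] cis_multiple_2pi)
      finally show ?thesis by (simp add: e_def)
    qed
    ultimately have "e n = (e n - e (Suc n)) * Complex (1/2) (c n / 2)"
      by (metis mult.assoc mult.right_neutral right_diff_distrib)
    also have "Complex (1/2) (c n / 2) = 1/2 + \<i>/2 * of_real (c n)"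
      by (simp add: complex_eq_iff)
    also have "(e n - e (Suc n)) * (1/2 + \<i>/2 * of_real (c n))
        = (e n - e (Suc n)) * (1/2) + (\<i>/2) * ((e n - e (Suc n)) * of_real (c n))"
      by (simp only: distrib_left mult.left_commute)
    finally show ?thesis .
  qed
  define T where "T = (\<Sum>n=p..r. (e n - e (Suc n)) * of_real (c n))"
  have "(\<Sum>n=p..r. e n) = (\<Sum>n=p..r. (e n - e (Suc n)) * (1/2) + (\<i>/2) * ((e n - e (Suc n)) * of_real (c n)))"
    by (intro sum.cong step) auto
  also have "\<dots> = (\<Sum>n=p..r. e n - e (Suc n)) * (1/2) + (\<i>/2) * T"
    unfolding T_def sum.distrib sum_distrib_left sum_distrib_right ..
  also have "(\<Sum>n=p..r. e n - e (Suc n)) = e p - e (Suc r)"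
    using r sum_Suc_diff'[of p "Suc r" "\<lambda>n. - e n"]
    by (simp add: atLeastLessThanSuc_atLeastAtMost)
  finally have "(\<Sum>n=p..q. e n) = (e p - e (Suc r)) * (1/2) + (\<i>/2) * T + e (Suc r)"
    using r by simp
  also have "norm \<dots> \<le> norm ((e p - e (Suc r)) * (1/2)) + norm ((\<i>/2) * T) + norm (e (Suc r))"
    by (rule norm_triangle_mono[OF norm_triangle_ineq order.refl])
  also have "norm ((e p - e (Suc r)) * (1/2)) \<le> 1"
    using norm_triangle_ineq4[of "e p" "e (Suc r)"] e1[of p] e1[of "Suc r"]
    by (simp add: norm_mult norm_divide)
  also have "norm ((\<i>/2) * T) = norm T / 2" by (simp add: norm_mult norm_divide)
  also have "norm T \<le> 4 / \<rho>"
  proof -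
    have "norm (T + e (Suc r) * of_real (c r)) \<le> \<bar>c p\<bar> + (c r - c p)"
      unfolding T_def using e1 cm r by (intro norm_sum_by_parts_le) auto
    moreover have "norm (e (Suc r) * of_real (c r)) \<le> 1 * \<bar>c r\<bar>"
      unfolding norm_mult using e1 by (intro mult_mono) auto
    moreover have "\<bar>c p\<bar> \<le> 1 / \<rho>" "\<bar>c r\<bar> \<le> 1 / \<rho>" using cb r by auto
    moreover have "norm T \<le> norm (T + e (Suc r) * of_real (c r)) + norm (e (Suc r) * of_real (c r))"
      by (metis add_diff_cancel_right' norm_triangle_ineq4)
    ultimately show ?thesis by linarith
  qed
  also have "norm (e (Suc r)) \<le> 1" by (rule e1)
  also have "1 + 4 / \<rho> / 2 + 1 \<le> 4 / \<rho>"
    using \<rho> by (simp add: field_simps)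
  finally show ?thesis unfolding e_def by simp
qed

section \<open>Van der Corput's inequality for concave phases\<close>

lemma card_differences_le:
  fixes D :: "nat \<Rightarrow> real" and T :: "nat set"
  assumes "\<mu> > 0" "\<rho> \<ge> 0"
    and T: "T \<subseteq> {p..<q}" "\<And>n. n \<in> T \<Longrightarrow> x \<le> D n \<and> D n \<le> x + \<rho>"
    and D: "\<And>n. p \<le> n \<Longrightarrow> Suc n < q \<Longrightarrow> D (Suc n) \<le> D n - \<mu>"
  shows "real (card T) \<le> \<rho> / \<mu> + 1"
proof (cases "T = {}")
  case True
  then show ?thesis using assms by simp
next
  case False
  have fin: "finite T" using T finite_subset by blast
  have gap: "D j \<le> D i - \<mu> * (real j - real i)" if "i \<le> j" "p \<le> i" "j < q" for i j
    using that
  proof (induction j rule: dec_induct)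
    case (step j)
    then show ?case using D[of j] by (auto simp: algebra_simps)
  qed auto
  define i j where "i = Min T" and "j = Max T"
  have ij: "i \<in> T" "j \<in> T" "i \<le> j"
    using fin False by (auto simp: i_def j_def)
  have "T \<subseteq> {i..j}" using fin by (auto simp: i_def j_def)
  then have "card T \<le> card {i..j}"
    by (intro card_mono) auto
  then have "real (card T) \<le> real j - real i + 1"
    using ij by auto
  moreover have "\<mu> * (real j - real i) \<le> \<rho>"
    using gap[of i j] T(2)[of i] T(2)[of j] ij T(1) by force
  then have "real j - real i \<le> \<rho> / \<mu>"
    using assms(1) by (simp add: pos_le_divide_eq mult.commute)
  ultimately show ?thesis by linarith
qed

text \<open>Differences within \<rho> of m or of m + 1 occur at most \<rho>/\<mu> + 1 times each and
  are estimated trivially. The indices in between form an interval, on which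
  \<open>kusmin_landau\<close> gives 4/\<rho>. The choice \<rho> = sqrt \<mu> balances \<rho>/\<mu>
  with 1/\<rho>.\<close>

lemma van_der_corput_window:
  fixes \<phi> :: "nat \<Rightarrow> real" and m :: int
  defines "D \<equiv> \<lambda>n. \<phi> (Suc n) - \<phi> n"
  assumes \<mu>: "\<mu> > 0"
    and D: "\<And>n. p \<le> n \<Longrightarrow> Suc n < q \<Longrightarrow> D (Suc n) \<le> D n - \<mu>"
  shows "norm (\<Sum>n | n \<in> {p..<q} \<and> \<lfloor>D n\<rfloor> = m. cis (2 * pi * \<phi> n)) \<le> 6 * (1 / sqrt \<mu> + 1)"
proof -
  define W where "W = {n. n \<in> {p..<q} \<and> \<lfloor>D n\<rfloor> = m}"
  have W: "m \<le> D n" "D n < m + 1" if "n \<in> W" for n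
    using that unfolding W_def by (auto simp: floor_eq_iff)
  have finW: "finite W" by (simp add: W_def)
  have triv: "norm (\<Sum>n\<in>T. cis (2 * pi * \<phi> n)) \<le> real (card T)" for T :: "nat set"
    using norm_sum[of "\<lambda>n. cis (2 * pi * \<phi> n)" T] by simp
  have "norm (\<Sum>n\<in>W. cis (2 * pi * \<phi> n)) \<le> 6 * (1 / sqrt \<mu> + 1)"
  proof (cases "\<mu> \<ge> 1/4")
    \<comment> \<open>With spacing at least 1/4 the window holds at most five indices. A smaller
      \<mu> makes \<rho> at most 1/2, so that the two outer strips are disjoint.\<close>
    case True
    have "real (card W) \<le> 1 / \<mu> + 1"
      using \<mu> D W by (intro card_differences_le[of \<mu> 1 W p q m D]) (auto simp: W_def less_imp_le)
    moreover have "1 / \<mu> \<le> 4" using True \<mu> by (simp add: field_simps)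
    moreover have "6 * 1 \<le> 6 * (1 / sqrt \<mu> + 1)" using \<mu> by (intro mult_left_mono) auto
    ultimately show ?thesis using triv[of W] by linarith
  next
    case False
    define \<rho> where "\<rho> = sqrt \<mu>"
    have \<rho>: "0 < \<rho>" "\<rho> \<le> 1/2" "\<rho> * \<rho> = \<mu>"
      using False \<mu> real_sqrt_le_mono[of \<mu> "1/4"] by (auto simp: \<rho>_def real_sqrt_divide)
    define A where "A = {n\<in>W. D n < m + \<rho>}"
    define B where "B = {n\<in>W. D n > m + 1 - \<rho>}"
    define M where "M = {n\<in>W. m + \<rho> \<le> D n \<and> D n \<le> m + 1 - \<rho>}"
    have part: "W = A \<union> (B \<union> M)" "A \<inter> (B \<union> M) = {}" "B \<inter> M = {}"
      using \<rho> by (auto simp: A_def B_def M_def)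
    have fin: "finite A" "finite B" "finite M"
      using finW by (auto simp: A_def B_def M_def)
    have "\<rho> / \<mu> = 1 / \<rho>" using \<rho>(1) unfolding \<rho>(3)[symmetric] by simp
    have "real (card A) \<le> \<rho> / \<mu> + 1"
      using \<mu> \<rho> D W by (intro card_differences_le[of \<mu> \<rho> A p q m D]) (auto simp: A_def W_def less_imp_le)
    moreover have "real (card B) \<le> \<rho> / \<mu> + 1"
      using \<mu> \<rho> D W by (intro card_differences_le[of \<mu> \<rho> B p q "m + 1 - \<rho>" D]) (auto simp: B_def W_def less_imp_le)
    moreover have "norm (\<Sum>n\<in>M. cis (2 * pi * \<phi> n)) \<le> 4 / \<rho>"
    proof (cases "M = {}")
      case True
      then show ?thesis using \<rho> by simp
    next
      case False
      define i j where "i = Min M" and "j = Max M"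
      have ij: "i \<in> M" "j \<in> M" "i \<le> j"
        using fin False by (auto simp: i_def j_def)
      have dec: "D l \<le> D k" if "k \<le> l" "p \<le> k" "l < q" for k l
        using that
      proof (induction l rule: dec_induct)
        case (step l)
        then show ?case using D[of l] \<mu> by auto
      qed auto
      have pq: "p \<le> i" "j < q" using ij by (auto simp: M_def W_def)
      have M: "M = {i..j}"
      proof (intro equalityI subsetI)
        fix n assume "n \<in> {i..j}"
        then have n: "D j \<le> D n" "D n \<le> D i" "p \<le> n" "n < q"
          using dec[of n j] dec[of i n] pq by auto
        have "m + \<rho> \<le> D j" "D i \<le> m + 1 - \<rho>" using ij by (auto simp: M_def)
        with n have mn: "m + \<rho> \<le> D n \<and> D n \<le> m + 1 - \<rho>" by linarith
        then have "\<lfloor>D n\<rfloor> = m" using \<rho> by (auto simp: floor_eq_iff)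
        with mn n show "n \<in> M" by (auto simp: M_def W_def)
      qed (use fin in \<open>auto simp: i_def j_def\<close>)
      have Mn: "m + \<rho> \<le> D n \<and> D n \<le> m + 1 - \<rho>" if "i \<le> n" "n \<le> j" for n
      proof -
        have "n \<in> M" using that unfolding M by simp
        then show ?thesis unfolding M_def by simp
      qed
      show ?thesis
        unfolding M
      proof (rule kusmin_landau)
        show "m + \<rho> \<le> \<phi> (Suc n) - \<phi> n \<and> \<phi> (Suc n) - \<phi> n \<le> m + 1 - \<rho>" if "i \<le> n" "n < j" for n
          using Mn[of n] that by (auto simp: D_def)
        show "\<phi> (Suc (Suc n)) - \<phi> (Suc n) \<le> \<phi> (Suc n) - \<phi> n" if "i \<le> n" "Suc n < j" for n
          using D[of n] that pq \<mu> by (auto simp: D_def)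
      qed (use \<rho> ij in auto)
    qed
    moreover have "(\<Sum>n\<in>W. cis (2 * pi * \<phi> n)) = (\<Sum>n\<in>A. cis (2 * pi * \<phi> n)) + ((\<Sum>n\<in>B. cis (2 * pi * \<phi> n)) + (\<Sum>n\<in>M. cis (2 * pi * \<phi> n)))"
      using part fin by (simp only: part(1) sum.union_disjoint finite_UnI)
    then have "norm (\<Sum>n\<in>W. cis (2 * pi * \<phi> n)) \<le> norm (\<Sum>n\<in>A. cis (2 * pi * \<phi> n)) + (norm (\<Sum>n\<in>B. cis (2 * pi * \<phi> n)) + norm (\<Sum>n\<in>M. cis (2 * pi * \<phi> n)))"
      by (simp only:) (intro order.trans[OF norm_triangle_ineq] add_left_mono norm_triangle_ineq)
    ultimately have "norm (\<Sum>n\<in>W. cis (2 * pi * \<phi> n)) \<le> (1 / \<rho> + 1) + ((1 / \<rho> + 1) + 4 / \<rho>)"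
      using triv[of A] triv[of B] unfolding \<open>\<rho> / \<mu> = 1 / \<rho>\<close>
      by (meson add_mono order.trans)
    also have "\<dots> \<le> 6 * (1 / \<rho> + 1)" by simp
    finally show ?thesis unfolding \<rho>_def .
  qed
  then show ?thesis unfolding W_def .
qed

text \<open>The differences meet at most 2\<Lambda> + 2 unit windows. The last index has no
  difference and is added with absolute value 1, which raises the constant from 12 to 13.\<close>

lemma van_der_corput_second_difference:
  fixes \<phi> :: "nat \<Rightarrow> real"
  assumes \<mu>: "\<mu> > 0" and \<Lambda>: "\<Lambda> \<ge> 0"
    and range: "\<And>n. p \<le> n \<Longrightarrow> Suc n < q \<Longrightarrow> \<bar>\<phi> (Suc n) - \<phi> n\<bar> \<le> \<Lambda>"
    and second: "\<And>n. p \<le> n \<Longrightarrow> Suc (Suc n) < q \<Longrightarrow> \<phi> (Suc (Suc n)) - \<phi> (Suc n) \<le> \<phi> (Suc n) - \<phi> n - \<mu>"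
  shows "norm (\<Sum>n=p..<q. cis (2 * pi * \<phi> n)) \<le> 13 * (\<Lambda> + 1) * (1 / sqrt \<mu> + 1)"
proof (cases "p < q")
  case False
  then show ?thesis using \<mu> \<Lambda> by simp
next
  case True
  then obtain r where r: "q = Suc r" "p \<le> r" by (cases q) auto
  define D where "D n = \<phi> (Suc n) - \<phi> n" for n
  let ?e = "\<lambda>n. cis (2 * pi * \<phi> n)"
  define I where "I = {-\<lceil>\<Lambda>\<rceil>..\<lfloor>\<Lambda>\<rfloor>}"
  have "(\<Sum>n=p..<r. ?e n) = (\<Sum>m\<in>I. \<Sum>n | n \<in> {p..<r} \<and> \<lfloor>D n\<rfloor> = m. ?e n)"
  proof (rule sum.group[symmetric])
    show "(\<lambda>n. \<lfloor>D n\<rfloor>) ` {p..<r} \<subseteq> I"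
    proof clarify
      fix n assume "n \<in> {p..<r}"
      then have "\<bar>D n\<bar> \<le> \<Lambda>" using range[of n] r by (auto simp: D_def)
      then show "\<lfloor>D n\<rfloor> \<in> I"
        unfolding I_def by (auto intro!: floor_mono) (linarith)
    qed
  qed (auto simp: I_def)
  also have "norm \<dots> \<le> (\<Sum>m\<in>I. 6 * (1 / sqrt \<mu> + 1))"
  proof (intro sum_norm_le)
    fix m
    show "norm (\<Sum>n | n \<in> {p..<r} \<and> \<lfloor>D n\<rfloor> = m. ?e n) \<le> 6 * (1 / sqrt \<mu> + 1)"
      unfolding D_def using second r \<mu> by (intro van_der_corput_window) auto
  qed
  also have "\<dots> = real (card I) * (6 * (1 / sqrt \<mu> + 1))" by simp
  also have "\<dots> \<le> (2 * \<Lambda> + 2) * (6 * (1 / sqrt \<mu> + 1))"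
  proof (rule mult_right_mono)
    show "real (card I) \<le> 2 * \<Lambda> + 2" unfolding I_def using \<Lambda> by simp linarith
  qed (use \<mu> in auto)
  also have "\<dots> = 12 * ((\<Lambda> + 1) * (1 / sqrt \<mu> + 1))"
    by (simp only: distrib_left distrib_right)
  finally have "norm (\<Sum>n=p..<r. ?e n) \<le> 12 * ((\<Lambda> + 1) * (1 / sqrt \<mu> + 1))" .
  moreover have "norm (\<Sum>n=p..<q. ?e n) \<le> norm (\<Sum>n=p..<r. ?e n) + 1"
    using r norm_triangle_ineq[of "\<Sum>n=p..<r. ?e n" "?e r"] by simp
  moreover have "1 * 1 \<le> (\<Lambda> + 1) * (1 / sqrt \<mu> + 1)"
    using \<Lambda> \<mu> by (intro mult_mono) auto
  ultimately show ?thesis by (simp only: mult.assoc)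
qed

section \<open>The phases k sqrt (s - x^2) on the circle\<close>

lemma sqrt_second_difference:
  fixes s x U :: real
  assumes s: "(x - 1)\<^sup>2 \<le> s" "(x + 1)\<^sup>2 \<le> s"
    and U: "U > 0" "sqrt (s - (x - 1)\<^sup>2) \<le> U" "sqrt (s - x\<^sup>2) \<le> U" "sqrt (s - (x + 1)\<^sup>2) \<le> U"
  shows "sqrt (s - (x + 1)\<^sup>2) - sqrt (s - x\<^sup>2) \<le> sqrt (s - x\<^sup>2) - sqrt (s - (x - 1)\<^sup>2) - s / U ^ 3"
proof -
  define a b c where "a = sqrt (s - (x - 1)\<^sup>2)" and "b = sqrt (s - x\<^sup>2)" and "c = sqrt (s - (x + 1)\<^sup>2)"
  have xs: "x\<^sup>2 + 1 \<le> s"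
    using s by (simp add: power2_eq_square algebra_simps)
  have sq: "a\<^sup>2 = s - (x - 1)\<^sup>2" "b\<^sup>2 = s - x\<^sup>2" "c\<^sup>2 = s - (x + 1)\<^sup>2"
    using s xs by (auto simp: a_def b_def c_def)
  have ge: "0 \<le> a" "0 \<le> b" "0 \<le> c" "a \<le> U" "b \<le> U" "c \<le> U"
    using U s xs by (auto simp: a_def b_def c_def)
  have "b\<^sup>2 > 0" using sq xs by simp
  then have b: "b > 0" using ge by (simp add: zero_less_power2)
  have ac: "(a - c) * (a + c) = 4 * x"
    using sq by (simp add: power2_eq_square algebra_simps)
  \<comment> \<open>Discrete form of u'' = -s / u^3 for u = sqrt (s - x^2). The second difference of
    u^2 is -2, so 4 b^2 - (a + c)^2 equals (a - c)^2 + 4, and its first factor is minus the second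
    difference of u.\<close>
  have key: "(2 * b - a - c) * (2 * b + a + c) = (a - c)\<^sup>2 + 4"
    using sq by (simp add: power2_eq_square algebra_simps)
  have "16 * x\<^sup>2 = ((a - c) * (a + c))\<^sup>2"
    unfolding ac by (simp add: power2_eq_square)
  also have "\<dots> = (a - c)\<^sup>2 * (a + c)\<^sup>2"
    by (rule power_mult_distrib)
  also have "\<dots> \<le> (a - c)\<^sup>2 * (2 * U)\<^sup>2"
    using ge by (intro mult_left_mono power_mono) auto
  finally have "4 * x\<^sup>2 \<le> (a - c)\<^sup>2 * U\<^sup>2"
    by (simp add: power2_eq_square algebra_simps)
  moreover have "b\<^sup>2 \<le> U\<^sup>2" using ge by (intro power_mono) auto
  then have "4 * (s - x\<^sup>2) \<le> 4 * U\<^sup>2" using sq by simp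
  ultimately have s4: "4 * s \<le> ((a - c)\<^sup>2 + 4) * U\<^sup>2"
    by (simp add: algebra_simps)
  have "0 \<le> 2 * b - a - c"
  proof (rule ccontr)
    assume "\<not> 0 \<le> 2 * b - a - c"
    then have "(2 * b - a - c) * (2 * b + a + c) < 0"
      using b ge by (intro mult_neg_pos) auto
    with key show False by (smt (verit) zero_le_power2)
  qed
  then have "(2 * b - a - c) * (2 * b + a + c) \<le> (2 * b - a - c) * (4 * U)"
    using ge by (intro mult_left_mono) auto
  with key have "(a - c)\<^sup>2 + 4 \<le> (2 * b - a - c) * (4 * U)" by simp
  then have "((a - c)\<^sup>2 + 4) * U\<^sup>2 \<le> (2 * b - a - c) * (4 * U) * U\<^sup>2"
    by (rule mult_right_mono) simp
  with s4 have "s \<le> (2 * b - a - c) * U ^ 3"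
    by (simp add: power2_eq_square power3_eq_cube algebra_simps)
  then have "s / U ^ 3 \<le> 2 * b - a - c"
    using U by (simp add: divide_le_eq)
  then show ?thesis
    unfolding a_def b_def c_def by linarith
qed

lemma sqrt_first_difference:
  fixes s x U :: real
  assumes "x\<^sup>2 \<le> s" "(x + 1)\<^sup>2 \<le> s" "- 1 / 2 \<le> x" "1 \<le> s" "U > 0"
    and "U / 2 \<le> sqrt (s - x\<^sup>2)" "U / 2 \<le> sqrt (s - (x + 1)\<^sup>2)"
  shows "\<bar>sqrt (s - (x + 1)\<^sup>2) - sqrt (s - x\<^sup>2)\<bar> \<le> 3 * sqrt s / U"
proof -
  define b c where "b = sqrt (s - x\<^sup>2)" and "c = sqrt (s - (x + 1)\<^sup>2)"
  have sq: "b\<^sup>2 = s - x\<^sup>2" "c\<^sup>2 = s - (x + 1)\<^sup>2"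
    using assms by (auto simp: b_def c_def)
  have bc: "U \<le> b + c" using assms unfolding b_def c_def by linarith
  have "x \<le> sqrt s" using assms by (intro real_le_rsqrt)
  moreover have "1 \<le> sqrt s" using assms by simp
  ultimately have x: "0 \<le> 2 * x + 1" "2 * x + 1 \<le> 3 * sqrt s" using assms(3) by linarith+
  have "(b - c) * (b + c) = 2 * x + 1"
    using sq by (simp add: power2_eq_square algebra_simps)
  then have "b - c = (2 * x + 1) / (b + c)"
    using bc assms by (simp add: field_simps)
  moreover have "(2 * x + 1) / (b + c) \<le> 3 * sqrt s / U"
    using x bc assms by (intro frac_le) auto
  moreover have "0 \<le> (2 * x + 1) / (b + c)"
    using x bc assms by auto
  ultimately show ?thesis unfolding b_def c_def by linarith
qed

text \<open>While u stays between U/2 and U, its slope is O(sqrt s / U) and its curvature at least s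
  / U^3. Multiplied by k, these are the \<Lambda> and \<mu> of van der Corput's inequality.\<close>

lemma circle_block_sum:
  fixes s \<theta> U k :: real
  assumes \<theta>: "- 1 / 2 \<le> \<theta>" and s: "1 \<le> s" and k: "0 < k" and U: "U > 0"
    and block: "\<And>n. p \<le> n \<Longrightarrow> n < q \<Longrightarrow> (real n + \<theta>)\<^sup>2 \<le> s
        \<and> U / 2 \<le> sqrt (s - (real n + \<theta>)\<^sup>2) \<and> sqrt (s - (real n + \<theta>)\<^sup>2) \<le> U"
  shows "norm (\<Sum>n=p..<q. cis (2 * pi * (k * sqrt (s - (real n + \<theta>)\<^sup>2))))
      \<le> 13 * (k * (3 * sqrt s / U) + 1) * (1 / sqrt (k * s / U ^ 3) + 1)"
proof (rule van_der_corput_second_difference)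
  have suc: "real (Suc n) + \<theta> = real n + \<theta> + 1" for n by simp
  show "0 < k * s / U ^ 3" using k s U by simp
  show "0 \<le> k * (3 * sqrt s / U)" using k s U by simp
  fix n assume n: "p \<le> n"
  {
    assume "Suc n < q"
    then have "\<bar>sqrt (s - (real (Suc n) + \<theta>)\<^sup>2) - sqrt (s - (real n + \<theta>)\<^sup>2)\<bar> \<le> 3 * sqrt s / U"
      unfolding suc using block[of n] block[of "Suc n"] n \<theta> s U unfolding suc
      by (intro sqrt_first_difference) auto
    then have "k * \<bar>sqrt (s - (real (Suc n) + \<theta>)\<^sup>2) - sqrt (s - (real n + \<theta>)\<^sup>2)\<bar> \<le> k * (3 * sqrt s / U)"
      using k by (intro mult_left_mono) auto
    then show "\<bar>k * sqrt (s - (real (Suc n) + \<theta>)\<^sup>2) - k * sqrt (s - (real n + \<theta>)\<^sup>2)\<bar> \<le> k * (3 * sqrt s / U)"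
      using k by (simp add: right_diff_distrib[symmetric] abs_mult)
  }
  assume q: "Suc (Suc n) < q"
  define x where "x = real (Suc n) + \<theta>"
  have x: "real n + \<theta> = x - 1" "real (Suc (Suc n)) + \<theta> = x + 1" by (auto simp: x_def)
  have "sqrt (s - (x + 1)\<^sup>2) - sqrt (s - x\<^sup>2) \<le> sqrt (s - x\<^sup>2) - sqrt (s - (x - 1)\<^sup>2) - s / U ^ 3"
    using block[of n] block[of "Suc n"] block[of "Suc (Suc n)"] n q U unfolding x x_def[symmetric]
    by (intro sqrt_second_difference) auto
  then have "k * (sqrt (s - (x + 1)\<^sup>2) - sqrt (s - x\<^sup>2)) \<le> k * (sqrt (s - x\<^sup>2) - sqrt (s - (x - 1)\<^sup>2) - s / U ^ 3)"
    using k by (intro mult_left_mono) auto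
  then show "k * sqrt (s - (real (Suc (Suc n)) + \<theta>)\<^sup>2) - k * sqrt (s - (real (Suc n) + \<theta>)\<^sup>2)
       \<le> k * sqrt (s - (real (Suc n) + \<theta>)\<^sup>2) - k * sqrt (s - (real n + \<theta>)\<^sup>2) - k * s / U ^ 3"
    unfolding x x_def[symmetric] by (simp add: right_diff_distrib)
qed

lemma downward_closed_nat:
  fixes Q :: "nat \<Rightarrow> bool"
  assumes "\<And>i j. i \<le> j \<Longrightarrow> j < m \<Longrightarrow> Q j \<Longrightarrow> Q i"
  obtains p where "p \<le> m" "\<And>n. n < m \<Longrightarrow> Q n \<longleftrightarrow> n < p"
proof
  define p where "p = (LEAST n. n \<ge> m \<or> \<not> Q n)"
  have P: "p \<ge> m \<or> \<not> Q p" unfolding p_def by (rule LeastI[of _ m]) simp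
  show "p \<le> m" unfolding p_def by (rule Least_le) simp
  show "Q n \<longleftrightarrow> n < p" if "n < m" for n
  proof
    assume "Q n"
    show "n < p"
    proof (rule ccontr)
      assume "\<not> n < p"
      then have "\<not> Q p" "p \<le> n" using P that by auto
      with assms[of p n] that \<open>Q n\<close> show False by auto
    qed
  next
    assume "n < p"
    then show "Q n" using not_less_Least[of n "\<lambda>n. n \<ge> m \<or> \<not> Q n"] unfolding p_def by auto
  qed
qed

text \<open>The curvature s / u^3 varies too much for a single application, so the indices are cut
  into dyadic blocks by the height u. The block at height r / 2^J costs a constant times sqrt (k r)
  2^(-J/2) + k 2^J.\<close>

lemma circle_exponential_sum_aux:
  fixes s \<theta> k r :: real
  assumes \<theta>: "- 1 / 2 \<le> \<theta>" "\<theta> \<le> 1 / 2" and s: "1 \<le> s" and k: "1 \<le> k"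
    and m: "\<And>n. n < m \<Longrightarrow> (real n + \<theta>)\<^sup>2 \<le> s"
    and r: "r = sqrt s"
  defines "u \<equiv> \<lambda>n. sqrt (s - (real n + \<theta>)\<^sup>2)"
  shows "norm (\<Sum>n | n < m \<and> r / 2 ^ J < u n. cis (2 * pi * (k * u n)))
     \<le> 52 * sqrt (k * r) * (\<Sum>j<J. (3/4) ^ j) + 52 * k * (\<Sum>j<J. 2 ^ j)"
proof (induction J)
  case 0
  have r1: "r \<ge> 1" using s r by simp
  have "{n. n < m \<and> r / 2 ^ 0 < u n} = {}"
    using r by (auto simp: u_def)
  then show ?case by (simp only: sum.empty) simp
next
  case (Suc J)
  have r1: "r \<ge> 1" "r\<^sup>2 = s" using s r by auto
  let ?e = "\<lambda>n. cis (2 * pi * (k * u n))"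
  have anti: "u j \<le> u i" if "i \<le> j" "j < m" for i j
  proof (cases "i = j")
    case False
    then have "\<bar>real i + \<theta>\<bar> \<le> \<bar>real j + \<theta>\<bar>" using that \<theta> by linarith
    then have "(real i + \<theta>)\<^sup>2 \<le> (real j + \<theta>)\<^sup>2" by (simp add: abs_le_square_iff)
    then show ?thesis by (simp add: u_def)
  qed simp
  obtain p where p: "p \<le> m" "\<And>n. n < m \<Longrightarrow> r / 2 ^ J < u n \<longleftrightarrow> n < p"
  proof (rule downward_closed_nat[of m "\<lambda>n. r / 2 ^ J < u n"])
    show "r / 2 ^ J < u i" if "i \<le> j" "j < m" "r / 2 ^ J < u j" for i j
      using anti[of i j] that by linarith
  qed (rule that)
  obtain q where q: "q \<le> m" "\<And>n. n < m \<Longrightarrow> r / 2 ^ Suc J < u n \<longleftrightarrow> n < q"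
  proof (rule downward_closed_nat[of m "\<lambda>n. r / 2 ^ Suc J < u n"])
    show "r / 2 ^ Suc J < u i" if "i \<le> j" "j < m" "r / 2 ^ Suc J < u j" for i j
      using anti[of i j] that by linarith
  qed (rule that)
  have le: "r / 2 ^ Suc J \<le> r / 2 ^ J" using r1 by (simp add: field_simps)
  have pq: "p \<le> q"
  proof (rule ccontr)
    assume "\<not> p \<le> q"
    then have "q < p" "q < m" using p by auto
    then show False using p(2)[of q] q(2)[of q] le by linarith
  qed
  have sets: "{n. n < m \<and> r / 2 ^ J < u n} = {..<p}" "{n. n < m \<and> r / 2 ^ Suc J < u n} = {..<q}"
    using p q by auto
  define U where "U = r / 2 ^ J"
  have U: "U > 0" using r1 by (simp add: U_def)
  have "norm (\<Sum>n=p..<q. ?e n) \<le> 13 * (k * (3 * sqrt s / U) + 1) * (1 / sqrt (k * s / U ^ 3) + 1)"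
    unfolding u_def
  proof (rule circle_block_sum)
    fix n assume n: "p \<le> n" "n < q"
    then have "n < m" using q by auto
    then show "(real n + \<theta>)\<^sup>2 \<le> s \<and> U / 2 \<le> sqrt (s - (real n + \<theta>)\<^sup>2) \<and> sqrt (s - (real n + \<theta>)\<^sup>2) \<le> U"
      using p(2)[of n] q(2)[of n] n m[of n] unfolding u_def U_def by (auto simp: field_simps)
  qed (use \<theta> s k U in auto)
  also have "\<dots> \<le> 52 * sqrt (k * r) * (3/4) ^ J + 52 * k * 2 ^ J"
  proof -
    have a: "k * (3 * sqrt s / U) = 3 * k * 2 ^ J"
      using r1 by (simp add: U_def r[symmetric])
    have one: "1 \<le> k * 2 ^ J" using k by (metis mult_mono one_le_power mult_1 zero_le_one order_trans one_le_numeral)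
    have sp: "0 \<le> 1 / sqrt (k * s / U ^ 3)" using k s U by simp
    have "13 * (k * (3 * sqrt s / U) + 1) * (1 / sqrt (k * s / U ^ 3) + 1)
       \<le> 13 * (4 * (k * 2 ^ J)) * (1 / sqrt (k * s / U ^ 3) + 1)"
      unfolding a using one sp by (intro mult_right_mono mult_left_mono) auto
    also have "\<dots> = 52 * (k * 2 ^ J * (1 / sqrt (k * s / U ^ 3))) + 52 * k * 2 ^ J"
      by (simp add: distrib_left)
    also have "k * 2 ^ J * (1 / sqrt (k * s / U ^ 3)) \<le> sqrt (k * r) * (3/4) ^ J"
    proof (rule power2_le_imp_le)
      have "(k * 2 ^ J * (1 / sqrt (k * s / U ^ 3)))\<^sup>2 = k\<^sup>2 * (2 ^ J)\<^sup>2 * (U ^ 3 / (k * s))"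
        using k s U by (simp add: power_mult_distrib power_divide)
      also have "\<dots> = k * r * (1 / 2) ^ J"
        using k r1(1) unfolding r1(2)[symmetric] U_def
        by (simp add: field_simps power2_eq_square power3_eq_cube power_divide)
      \<comment> \<open>Since 1/2 \<le> (3/4)^2, the rational ratio 3/4 can replace 2^(-1/2), and
        the geometric series still converges.\<close>
      also have "\<dots> \<le> k * r * ((3/4)\<^sup>2) ^ J"
        using k r1 by (intro mult_left_mono power_mono) (auto simp: power2_eq_square)
      also have "\<dots> = (sqrt (k * r) * (3/4) ^ J)\<^sup>2"
        using k r1 by (simp add: power_mult_distrib power_mult[symmetric] mult.commute)
      finally show "(k * 2 ^ J * (1 / sqrt (k * s / U ^ 3)))\<^sup>2 \<le> (sqrt (k * r) * (3/4) ^ J)\<^sup>2" .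
      show "0 \<le> sqrt (k * r) * (3/4) ^ J" using k r1 by simp
    qed
    finally show ?thesis by (simp add: mult.assoc)
  qed
  finally have B: "norm (\<Sum>n=p..<q. ?e n) \<le> 52 * sqrt (k * r) * (3/4) ^ J + 52 * k * 2 ^ J" .
  have "(\<Sum>n | n < m \<and> r / 2 ^ Suc J < u n. ?e n) = (\<Sum>n | n < m \<and> r / 2 ^ J < u n. ?e n) + (\<Sum>n=p..<q. ?e n)"
    unfolding sets using pq by (simp add: lessThan_atLeast0 sum.atLeastLessThan_concat)
  then have "norm (\<Sum>n | n < m \<and> r / 2 ^ Suc J < u n. ?e n)
     \<le> norm (\<Sum>n | n < m \<and> r / 2 ^ J < u n. ?e n) + norm (\<Sum>n=p..<q. ?e n)"
    by (simp only: norm_triangle_ineq)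
  also note add_mono[OF Suc.IH B]
  finally show ?case by (simp add: distrib_left)
qed

text \<open>The dyadic cutting stops when 2^J is about sqrt (r/k), where the growing cost k 2^J
  reaches sqrt (k r). The remaining heights are at most r / 2^J. Their indices lie within about r /
  4^J \<le> 4 k of the end of the range and are counted trivially.\<close>

lemma circle_exponential_sum:
  fixes s \<theta> k R :: real
  assumes \<theta>: "- 1 / 2 \<le> \<theta>" "\<theta> \<le> 1 / 2" and k: "1 \<le> k" and R: "1 \<le> R" "s \<le> R\<^sup>2"
    and m: "\<And>n. n < m \<Longrightarrow> (real n + \<theta>)\<^sup>2 \<le> s"
  shows "norm (\<Sum>n<m. cis (2 * pi * (k * sqrt (s - (real n + \<theta>)\<^sup>2)))) \<le> 300 * sqrt (k * R)"
proof -
  define r where "r = sqrt s"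
  define u where "u n = sqrt (s - (real n + \<theta>)\<^sup>2)" for n
  let ?e = "\<lambda>n. cis (2 * pi * (k * u n))"
  have triv: "norm (\<Sum>n\<in>T. ?e n) \<le> real (card T)" for T :: "nat set"
    using norm_sum[of ?e T] by simp
  have kR: "1 \<le> sqrt (k * R)"
    using k R mult_mono[of 1 k 1 R] by simp
  have rR: "r \<le> R" unfolding r_def using R by (simp add: real_le_lsqrt)
  have mr: "real n \<le> r + 1 / 2" if "n < m" for n
  proof -
    have "real n + \<theta> \<le> r" unfolding r_def using m[OF that] by (rule real_le_rsqrt)
    then show ?thesis using \<theta> by linarith
  qed
  have cm: "real m \<le> r + 3 / 2" if "m > 0"
    using mr[of "m - 1"] that by (simp add: of_nat_diff)
  consider "m = 0" | "m > 0" "s < 1 \<or> r < k" | "m > 0" "1 \<le> s" "k \<le> r" by linarith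
  then have "norm (\<Sum>n<m. ?e n) \<le> 300 * sqrt (k * R)"
  proof cases
    case 1
    then show ?thesis using kR by simp
  next
    \<comment> \<open>The trivial bound r + 3/2 suffices: r \<le> 1 if s < 1, and r^2 \<le> k R if r
      < k.\<close>
    case 2
    have "r \<le> sqrt (k * R)"
    proof (cases "s < 1")
      case True
      then have "r \<le> 1" by (cases "s \<ge> 0") (auto simp: r_def)
      then show ?thesis using kR by linarith
    next
      case False
      then have "r \<ge> 0" "r < k" using 2 by (auto simp: r_def)
      then have "r\<^sup>2 \<le> k * R" using rR unfolding power2_eq_square by (intro mult_mono) auto
      then show ?thesis by (rule real_le_rsqrt)
    qed
    then have "real m \<le> 300 * sqrt (k * R)" using cm[OF 2(1)] kR by linarith
    then show ?thesis using triv[of "{..<m}"] by simp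
  next
    case 3
    have r1: "r \<ge> 1" using 3 by (simp add: r_def)
    define J where "J = nat \<lfloor>log 2 (sqrt (r / k))\<rfloor>"
    have q1: "1 \<le> sqrt (r / k)" using 3 k by simp
    then have l0: "0 \<le> log 2 (sqrt (r / k))" by simp
    have J: "2 ^ J \<le> sqrt (r / k)" "sqrt (r / k) < 2 ^ Suc J"
    proof -
      have "real J \<le> log 2 (sqrt (r / k))" "log 2 (sqrt (r / k)) < real J + 1"
        unfolding J_def using l0 by linarith+
      then have "2 powr (real J) \<le> sqrt (r / k)" "sqrt (r / k) < 2 powr (real J + 1)"
        using q1 by (auto simp: le_log_iff log_less_iff)
      then show "2 ^ J \<le> sqrt (r / k)" "sqrt (r / k) < 2 ^ Suc J"
        by (auto simp: powr_realpow powr_add)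
    qed
    have k2: "k * 2 ^ J \<le> sqrt (k * R)"
    proof -
      have "k * 2 ^ J \<le> k * sqrt (r / k)" using J k by (intro mult_left_mono) auto
      also have "\<dots> = sqrt (k * r)"
        using k r1 by (simp add: real_sqrt_mult real_sqrt_divide field_simps)
      also have "\<dots> \<le> sqrt (k * R)" using rR k by simp
      finally show ?thesis .
    qed
    define T where "T = {n. n < m \<and> \<not> r / 2 ^ J < u n}"
    \<comment> \<open>By Pythagoras, u n \<le> r / 2^J forces \<bar>n + \<theta>\<bar> \<ge> r (1 -
      1/4^J). The interval is longer by 1 to allow for n = 0 with negative \<theta>.\<close>
    have "real (card T) \<le> (r / 4 ^ J + 1) / 1 + 1"
    proof (rule card_differences_le[of _ _ _ 0 m "- (r - \<theta>)" "\<lambda>n. - real n"])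
      fix n assume "n \<in> T"
      then have n: "n < m" "u n \<le> r / 2 ^ J" by (auto simp: T_def)
      have "s - (real n + \<theta>)\<^sup>2 = (u n)\<^sup>2" using m[OF n(1)] by (simp add: u_def)
      also have "\<dots> \<le> (r / 2 ^ J)\<^sup>2" using n m[OF n(1)] by (intro power_mono) (auto simp: u_def)
      also have "\<dots> = s * (1 / 4 ^ J)"
        using 3 by (simp add: r_def power_divide power_mult[symmetric] mult.commute[of J] power_mult)
      finally have "s * (1 - 1 / 4 ^ J) \<le> (real n + \<theta>)\<^sup>2" by (simp add: algebra_simps)
      moreover have "(r * (1 - 1 / 4 ^ J))\<^sup>2 \<le> s * (1 - 1 / 4 ^ J)"
      proof -
        have "(1 - 1 / 4 ^ J) * (1 - 1 / 4 ^ J) \<le> (1 - 1 / 4 ^ J) * (1::real)"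
          by (intro mult_left_mono) auto
        then have "s * ((1 - 1 / 4 ^ J) * (1 - 1 / 4 ^ J)) \<le> s * ((1 - 1 / 4 ^ J) * 1)"
          using 3 by (intro mult_left_mono) auto
        moreover have "r\<^sup>2 = s" using 3 by (simp add: r_def)
        ultimately show ?thesis by (simp only: power_mult_distrib power2_eq_square[of "1 - 1 / 4 ^ J"] mult_1_right)
      qed
      ultimately have "(r * (1 - 1 / 4 ^ J))\<^sup>2 \<le> (real n + \<theta>)\<^sup>2" by linarith
      moreover have "(1::real) / 4 ^ J \<le> 1" by simp
      then have "0 \<le> r * (1 - 1 / 4 ^ J)" using r1 by (intro mult_nonneg_nonneg) auto
      ultimately have "r * (1 - 1 / 4 ^ J) \<le> \<bar>real n + \<theta>\<bar>"
        by (metis abs_le_square_iff abs_of_nonneg)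
      moreover have "\<bar>real n + \<theta>\<bar> \<le> real n + \<theta> \<or> n = 0" using \<theta> by (cases n) auto
      moreover have "real n + \<theta> \<le> r" unfolding r_def using m[OF n(1)] by (rule real_le_rsqrt)
      ultimately show "- (r - \<theta>) \<le> - real n \<and> - real n \<le> - (r - \<theta>) + (r / 4 ^ J + 1)"
        using \<theta> by (auto simp: algebra_simps)
    qed (use r1 in \<open>auto simp: T_def\<close>)
    moreover have "r / 4 ^ J \<le> 4 * k"
    proof -
      have "r / k \<le> (2 ^ Suc J)\<^sup>2"
      proof -
        have "(sqrt (r / k))\<^sup>2 \<le> (2 ^ Suc J)\<^sup>2" using J(2) q1 by (intro power_mono) auto
        then show ?thesis using r1 k by simp
      qed
      also have "(2 ^ Suc J)\<^sup>2 = 4 * (4::real) ^ J"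
        by (simp add: power_mult_distrib power_mult[symmetric] mult.commute[of J] power_mult)
      finally show ?thesis using k by (simp add: field_simps)
    qed
    moreover have "k \<le> sqrt (k * R)"
    proof -
      have "k * 1 \<le> k * 2 ^ J" using k by (intro mult_left_mono) auto
      then show ?thesis using k2 by linarith
    qed
    ultimately have "real (card T) \<le> 6 * sqrt (k * R)"
      using kR by argo
    then have T: "norm (\<Sum>n\<in>T. ?e n) \<le> 6 * sqrt (k * R)"
      using triv[of T] by (rule order.trans[rotated])
    have "(\<Sum>j<J. (3/4) ^ j) = (1 - (3/4::real) ^ J) / (1 - 3/4)"
      by (subst sum_gp_strict) auto
    then have g1: "(\<Sum>j<J. (3/4::real) ^ j) \<le> 4" by simp
    have "(\<Sum>j<J. (2::real) ^ j) = 2 ^ J - 1"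
      by (subst sum_gp_strict) auto
    then have g2: "(\<Sum>j<J. (2::real) ^ j) \<le> 2 ^ J" by simp
    have "norm (\<Sum>n | n < m \<and> r / 2 ^ J < u n. ?e n)
      \<le> 52 * sqrt (k * r) * (\<Sum>j<J. (3/4) ^ j) + 52 * k * (\<Sum>j<J. 2 ^ j)"
      unfolding u_def using \<theta> 3 k m by (intro circle_exponential_sum_aux) (auto simp: r_def)
    also have "\<dots> \<le> 52 * sqrt (k * R) * 4 + 52 * k * 2 ^ J"
      using g1 g2 rR k r1 by (intro add_mono mult_mono) (auto intro!: sum_nonneg)
    also have "\<dots> \<le> 260 * sqrt (k * R)" using k2 by simp
    finally have A: "norm (\<Sum>n | n < m \<and> r / 2 ^ J < u n. ?e n) \<le> 260 * sqrt (k * R)" .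
    have "{..<m} = {n. n < m \<and> r / 2 ^ J < u n} \<union> T" by (auto simp: T_def)
    then have "(\<Sum>n<m. ?e n) = (\<Sum>n | n < m \<and> r / 2 ^ J < u n. ?e n) + (\<Sum>n\<in>T. ?e n)"
      by (simp only:) (rule sum.union_disjoint, auto simp: T_def)
    then have "norm (\<Sum>n<m. ?e n) \<le> norm (\<Sum>n | n < m \<and> r / 2 ^ J < u n. ?e n) + norm (\<Sum>n\<in>T. ?e n)"
      by (simp only: norm_triangle_ineq)
    then show ?thesis using A T kR by linarith
  qed
  then show ?thesis unfolding u_def .
qed

section \<open>Fourier series of Bernoulli functions\<close>

lemma dirichlet_kernel:
  fixes a :: real
  shows "2 * sin a * (\<Sum>k=1..n. cos (2 * real k * a)) = sin ((2 * real n + 1) * a) - sin a"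
proof (induction n)
  case (Suc n)
  have "2 * sin a * cos (2 * real (Suc n) * a) = sin ((2 * real (Suc n) + 1) * a) - sin ((2 * real n + 1) * a)"
  proof -
    have "sin ((2 * real (Suc n) + 1) * a) = sin (2 * real (Suc n) * a + a)"
      and "sin ((2 * real n + 1) * a) = sin (2 * real (Suc n) * a - a)"
      by (simp_all add: algebra_simps)
    then show ?thesis by (simp only: sin_add sin_diff) simp
  qed
  then show ?case using Suc by (simp add: distrib_left)
qed simp

text \<open>Where sin a stays away from 0, this sum plus n/2 remains bounded and so tends to 0 after
  division by n. With the Dirichlet kernel a Riemann-Lebesgue argument would be needed.\<close>

lemma fejer_kernel:
  fixes a :: real
  shows "2 * (sin a)\<^sup>2 * (\<Sum>k=1..n. (real n - real k) * cos (2 * real k * a)) = (sin (real n * a))\<^sup>2 - real n * (sin a)\<^sup>2"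
proof (induction n)
  case (Suc n)
  have "(\<Sum>k=1..Suc n. (real (Suc n) - real k) * cos (2 * real k * a))
      = (\<Sum>k=1..n. (real n - real k) * cos (2 * real k * a) + cos (2 * real k * a))"
    by (simp add: algebra_simps)
  then have "2 * (sin a)\<^sup>2 * (\<Sum>k=1..Suc n. (real (Suc n) - real k) * cos (2 * real k * a))
      = ((sin (real n * a))\<^sup>2 - real n * (sin a)\<^sup>2) + sin a * (2 * sin a * (\<Sum>k=1..n. cos (2 * real k * a)))"
    unfolding Suc.IH[symmetric] sum.distrib by (simp add: power2_eq_square algebra_simps)
  also have "\<dots> = (sin (real n * a))\<^sup>2 + sin a * sin ((2 * real n + 1) * a) - real (Suc n) * (sin a)\<^sup>2"
    unfolding dirichlet_kernel by (simp add: power2_eq_square algebra_simps)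
  also have "sin a * sin ((2 * real n + 1) * a) = (sin (real (Suc n) * a))\<^sup>2 - (sin (real n * a))\<^sup>2"
  proof -
    have "sin (real (Suc n) * a) = sin (real n * a + a)" by (simp add: algebra_simps)
    then have s: "sin (real (Suc n) * a) = sin (real n * a) * cos a + cos (real n * a) * sin a"
      by (simp only: sin_add)
    have "sin ((2 * real n + 1) * a) = sin (2 * (real n * a) + a)" by (simp add: algebra_simps)
    then have t: "sin ((2 * real n + 1) * a) = 2 * sin (real n * a) * cos (real n * a) * cos a + (1 - 2 * (sin (real n * a))\<^sup>2) * sin a"
      by (simp only: sin_add sin_double cos_double_sin)
    have c: "(cos a)\<^sup>2 = 1 - (sin a)\<^sup>2" "(cos (real n * a))\<^sup>2 = 1 - (sin (real n * a))\<^sup>2"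
      by (simp_all add: cos_squared_eq)
    show ?thesis unfolding s t using c by algebra
  qed
  finally show ?case by simp
qed simp

lemma sum_inverse_le_sqrt: "(\<Sum>k=1..n. 1 / real k) \<le> 2 * sqrt (real n)"
proof (induction n)
  case (Suc n)
  define a b where "a = sqrt (real n)" and "b = sqrt (real (Suc n))"
  have ab: "0 \<le> a" "a \<le> b" "b \<ge> 1" "b * b = real (Suc n)" "a * a = real n"
    by (auto simp: a_def b_def)
  have "1 / real (Suc n) \<le> 2 * (b - a)"
  proof -
    have "1 = (b - a) * (b + a)" using ab by (simp add: algebra_simps)
    also have "\<dots> \<le> (b - a) * (2 * (b * b))"
    proof (rule mult_left_mono)
      have "b * 1 \<le> b * b" using ab by (intro mult_left_mono) auto
      then show "b + a \<le> 2 * (b * b)" using ab by linarith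
    qed (use ab in auto)
    finally have "1 \<le> 2 * (b - a) * real (Suc n)" unfolding ab(4) by (simp only: mult_ac)
    then show ?thesis by (simp add: divide_le_eq mult.commute)
  qed
  then show ?case using Suc unfolding a_def b_def by simp
qed simp

text \<open>Integration by parts identifies \<open>a k\<close> with the integral of (v - y) cos
  (2\<pi> k v) over [y, 1/2]. There sin (\<pi> v) \<ge> sin (\<pi> y), so the Fejer sum plus n/2 is
  bounded, and n/2 accounts for the main term.\<close>

lemma fejer_weighted_cosine_bound:
  fixes y :: real
  assumes y: "0 < y" "y \<le> 1 / 2" and n: "n > 0"
  defines "a \<equiv> \<lambda>k. (cos (pi * real k) - cos (2 * pi * real k * y)) / (4 * pi\<^sup>2 * (real k)\<^sup>2)"
  shows "\<bar>(\<Sum>k=1..n. (real n - real k) * a k) + real n * (1/2 - y)\<^sup>2 / 4\<bar> \<le> 1 / (sin (pi * y))\<^sup>2"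
proof -
  have int_a: "((\<lambda>v. (v - y) * cos (2 * real k * (pi * v))) has_integral a k) {y..1/2}" if k: "k \<ge> 1" for k
  proof -
    let ?P = "\<lambda>v. (v - y) * sin (2 * pi * real k * v) / (2 * pi * real k) + cos (2 * pi * real k * v) / (4 * pi\<^sup>2 * (real k)\<^sup>2)"
    have "((\<lambda>v. (v - y) * cos (2 * real k * (pi * v))) has_integral ?P (1/2) - ?P y) {y..1/2}"
    proof (rule fundamental_theorem_of_calculus)
      fix v :: real
      have "(?P has_real_derivative (v - y) * cos (2 * real k * (pi * v))) (at v)"
        using k by (auto intro!: derivative_eq_intros simp: field_simps power2_eq_square)
      then show "(?P has_vector_derivative (v - y) * cos (2 * real k * (pi * v))) (at v within {y..1/2})"
        by (simp add: has_real_derivative_iff_has_vector_derivative[symmetric] has_field_derivative_at_within)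
    qed (use y in simp)
    also have "?P (1/2) - ?P y = a k"
      by (simp add: a_def diff_divide_distrib mult.commute[of pi])
    finally show ?thesis .
  qed
  have S: "((\<lambda>v. \<Sum>k=1..n. (real n - real k) * ((v - y) * cos (2 * real k * (pi * v)))) has_integral (\<Sum>k=1..n. (real n - real k) * a k)) {y..1/2}"
    by (intro has_integral_sum has_integral_mult_right int_a) auto
  have L: "((\<lambda>v. real n / 2 * (v - y)) has_integral real n / 2 * ((1/2 - y)\<^sup>2 / 2)) {y..1/2}"
  proof (intro has_integral_mult_right)
    have "((\<lambda>v. v - y) has_integral (1/2 - y)\<^sup>2 / 2 - (y - y)\<^sup>2 / 2) {y..1/2}"
      using y by (intro fundamental_theorem_of_calculus)
        (auto intro!: derivative_eq_intros simp: has_real_derivative_iff_has_vector_derivative[symmetric])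
    then show "((\<lambda>v. v - y) has_integral (1/2 - y)\<^sup>2 / 2) {y..1/2}" by simp
  qed
  have sy: "sin (pi * y) > 0"
    using y by (intro sin_gt_zero) auto
  have "norm ((\<Sum>k=1..n. (real n - real k) * a k) + real n / 2 * ((1/2 - y)\<^sup>2 / 2)) \<le> 1 / (sin (pi * y))\<^sup>2 * measure lborel (cbox y (1/2))"
  proof (rule has_integral_bound)
    show "((\<lambda>v. (\<Sum>k=1..n. (real n - real k) * ((v - y) * cos (2 * real k * (pi * v)))) + real n / 2 * (v - y)) has_integral
       (\<Sum>k=1..n. (real n - real k) * a k) + real n / 2 * ((1/2 - y)\<^sup>2 / 2)) (cbox y (1/2))"
      using has_integral_add[OF S L] by simp
    fix v assume "v \<in> cbox y (1/2)"
    then have v: "y \<le> v" "v \<le> 1/2" by auto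
    have sv: "sin (pi * y) \<le> sin (pi * v)"
    proof (rule sin_monotone_2pi_le)
      have "0 \<le> pi * y" using y by simp
      then show "- (pi / 2) \<le> pi * y" using pi_gt_zero by linarith
    qed (use v in auto)
    define F where "F = (\<Sum>k=1..n. (real n - real k) * cos (2 * real k * (pi * v)))"
    have "2 * (sin (pi * v))\<^sup>2 * F = (sin (real n * (pi * v)))\<^sup>2 - real n * (sin (pi * v))\<^sup>2"
      unfolding F_def by (rule fejer_kernel)
    then have F: "F + real n / 2 = (sin (real n * (pi * v)))\<^sup>2 / (2 * (sin (pi * v))\<^sup>2)"
      using sv sy by (simp add: field_simps)
    have "(\<Sum>k=1..n. (real n - real k) * ((v - y) * cos (2 * real k * (pi * v)))) + real n / 2 * (v - y) = (v - y) * (F + real n / 2)"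
      by (simp add: F_def sum_distrib_left algebra_simps)
    also have "norm \<dots> \<le> 1 * (1 / (sin (pi * y))\<^sup>2)"
      unfolding norm_mult
    proof (rule mult_mono)
      have "norm (F + real n / 2) = (sin (real n * (pi * v)))\<^sup>2 / (2 * (sin (pi * v))\<^sup>2)"
        unfolding F by simp
      also have "\<dots> \<le> 1 / (sin (pi * y))\<^sup>2"
      proof (rule frac_le)
        have "(sin (pi * y))\<^sup>2 \<le> (sin (pi * v))\<^sup>2" using sv sy by (intro power_mono) auto
        then show "(sin (pi * y))\<^sup>2 \<le> 2 * (sin (pi * v))\<^sup>2" by (smt (verit) zero_le_power2)
        show "(sin (real n * (pi * v)))\<^sup>2 \<le> 1" by (simp add: abs_square_le_1)
      qed (use sy in auto)
      finally show "norm (F + real n / 2) \<le> 1 / (sin (pi * y))\<^sup>2" .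
    qed (use v y in auto)
    finally show "norm ((\<Sum>k=1..n. (real n - real k) * ((v - y) * cos (2 * real k * (pi * v)))) + real n / 2 * (v - y)) \<le> 1 / (sin (pi * y))\<^sup>2" by simp
  qed (use sy in auto)
  also have "\<dots> \<le> 1 / (sin (pi * y))\<^sup>2 * 1"
    using y sy by (intro mult_left_mono) auto
  finally show ?thesis by simp
qed

lemma inverse_squares_sums': "(\<lambda>k. 1 / (real k + 1)\<^sup>2) sums (pi\<^sup>2 / 6)"
  using inverse_squares_sums by (simp add: add.commute)

lemma summable_cos_over_squares: "summable (\<lambda>k. cos (2 * pi * real (Suc k) * y) / (real (Suc k))\<^sup>2)"
proof (rule summable_comparison_test)
  show "summable (\<lambda>k. 1 / (real k + 1)\<^sup>2)"
    using inverse_squares_sums' by (rule sums_summable)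
  show "\<exists>N. \<forall>k\<ge>N. norm (cos (2 * pi * real (Suc k) * y) / (real (Suc k))\<^sup>2) \<le> 1 / (real k + 1)\<^sup>2"
    by (auto simp: abs_mult divide_simps add.commute)
qed

text \<open>By the Fejer bound the Cesaro means of \<open>a k\<close> tend to -(1/2 - y)^2 / 4. The
  partial sums have the same limit because k \<open>a k\<close> = O(1/k); the crude bound of
  \<open>sum_inverse_le_sqrt\<close> is enough, as it is divided by n.\<close>

lemma cosine_difference_series:
  fixes y :: real
  assumes y: "0 < y" "y \<le> 1 / 2"
  shows "(\<Sum>k. cos (2 * pi * real (Suc k) * y) / (real (Suc k))\<^sup>2)
     = (\<Sum>k. cos (2 * pi * real (Suc k) * (1/2)) / (real (Suc k))\<^sup>2) + pi\<^sup>2 * (1/2 - y)\<^sup>2"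
proof -
  define a where "a k = (cos (pi * real k) - cos (2 * pi * real k * y)) / (4 * pi\<^sup>2 * (real k)\<^sup>2)" for k
  let ?F = "\<lambda>y. (\<Sum>k. cos (2 * pi * real (Suc k) * y) / (real (Suc k))\<^sup>2)"
  have "(\<lambda>k. 1 / (4 * pi\<^sup>2) * (cos (2 * pi * real (Suc k) * (1/2)) / (real (Suc k))\<^sup>2 - cos (2 * pi * real (Suc k) * y) / (real (Suc k))\<^sup>2))
     sums (1 / (4 * pi\<^sup>2) * (?F (1/2) - ?F y))"
    by (intro sums_mult sums_diff summable_sums summable_cos_over_squares)
  then have "(\<lambda>k. a (Suc k)) sums (1 / (4 * pi\<^sup>2) * (?F (1/2) - ?F y))"
  proof (rule sums_cong[THEN iffD1, rotated])
    fix k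
    have "cos (2 * pi * real (Suc k) * (1/2)) = cos (pi * real (Suc k))" by (rule arg_cong) simp
    then show "1 / (4 * pi\<^sup>2) * (cos (2 * pi * real (Suc k) * (1/2)) / (real (Suc k))\<^sup>2 - cos (2 * pi * real (Suc k) * y) / (real (Suc k))\<^sup>2) = a (Suc k)"
      unfolding a_def by (simp only: diff_divide_distrib[symmetric] times_divide_times_eq mult_1_left)
  qed
  then have lim1: "(\<lambda>n. \<Sum>k=1..n. a k) \<longlonglongrightarrow> 1 / (4 * pi\<^sup>2) * (?F (1/2) - ?F y)"
    unfolding sums_def by (simp add: sum.atLeast1_atMost_eq)
  have abs_a: "\<bar>real k * a k\<bar> \<le> 1 / real k" if "k \<ge> 1" for k
  proof -
    have "\<bar>cos (pi * real k) - cos (2 * pi * real k * y)\<bar> \<le> 1 + 1"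
      by (rule order.trans[OF abs_triangle_ineq4]) (intro add_mono abs_cos_le_one)
    also have "(1 + 1 :: real) \<le> 4 * pi\<^sup>2" using pi_ge_two power_mono[OF pi_ge_two, of 2] by simp
    finally have "\<bar>cos (pi * real k) - cos (2 * pi * real k * y)\<bar> / (4 * pi\<^sup>2) \<le> 1" by simp
    then have "\<bar>cos (pi * real k) - cos (2 * pi * real k * y)\<bar> / (4 * pi\<^sup>2) / real k \<le> 1 / real k"
      by (rule divide_right_mono) simp
    then show ?thesis using that by (simp add: a_def abs_mult power2_eq_square mult.assoc)
  qed
  have lim2: "(\<lambda>n. (\<Sum>k=1..n. real k * a k) / real n) \<longlonglongrightarrow> 0"
  proof (rule Lim_null_comparison)
    show "(\<lambda>n. 2 * sqrt (real n) / real n) \<longlonglongrightarrow> 0" by real_asymp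
    show "\<forall>\<^sub>F n in sequentially. norm ((\<Sum>k=1..n. real k * a k) / real n) \<le> 2 * sqrt (real n) / real n"
    proof (intro always_eventually allI)
      fix n
      have "norm (\<Sum>k=1..n. real k * a k) \<le> (\<Sum>k=1..n. 1 / real k)"
        by (rule sum_norm_le) (use abs_a in auto)
      also note sum_inverse_le_sqrt
      finally show "norm ((\<Sum>k=1..n. real k * a k) / real n) \<le> 2 * sqrt (real n) / real n"
        by (simp add: divide_right_mono)
    qed
  qed
  have lim3: "(\<lambda>n. (\<Sum>k=1..n. (real n - real k) * a k) / real n) \<longlonglongrightarrow> - ((1/2 - y)\<^sup>2 / 4)"
  proof (rule LIM_zero_cancel, rule Lim_null_comparison)
    show "(\<lambda>n. (1 / (sin (pi * y))\<^sup>2) / real n) \<longlonglongrightarrow> 0" by real_asymp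
    show "\<forall>\<^sub>F n in sequentially. norm ((\<Sum>k=1..n. (real n - real k) * a k) / real n - - ((1/2 - y)\<^sup>2 / 4)) \<le> (1 / (sin (pi * y))\<^sup>2) / real n"
    proof (rule eventually_mono[OF eventually_gt_at_top[of 0]])
      fix n :: nat assume n: "0 < n"
      have "(\<Sum>k=1..n. (real n - real k) * a k) / real n - - ((1/2 - y)\<^sup>2 / 4)
         = ((\<Sum>k=1..n. (real n - real k) * a k) + real n * (1/2 - y)\<^sup>2 / 4) / real n"
        using n by (simp add: add_divide_distrib)
      also have "norm \<dots> \<le> (1 / (sin (pi * y))\<^sup>2) / real n"
        using divide_right_mono[OF fejer_weighted_cosine_bound[OF y n, folded a_def], of "real n"]
        by (simp add: norm_divide)
      finally show "norm ((\<Sum>k=1..n. (real n - real k) * a k) / real n - - ((1/2 - y)\<^sup>2 / 4)) \<le> (1 / (sin (pi * y))\<^sup>2) / real n" .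
    qed
  qed
  have "(\<lambda>n. \<Sum>k=1..n. a k) \<longlonglongrightarrow> - ((1/2 - y)\<^sup>2 / 4) + 0"
  proof (rule Lim_transform_eventually[OF tendsto_add[OF lim3 lim2]])
    show "\<forall>\<^sub>F n in sequentially. (\<Sum>k=1..n. (real n - real k) * a k) / real n + (\<Sum>k=1..n. real k * a k) / real n = (\<Sum>k=1..n. a k)"
    proof (rule eventually_mono[OF eventually_gt_at_top[of 0]])
      fix n :: nat assume n: "0 < n"
      have "(\<Sum>k=1..n. (real n - real k) * a k) + (\<Sum>k=1..n. real k * a k) = real n * (\<Sum>k=1..n. a k)"
        by (simp add: sum.distrib[symmetric] sum_distrib_left algebra_simps)
      then show "(\<Sum>k=1..n. (real n - real k) * a k) / real n + (\<Sum>k=1..n. real k * a k) / real n = (\<Sum>k=1..n. a k)"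
        using n by (simp add: add_divide_distrib[symmetric])
    qed
  qed
  from LIMSEQ_unique[OF this lim1] show ?thesis
    by (simp add: field_simps)
qed

text \<open>\<open>cosine_difference_series\<close> gives the sum on (0, 1/2] up to its value at
  1/2. Continuity at 0, where the series is that of the inverse squares, fixes this value.
  Reflection and periodicity extend the formula to all u.\<close>

theorem cosine_series_bernoulli2:
  "(\<lambda>k. cos (2 * pi * real (Suc k) * u) / (real (Suc k))\<^sup>2) sums (pi\<^sup>2 * ((frac u)\<^sup>2 - frac u + 1/6))"
proof -
  define F where "F y = (\<Sum>k. cos (2 * pi * real (Suc k) * y) / (real (Suc k))\<^sup>2)" for y
  have F_half: "F y = F (1/2) + pi\<^sup>2 * (1/2 - y)\<^sup>2" if "0 < y" "y \<le> 1/2" for y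
    unfolding F_def by (rule cosine_difference_series[OF that])
  have F0: "F 0 = pi\<^sup>2 / 6"
    using sums_unique[OF inverse_squares_sums] by (simp add: F_def add.commute)
  have "continuous_on UNIV F"
  proof (rule uniform_limit_theorem)
    show "uniform_limit UNIV (\<lambda>n y. \<Sum>k<n. cos (2 * pi * real (Suc k) * y) / (real (Suc k))\<^sup>2) F sequentially"
      unfolding F_def
    proof (rule Weierstrass_m_test)
      show "summable (\<lambda>k. 1 / (real k + 1)\<^sup>2)"
        using inverse_squares_sums' by (rule sums_summable)
    qed (auto simp: divide_simps add.commute)
    show "\<forall>\<^sub>F n in sequentially. continuous_on UNIV (\<lambda>y. \<Sum>k<n. cos (2 * pi * real (Suc k) * y) / (real (Suc k))\<^sup>2)"
      by (intro always_eventually allI continuous_intros) auto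
  qed auto
  then have "isCont F 0" by (simp add: continuous_on_eq_continuous_at)
  \<comment> \<open>These points lie in (0, 1/2], where \<open>F_half\<close> applies.\<close>
  moreover have "(\<lambda>n. 1 / real (n + 2)) \<longlonglongrightarrow> 0" by real_asymp
  ultimately have "(\<lambda>n. F (1 / real (n + 2))) \<longlonglongrightarrow> F 0"
    by (rule isCont_tendsto_compose)
  moreover have "(\<lambda>n. F (1 / real (n + 2))) = (\<lambda>n. F (1/2) + pi\<^sup>2 * (1/2 - 1 / real (n + 2))\<^sup>2)"
    by (intro ext F_half) (auto simp: field_simps)
  moreover have "(\<lambda>n. F (1/2) + pi\<^sup>2 * (1/2 - 1 / real (n + 2))\<^sup>2) \<longlonglongrightarrow> F (1/2) + pi\<^sup>2 * (1/2 - 0)\<^sup>2"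
    by (intro tendsto_intros) real_asymp
  ultimately have "F 0 = F (1/2) + pi\<^sup>2 * (1/2 - 0)\<^sup>2"
    using LIMSEQ_unique by metis
  then have half: "F (1/2) = - pi\<^sup>2 / 12" using F0 by (simp add: power2_eq_square)
  have F01: "F y = pi\<^sup>2 * (y\<^sup>2 - y + 1/6)" if "0 \<le> y" "y \<le> 1/2" for y
  proof (cases "y = 0")
    case True
    then show ?thesis using F0 by simp
  next
    case False
    then show ?thesis using F_half[of y] that half by (simp add: power2_eq_square field_simps)
  qed
  have refl: "F (1 - y) = F y" for y
  proof -
    have "cos (2 * pi * real (Suc k) * (1 - y)) = cos (2 * pi * real (Suc k) * y)" for k
    proof -
      have "cos (2 * pi * real (Suc k) * (1 - y)) = cos (2 * pi * real (Suc k) - 2 * pi * real (Suc k) * y)"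
        by (simp add: algebra_simps)
      also have "\<dots> = cos (2 * pi * real (Suc k) * y)"
        using cos_int_2pin[of "int (Suc k)"] sin_int_2pin[of "int (Suc k)"]
        by (simp add: cos_diff del: of_nat_Suc)
      finally show ?thesis .
    qed
    then show ?thesis by (simp add: F_def)
  qed
  have Ffrac: "F (frac u) = pi\<^sup>2 * ((frac u)\<^sup>2 - frac u + 1/6)"
  proof (cases "frac u \<le> 1/2")
    case True
    then show ?thesis using F01 by simp
  next
    case False
    then have "F (1 - frac u) = pi\<^sup>2 * ((1 - frac u)\<^sup>2 - (1 - frac u) + 1/6)"
      using frac_lt_1[of u] by (intro F01) auto
    then show ?thesis unfolding refl by (simp add: power2_eq_square algebra_simps)
  qed
  have "cos (2 * pi * real (Suc k) * u) = cos (2 * pi * real (Suc k) * frac u)" for k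
  proof -
    have "cos (2 * pi * real (Suc k) * u) = cos (2 * pi * real (Suc k) * frac u + 2 * pi * of_int (int (Suc k) * \<lfloor>u\<rfloor>))"
      by (simp add: frac_def algebra_simps)
    also have "\<dots> = cos (2 * pi * real (Suc k) * frac u)"
      unfolding cos_add cos_int_2pin sin_int_2pin by simp
    finally show ?thesis .
  qed
  then have "(\<lambda>k. cos (2 * pi * real (Suc k) * u) / (real (Suc k))\<^sup>2) sums F (frac u)"
    unfolding F_def using summable_sums[OF summable_cos_over_squares[of "frac u"]] by simp
  then show ?thesis unfolding Ffrac .
qed

section \<open>Weighted exponential sums over half chords\<close>

lemma norm_sum_antimono_weights_le:
  fixes e :: "nat \<Rightarrow> complex" and w :: "nat \<Rightarrow> real"
  assumes w: "\<And>n. w (Suc n) \<le> w n" "\<And>n. 0 \<le> w n"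
    and E: "\<And>i. i \<le> m \<Longrightarrow> norm (\<Sum>n<i. e n) \<le> B"
  shows "norm (\<Sum>n<m. of_real (w n) * e n) \<le> B * w 0"
proof -
  define S where "S i = (\<Sum>n<i. e n)" for i
  have "norm ((\<Sum>n<m. of_real (w n) * e n) - of_real (w m) * S m) \<le> B * (w 0 - w m)"
    using E
  proof (induction m)
    case (Suc m)
    have "(\<Sum>n<Suc m. of_real (w n) * e n) - of_real (w (Suc m)) * S (Suc m)
      = ((\<Sum>n<m. of_real (w n) * e n) - of_real (w m) * S m) + of_real (w m - w (Suc m)) * S (Suc m)"
      by (simp add: S_def algebra_simps)
    moreover have "norm (of_real (w m - w (Suc m)) * S (Suc m)) \<le> (w m - w (Suc m)) * B"
    proof -
      have "norm (of_real (w m - w (Suc m)) :: complex) = w m - w (Suc m)"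
        using w(1)[of m] by (subst norm_of_real) simp
      then show ?thesis
        unfolding norm_mult using w(1)[of m] Suc.prems[of "Suc m"] by (intro mult_mono) (auto simp: S_def)
    qed
    moreover have "norm ((\<Sum>n<m. of_real (w n) * e n) - of_real (w m) * S m) \<le> B * (w 0 - w m)"
      using Suc by auto
    ultimately have "norm ((\<Sum>n<Suc m. of_real (w n) * e n) - of_real (w (Suc m)) * S (Suc m))
        \<le> B * (w 0 - w m) + (w m - w (Suc m)) * B"
      by (simp only:) (rule order.trans[OF norm_triangle_ineq add_mono])
    then show ?case by (simp only: algebra_simps)
  qed (simp add: S_def)
  moreover have "norm (of_real (w m) * S m) \<le> w m * B"
    unfolding norm_mult using w(2)[of m] E[of m] by (intro mult_mono) (auto simp: S_def)
  ultimately have "norm (((\<Sum>n<m. of_real (w n) * e n) - of_real (w m) * S m) + of_real (w m) * S m)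
      \<le> B * (w 0 - w m) + w m * B"
    by (intro order.trans[OF norm_triangle_ineq add_mono])
  then show ?thesis by (simp add: algebra_simps)
qed

text \<open>For \<open>u = \<surd>(s - b)\<close> the substitution \<open>ds = 2 u du\<close> turns the integral of \<open>sin (2\<pi>ku)\<close> into an elementary one.\<close>

lemma has_integral_sin_sqrt:
  fixes k b s1 s2 :: real
  assumes "s1 \<le> s2" and k: "k > 0"
  defines "u \<equiv> \<lambda>s. sqrt (max 0 (s - b))"
  shows "((\<lambda>s. sin (2 * pi * (k * u s))) has_integral
     (sin (2 * pi * (k * u s2)) - sin (2 * pi * (k * u s1))) / (2 * pi\<^sup>2 * k\<^sup>2)
      - (u s2 * cos (2 * pi * (k * u s2)) - u s1 * cos (2 * pi * (k * u s1))) / (pi * k)) {s1..s2}"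
proof -
  let ?Q = "\<lambda>s. sin (2 * pi * (k * u s)) / (2 * pi\<^sup>2 * k\<^sup>2) - u s * cos (2 * pi * (k * u s)) / (pi * k)"
  have "((\<lambda>s. sin (2 * pi * (k * u s))) has_integral ?Q s2 - ?Q s1) {s1..s2}"
  \<comment> \<open>At s = b the square root is not differentiable, but continuity of the primitive
    is enough there. For s < b the sine and the primitive are both 0.\<close>
  proof (rule fundamental_theorem_of_calculus_interior_strong[of "{b}"])
    show "continuous_on {s1..s2} ?Q"
      unfolding u_def using k by (intro continuous_intros) auto
    fix s assume s: "s \<in> {s1<..<s2} - {b}"
    have "(?Q has_real_derivative sin (2 * pi * (k * u s))) (at s)"
    proof (cases "s < b")
      case True
      have "((\<lambda>_. 0) has_real_derivative 0) (at s)" by simp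
      then have "(?Q has_real_derivative 0) (at s)"
      proof (rule has_field_derivative_transform_within_open[where S = "{..<b}"])
        show "0 = ?Q x" if "x \<in> {..<b}" for x using that by (simp add: u_def max_def)
      qed (use True in auto)
      then show ?thesis using True by (simp add: u_def max_def)
    next
      case False
      then have sb: "b < s" using s by auto
      define v where "v = sqrt (s - b)"
      have v: "v > 0" using sb by (simp add: v_def)
      have "((\<lambda>s. sin (2 * pi * (k * sqrt (s - b))) / (2 * pi\<^sup>2 * k\<^sup>2) - sqrt (s - b) * cos (2 * pi * (k * sqrt (s - b))) / (pi * k))
         has_real_derivative sin (2 * pi * (k * u s))) (at s)"
      proof -
        have us: "u s = v" using sb by (simp add: u_def v_def max_def)
        have "((\<lambda>s. sqrt (s - b)) has_real_derivative inverse v / 2) (at s)"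
          using sb unfolding v_def by (auto intro!: derivative_eq_intros)
        note d = this
        have "((\<lambda>x. sin (2 * pi * (k * x)) / (2 * pi\<^sup>2 * k\<^sup>2) - x * cos (2 * pi * (k * x)) / (pi * k))
           has_real_derivative 2 * v * sin (2 * pi * (k * v))) (at v)"
          using k by (auto intro!: derivative_eq_intros simp: field_simps power2_eq_square)
        from DERIV_chain2[OF this[unfolded v_def] d]
        have "((\<lambda>s. sin (2 * pi * (k * sqrt (s - b))) / (2 * pi\<^sup>2 * k\<^sup>2) - sqrt (s - b) * cos (2 * pi * (k * sqrt (s - b))) / (pi * k))
          has_real_derivative 2 * v * sin (2 * pi * (k * v)) * (inverse v / 2)) (at s)"
          by (simp only: v_def)
        moreover have "2 * v * sin (2 * pi * (k * v)) * (inverse v / 2) = sin (2 * pi * (k * v))"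
          using v by simp
        ultimately show ?thesis unfolding us by (simp only:)
      qed
      then show ?thesis
      proof (rule has_field_derivative_transform_within_open[where S = "{b<..}"])
        show "sin (2 * pi * (k * sqrt (x - b))) / (2 * pi\<^sup>2 * k\<^sup>2) - sqrt (x - b) * cos (2 * pi * (k * sqrt (x - b))) / (pi * k) = ?Q x"
          if "x \<in> {b<..}" for x using that by (simp add: u_def max_def)
      qed (use sb in auto)
    qed
    then show "(?Q has_vector_derivative sin (2 * pi * (k * u s))) (at s)"
      by (simp add: has_real_derivative_iff_has_vector_derivative)
  qed (use assms in auto)
  also have "?Q s2 - ?Q s1 = (sin (2 * pi * (k * u s2)) - sin (2 * pi * (k * u s1))) / (2 * pi\<^sup>2 * k\<^sup>2)
      - (u s2 * cos (2 * pi * (k * u s2)) - u s1 * cos (2 * pi * (k * u s1))) / (pi * k)"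
    by (simp add: diff_divide_distrib)
  finally show ?thesis .
qed

text \<open>Half the chord at abscissa n + \<theta> in the circle of radius sqrt s, and 0 outside
  the circle. Sums over n can thus have a range that is independent of s and be integrated over
  s.\<close>

definition half_chord :: "real \<Rightarrow> real \<Rightarrow> nat \<Rightarrow> real" where
  "half_chord \<theta> s n = sqrt (max 0 (s - (real n + \<theta>)\<^sup>2))"

lemma half_chord_nonneg: "0 \<le> half_chord \<theta> s n"
  by (simp add: half_chord_def)

lemma half_chord_Suc_le: "- 1 / 2 \<le> \<theta> \<Longrightarrow> half_chord \<theta> s (Suc n) \<le> half_chord \<theta> s n"
proof -
  assume "- 1 / 2 \<le> \<theta>"
  then have "\<bar>real n + \<theta>\<bar> \<le> \<bar>real (Suc n) + \<theta>\<bar>" by linarith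
  then have "(real n + \<theta>)\<^sup>2 \<le> (real (Suc n) + \<theta>)\<^sup>2" by (simp only: abs_le_square_iff)
  then show ?thesis by (simp add: half_chord_def)
qed

lemma half_chord_le: "0 \<le> R \<Longrightarrow> s \<le> R\<^sup>2 \<Longrightarrow> half_chord \<theta> s n \<le> R"
  unfolding half_chord_def by (rule real_le_lsqrt) (auto, smt (verit) zero_le_power2)

text \<open>Chords outside the circle contribute F 0 = 0. The cutoff leads back to the indices for
  which the plain square root and \<open>circle_exponential_sum\<close> apply.\<close>

lemma chord_cutoff:
  fixes F :: "real \<Rightarrow> 'a::comm_monoid_add"
  assumes \<theta>: "- 1 / 2 \<le> \<theta>" and F: "F 0 = 0"
  obtains m where "m \<le> M" "\<And>n. n < m \<Longrightarrow> (real n + \<theta>)\<^sup>2 \<le> s"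
    "(\<Sum>n<M. F (half_chord \<theta> s n)) = (\<Sum>n<m. F (half_chord \<theta> s n))"
proof -
  have dc: "(real i + \<theta>)\<^sup>2 \<le> s" if "i \<le> j" "(real j + \<theta>)\<^sup>2 \<le> s" for i j
  proof (cases "i = j")
    case False
    then have "\<bar>real i + \<theta>\<bar> \<le> \<bar>real j + \<theta>\<bar>" using that \<theta> by linarith
    then have "(real i + \<theta>)\<^sup>2 \<le> (real j + \<theta>)\<^sup>2" by (simp only: abs_le_square_iff)
    then show ?thesis using that by linarith
  qed (use that in simp)
  obtain m where m: "m \<le> M" "\<And>n. n < M \<Longrightarrow> (real n + \<theta>)\<^sup>2 \<le> s \<longleftrightarrow> n < m"
  proof (rule downward_closed_nat[of M "\<lambda>n. (real n + \<theta>)\<^sup>2 \<le> s"])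
    show "(real i + \<theta>)\<^sup>2 \<le> s" if "i \<le> j" "j < M" "(real j + \<theta>)\<^sup>2 \<le> s" for i j
      using dc that by blast
  qed (rule that)
  have "(\<Sum>n<M. F (half_chord \<theta> s n)) = (\<Sum>n<m. F (half_chord \<theta> s n))"
  proof (rule sum.mono_neutral_right)
    show "\<forall>i\<in>{..<M} - {..<m}. F (half_chord \<theta> s i) = 0"
    proof
      fix i assume "i \<in> {..<M} - {..<m}"
      then have "\<not> (real i + \<theta>)\<^sup>2 \<le> s" using m(2)[of i] by auto
      then show "F (half_chord \<theta> s i) = 0" using F by (simp add: half_chord_def max_def)
    qed
  qed (use m in auto)
  with m that show thesis by fastforce
qed

lemma chord_sin_sum_le:
  assumes "- 1 / 2 \<le> \<theta>" "\<theta> \<le> 1 / 2" "1 \<le> k" "1 \<le> R" "s \<le> R\<^sup>2"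
  shows "\<bar>\<Sum>n<M. sin (2 * pi * (k * half_chord \<theta> s n))\<bar> \<le> 300 * sqrt (k * R)"
proof -
  obtain m where m: "m \<le> M" "\<And>n. n < m \<Longrightarrow> (real n + \<theta>)\<^sup>2 \<le> s"
     "(\<Sum>n<M. sin (2 * pi * (k * half_chord \<theta> s n))) = (\<Sum>n<m. sin (2 * pi * (k * half_chord \<theta> s n)))"
    by (rule chord_cutoff[where F = "\<lambda>u. sin (2 * pi * (k * u))" and M = M and s = s and \<theta> = \<theta>])
       (use assms in auto)
  have "(\<Sum>n<m. sin (2 * pi * (k * half_chord \<theta> s n))) = Im (\<Sum>n<m. cis (2 * pi * (k * sqrt (s - (real n + \<theta>)\<^sup>2))))"
    using m(2) by (auto simp: half_chord_def max_def intro!: sum.cong)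
  also have "\<bar>\<dots>\<bar> \<le> 300 * sqrt (k * R)"
    by (rule order.trans[OF abs_Im_le_cmod circle_exponential_sum]) (use assms m in auto)
  finally show ?thesis using m by simp
qed

lemma chord_cos_sum_le:
  assumes "- 1 / 2 \<le> \<theta>" "\<theta> \<le> 1 / 2" "1 \<le> k" "1 \<le> R" "s \<le> R\<^sup>2"
  shows "\<bar>\<Sum>n<M. half_chord \<theta> s n * cos (2 * pi * (k * half_chord \<theta> s n))\<bar> \<le> 300 * sqrt (k * R) * R"
proof -
  let ?e = "\<lambda>n. cis (2 * pi * (k * sqrt (s - (real n + \<theta>)\<^sup>2)))"
  obtain m where m: "m \<le> M" "\<And>n. n < m \<Longrightarrow> (real n + \<theta>)\<^sup>2 \<le> s"
     "(\<Sum>n<M. half_chord \<theta> s n * cos (2 * pi * (k * half_chord \<theta> s n))) = (\<Sum>n<m. half_chord \<theta> s n * cos (2 * pi * (k * half_chord \<theta> s n)))"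
    by (rule chord_cutoff[where F = "\<lambda>u. u * cos (2 * pi * (k * u))" and M = M and s = s and \<theta> = \<theta>])
       (use assms in auto)
  have "(\<Sum>n<m. half_chord \<theta> s n * cos (2 * pi * (k * half_chord \<theta> s n))) = Re (\<Sum>n<m. of_real (half_chord \<theta> s n) * ?e n)"
    using m(2) by (auto simp: half_chord_def max_def intro!: sum.cong)
  also have "\<bar>\<dots>\<bar> \<le> norm (\<Sum>n<m. of_real (half_chord \<theta> s n) * ?e n)"
    by (rule abs_Re_le_cmod)
  also have "\<dots> \<le> 300 * sqrt (k * R) * half_chord \<theta> s 0"
  proof (rule norm_sum_antimono_weights_le)
    fix i assume "i \<le> m"
    then show "norm (\<Sum>n<i. ?e n) \<le> 300 * sqrt (k * R)"
      using assms m by (intro circle_exponential_sum) auto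
  qed (use assms in \<open>auto simp: half_chord_nonneg half_chord_Suc_le\<close>)
  also have "\<dots> \<le> 300 * sqrt (k * R) * R"
    using assms by (intro mult_left_mono half_chord_le) auto
  finally show ?thesis using m by simp
qed

text \<open>By \<open>has_integral_sin_sqrt\<close> the sum c is, up to a bounded term for each
  chord, -\<pi> k times a primitive in s of the sine sum. Compared with
  \<open>chord_cos_sum_le\<close> this gains when k (s2 - s1) is small against R.\<close>

lemma chord_cos_sum_diff_le:
  fixes M :: nat
  assumes "- 1 / 2 \<le> \<theta>" "\<theta> \<le> 1 / 2" "1 \<le> k" "1 \<le> R" "s1 \<le> s2" "s2 \<le> R\<^sup>2"
  defines "c \<equiv> \<lambda>s. \<Sum>n<M. half_chord \<theta> s n * cos (2 * pi * (k * half_chord \<theta> s n))"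
  shows "\<bar>c s2 - c s1\<bar> \<le> real M + 1200 * k * sqrt (k * R) * (s2 - s1)"
proof -
  let ?S = "\<lambda>n s. sin (2 * pi * (k * half_chord \<theta> s n))"
  let ?C = "\<lambda>n s. half_chord \<theta> s n * cos (2 * pi * (k * half_chord \<theta> s n))"
  define I where "I = (\<Sum>n<M. (?S n s2 - ?S n s1) / (2 * pi\<^sup>2 * k\<^sup>2) - (?C n s2 - ?C n s1) / (pi * k))"
  have "((\<lambda>s. \<Sum>n<M. ?S n s) has_integral I) (cbox s1 s2)"
    unfolding I_def half_chord_def cbox_interval
    by (intro has_integral_sum has_integral_sin_sqrt) (use assms in auto)
  then have "norm I \<le> 300 * sqrt (k * R) * measure lborel (cbox s1 s2)"
    by (rule has_integral_bound[rotated]) (use assms chord_sin_sum_le in auto)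
  then have I: "\<bar>I\<bar> \<le> 300 * sqrt (k * R) * (s2 - s1)" using assms by simp
  have "I = (\<Sum>n<M. ?S n s2 - ?S n s1) / (2 * pi\<^sup>2 * k\<^sup>2) - (c s2 - c s1) / (pi * k)"
    unfolding I_def c_def by (simp only: sum_subtractf sum_divide_distrib[symmetric])
  then have eq: "c s2 - c s1 = (\<Sum>n<M. ?S n s2 - ?S n s1) / (2 * pi * k) - pi * k * I"
    using assms by (simp add: field_simps power2_eq_square)
  have "\<bar>\<Sum>n<M. ?S n s2 - ?S n s1\<bar> \<le> (\<Sum>n<M. 2)"
  proof (rule order.trans[OF sum_abs sum_mono])
    show "\<bar>?S n s2 - ?S n s1\<bar> \<le> 2" for n
      using abs_sin_le_one[of "2 * pi * (k * half_chord \<theta> s2 n)"] abs_sin_le_one[of "2 * pi * (k * half_chord \<theta> s1 n)"]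
      by linarith
  qed
  then have "\<bar>\<Sum>n<M. ?S n s2 - ?S n s1\<bar> / (2 * pi * k) \<le> 2 * real M / (2 * pi * k)"
    using assms by (intro divide_right_mono) auto
  then have "\<bar>(\<Sum>n<M. ?S n s2 - ?S n s1) / (2 * pi * k)\<bar> \<le> 2 * real M / (2 * pi * k)"
    using assms by (simp only: abs_divide) simp
  also have "\<dots> \<le> real M"
  proof -
    have "1 * 1 \<le> pi * k" using assms pi_ge_two by (intro mult_mono) auto
    then have "real M * 1 \<le> real M * (pi * k)" by (intro mult_left_mono) auto
    then show ?thesis using assms by (simp add: divide_le_eq algebra_simps)
  qed
  finally have 1: "\<bar>(\<Sum>n<M. ?S n s2 - ?S n s1) / (2 * pi * k)\<bar> \<le> real M" .
  have "\<bar>pi * k * I\<bar> = pi * (k * \<bar>I\<bar>)" using assms by (simp add: abs_mult)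
  also have "\<dots> \<le> 4 * (k * (300 * sqrt (k * R) * (s2 - s1)))"
    using I assms pi_less_4 by (intro mult_mono) auto
  finally have 2: "\<bar>pi * k * I\<bar> \<le> 1200 * k * sqrt (k * R) * (s2 - s1)" by simp
  show ?thesis unfolding eq using 1 2 by linarith
qed

text \<open>The two bounds cross at k = y. Up to there the sum of 1 / sqrt k is O(sqrt y), and
  beyond it y times the tail of the sum of k^(-3/2) is O(sqrt y) as well.\<close>

lemma sum_min_powers_le:
  fixes y :: real
  assumes "y > 0"
  shows "(\<Sum>k=1..n. min (y / (real k * sqrt (real k))) (1 / sqrt (real k))) \<le> 8 * sqrt y"
proof -
  let ?f = "\<lambda>k. min (y / (real k * sqrt (real k))) (1 / sqrt (real k))"
  have first: "(\<Sum>k=1..n. 1 / sqrt (real k)) \<le> 2 * sqrt (real n)" for n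
  proof (induction n)
    case (Suc n)
    define a b where "a = sqrt (real n)" and "b = sqrt (real (Suc n))"
    have ab: "0 \<le> a" "a \<le> b" "b > 0" "b * b = real (Suc n)" "a * a = real n"
      by (auto simp: a_def b_def)
    have "1 = (b - a) * (b + a)" using ab by (simp add: algebra_simps)
    also have "\<dots> \<le> (b - a) * (2 * b)" using ab by (intro mult_left_mono) auto
    finally have "1 / b \<le> 2 * (b - a)" using ab by (simp add: divide_le_eq mult_ac)
    then show ?case using Suc unfolding a_def b_def by simp
  qed simp
  \<comment> \<open>The summand k^(-3/2) is at most 6 times the difference of k^(-1/2) and (k +
    1)^(-1/2), because sqrt (k + 1) \<le> (3/2) sqrt k.\<close>
  have second: "(\<Sum>k=m+1..m+j. 1 / (real k * sqrt (real k))) \<le> 6 / sqrt (real m + 1) - 6 / sqrt (real m + real j + 1)" for m j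
  proof (induction j)
    case (Suc j)
    define a b where "a = sqrt (real m + real j + 1)" and "b = sqrt (real m + real j + 2)"
    have a1: "a \<ge> 1" by (simp add: a_def)
    have ab: "0 < a" "a \<le> b" "b * b = real m + real j + 2" "a * a = real m + real j + 1"
      by (auto simp: a_def b_def)
    have b32: "b \<le> 3/2 * a"
    proof (rule power2_le_imp_le)
      show "b\<^sup>2 \<le> (3/2 * a)\<^sup>2" using ab a1 by (simp add: power2_eq_square)
    qed (use ab in simp)
    have "a * b * (a + b) \<le> a * (3/2 * a) * (a + 3/2 * a)"
      using b32 ab by (intro mult_mono add_mono) auto
    also have "\<dots> \<le> 6 * (a * a * a)" using ab by simp
    finally have "a * b * (a + b) \<le> 6 * (a * a * a)" .
    have "1 = (b - a) * (a + b)" using ab by (simp add: algebra_simps)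
    moreover have "1 / a - 1 / b = (b - a) * (a + b) / (a * b * (a + b))"
      using ab by (simp add: diff_frac_eq)
    ultimately have "1 / a - 1 / b = 1 / (a * b * (a + b))" by simp
    moreover have "1 / (6 * (a * a * a)) \<le> 1 / (a * b * (a + b))"
      using \<open>a * b * (a + b) \<le> 6 * (a * a * a)\<close> ab by (intro divide_left_mono) auto
    moreover have "1 / (a * a * a) = 6 * (1 / (6 * (a * a * a)))" "6 / a - 6 / b = 6 * (1 / a - 1 / b)"
      by simp_all
    ultimately have "1 / (a * a * a) \<le> 6 / a - 6 / b" by argo
    moreover have "real (m + Suc j) = a * a" "sqrt (real (m + Suc j)) = a"
      unfolding ab(4) by (simp_all add: a_def add_ac)
    ultimately have "1 / (real (m + Suc j) * sqrt (real (m + Suc j))) \<le> 6 / a - 6 / b"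
      by (simp only:)
    moreover have "(\<Sum>k=m+1..m+Suc j. 1 / (real k * sqrt (real k)))
        = (\<Sum>k=m+1..m+j. 1 / (real k * sqrt (real k))) + 1 / (real (m + Suc j) * sqrt (real (m + Suc j)))"
      by simp
    moreover have "sqrt (real m + real (Suc j) + 1) = b"
      unfolding b_def by (rule arg_cong[where f = sqrt]) simp
    ultimately show ?case
      using Suc.IH unfolding a_def[symmetric] \<open>sqrt (real m + real (Suc j) + 1) = b\<close> by argo
  qed simp
  define m where "m = min n (nat \<lfloor>y\<rfloor>)"
  have my: "real m \<le> y" using assms unfolding m_def by linarith
  have "(\<Sum>k=1..n. ?f k) = (\<Sum>k=1..m. ?f k) + (\<Sum>k=m+1..m+(n-m). ?f k)"
  proof -
    have "(\<Sum>k=1..m+(n-m). ?f k) = (\<Sum>k=1..m. ?f k) + (\<Sum>k=m+1..m+(n-m). ?f k)"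
      by (rule sum.ub_add_nat) simp
    moreover have "m + (n - m) = n" by (simp add: m_def)
    ultimately show ?thesis by (simp only:)
  qed
  also have "(\<Sum>k=1..m. ?f k) \<le> (\<Sum>k=1..m. 1 / sqrt (real k))" by (intro sum_mono) auto
  also have "\<dots> \<le> 2 * sqrt (real m)" by (rule first)
  also have "\<dots> \<le> 2 * sqrt y" using my by simp
  also have "(\<Sum>k=m+1..m+(n-m). ?f k) \<le> 6 * sqrt y"
  proof (cases "m = n")
    case True
    then show ?thesis using assms by simp
  next
    case False
    then have ym: "y \<le> real m + 1" unfolding m_def using assms by linarith
    have "(\<Sum>k=m+1..m+(n-m). ?f k) \<le> y * (\<Sum>k=m+1..m+(n-m). 1 / (real k * sqrt (real k)))"
      unfolding sum_distrib_left by (intro sum_mono) auto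
    also have "\<dots> \<le> y * (6 / sqrt (real m + 1))"
    proof (rule mult_left_mono)
      have "0 \<le> 6 / sqrt (real m + real (n - m) + 1)" by simp
      then show "(\<Sum>k=m+1..m+(n-m). 1 / (real k * sqrt (real k))) \<le> 6 / sqrt (real m + 1)"
        using second[of m "n - m"] by argo
    qed (use assms in simp)
    also have "\<dots> \<le> y * (6 / sqrt y)"
      using ym assms by (intro mult_left_mono divide_left_mono) auto
    also have "\<dots> = 6 * (y / sqrt y)" by (simp only: times_divide_eq_right mult.commute)
    also have "\<dots> = 6 * sqrt y" using assms by (simp only: real_div_sqrt less_imp_le)
    finally show ?thesis .
  qed
  finally have "(\<Sum>k=1..n. ?f k) \<le> 2 * sqrt y + 6 * sqrt y" by (simp only: add_le_cancel_left)
  then show ?thesis by argo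
qed

section \<open>Lattice sums and integrals of radial functions\<close>

definition bdd_borel :: "(real \<Rightarrow> real) \<Rightarrow> bool" where
  "bdd_borel f \<longleftrightarrow> f \<in> borel_measurable borel \<and> (\<exists>M. \<forall>x. \<bar>f x\<bar> \<le> M)"

text \<open>The disjoint union of the unit cells centred at -N, ..., N, so that each term of
  \<open>lattice_op N\<close> faces one cell of \<open>integral_op N\<close>.\<close>

definition window :: "nat \<Rightarrow> real set" where
  "window N = {- (real N + 1/2)..<real N + 1/2}"

text \<open>Iterating \<open>k\<close> times the operators \<open>lattice_op\<close> and \<open>integral_op\<close> on a function \<open>f\<close> that vanishes above \<open>N\<^sup>2\<close>
  gives, at \<open>0\<close>, the sum of \<open>f \<bar>z\<bar>\<^sup>2\<close> over \<open>\<int>\<^sup>k\<close> and its integral over \<open>\<real>\<^sup>k\<close>.\<close>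

definition lattice_op :: "nat \<Rightarrow> (real \<Rightarrow> real) \<Rightarrow> real \<Rightarrow> real" where
  "lattice_op N f c = (\<Sum>n\<in>{-int N..int N}. f (c + (of_int n)\<^sup>2))"

definition integral_op :: "nat \<Rightarrow> (real \<Rightarrow> real) \<Rightarrow> real \<Rightarrow> real" where
  "integral_op N f c = (\<integral>x. indicator (window N) x * f (c + x\<^sup>2) \<partial>lborel)"

lemma window_sets [measurable]: "window N \<in> sets borel"
  by (simp add: window_def)

lemma integrable_bdd_borel:
  assumes f: "bdd_borel f" and g: "g \<in> borel_measurable borel"
    and S: "S \<in> sets borel" "bounded S"
  shows "integrable lborel (\<lambda>x. indicator S x * f (g x))"
proof -
  obtain M where M: "\<And>x. \<bar>f x\<bar> \<le> M" using f by (auto simp: bdd_borel_def)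
  have "emeasure lborel S < \<infinity>"
    using emeasure_bounded_finite[OF S(2)] S(1) by simp
  then have "integrable lborel (\<lambda>x. M * indicator S x)"
    using S by (intro integrable_mult_right integrable_real_indicator) auto
  then show ?thesis
  proof (rule Bochner_Integration.integrable_bound)
    show "(\<lambda>x. indicator S x * f (g x)) \<in> borel_measurable lborel"
      using f g S measurable_compose[OF g, of f borel] unfolding bdd_borel_def by auto
    show "AE x in lborel. norm (indicator S x * f (g x)) \<le> norm (M * indicator S x)"
      using M by (auto simp: indicator_def abs_mult intro!: AE_I2 order.trans[OF M])
  qed
qed

lemma bounded_window: "bounded (window N)"
  unfolding window_def by (rule bounded_subset[OF bounded_closed_interval[of "- (real N + 1/2)" "real N + 1/2"]]) auto

lemma integrable_window:
  "bdd_borel f \<Longrightarrow> integrable lborel (\<lambda>x. indicator (window N) x * f (c + x\<^sup>2))"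
  by (rule integrable_bdd_borel) (auto simp: bounded_window)

lemma measure_window: "measure lborel (window N) = 2 * real N + 1"
  by (simp add: window_def)

lemma integral_op_abs_le:
  assumes f: "bdd_borel f" and M: "\<And>x. x \<in> window N \<Longrightarrow> \<bar>f (c + x\<^sup>2)\<bar> \<le> M"
  shows "\<bar>integral_op N f c\<bar> \<le> (2 * real N + 1) * M"
proof -
  have fin: "emeasure lborel (window N) < \<infinity>"
    using emeasure_bounded_finite[OF bounded_window] by simp
  have "\<bar>integral_op N f c\<bar> \<le> (\<integral>x. M * indicator (window N) x \<partial>lborel)"
    unfolding integral_op_def real_norm_def[symmetric]
  proof (rule Bochner_Integration.integral_norm_bound_integral)
    show "integrable lborel (\<lambda>x. M * indicator (window N) x)"
      using fin by (intro integrable_mult_right integrable_real_indicator) auto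
    show "norm (indicator (window N) x * f (c + x\<^sup>2)) \<le> M * indicator (window N) x" for x
      using M[of x] by (auto simp: indicator_def)
  qed (rule integrable_window[OF f])
  also have "\<dots> = (2 * real N + 1) * M"
    using fin by (simp add: measure_window)
  finally show ?thesis .
qed

lemma bdd_borel_integral_op [intro]:
  assumes "bdd_borel f"
  shows "bdd_borel (integral_op N f)"
proof -
  have [measurable]: "f \<in> borel_measurable borel" using assms by (simp add: bdd_borel_def)
  have "integral_op N f \<in> borel_measurable borel"
    unfolding integral_op_def[abs_def] by measurable
  moreover obtain M where "\<And>x. \<bar>f x\<bar> \<le> M" using assms by (auto simp: bdd_borel_def)
  then have "\<bar>integral_op N f c\<bar> \<le> (2 * real N + 1) * M" for c
    using assms by (intro integral_op_abs_le) auto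
  ultimately show ?thesis unfolding bdd_borel_def by blast
qed

lemma bdd_borel_lattice_op [intro]:
  assumes "bdd_borel f"
  shows "bdd_borel (lattice_op N f)"
proof -
  have [measurable]: "f \<in> borel_measurable borel" using assms by (simp add: bdd_borel_def)
  have "lattice_op N f \<in> borel_measurable borel"
    unfolding lattice_op_def[abs_def] by measurable
  moreover obtain M where M: "\<And>x. \<bar>f x\<bar> \<le> M" using assms by (auto simp: bdd_borel_def)
  have "\<bar>lattice_op N f c\<bar> \<le> (\<Sum>n\<in>{-int N..int N}. M)" for c
    unfolding lattice_op_def by (rule order.trans[OF sum_abs sum_mono]) (rule M)
  ultimately show ?thesis unfolding bdd_borel_def by blast
qed

lemma bdd_borel_diff [intro]:
  assumes "bdd_borel f" "bdd_borel g"
  shows "bdd_borel (\<lambda>x. f x - g x)"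
proof -
  obtain M M' where "\<And>x. \<bar>f x\<bar> \<le> M" "\<And>x. \<bar>g x\<bar> \<le> M'"
    using assms by (auto simp: bdd_borel_def)
  then have "\<bar>f x - g x\<bar> \<le> M + M'" for x
    by (meson abs_triangle_ineq4 add_mono order.trans)
  then show ?thesis using assms unfolding bdd_borel_def by auto
qed

lemma lattice_op_diff: "lattice_op N (\<lambda>x. f x - g x) c = lattice_op N f c - lattice_op N g c"
  by (simp add: lattice_op_def sum_subtractf)

lemma integral_op_diff:
  "bdd_borel f \<Longrightarrow> bdd_borel g \<Longrightarrow> integral_op N (\<lambda>x. f x - g x) c = integral_op N f c - integral_op N g c"
  unfolding integral_op_def right_diff_distrib
  by (rule Bochner_Integration.integral_diff) (rule integrable_window; assumption)+

lemma lattice_integral_op_commute: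
  assumes "bdd_borel f"
  shows "lattice_op N (integral_op N' f) = integral_op N' (lattice_op N f)"
proof
  fix c
  have "integral_op N' (lattice_op N f) c
      = (\<integral>x. (\<Sum>n\<in>{-int N..int N}. indicator (window N') x * f ((c + (of_int n)\<^sup>2) + x\<^sup>2)) \<partial>lborel)"
    by (simp add: integral_op_def lattice_op_def sum_distrib_left add_ac)
  also have "\<dots> = (\<Sum>n\<in>{-int N..int N}. integral_op N' f (c + (of_int n)\<^sup>2))"
    unfolding integral_op_def using assms by (intro Bochner_Integration.integral_sum integrable_window)
  finally show "lattice_op N (integral_op N' f) c = integral_op N' (lattice_op N f) c"
    by (simp add: lattice_op_def)
qed

lemma indicator_window_sum:
  "indicator (window N) x = (\<Sum>n\<in>{-int N..int N}. indicator {of_int n - 1/2..<of_int n + 1/2} x :: real)"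
proof -
  define m where "m = \<lfloor>x + 1/2\<rfloor>"
  have iff: "x \<in> {of_int n - 1/2..<of_int n + 1/2} \<longleftrightarrow> n = m" for n :: int
    unfolding m_def by (auto simp: floor_eq_iff algebra_simps eq_commute[of n])
  have "x \<in> window N \<longleftrightarrow> m \<in> {-int N..int N}"
    unfolding m_def window_def by (auto simp: le_floor_iff floor_le_iff)
  then show ?thesis
    unfolding indicator_def iff by (simp add: sum.If_cases)
qed

text \<open>The integral becomes an average over \<theta> of lattice sums shifted by \<theta>; a
  bound that is uniform in the shift therefore controls the integral too.\<close>

lemma integral_op_cells:
  assumes "bdd_borel f"
  shows "integral_op N f c = (\<integral>\<theta>. indicator {-1/2..<1/2} \<theta> * (\<Sum>n\<in>{-int N..int N}. f (c + (of_int n + \<theta>)\<^sup>2)) \<partial>lborel)"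
proof -
  let ?I = "\<lambda>n::int. {of_int n - 1/2..<of_int n + 1/2 :: real}"
  have [measurable]: "f \<in> borel_measurable borel" using assms by (simp add: bdd_borel_def)
  have bI: "bounded {a..<b}" for a b :: real
    by (rule bounded_subset[OF bounded_closed_interval[of a b]]) auto
  have "integral_op N f c = (\<integral>x. (\<Sum>n\<in>{-int N..int N}. indicator (?I n) x * f (c + x\<^sup>2)) \<partial>lborel)"
    unfolding integral_op_def indicator_window_sum sum_distrib_right ..
  also have "\<dots> = (\<Sum>n\<in>{-int N..int N}. \<integral>x. indicator (?I n) x * f (c + x\<^sup>2) \<partial>lborel)"
    by (intro Bochner_Integration.integral_sum integrable_bdd_borel[OF assms]) (auto simp: bI)
  also have "\<dots> = (\<Sum>n\<in>{-int N..int N}. \<integral>\<theta>. indicator {-1/2..<1/2} \<theta> * f (c + (of_int n + \<theta>)\<^sup>2) \<partial>lborel)"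
  proof (rule sum.cong[OF refl])
    fix n :: int
    show "(\<integral>x. indicator (?I n) x * f (c + x\<^sup>2) \<partial>lborel) = (\<integral>\<theta>. indicator {-1/2..<1/2} \<theta> * f (c + (of_int n + \<theta>)\<^sup>2) \<partial>lborel)"
      by (subst lborel_integral_real_affine[where c = 1 and t = "of_int n"])
         (auto intro!: Bochner_Integration.integral_cong simp: indicator_def)
  qed
  also have "\<dots> = (\<integral>\<theta>. (\<Sum>n\<in>{-int N..int N}. indicator {-1/2..<1/2} \<theta> * f (c + (of_int n + \<theta>)\<^sup>2)) \<partial>lborel)"
    by (intro Bochner_Integration.integral_sum[symmetric] integrable_bdd_borel[OF assms]) (auto simp: bI)
  finally show ?thesis by (simp add: sum_distrib_left)
qed

lemma integral_unit_cell_abs_le: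
  fixes F :: "real \<Rightarrow> real"
  assumes F: "integrable lborel (\<lambda>\<theta>. indicator {-1/2..<1/2} \<theta> * F \<theta>)"
    and M: "\<And>\<theta>. \<theta> \<in> {-1/2..<1/2} \<Longrightarrow> \<bar>F \<theta>\<bar> \<le> M"
  shows "\<bar>\<integral>\<theta>. indicator {-1/2..<1/2} \<theta> * F \<theta> \<partial>lborel\<bar> \<le> M"
proof -
  have "\<bar>\<integral>\<theta>. indicator {-1/2..<1/2} \<theta> * F \<theta> \<partial>lborel\<bar> \<le> (\<integral>\<theta>. M * indicator {-1/2..<1/2::real} \<theta> \<partial>lborel)"
    unfolding real_norm_def[symmetric]
  proof (rule Bochner_Integration.integral_norm_bound_integral[OF F])
    show "integrable lborel (\<lambda>\<theta>. M * indicator {-1/2..<1/2::real} \<theta>)"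
      by (intro integrable_mult_right integrable_real_indicator) auto
    show "norm (indicator {-1/2..<1/2} \<theta> * F \<theta>) \<le> M * indicator {-1/2..<1/2} \<theta>" for \<theta>
      using M[of \<theta>] by (auto simp: indicator_def)
  qed
  also have "\<dots> = M" by simp
  finally show ?thesis .
qed

text \<open>Both error terms of \<open>L\<^sup>2 - J\<^sup>2 = L (L - J) + J (L - J)\<close> are controlled by shifted one-dimensional sums.\<close>

lemma lattice_minus_integral_op_two_dim:
  assumes f: "bdd_borel f"
    and M: "\<And>\<theta>. \<theta> \<in> {-1/2..1/2} \<Longrightarrow> \<bar>\<Sum>n\<in>{-int N..int N}. lattice_op N f ((of_int n + \<theta>)\<^sup>2) - integral_op N f ((of_int n + \<theta>)\<^sup>2)\<bar> \<le> M"
  shows "\<bar>lattice_op N (lattice_op N f) 0 - integral_op N (integral_op N f) 0\<bar> \<le> 2 * M"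
proof -
  define D where "D c = lattice_op N f c - integral_op N f c" for c
  have D: "bdd_borel D" unfolding D_def using f by auto
  have "lattice_op N (lattice_op N f) 0 - integral_op N (integral_op N f) 0 = lattice_op N D 0 + integral_op N D 0"
    unfolding D_def using f lattice_integral_op_commute[OF f, of N N]
    by (simp add: lattice_op_diff integral_op_diff bdd_borel_integral_op bdd_borel_lattice_op)
  moreover have "\<bar>lattice_op N D 0\<bar> \<le> M"
    using M[of 0] by (simp add: lattice_op_def[of _ D] D_def)
  moreover have "\<bar>integral_op N D 0\<bar> \<le> M"
    unfolding integral_op_cells[OF D]
  proof (rule integral_unit_cell_abs_le)
    have "integrable lborel (\<lambda>\<theta>. \<Sum>n\<in>{-int N..int N}. indicator {-1/2..<1/2} \<theta> * D (0 + (of_int n + \<theta>)\<^sup>2))"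
      by (intro Bochner_Integration.integrable_sum integrable_bdd_borel[OF D])
         (auto intro: bounded_subset[OF bounded_closed_interval[of "-1/2::real" "1/2"]])
    then show "integrable lborel (\<lambda>\<theta>. indicator {-1/2..<1/2} \<theta> * (\<Sum>n\<in>{-int N..int N}. D (0 + (of_int n + \<theta>)\<^sup>2)))"
      by (simp add: sum_distrib_left)
    show "\<bar>\<Sum>n\<in>{-int N..int N}. D (0 + (of_int n + \<theta>)\<^sup>2)\<bar> \<le> M" if "\<theta> \<in> {-1/2..<1/2}" for \<theta>
      using M[of \<theta>] that by (simp add: D_def)
  qed
  ultimately show ?thesis by linarith
qed

section \<open>The circle problem on average\<close>

text \<open>With f = frac u this is (2/3) B3(f) - 2 u B2(f) in terms of Bernoulli polynomials, the
  Euler-Maclaurin remainder of the sum of u^2 - n^2 over \<bar>n\<bar> \<le> u; see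
  \<open>tent_defect\<close>. Only the B2 term is unbounded, and its Fourier series is
  \<open>cosine_series_bernoulli2\<close>.\<close>

definition chord_defect :: "real \<Rightarrow> real" where
  "chord_defect u = 4 * ((frac u) ^ 3 / 6 - (frac u)\<^sup>2 / 4 + frac u / 12) - 2 * (u * ((frac u)\<^sup>2 - frac u + 1/6))"

text \<open>After Fourier expansion, frequency k contributes O(R / k^2) plus a constant times min (R
  sqrt (k R), k h sqrt (k R)) / k^2, where h = s2 - s1. The two bounds cross at k = R/h, and the sum
  over k is O(R sqrt h). The constant is 9606 = 1200 * 8 + 3 * 2.\<close>

lemma sum_integral_cos_bound:
  fixes \<theta> R s1 s2 :: real and M :: nat
  assumes \<theta>: "- 1 / 2 \<le> \<theta>" "\<theta> \<le> 1 / 2" and R: "1 \<le> R" and s: "s1 + 1 \<le> s2" "s2 \<le> R\<^sup>2"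
    and M: "real M \<le> 3 * R"
  defines "B \<equiv> \<lambda>u. u * ((frac u)\<^sup>2 - frac u + 1/6)"
  shows "\<bar>(\<Sum>n<M. B (half_chord \<theta> s2 n)) - (\<Sum>n<M. B (half_chord \<theta> s1 n))\<bar> \<le> 9606 * R * sqrt (s2 - s1)"
proof -
  define h where "h = s2 - s1"
  have h: "h \<ge> 1" using s by (simp add: h_def)
  have hs: "1 \<le> sqrt h" using h by simp
  define c where "c k s = (\<Sum>n<M. half_chord \<theta> s n * cos (2 * pi * (k * half_chord \<theta> s n)))" for k s
  have series: "(\<lambda>k. c (real (Suc k)) s / (real (Suc k))\<^sup>2) sums (pi\<^sup>2 * (\<Sum>n<M. B (half_chord \<theta> s n)))" for s
  proof -
    have "(\<lambda>k. \<Sum>n<M. half_chord \<theta> s n * (cos (2 * pi * real (Suc k) * half_chord \<theta> s n) / (real (Suc k))\<^sup>2))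
        sums (\<Sum>n<M. half_chord \<theta> s n * (pi\<^sup>2 * ((frac (half_chord \<theta> s n))\<^sup>2 - frac (half_chord \<theta> s n) + 1/6)))"
      by (intro sums_sum sums_mult cosine_series_bernoulli2)
    moreover have "(\<Sum>n<M. half_chord \<theta> s n * (cos (2 * pi * real (Suc k) * half_chord \<theta> s n) / (real (Suc k))\<^sup>2)) = c (real (Suc k)) s / (real (Suc k))\<^sup>2" for k
      unfolding c_def sum_divide_distrib by (intro sum.cong refl) (simp only: times_divide_eq_right mult.assoc)
    moreover have "(\<Sum>n<M. half_chord \<theta> s n * (pi\<^sup>2 * ((frac (half_chord \<theta> s n))\<^sup>2 - frac (half_chord \<theta> s n) + 1/6))) = pi\<^sup>2 * (\<Sum>n<M. B (half_chord \<theta> s n))"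
      unfolding B_def sum_distrib_left by (intro sum.cong refl) (simp only: mult.left_commute)
    ultimately show ?thesis by (simp only:)
  qed
  have bound: "\<bar>c k s2 - c k s1\<bar> / k\<^sup>2 \<le> 3 * R * (1 / k\<^sup>2) + 1200 * sqrt R * h * min (R / h / (k * sqrt k)) (1 / sqrt k)" if k: "1 \<le> k" for k
  proof -
    have 1: "\<bar>c k s2 - c k s1\<bar> \<le> 600 * sqrt (k * R) * R"
    proof -
      have "\<bar>c k s2\<bar> \<le> 300 * sqrt (k * R) * R" "\<bar>c k s1\<bar> \<le> 300 * sqrt (k * R) * R"
        unfolding c_def using \<theta> k R s by (intro chord_cos_sum_le; simp)+
      then show ?thesis by linarith
    qed
    have 2: "\<bar>c k s2 - c k s1\<bar> \<le> real M + 1200 * k * sqrt (k * R) * h"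
      unfolding c_def h_def using \<theta> k R s by (intro chord_cos_sum_diff_le) auto
    have sk: "sqrt k * sqrt k = k" using k by simp
    have skR: "sqrt (k * R) = sqrt k * sqrt R" by (simp add: real_sqrt_mult)
    have e1: "1200 * sqrt R * h * (R / h / (k * sqrt k)) = 1200 * sqrt (k * R) * R / k\<^sup>2"
      unfolding skR using h k sk by (simp add: field_simps power2_eq_square)
    have e2: "1200 * sqrt R * h * (1 / sqrt k) = 1200 * k * sqrt (k * R) * h / k\<^sup>2"
      unfolding skR using h k sk by (simp add: field_simps power2_eq_square)
    have pos: "0 \<le> 3 * R * (1 / k\<^sup>2)" using R by simp
    show ?thesis
    proof (cases "R / h / (k * sqrt k) \<le> 1 / sqrt k")
      case True
      have "\<bar>c k s2 - c k s1\<bar> / k\<^sup>2 \<le> 1200 * sqrt (k * R) * R / k\<^sup>2"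
      proof (rule divide_right_mono)
        have "0 \<le> sqrt (k * R) * R" using k R by simp
        with 1 show "\<bar>c k s2 - c k s1\<bar> \<le> 1200 * sqrt (k * R) * R" by linarith
      qed simp
      then show ?thesis using True pos e1 by (simp only: min_absorb1)
    next
      case False
      have "\<bar>c k s2 - c k s1\<bar> / k\<^sup>2 \<le> (3 * R + 1200 * k * sqrt (k * R) * h) / k\<^sup>2"
        using 2 M by (intro divide_right_mono) auto
      also have "\<dots> = 3 * R * (1 / k\<^sup>2) + 1200 * sqrt R * h * (1 / sqrt k)"
        unfolding e2 by (simp add: add_divide_distrib)
      finally show ?thesis using False by (simp add: min_def)
    qed
  qed
  have partial: "norm (\<Sum>k<K. c (real (Suc k)) s2 / (real (Suc k))\<^sup>2 - c (real (Suc k)) s1 / (real (Suc k))\<^sup>2) \<le> 9606 * R * sqrt h" for K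
  proof -
    have "norm (\<Sum>k<K. c (real (Suc k)) s2 / (real (Suc k))\<^sup>2 - c (real (Suc k)) s1 / (real (Suc k))\<^sup>2)
       \<le> (\<Sum>k<K. \<bar>c (real (Suc k)) s2 - c (real (Suc k)) s1\<bar> / (real (Suc k))\<^sup>2)"
      by (rule sum_norm_le) (simp add: diff_divide_distrib[symmetric] abs_divide)
    also have "\<dots> \<le> (\<Sum>k<K. 3 * R * (1 / (real (Suc k))\<^sup>2) + 1200 * sqrt R * h * min (R / h / (real (Suc k) * sqrt (real (Suc k)))) (1 / sqrt (real (Suc k))))"
      by (intro sum_mono bound) simp
    also have "\<dots> = 3 * R * (\<Sum>k<K. 1 / (real (Suc k))\<^sup>2) + 1200 * sqrt R * h * (\<Sum>k=1..K. min (R / h / (real k * sqrt (real k))) (1 / sqrt (real k)))"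
      unfolding sum.distrib sum_distrib_left[symmetric] by (simp add: sum.atLeast1_atMost_eq)
    also have "\<dots> \<le> 3 * R * 2 + 1200 * sqrt R * h * (8 * sqrt (R / h))"
    proof (intro add_mono mult_left_mono)
      have "(\<Sum>k<K. 1 / (real (Suc k))\<^sup>2) \<le> (\<Sum>k. 1 / (real k + 1)\<^sup>2)"
        using sum_le_suminf[OF sums_summable[OF inverse_squares_sums'], of "{..<K}"] by (simp add: add.commute)
      also have "\<dots> = pi\<^sup>2 / 6" using inverse_squares_sums' by (rule sums_unique[symmetric])
      also have "\<dots> \<le> 2"
      proof -
        have "pi \<le> 3.2" using pi_approx by simp
        then have "pi\<^sup>2 \<le> 3.2\<^sup>2" by (intro power_mono) auto
        then show ?thesis by (simp add: power2_eq_square)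
      qed
      finally show "(\<Sum>k<K. 1 / (real (Suc k))\<^sup>2) \<le> 2" .
      show "(\<Sum>k=1..K. min (R / h / (real k * sqrt (real k))) (1 / sqrt (real k))) \<le> 8 * sqrt (R / h)"
        using R h by (intro sum_min_powers_le) auto
    qed (use R h in auto)
    also have "1200 * sqrt R * h * (8 * sqrt (R / h)) = 9600 * R * sqrt h"
    proof -
      have "sqrt R * sqrt R = R" "h = sqrt h * sqrt h" using R h by auto
      then have "sqrt R * h * sqrt (R / h) = R * sqrt h"
        using hs by (simp add: real_sqrt_divide field_simps)
      then show ?thesis by (simp add: mult_ac)
    qed
    also have "3 * R * 2 + 9600 * R * sqrt h \<le> 6 * R * sqrt h + 9600 * R * sqrt h"
      using R hs by simp
    finally show ?thesis by (simp add: algebra_simps)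
  qed
  let ?D = "(\<Sum>n<M. B (half_chord \<theta> s2 n)) - (\<Sum>n<M. B (half_chord \<theta> s1 n))"
  have "(\<lambda>k. c (real (Suc k)) s2 / (real (Suc k))\<^sup>2 - c (real (Suc k)) s1 / (real (Suc k))\<^sup>2) sums (pi\<^sup>2 * ?D)"
    unfolding right_diff_distrib by (intro sums_diff series)
  then have "(\<lambda>K. \<Sum>k<K. c (real (Suc k)) s2 / (real (Suc k))\<^sup>2 - c (real (Suc k)) s1 / (real (Suc k))\<^sup>2) \<longlonglongrightarrow> pi\<^sup>2 * ?D"
    by (simp only: sums_def)
  then have "norm (pi\<^sup>2 * ?D) \<le> 9606 * R * sqrt h"
    by (rule Lim_norm_ubound[OF sequentially_bot]) (simp only: partial eventually_True)
  then have "pi\<^sup>2 * \<bar>?D\<bar> \<le> 9606 * R * sqrt h" by (simp only: real_norm_def abs_mult abs_power2)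
  moreover have "1 * \<bar>?D\<bar> \<le> pi\<^sup>2 * \<bar>?D\<bar>"
    using pi_ge_two by (intro mult_right_mono one_le_power) auto
  ultimately show ?thesis unfolding h_def mult_1_left by (rule order.trans[rotated])
qed

lemma cubic_frac_bound: "\<bar>4 * ((frac u) ^ 3 / 6 - (frac u)\<^sup>2 / 4 + frac u / 12)\<bar> \<le> (1::real)"
proof -
  define f where "f = frac u"
  have f: "0 \<le> f" "f \<le> 1" using frac_lt_1[of u] by (auto simp: f_def)
  then have "0 \<le> f ^ 3" "f ^ 3 \<le> 1" "0 \<le> f\<^sup>2" "f\<^sup>2 \<le> 1" by (auto intro: power_le_one)
  moreover have "\<bar>4 * (a / 6 - b / 4 + f / 12)\<bar> \<le> 1" if "0 \<le> a" "a \<le> 1" "0 \<le> b" "b \<le> 1" for a b :: real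
  proof (rule abs_leI)
    show "4 * (a / 6 - b / 4 + f / 12) \<le> 1" using that f by argo
    show "- (4 * (a / 6 - b / 4 + f / 12)) \<le> 1" using that f by argo
  qed
  ultimately show ?thesis unfolding f_def[symmetric] by blast
qed

lemma quadratic_frac_bound: "\<bar>(frac u)\<^sup>2 - frac u + 1/6\<bar> \<le> (1::real)"
proof -
  define f where "f = frac u"
  have f: "0 \<le> f" "f \<le> 1" using frac_lt_1[of u] by (auto simp: f_def)
  then have "f\<^sup>2 \<le> f" "0 \<le> f\<^sup>2" by (auto simp: power2_eq_square mult_left_le)
  then show ?thesis using f unfolding f_def[symmetric] abs_le_iff by (intro conjI) linarith+
qed

lemma chord_defect_le: "0 \<le> u \<Longrightarrow> \<bar>chord_defect u\<bar> \<le> 2 * u + 1"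
proof -
  assume u: "0 \<le> u"
  have "\<bar>u * ((frac u)\<^sup>2 - frac u + 1/6)\<bar> \<le> u * 1"
    unfolding abs_mult using u quadratic_frac_bound[of u] by (intro mult_mono) auto
  then show ?thesis using cubic_frac_bound[of u] unfolding chord_defect_def by linarith
qed

text \<open>Twice the bound 9606 for the B2 part, plus 3 R for the bounded B3 part at each of s1 and
  s2, which is absorbed because s2 - s1 \<ge> 1.\<close>

lemma half_chord_defect_diff_le:
  fixes \<theta> R s1 s2 :: real and M :: nat
  assumes \<theta>: "- 1 / 2 \<le> \<theta>" "\<theta> \<le> 1 / 2" and R: "1 \<le> R" and s: "s1 + 1 \<le> s2" "s2 \<le> R\<^sup>2"
    and M: "real M \<le> 3 * R"
  shows "\<bar>(\<Sum>n<M. chord_defect (half_chord \<theta> s2 n)) - (\<Sum>n<M. chord_defect (half_chord \<theta> s1 n))\<bar> \<le> 19218 * R * sqrt (s2 - s1)"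
proof -
  let ?B = "\<lambda>u. u * ((frac u)\<^sup>2 - frac u + 1/6) :: real"
  let ?C = "\<lambda>u. 4 * ((frac u) ^ 3 / 6 - (frac u)\<^sup>2 / 4 + frac u / 12) :: real"
  have hs: "1 \<le> sqrt (s2 - s1)" using s by simp
  have C: "\<bar>\<Sum>n<M. ?C (half_chord \<theta> s n)\<bar> \<le> 3 * R" for s
  proof -
    have "\<bar>\<Sum>n<M. ?C (half_chord \<theta> s n)\<bar> \<le> (\<Sum>n<M. 1)"
      by (rule order.trans[OF sum_abs sum_mono]) (rule cubic_frac_bound)
    then show ?thesis using M by simp
  qed
  have split: "(\<Sum>n<M. chord_defect (half_chord \<theta> s n)) = (\<Sum>n<M. ?C (half_chord \<theta> s n)) - 2 * (\<Sum>n<M. ?B (half_chord \<theta> s n))" for s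
    by (simp only: chord_defect_def sum_subtractf sum_distrib_left)
  have "\<bar>(\<Sum>n<M. ?B (half_chord \<theta> s2 n)) - (\<Sum>n<M. ?B (half_chord \<theta> s1 n))\<bar> \<le> 9606 * R * sqrt (s2 - s1)"
    by (rule sum_integral_cos_bound[OF \<theta> R s M])
  moreover have "R * 1 \<le> R * sqrt (s2 - s1)" using R hs by (intro mult_left_mono) auto
  ultimately show ?thesis
    unfolding split using C[of s1] C[of s2] by argo
qed

text \<open>For v \<ge> 0 and s \<ge> 0 this is the length of the set of all sigma in [0, s] with v
  \<le> sigma. Lattice sums of tents are therefore primitives of lattice counts. Moreover
  \<open>tent s\<close> is \<open>profile 1 s\<close>, the case \<alpha> = 2.\<close>

definition tent :: "real \<Rightarrow> real \<Rightarrow> real" where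
  "tent s v = (if 0 \<le> v \<and> v \<le> s then s - v else 0)"

lemma bdd_borel_tent: "bdd_borel (tent s)"
proof -
  have "tent s \<in> borel_measurable borel" unfolding tent_def[abs_def] by measurable
  moreover have "\<bar>tent s v\<bar> \<le> \<bar>s\<bar>" for v by (auto simp: tent_def)
  ultimately show ?thesis unfolding bdd_borel_def by blast
qed

lemma sum_squares_symmetric:
  "(\<Sum>n\<in>{-int m..int m}. u\<^sup>2 - (of_int n)\<^sup>2) = (2 * real m + 1) * u\<^sup>2 - real m * (real m + 1) * (2 * real m + 1) / (3::real)"
proof (induction m)
  case (Suc m)
  have "{-int (Suc m)..int (Suc m)} = insert (- int (Suc m)) (insert (int (Suc m)) {-int m..int m})" by auto
  then have "(\<Sum>n\<in>{-int (Suc m)..int (Suc m)}. u\<^sup>2 - (of_int n)\<^sup>2)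
      = (\<Sum>n\<in>{-int m..int m}. u\<^sup>2 - (of_int n)\<^sup>2) + 2 * (u\<^sup>2 - (real m + 1)\<^sup>2)"
    by (simp add: power2_eq_square algebra_simps)
  then show ?case unfolding Suc.IH by (simp add: field_simps power2_eq_square)
qed auto

lemma tent_shift:
  assumes "0 \<le> c"
  shows "tent s (c + y\<^sup>2) = (if \<bar>y\<bar> \<le> sqrt (max 0 (s - c)) then max 0 (s - c) - y\<^sup>2 else 0)"
proof (cases "c \<le> s")
  case True
  have "\<bar>y\<bar> \<le> sqrt (s - c) \<longleftrightarrow> y\<^sup>2 \<le> s - c"
    using True real_sqrt_le_iff[of "y\<^sup>2" "s - c"] by (simp add: real_sqrt_abs[symmetric] del: real_sqrt_abs)
  then show ?thesis using assms True by (auto simp: tent_def max_def)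
next
  case False
  then show ?thesis using assms by (auto simp: tent_def max_def)
    (smt (verit) zero_le_power2)
qed

lemma lattice_op_tent:
  assumes c: "0 \<le> c" and s: "s \<le> (real N)\<^sup>2"
  defines "u \<equiv> sqrt (max 0 (s - c))"
  defines "m \<equiv> of_int \<lfloor>u\<rfloor>"
  shows "lattice_op N (tent s) c = (2 * m + 1) * u\<^sup>2 - m * (m + 1) * (2 * m + 1) / 3"
proof -
  have u: "0 \<le> u" "u\<^sup>2 = max 0 (s - c)" by (auto simp: u_def)
  have uN: "u \<le> real N" unfolding u_def using c s by (intro real_le_lsqrt) auto
  define k where "k = nat \<lfloor>u\<rfloor>"
  have k: "real k = m" "k \<le> N" using u uN by (auto simp: k_def m_def nat_le_iff floor_le_iff)
  have iff: "\<bar>of_int n\<bar> \<le> u \<longleftrightarrow> n \<in> {-int k..int k}" for n :: int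
  proof -
    have "\<bar>of_int n\<bar> \<le> u \<longleftrightarrow> \<bar>n\<bar> \<le> \<lfloor>u\<rfloor>" by (simp add: le_floor_iff)
    also have "\<dots> \<longleftrightarrow> n \<in> {-int k..int k}" using u by (auto simp: k_def)
    finally show ?thesis .
  qed
  have "lattice_op N (tent s) c = (\<Sum>n\<in>{-int N..int N}. if n \<in> {-int k..int k} then u\<^sup>2 - (of_int n)\<^sup>2 else 0)"
    unfolding lattice_op_def tent_shift[OF c] u(2) u_def[symmetric] iff ..
  also have "\<dots> = (\<Sum>n\<in>{-int k..int k}. u\<^sup>2 - (of_int n)\<^sup>2)"
    using k by (intro sum.mono_neutral_cong_right) auto
  finally show ?thesis unfolding sum_squares_symmetric k .
qed

lemma integral_op_tent:
  assumes c: "0 \<le> c" and s: "s \<le> (real N)\<^sup>2"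
  defines "u \<equiv> sqrt (max 0 (s - c))"
  shows "integral_op N (tent s) c = 4 * u ^ 3 / 3"
proof -
  have u: "0 \<le> u" "u\<^sup>2 = max 0 (s - c)" by (auto simp: u_def)
  have uN: "u \<le> real N" unfolding u_def using c s by (intro real_le_lsqrt) auto
  have "integral_op N (tent s) c = (\<integral>x. (u\<^sup>2 - x\<^sup>2) * indicator {-u..u} x \<partial>lborel)"
    unfolding integral_op_def tent_shift[OF c, folded u_def] u(2)[symmetric]
    using u(1) uN by (intro Bochner_Integration.integral_cong refl) (auto simp: indicator_def window_def abs_le_iff)
  also have "\<dots> = (u\<^sup>2 * u - u ^ 3 / 3) - (u\<^sup>2 * (-u) - (-u) ^ 3 / 3)"
    using u by (intro integral_FTC_Icc_real[where F = "\<lambda>x. u\<^sup>2 * x - x ^ 3 / 3"])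
       (auto intro!: derivative_eq_intros continuous_intros simp: power2_eq_square)
  also have "\<dots> = 4 * u ^ 3 / 3" by (simp add: power3_eq_cube power2_eq_square)
  finally show ?thesis .
qed

lemma tent_defect:
  assumes c: "0 \<le> c" and s: "s \<le> (real N)\<^sup>2"
  shows "lattice_op N (tent s) c - integral_op N (tent s) c = chord_defect (sqrt (max 0 (s - c)))"
proof -
  define u where "u = sqrt (max 0 (s - c))"
  define f where "f = frac u"
  have m: "of_int \<lfloor>u\<rfloor> = u - f" by (simp add: f_def frac_def)
  show ?thesis
    unfolding lattice_op_tent[OF assms] integral_op_tent[OF assms] u_def[symmetric] m chord_defect_def f_def[symmetric]
    by (simp add: field_simps power2_eq_square power3_eq_cube)
qed

text \<open>Reflecting the negative n turns the shift \<theta> into -\<theta>. The index 0 is then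
  counted twice, hence the correction.\<close>

lemma sum_int_symmetric:
  fixes F :: "real \<Rightarrow> real"
  shows "(\<Sum>n\<in>{-int N..int N}. F ((of_int n + \<theta>)\<^sup>2))
    = (\<Sum>n<Suc N. F ((real n + \<theta>)\<^sup>2)) + (\<Sum>n<Suc N. F ((real n + (- \<theta>))\<^sup>2)) - F (\<theta>\<^sup>2)"
proof (induction N)
  case (Suc N)
  have "{-int (Suc N)..int (Suc N)} = insert (- int (Suc N)) (insert (int (Suc N)) {-int N..int N})" by auto
  moreover have "(of_int (- int (Suc N)) + \<theta>)\<^sup>2 = (real (Suc N) + (- \<theta>))\<^sup>2"
    by (simp add: power2_eq_square algebra_simps)
  ultimately show ?case using Suc by (simp del: of_int_minus)
qed simp

text \<open>The number of lattice points in the disc of area \<open>\<pi>s\<close>, minus \<open>\<pi>s\<close>, integrated over \<open>s\<close>.\<close>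

definition circle_primitive :: "nat \<Rightarrow> real \<Rightarrow> real" where
  "circle_primitive N s = lattice_op N (lattice_op N (tent s)) 0 - integral_op N (integral_op N (tent s)) 0"

lemma shifted_tent_defect_sum:
  assumes s: "s \<le> (real N)\<^sup>2"
  shows "(\<Sum>n\<in>{-int N..int N}. lattice_op N (tent s) ((of_int n + \<theta>)\<^sup>2) - integral_op N (tent s) ((of_int n + \<theta>)\<^sup>2))
   = (\<Sum>n<Suc N. chord_defect (half_chord \<theta> s n)) + (\<Sum>n<Suc N. chord_defect (half_chord (- \<theta>) s n)) - chord_defect (half_chord \<theta> s 0)"
proof -
  have "(\<Sum>n\<in>{-int N..int N}. lattice_op N (tent s) ((of_int n + \<theta>)\<^sup>2) - integral_op N (tent s) ((of_int n + \<theta>)\<^sup>2))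
     = (\<Sum>n\<in>{-int N..int N}. chord_defect (sqrt (max 0 (s - (of_int n + \<theta>)\<^sup>2))))"
    by (intro sum.cong refl tent_defect s) simp
  then show ?thesis
    unfolding sum_int_symmetric[of "\<lambda>c. chord_defect (sqrt (max 0 (s - c)))"] half_chord_def by simp
qed

lemma circle_primitive_le:
  assumes R: "1 \<le> R" "s \<le> R\<^sup>2" and N: "R \<le> real N" "real N \<le> 2 * R"
  shows "\<bar>circle_primitive N s\<bar> \<le> 50 * R\<^sup>2"
proof -
  have s: "s \<le> (real N)\<^sup>2" using R N power_mono[of R "real N" 2] by linarith
  have "\<bar>circle_primitive N s\<bar> \<le> 2 * (21 * R\<^sup>2)"
    unfolding circle_primitive_def
  proof (rule lattice_minus_integral_op_two_dim[OF bdd_borel_tent])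
    fix \<theta> :: real
    have d: "\<bar>chord_defect (half_chord \<theta> s n)\<bar> \<le> 3 * R" for \<theta> n
      using chord_defect_le[OF half_chord_nonneg, of \<theta> s n] half_chord_le[of R s \<theta> n] R by linarith
    have S: "\<bar>\<Sum>n<Suc N. chord_defect (half_chord \<theta> s n)\<bar> \<le> 9 * R\<^sup>2" for \<theta>
    proof -
      have "\<bar>\<Sum>n<Suc N. chord_defect (half_chord \<theta> s n)\<bar> \<le> (\<Sum>n<Suc N. 3 * R)"
        by (rule order.trans[OF sum_abs sum_mono]) (rule d)
      also have "\<dots> = (real N + 1) * (3 * R)" by simp
      also have "\<dots> \<le> (3 * R) * (3 * R)" using N R by (intro mult_right_mono) auto
      finally show ?thesis by (simp add: power2_eq_square)
    qed
    have "R * 1 \<le> R * R" using R by (intro mult_left_mono) auto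
    then show "\<bar>\<Sum>n\<in>{-int N..int N}. lattice_op N (tent s) ((of_int n + \<theta>)\<^sup>2) - integral_op N (tent s) ((of_int n + \<theta>)\<^sup>2)\<bar> \<le> 21 * R\<^sup>2"
      unfolding shifted_tent_defect_sum[OF s]
      using S[of \<theta>] S[of "- \<theta>"] d[of \<theta> 0] unfolding power2_eq_square by linarith
  qed
  moreover have "0 \<le> R\<^sup>2" by simp
  ultimately show ?thesis by linarith
qed

text \<open>The operators are linear, so the two-dimensional comparison applies to the difference of
  the tents. For each shift the chord sums for \<theta> and -\<theta> change by O(R sqrt (s2 -
  s1)).\<close>

theorem circle_primitive_diff_le:
  assumes R: "1 \<le> R" and s: "s1 + 1 \<le> s2" "s2 \<le> R\<^sup>2" and N: "R \<le> real N" "real N \<le> 2 * R"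
  shows "\<bar>circle_primitive N s2 - circle_primitive N s1\<bar> \<le> 80000 * R * sqrt (s2 - s1)"
proof -
  have "R\<^sup>2 \<le> (real N)\<^sup>2" using R N by (intro power_mono) auto
  then have s2: "s2 \<le> (real N)\<^sup>2" and s1: "s1 \<le> (real N)\<^sup>2" using s by auto
  have hs: "R * 1 \<le> R * sqrt (s2 - s1)" using s R by (intro mult_left_mono) auto
  let ?f = "\<lambda>v. tent s2 v - tent s1 v"
  have f: "bdd_borel ?f" by (intro bdd_borel_diff bdd_borel_tent)
  have lin1: "lattice_op N ?f = (\<lambda>c. lattice_op N (tent s2) c - lattice_op N (tent s1) c)"
    by (intro ext lattice_op_diff)
  have lin2: "integral_op N ?f = (\<lambda>c. integral_op N (tent s2) c - integral_op N (tent s1) c)"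
    by (intro ext integral_op_diff bdd_borel_tent)
  have "circle_primitive N s2 - circle_primitive N s1
      = lattice_op N (lattice_op N ?f) 0 - integral_op N (integral_op N ?f) 0"
    unfolding circle_primitive_def lin1 lin2
    by (simp add: lattice_op_diff integral_op_diff bdd_borel_integral_op bdd_borel_tent)
  also have "\<bar>\<dots>\<bar> \<le> 2 * (38448 * R * sqrt (s2 - s1))"
  proof (rule lattice_minus_integral_op_two_dim[OF f])
    fix \<theta> :: real assume \<theta>: "\<theta> \<in> {-1/2..1/2}"
    have d: "\<bar>chord_defect (half_chord \<theta> s 0)\<bar> \<le> 3 * R" if "s \<le> R\<^sup>2" for s
      using chord_defect_le[OF half_chord_nonneg, of \<theta> s 0] half_chord_le[of R s \<theta> 0] R that by linarith
    have S: "\<bar>(\<Sum>n<Suc N. chord_defect (half_chord \<theta> s2 n)) - (\<Sum>n<Suc N. chord_defect (half_chord \<theta> s1 n))\<bar> \<le> 19218 * R * sqrt (s2 - s1)"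
      if "\<theta> \<in> {-1/2..1/2}" for \<theta>
      using that R s N by (intro half_chord_defect_diff_le) auto
    let ?D = "\<lambda>s. lattice_op N (tent s) ((of_int n + \<theta>)\<^sup>2) - integral_op N (tent s) ((of_int n + \<theta>)\<^sup>2)"
    have "(\<Sum>n\<in>{-int N..int N}. lattice_op N ?f ((of_int n + \<theta>)\<^sup>2) - integral_op N ?f ((of_int n + \<theta>)\<^sup>2))
      = (\<Sum>n\<in>{-int N..int N}. lattice_op N (tent s2) ((of_int n + \<theta>)\<^sup>2) - integral_op N (tent s2) ((of_int n + \<theta>)\<^sup>2))
      - (\<Sum>n\<in>{-int N..int N}. lattice_op N (tent s1) ((of_int n + \<theta>)\<^sup>2) - integral_op N (tent s1) ((of_int n + \<theta>)\<^sup>2))"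
      unfolding lin1 lin2 sum_subtractf[symmetric] by (intro sum.cong refl) simp
    also have "\<bar>\<dots>\<bar> \<le> 38448 * R * sqrt (s2 - s1)"
      unfolding shifted_tent_defect_sum[OF s1] shifted_tent_defect_sum[OF s2]
      using S[of \<theta>] S[of "- \<theta>"] \<theta> d[of s1] d[of s2] s hs by (simp only: atLeastAtMost_iff) argo
    finally show "\<bar>\<Sum>n\<in>{-int N..int N}. lattice_op N ?f ((of_int n + \<theta>)\<^sup>2) - integral_op N ?f ((of_int n + \<theta>)\<^sup>2)\<bar> \<le> 38448 * R * sqrt (s2 - s1)" .
  qed
  also have "\<dots> \<le> 80000 * R * sqrt (s2 - s1)" using hs R by argo
  finally show ?thesis .
qed

section \<open>The profile of the balls\<close>

lemma has_integral_step:
  fixes F :: "real \<Rightarrow> real"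
  assumes "p \<le> v" "(F has_integral I) {v..q}"
  shows "((\<lambda>s. if v \<le> s then F s else 0) has_integral I) {p..q}"
proof -
  have "((\<lambda>s. if s \<in> {v..q} then F s else 0) has_integral I) {p..q}"
    using assms by (subst has_integral_restrict) auto
  then show ?thesis
    by (rule has_integral_eq[rotated]) auto
qed

text \<open>Only integrals of E over subintervals enter, so cancellation in E survives
  multiplication by a monotone weight. The bound C counts twice, once for each end point.\<close>

lemma second_mean_value_bound:
  fixes w E :: "real \<Rightarrow> real"
  assumes pq: "p \<le> q" and E: "E integrable_on {p..q}"
    and M: "\<And>c d. p \<le> c \<Longrightarrow> c \<le> d \<Longrightarrow> d \<le> q \<Longrightarrow> \<bar>integral {c..d} E\<bar> \<le> M"
    and w: "mono_on {p..q} w \<or> antimono_on {p..q} w"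
    and C: "\<And>s. p \<le> s \<Longrightarrow> s \<le> q \<Longrightarrow> \<bar>w s\<bar> \<le> C"
  shows "(\<lambda>s. w s * E s) integrable_on {p..q}" "\<bar>integral {p..q} (\<lambda>s. w s * E s)\<bar> \<le> 2 * C * M"
proof -
  have M0: "0 \<le> M" using M[of p p] pq by simp
  have "(\<lambda>s. w s * E s) integrable_on {p..q} \<and> \<bar>integral {p..q} (\<lambda>s. w s * E s)\<bar> \<le> 2 * C * M"
    if w: "mono_on {p..q} w" and C: "\<And>s. p \<le> s \<Longrightarrow> s \<le> q \<Longrightarrow> \<bar>w s\<bar> \<le> C" for w
  proof -
    obtain c where c: "c \<in> {p..q}"
      "((\<lambda>s. w s * E s) has_integral (w p * integral {p..c} E + w q * integral {c..q} E)) {p..q}"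
      using second_mean_value_theorem_full[OF E pq, of w] w unfolding mono_on_def by auto
    have "\<bar>w p * integral {p..c} E + w q * integral {c..q} E\<bar> \<le> \<bar>w p * integral {p..c} E\<bar> + \<bar>w q * integral {c..q} E\<bar>"
      by (rule abs_triangle_ineq)
    also have "\<dots> \<le> C * M + C * M"
      unfolding abs_mult using C[of p] C[of q] M[of p c] M[of c q] c pq M0
      by (intro add_mono mult_mono) auto
    finally show ?thesis using c(2) by (auto simp: has_integral_iff)
  qed
  note up = this
  have "(\<lambda>s. w s * E s) integrable_on {p..q} \<and> \<bar>integral {p..q} (\<lambda>s. w s * E s)\<bar> \<le> 2 * C * M"
  proof (cases "mono_on {p..q} w")
    case True
    then show ?thesis using up C by blast
  next
    case False
    then have "antimono_on {p..q} w" using w by blast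
    then have "mono_on {p..q} (\<lambda>s. - w s)" by (auto simp: monotone_on_def)
    then have "(\<lambda>s. - w s * E s) integrable_on {p..q} \<and> \<bar>integral {p..q} (\<lambda>s. - w s * E s)\<bar> \<le> 2 * C * M"
      by (rule up) (use C in auto)
    then show ?thesis using integrable_neg[of "\<lambda>s. - w s * E s" "{p..q}"] by simp
  qed
  then show "(\<lambda>s. w s * E s) integrable_on {p..q}" "\<bar>integral {p..q} (\<lambda>s. w s * E s)\<bar> \<le> 2 * C * M"
    by auto
qed

definition profile :: "real \<Rightarrow> real \<Rightarrow> real \<Rightarrow> real" where
  "profile a X s = (if 0 \<le> s \<and> s \<le> X then (X powr a - s powr a) powr (1 / a) else 0)"

text \<open>Minus the derivative of the profile on (0, X). It is unbounded near X for a > 1 and near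
  0 for a < 1, whereas \<open>powr\<close> makes its value at the singular point itself 0.\<close>

definition profile_kernel :: "real \<Rightarrow> real \<Rightarrow> real \<Rightarrow> real" where
  "profile_kernel a X s = (X powr a - s powr a) powr (1 / a - 1) * s powr (a - 1)"

context
  fixes a X :: real
  assumes a: "a > 0" and X: "X \<ge> 1"
begin

lemma powr_gap_nonneg: "0 \<le> s \<Longrightarrow> s \<le> X \<Longrightarrow> 0 \<le> X powr a - s powr a"
  using a by (simp add: powr_mono2)

lemma profile_nonneg: "0 \<le> profile a X s"
  by (simp add: profile_def)

lemma profile_le: "profile a X s \<le> X"
proof (cases "0 \<le> s \<and> s \<le> X")
  case True
  then have "(X powr a - s powr a) powr (1 / a) \<le> (X powr a) powr (1 / a)"
    using a powr_gap_nonneg by (intro powr_mono2) auto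
  then show ?thesis using True a X by (simp add: profile_def powr_powr)
qed (use X in \<open>auto simp: profile_def\<close>)

lemma profile_antimono: "0 \<le> s \<Longrightarrow> s \<le> t \<Longrightarrow> profile a X t \<le> profile a X s"
  using a powr_gap_nonneg by (auto simp: profile_def intro!: powr_mono2)

lemma profile_X: "profile a X X = 0"
  using a by (simp add: profile_def)

lemma bdd_borel_profile: "bdd_borel (profile a X)"
proof -
  have "profile a X \<in> borel_measurable borel" unfolding profile_def[abs_def] by measurable
  moreover have "\<bar>profile a X s\<bar> \<le> X" for s using profile_nonneg[of s] profile_le[of s] by simp
  ultimately show ?thesis unfolding bdd_borel_def by blast
qed

lemma continuous_on_profile: "continuous_on {0..X} (profile a X)"
proof -
  have "continuous_on {0..X} (\<lambda>s. (X powr a - s powr a) powr (1 / a))"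
    using a powr_gap_nonneg by (intro continuous_on_powr' continuous_intros) auto
  then show ?thesis by (rule continuous_on_eq) (simp add: profile_def)
qed

lemma profile_has_derivative:
  assumes "0 < s" "s < X"
  shows "(profile a X has_real_derivative - profile_kernel a X s) (at s)"
proof -
  have gap: "0 < X powr a - s powr a" using assms a by (simp add: powr_less_mono2)
  have "((\<lambda>s. (X powr a - s powr a) powr (1 / a)) has_real_derivative - profile_kernel a X s) (at s)"
    using assms gap a
    by (auto intro!: derivative_eq_intros simp: profile_kernel_def field_simps)
  then show ?thesis
    by (rule has_field_derivative_transform_within_open[where S = "{0<..<X}"])
       (use assms in \<open>auto simp: profile_def\<close>)
qed

text \<open>The fundamental theorem asks for the derivative inside the interval only and for
  continuity up to its ends, so the singularities at 0 and X do no harm.\<close>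

lemma profile_kernel_integral:
  assumes "0 \<le> p" "p \<le> q" "q \<le> X"
  shows "(profile_kernel a X has_integral (profile a X p - profile a X q)) {p..q}"
proof -
  have "((\<lambda>s. - profile_kernel a X s) has_integral (profile a X q - profile a X p)) {p..q}"
  proof (rule fundamental_theorem_of_calculus_interior)
    show "continuous_on {p..q} (profile a X)"
      using continuous_on_profile by (rule continuous_on_subset) (use assms in auto)
    show "(profile a X has_vector_derivative - profile_kernel a X s) (at s)" if "s \<in> {p<..<q}" for s
      using profile_has_derivative[of s] that assms
      by (simp add: has_real_derivative_iff_has_vector_derivative)
  qed (use assms in auto)
  from has_integral_neg[OF this] show ?thesis by simp
qed

text \<open>Integration by parts: the boundary terms vanish at w because of the factor s - w and at
  X because the profile does. This moment yields the main term in the plane, the second moment the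
  one in four dimensions.\<close>

lemma profile_kernel_moment1:
  assumes "0 \<le> w" "w \<le> X"
  shows "((\<lambda>s. profile_kernel a X s * (s - w)) has_integral integral {w..X} (profile a X)) {w..X}"
proof -
  have cont: "continuous_on {w..X} (profile a X)"
    using continuous_on_profile by (rule continuous_on_subset) (use assms in auto)
  have "((\<lambda>s. profile a X s - profile_kernel a X s * (s - w)) has_integral
     (X - w) * profile a X X - (w - w) * profile a X w) {w..X}"
  proof (rule fundamental_theorem_of_calculus_interior)
    show "continuous_on {w..X} (\<lambda>s. (s - w) * profile a X s)"
      using cont by (intro continuous_intros)
    fix s assume s: "s \<in> {w<..<X}"
    have "((\<lambda>s. (s - w) * profile a X s) has_real_derivative profile a X s - profile_kernel a X s * (s - w)) (at s)"
      using profile_has_derivative[of s] s assms by (auto intro!: derivative_eq_intros)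
    then show "((\<lambda>s. (s - w) * profile a X s) has_vector_derivative profile a X s - profile_kernel a X s * (s - w)) (at s)"
      by (simp add: has_real_derivative_iff_has_vector_derivative)
  qed (use assms in auto)
  then have z: "((\<lambda>s. profile a X s - profile_kernel a X s * (s - w)) has_integral 0) {w..X}"
    by (simp add: profile_X)
  have "(profile a X has_integral integral {w..X} (profile a X)) {w..X}"
    using cont by (intro integrable_integral integrable_continuous_real)
  from has_integral_diff[OF this z] show ?thesis by simp
qed

lemma profile_kernel_moment2:
  assumes "0 \<le> w" "w \<le> X"
  shows "((\<lambda>s. profile_kernel a X s * (s - w)\<^sup>2) has_integral 2 * integral {w..X} (\<lambda>s. (s - w) * profile a X s)) {w..X}"
proof -
  have cont: "continuous_on {w..X} (profile a X)"
    using continuous_on_profile by (rule continuous_on_subset) (use assms in auto)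
  have "((\<lambda>s. 2 * ((s - w) * profile a X s) - profile_kernel a X s * (s - w)\<^sup>2) has_integral
     (X - w)\<^sup>2 * profile a X X - (w - w)\<^sup>2 * profile a X w) {w..X}"
  proof (rule fundamental_theorem_of_calculus_interior)
    show "continuous_on {w..X} (\<lambda>s. (s - w)\<^sup>2 * profile a X s)"
      using cont by (intro continuous_intros)
    fix s assume s: "s \<in> {w<..<X}"
    have "((\<lambda>s. (s - w)\<^sup>2 * profile a X s) has_real_derivative 2 * ((s - w) * profile a X s) - profile_kernel a X s * (s - w)\<^sup>2) (at s)"
      using profile_has_derivative[of s] s assms by (auto intro!: derivative_eq_intros)
    then show "((\<lambda>s. (s - w)\<^sup>2 * profile a X s) has_vector_derivative 2 * ((s - w) * profile a X s) - profile_kernel a X s * (s - w)\<^sup>2) (at s)"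
      by (simp add: has_real_derivative_iff_has_vector_derivative)
  qed (use assms in auto)
  then have z: "((\<lambda>s. 2 * ((s - w) * profile a X s) - profile_kernel a X s * (s - w)\<^sup>2) has_integral 0) {w..X}"
    by (simp add: profile_X)
  have "((\<lambda>s. 2 * ((s - w) * profile a X s)) has_integral 2 * integral {w..X} (\<lambda>s. (s - w) * profile a X s)) {w..X}"
    using cont by (intro has_integral_mult_right integrable_integral integrable_continuous_real continuous_intros)
  from has_integral_diff[OF this z] show ?thesis by simp
qed

lemma powr_gap_ge:
  assumes "1 \<le> a" "0 \<le> h" "h \<le> X"
  shows "X powr (a - 1) * h \<le> X powr a - (X - h) powr a"
proof -
  have "(X - h) powr a = (X - h) * (X - h) powr (a - 1)"
    using assms by (cases "h = X") (auto simp: powr_mult_base)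
  also have "\<dots> \<le> (X - h) * X powr (a - 1)"
    using assms by (intro mult_left_mono powr_mono2) auto
  also have "\<dots> = X powr a - X powr (a - 1) * h"
    using X powr_mult_base[of X "a - 1"] by (simp add: algebra_simps)
  finally show ?thesis by simp
qed

text \<open>For a \<ge> 1 this is the mean value theorem for x^a between 1 - h/X and 1, and for a <
  1 the inequality x \<le> x^a on [0, 1].\<close>

lemma powr_gap_le:
  assumes "0 \<le> h" "h \<le> X"
  shows "X powr a - (X - h) powr a \<le> max 1 a * X powr (a - 1) * h"
proof -
  have Xpow: "X powr a = X * X powr (a - 1)" using X by (simp add: powr_mult_base)
  have "1 - (1 - h / X) powr a \<le> max 1 a * (h / X)"
  proof (cases "a \<ge> 1")
    case True
    show ?thesis
    proof (cases "h = X")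
      case False
      then have t: "0 \<le> h / X" "h / X < 1" using assms X by auto
      have "\<exists>z>1 - h / X. z < 1 \<and> 1 powr a - (1 - h / X) powr a = (1 - (1 - h / X)) * (a * z powr (a - 1))" if "h \<noteq> 0"
      proof (rule MVT2)
        show "1 - h / X < 1" using that assms X by simp
        fix x assume "1 - h / X \<le> x"
        then have "0 < x" using t by linarith
        then show "((\<lambda>x. x powr a) has_real_derivative a * x powr (a - 1)) (at x)"
          by (auto intro!: derivative_eq_intros)
      qed
      moreover have "z powr (a - 1) \<le> 1" if "0 < z" "z < 1" for z
        using that True powr_mono2[of "a - 1" z 1] by simp
      ultimately show ?thesis
      proof (cases "h = 0")
        case False
        then obtain z where z: "1 - h / X < z" "z < 1" "1 powr a - (1 - h / X) powr a = (1 - (1 - h / X)) * (a * z powr (a - 1))"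
          using \<open>h \<noteq> 0 \<Longrightarrow> _\<close> by blast
        have "h / X * (a * z powr (a - 1)) \<le> h / X * (a * 1)"
          using \<open>\<And>z. 0 < z \<Longrightarrow> z < 1 \<Longrightarrow> z powr (a - 1) \<le> 1\<close>[of z] z t a by (intro mult_left_mono) auto
        then show ?thesis using z True by (simp add: max_def mult.commute)
      qed simp
    qed (use True X a in \<open>simp add: max_def\<close>)
  next
    case False
    have "1 - h / X \<le> (1 - h / X) powr a"
    proof (cases "h = X")
      case False
      then have "0 < 1 - h / X" "1 - h / X \<le> 1" using assms X by auto
      then show ?thesis using \<open>\<not> 1 \<le> a\<close> powr_mono'[of a 1 "1 - h / X"] by simp
    qed (use X in simp)
    then show ?thesis using False by (simp add: max_def)
  qed
  then have "X powr a * (1 - (1 - h / X) powr a) \<le> X powr a * (max 1 a * (h / X))"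
    by (intro mult_left_mono) auto
  moreover have "X powr a * (1 - h / X) powr a = (X - h) powr a"
  proof -
    have "(X * (1 - h / X)) powr a = X powr a * (1 - h / X) powr a"
      by (rule powr_mult)
    moreover have "X * (1 - h / X) = X - h" using X by (simp add: field_simps)
    ultimately show ?thesis by simp
  qed
  moreover have "X powr a * (max 1 a * (h / X)) = max 1 a * X powr (a - 1) * h"
    unfolding Xpow using X by simp
  ultimately show ?thesis by (simp add: right_diff_distrib)
qed

end

section \<open>Radial functions in Euclidean space\<close>

text \<open>The minus sign turns the half-lines above x, on which the two measures are compared,
  into discs. Without it they would be complements of discs, of infinite measure.\<close>

lemma distr_neg_plane_norm_squared:
  "distr (lborel :: (real \<times> real) measure) borel (\<lambda>p. - ((fst p)\<^sup>2 + (snd p)\<^sup>2))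
     = density lborel (\<lambda>w. ennreal pi * indicator {..0} w)"
proof (rule measure_eqI_lessThan)
  have m: "(\<lambda>p::real\<times>real. - ((fst p)\<^sup>2 + (snd p)\<^sup>2)) \<in> borel_measurable borel"
    unfolding borel_prod[symmetric] by measurable
  fix x :: real
  have left: "emeasure (distr (lborel :: (real \<times> real) measure) borel (\<lambda>p. - ((fst p)\<^sup>2 + (snd p)\<^sup>2))) {x<..}
      = ennreal (pi * max 0 (- x))"
  proof -
    have "(\<lambda>p::real\<times>real. - ((fst p)\<^sup>2 + (snd p)\<^sup>2)) -` {x<..} = ball 0 (sqrt (max 0 (- x)))"
    proof -
      have "(x < - (y\<^sup>2 + z\<^sup>2)) \<longleftrightarrow> sqrt (y\<^sup>2 + z\<^sup>2) < sqrt (max 0 (- x))" for y z :: real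
        by (auto simp: max_def) (smt (verit) zero_le_power2)+
      then show ?thesis by (auto simp: norm_Pair dist_norm)
    qed
    then have "emeasure (distr (lborel :: (real \<times> real) measure) borel (\<lambda>p. - ((fst p)\<^sup>2 + (snd p)\<^sup>2))) {x<..}
      = emeasure (lborel :: (real \<times> real) measure) (ball 0 (sqrt (max 0 (- x))))"
      using m by (subst emeasure_distr) auto
    also have "\<dots> = ennreal (pi * max 0 (- x))"
      by (subst emeasure_ball) (auto simp: unit_ball_vol_2)
    finally show ?thesis .
  qed
  have right: "emeasure (density lborel (\<lambda>w. ennreal pi * indicator {..0} w)) {x<..} = ennreal (pi * max 0 (- x))"
  proof -
    have "emeasure (density lborel (\<lambda>w. ennreal pi * indicator {..0} w)) {x<..}
        = (\<integral>\<^sup>+w. ennreal pi * indicator ({x<..} \<inter> {..0}) w \<partial>lborel)"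
      by (subst emeasure_density) (auto intro!: nn_integral_cong simp: indicator_def)
    also have "\<dots> = ennreal pi * emeasure lborel ({x<..} \<inter> {..0})"
      by (subst nn_integral_cmult_indicator) auto
    also have "{x<..} \<inter> {..0} = {x<..0}" by auto
    also have "emeasure lborel {x<..0} = ennreal (max 0 (- x))"
      by (cases "x \<le> 0") (auto simp: max_def)
    finally show ?thesis by (simp add: ennreal_mult)
  qed
  show "emeasure (distr (lborel :: (real \<times> real) measure) borel (\<lambda>p. - ((fst p)\<^sup>2 + (snd p)\<^sup>2))) {x<..}
     = emeasure (density lborel (\<lambda>w. ennreal pi * indicator {..0} w)) {x<..}"
    unfolding left right ..
  show "emeasure (distr (lborel :: (real \<times> real) measure) borel (\<lambda>p. - ((fst p)\<^sup>2 + (snd p)\<^sup>2))) {x<..} < \<infinity>"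
    unfolding left by simp
qed auto

text \<open>Polar coordinates in the variable v = r^2, in which area becomes \<pi> dv.\<close>

lemma nn_integral_plane_radial:
  fixes F :: "real \<Rightarrow> ennreal"
  assumes [measurable]: "F \<in> borel_measurable borel"
  shows "(\<integral>\<^sup>+x. \<integral>\<^sup>+y. F (x\<^sup>2 + y\<^sup>2) \<partial>lborel \<partial>lborel) = ennreal pi * (\<integral>\<^sup>+v. F v * indicator {0..} v \<partial>lborel)"
proof -
  have m: "(\<lambda>p::real\<times>real. - ((fst p)\<^sup>2 + (snd p)\<^sup>2)) \<in> borel_measurable borel"
    unfolding borel_prod[symmetric] by measurable
  have "(\<integral>\<^sup>+x. \<integral>\<^sup>+y. F (x\<^sup>2 + y\<^sup>2) \<partial>lborel \<partial>lborel) = (\<integral>\<^sup>+p. F ((fst p)\<^sup>2 + (snd p)\<^sup>2) \<partial>(lborel \<Otimes>\<^sub>M lborel))"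
    using lborel.nn_integral_fst[of "\<lambda>p. F ((fst p)\<^sup>2 + (snd p)\<^sup>2)" lborel] by simp
  also have "\<dots> = (\<integral>\<^sup>+w. F (- w) \<partial>distr (lborel :: (real \<times> real) measure) borel (\<lambda>p. - ((fst p)\<^sup>2 + (snd p)\<^sup>2)))"
    unfolding lborel_prod using m by (subst nn_integral_distr) (auto simp del: minus_add_distrib)
  also have "\<dots> = (\<integral>\<^sup>+w. (ennreal pi * indicator {..0} w) * F (- w) \<partial>lborel)"
    unfolding distr_neg_plane_norm_squared by (subst nn_integral_density) auto
  also have "\<dots> = (\<integral>\<^sup>+w. (ennreal pi * indicator {..0} (- w)) * F w \<partial>lborel)"
    by (subst nn_integral_real_affine[where c = "-1" and t = 0]) auto
  also have "\<dots> = (\<integral>\<^sup>+w. ennreal pi * (F w * indicator {0..} w) \<partial>lborel)"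
    by (intro nn_integral_cong) (auto simp: indicator_def mult_ac)
  also have "\<dots> = ennreal pi * (\<integral>\<^sup>+w. F w * indicator {0..} w \<partial>lborel)"
    by (subst nn_integral_cmult) auto
  finally show ?thesis .
qed

text \<open>Nonnegativity permits Tonelli's theorem. The support condition makes truncation to
  \<open>window N\<close> exact, because squares of points outside the window exceed N^2.\<close>

definition radial_class :: "nat \<Rightarrow> (real \<Rightarrow> real) \<Rightarrow> bool" where
  "radial_class N f \<longleftrightarrow> bdd_borel f \<and> (\<forall>v. 0 \<le> f v) \<and> (\<forall>v > (real N)\<^sup>2. f v = 0)"

lemma radial_class_bdd: "radial_class N f \<Longrightarrow> bdd_borel f"
  by (simp add: radial_class_def)

lemma outside_window: "x \<notin> window N \<Longrightarrow> (real N)\<^sup>2 < x\<^sup>2"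
proof -
  assume "x \<notin> window N"
  then have "real N < \<bar>x\<bar>" by (auto simp: window_def)
  then have "(real N)\<^sup>2 < \<bar>x\<bar>\<^sup>2" by (intro power_strict_mono) auto
  then show ?thesis by simp
qed

lemma integral_op_nonneg: "(\<And>v. 0 \<le> f v) \<Longrightarrow> 0 \<le> integral_op N f c"
  unfolding integral_op_def by (intro Bochner_Integration.integral_nonneg) auto

lemma nn_integral_integral_op:
  assumes f: "radial_class N f" and c: "0 \<le> c"
  shows "(\<integral>\<^sup>+x. ennreal (f (c + x\<^sup>2)) \<partial>lborel) = ennreal (integral_op N f c)"
proof -
  have f0: "0 \<le> f v" for v using f by (simp add: radial_class_def)
  have "(\<integral>\<^sup>+x. ennreal (f (c + x\<^sup>2)) \<partial>lborel) = (\<integral>\<^sup>+x. ennreal (indicator (window N) x * f (c + x\<^sup>2)) \<partial>lborel)"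
  proof (rule nn_integral_cong)
    fix x
    show "ennreal (f (c + x\<^sup>2)) = ennreal (indicator (window N) x * f (c + x\<^sup>2))"
    proof (cases "x \<in> window N")
      case False
      then have "(real N)\<^sup>2 < c + x\<^sup>2" using outside_window[of x N] c by linarith
      then show ?thesis using f False by (simp add: radial_class_def)
    qed simp
  qed
  also have "\<dots> = ennreal (integral_op N f c)"
    unfolding integral_op_def using f0
    by (intro nn_integral_eq_integral integrable_window radial_class_bdd[OF f]) auto
  finally show ?thesis .
qed

lemma radial_class_integral_op:
  assumes f: "radial_class N f"
  shows "radial_class N (integral_op N f)"
proof -
  have "integral_op N f c = 0" if "(real N)\<^sup>2 < c" for c
  proof -
    have "f (c + x\<^sup>2) = 0" for x
    proof -
      have "(real N)\<^sup>2 < c + x\<^sup>2" using that by (smt (verit) zero_le_power2)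
      then show ?thesis using f by (simp add: radial_class_def)
    qed
    then show ?thesis by (simp add: integral_op_def)
  qed
  then show ?thesis
    using f unfolding radial_class_def by (auto intro: integral_op_nonneg)
qed

text \<open>Two integrations replace f by \<pi> times its tail integral, a gain of one derivative
  for every two coordinates.\<close>

lemma integral_op_twice:
  assumes f: "radial_class N f" and c: "0 \<le> c"
  shows "ennreal (integral_op N (integral_op N f) c) = ennreal pi * (\<integral>\<^sup>+v. ennreal (f v) * indicator {c..} v \<partial>lborel)"
proof -
  have [measurable]: "f \<in> borel_measurable borel" using f by (simp add: radial_class_def bdd_borel_def)
  have "ennreal (integral_op N (integral_op N f) c) = (\<integral>\<^sup>+x. ennreal (integral_op N f (c + x\<^sup>2)) \<partial>lborel)"
    by (rule nn_integral_integral_op[OF radial_class_integral_op[OF f] c, symmetric])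
  also have "\<dots> = (\<integral>\<^sup>+x. \<integral>\<^sup>+y. ennreal (f (c + x\<^sup>2 + y\<^sup>2)) \<partial>lborel \<partial>lborel)"
    using c by (intro nn_integral_cong nn_integral_integral_op[OF f, symmetric]) auto
  also have "\<dots> = (\<integral>\<^sup>+x. \<integral>\<^sup>+y. ennreal (f (c + (x\<^sup>2 + y\<^sup>2))) \<partial>lborel \<partial>lborel)"
    by (simp only: add.assoc)
  also have "\<dots> = ennreal pi * (\<integral>\<^sup>+v. ennreal (f (c + v)) * indicator {0..} v \<partial>lborel)"
    by (rule nn_integral_plane_radial) measurable
  also have "(\<integral>\<^sup>+v. ennreal (f (c + v)) * indicator {0..} v \<partial>lborel) = (\<integral>\<^sup>+v. ennreal (f v) * indicator {c..} v \<partial>lborel)"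
    by (subst (2) nn_integral_real_affine[where c = 1 and t = c])
       (auto intro!: nn_integral_cong simp: indicator_def)
  finally show ?thesis .
qed

lemma integral_op_twice_has_integral:
  assumes f: "radial_class N f" and c: "0 \<le> c" "c \<le> X" and supp: "\<And>v. X < v \<Longrightarrow> f v = 0"
    and I: "(f has_integral I) {c..X}"
  shows "integral_op N (integral_op N f) c = pi * I"
proof -
  have f0: "0 \<le> f v" for v using f by (simp add: radial_class_def)
  have [measurable]: "f \<in> borel_measurable borel" using f by (simp add: radial_class_def bdd_borel_def)
  have I0: "0 \<le> I" by (rule has_integral_nonneg[OF I]) (simp add: f0)
  have "(\<integral>\<^sup>+v. ennreal (f v) * indicator {c..} v \<partial>lborel) = (\<integral>\<^sup>+v. ennreal (f v * indicator {c..X} v) \<partial>lborel)"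
  proof (intro nn_integral_cong)
    fix v
    show "ennreal (f v) * indicator {c..} v = ennreal (f v * indicator {c..X} v)"
      using supp[of v] by (cases "v \<le> X") (auto simp: indicator_def)
  qed
  also have "\<dots> = ennreal I"
  proof (rule nn_integral_has_integral_lborel)
    show "((\<lambda>v. f v * indicator {c..X} v) has_integral I) UNIV"
    proof -
      have "(\<lambda>v. f v * indicator {c..X} v) = (\<lambda>v. if v \<in> {c..X} then f v else 0)" by auto
      then show ?thesis using I by (simp only: has_integral_restrict_UNIV)
    qed
  qed (use f0 in auto)
  finally have "ennreal (integral_op N (integral_op N f) c) = ennreal (pi * I)"
    using integral_op_twice[OF f c(1)] I0 by (simp add: ennreal_mult)
  moreover have "0 \<le> integral_op N (integral_op N f) c" using f0 by (intro integral_op_nonneg)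
  ultimately show ?thesis using I0 by (subst (asm) ennreal_inj) auto
qed

lemma nn_integral_PiM_radial:
  fixes I :: "'i set"
  assumes "finite I" "radial_class N f" "0 \<le> c"
  shows "(\<integral>\<^sup>+x. ennreal (f (c + (\<Sum>i\<in>I. (x i)\<^sup>2))) \<partial>(\<Pi>\<^sub>M i\<in>I. lborel)) = ennreal ((integral_op N ^^ card I) f c)"
  using assms
proof (induction I arbitrary: f rule: finite_induct)
  case empty
  interpret product_sigma_finite "\<lambda>_. lborel :: real measure" by standard
  show ?case by (simp add: space_PiM_empty)
next
  case (insert i I)
  interpret product_sigma_finite "\<lambda>_. lborel :: real measure" by standard
  have [measurable]: "f \<in> borel_measurable borel" using insert.prems by (simp add: radial_class_def bdd_borel_def)
  have "(\<integral>\<^sup>+x. ennreal (f (c + (\<Sum>i\<in>insert i I. (x i)\<^sup>2))) \<partial>(\<Pi>\<^sub>M i\<in>insert i I. lborel))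
     = (\<integral>\<^sup>+x. \<integral>\<^sup>+y. ennreal (f (c + (\<Sum>j\<in>insert i I. ((x(i := y)) j)\<^sup>2))) \<partial>lborel \<partial>(\<Pi>\<^sub>M i\<in>I. lborel))"
    using insert by (intro product_nn_integral_insert) auto
  also have "\<dots> = (\<integral>\<^sup>+x. \<integral>\<^sup>+y. ennreal (f ((c + (\<Sum>j\<in>I. (x j)\<^sup>2)) + y\<^sup>2)) \<partial>lborel \<partial>(\<Pi>\<^sub>M i\<in>I. lborel))"
  proof (intro nn_integral_cong)
    fix x :: "'i \<Rightarrow> real" and y :: real
    have "(\<Sum>j\<in>I. ((x(i := y)) j)\<^sup>2) = (\<Sum>j\<in>I. (x j)\<^sup>2)"
      using insert by (intro sum.cong) auto
    then show "ennreal (f (c + (\<Sum>j\<in>insert i I. ((x(i := y)) j)\<^sup>2))) = ennreal (f ((c + (\<Sum>j\<in>I. (x j)\<^sup>2)) + y\<^sup>2))"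
      using insert by (simp add: add_ac)
  qed
  also have "\<dots> = (\<integral>\<^sup>+x. ennreal (integral_op N f (c + (\<Sum>j\<in>I. (x j)\<^sup>2))) \<partial>(\<Pi>\<^sub>M i\<in>I. lborel))"
    using insert.prems by (intro nn_integral_cong nn_integral_integral_op) (auto intro!: add_nonneg_nonneg sum_nonneg)
  also have "\<dots> = ennreal ((integral_op N ^^ card I) (integral_op N f) c)"
    using insert.prems by (intro insert.IH radial_class_integral_op) auto
  finally show ?case using insert by (simp add: funpow_swap1)
qed

lemma norm_sum_Basis_squared:
  "(norm (\<Sum>b\<in>Basis. x b *\<^sub>R b :: 'a::euclidean_space))\<^sup>2 = (\<Sum>b\<in>Basis. (x b)\<^sup>2)"
  by (subst power2_norm_eq_inner, subst euclidean_inner, intro sum.cong refl)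
     (simp add: power2_eq_square inner_sum_left_Basis)

lemma nn_integral_euclidean_radial:
  assumes f: "radial_class N f"
  shows "(\<integral>\<^sup>+z. ennreal (f ((norm (z :: 'a::euclidean_space))\<^sup>2)) \<partial>lborel) = ennreal ((integral_op N ^^ DIM('a)) f 0)"
proof -
  have [measurable]: "f \<in> borel_measurable borel" using f by (simp add: radial_class_def bdd_borel_def)
  have "(\<integral>\<^sup>+z. ennreal (f ((norm (z :: 'a))\<^sup>2)) \<partial>lborel)
      = (\<integral>\<^sup>+x. ennreal (f ((norm (\<Sum>b\<in>Basis. x b *\<^sub>R b :: 'a))\<^sup>2)) \<partial>(\<Pi>\<^sub>M b\<in>(Basis :: 'a set). lborel))"
    by (subst lborel_eq, subst nn_integral_distr) auto
  also have "\<dots> = ennreal ((integral_op N ^^ DIM('a)) f 0)"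
    unfolding norm_sum_Basis_squared using nn_integral_PiM_radial[OF finite_Basis f, of 0] by simp
  finally show ?thesis .
qed

lemma sum_PiE_radial:
  assumes "finite I"
  shows "(\<Sum>x\<in>I \<rightarrow>\<^sub>E {-int N..int N}. f (c + (\<Sum>i\<in>I. (of_int (x i))\<^sup>2))) = (lattice_op N ^^ card I) f c"
  using assms
proof (induction I arbitrary: f rule: finite_induct)
  case (insert i I)
  let ?S = "{-int N..int N}"
  have "(\<Sum>x\<in>insert i I \<rightarrow>\<^sub>E ?S. f (c + (\<Sum>j\<in>insert i I. (of_int (x j))\<^sup>2)))
     = (\<Sum>(y, x)\<in>?S \<times> (I \<rightarrow>\<^sub>E ?S). f (c + (\<Sum>j\<in>insert i I. (of_int ((x(i := y)) j))\<^sup>2)))"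
    unfolding PiE_insert_eq
    by (subst sum.reindex, rule inj_combinator[OF insert.hyps(2)]) (simp add: split_def o_def)
  also have "\<dots> = (\<Sum>(y, x)\<in>?S \<times> (I \<rightarrow>\<^sub>E ?S). f ((c + (\<Sum>j\<in>I. (of_int (x j))\<^sup>2)) + (of_int y)\<^sup>2))"
  proof (intro sum.cong refl, clarify)
    fix x y
    have "(\<Sum>j\<in>I. (of_int ((x(i := y)) j))\<^sup>2) = (\<Sum>j\<in>I. (of_int (x j))\<^sup>2 :: real)"
      using insert by (intro sum.cong) auto
    then show "f (c + (\<Sum>j\<in>insert i I. (of_int ((x(i := y)) j))\<^sup>2)) = f ((c + (\<Sum>j\<in>I. (of_int (x j))\<^sup>2)) + (of_int y)\<^sup>2)"
      using insert by (simp add: add_ac)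
  qed
  also have "\<dots> = (\<Sum>x\<in>I \<rightarrow>\<^sub>E ?S. lattice_op N f (c + (\<Sum>j\<in>I. (of_int (x j))\<^sup>2)))"
    unfolding lattice_op_def by (subst sum.cartesian_product[symmetric], subst sum.swap) simp
  also have "\<dots> = (lattice_op N ^^ card I) (lattice_op N f) c" by (rule insert.IH)
  finally show ?case using insert by (simp add: funpow_swap1)
qed simp

text \<open>The operators sum over the whole box of integer vectors with coordinates in -N..N;
  cutting f off at X removes those outside the ball.\<close>

lemma sum_integer_points_radial:
  fixes f :: "real \<Rightarrow> real"
  assumes "X \<le> (real N)\<^sup>2"
  shows "(\<Sum>z | (\<forall>b\<in>Basis. z \<bullet> b \<in> \<int>) \<and> (norm (z :: 'a::euclidean_space))\<^sup>2 \<le> X. f ((norm z)\<^sup>2))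
     = (lattice_op N ^^ DIM('a)) (\<lambda>v. if v \<le> X then f v else 0) 0"
proof -
  let ?g = "\<lambda>v. if v \<le> X then f v else 0"
  let ?P = "Basis \<rightarrow>\<^sub>E {-int N..int N} :: ('a \<Rightarrow> int) set"
  let ?h = "\<lambda>x. \<Sum>b\<in>Basis. real_of_int (x b) *\<^sub>R b :: 'a"
  let ?Z = "{z :: 'a. (\<forall>b\<in>Basis. z \<bullet> b \<in> \<int>) \<and> (norm z)\<^sup>2 \<le> X}"
  have coord: "?h x \<bullet> b = of_int (x b)" if "b \<in> Basis" for x b
    using that by (simp add: inner_sum_left_Basis)
  have inj: "inj_on ?h ?P"
  proof (rule inj_onI)
    fix x y assume xy: "x \<in> ?P" "y \<in> ?P" "?h x = ?h y"
    have "x b = y b" for b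
    proof (cases "b \<in> Basis")
      case True
      have "?h x \<bullet> b = ?h y \<bullet> b" using xy(3) by (simp only:)
      then show ?thesis unfolding coord[OF True] by (simp only: of_int_eq_iff)
    next
      case False
      then show ?thesis using PiE_arb[OF xy(1) False] PiE_arb[OF xy(2) False] by simp
    qed
    then show "x = y" by auto
  qed
  have sub: "?Z \<subseteq> ?h ` ?P"
  proof
    fix z assume z: "z \<in> ?Z"
    define x where "x = restrict (\<lambda>b. \<lfloor>z \<bullet> b\<rfloor>) (Basis :: 'a set)"
    have xb: "of_int (x b) = z \<bullet> b" if "b \<in> Basis" for b
      using z that by (auto simp: x_def elim!: Ints_cases)
    have "x b \<in> {-int N..int N}" if "b \<in> Basis" for b
    proof -
      have "\<bar>z \<bullet> b\<bar> \<le> norm z" using that by (rule Basis_le_norm)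
      then have "\<bar>z \<bullet> b\<bar>\<^sup>2 \<le> (norm z)\<^sup>2" by (intro power_mono) auto
      then have "(of_int (x b))\<^sup>2 \<le> (real N)\<^sup>2" using z assms xb[OF that] by simp
      then have "\<bar>of_int (x b)\<bar> \<le> real N" by (simp add: abs_le_square_iff[symmetric])
      then show ?thesis by auto
    qed
    then have "x \<in> ?P" by (auto simp: x_def)
    moreover have "z = ?h x"
    proof -
      have "?h x = (\<Sum>b\<in>Basis. (z \<bullet> b) *\<^sub>R b)" by (intro sum.cong) (auto simp: xb)
      then show ?thesis by (simp add: euclidean_representation)
    qed
    ultimately show "z \<in> ?h ` ?P" by blast
  qed
  have fin: "finite (?h ` ?P)" by (intro finite_imageI finite_PiE) auto
  have "(\<Sum>z\<in>?Z. f ((norm z)\<^sup>2)) = (\<Sum>z\<in>?h ` ?P. ?g ((norm z)\<^sup>2))"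
  proof (rule sum.mono_neutral_cong_left[OF fin sub])
    show "\<forall>z\<in>?h ` ?P - ?Z. ?g ((norm z)\<^sup>2) = 0"
    proof
      fix z assume z: "z \<in> ?h ` ?P - ?Z"
      then have "\<forall>b\<in>Basis. z \<bullet> b \<in> \<int>" using coord by auto
      then show "?g ((norm z)\<^sup>2) = 0" using z by auto
    qed
  qed auto
  also have "\<dots> = (\<Sum>x\<in>?P. ?g (0 + (\<Sum>b\<in>Basis. (of_int (x b))\<^sup>2)))"
    by (subst sum.reindex[OF inj]) (simp only: o_def norm_sum_Basis_squared add_0_left)
  also have "\<dots> = (lattice_op N ^^ DIM('a)) ?g 0"
    by (rule sum_PiE_radial) simp
  finally show ?thesis .
qed

section \<open>Profiles in the plane\<close>

definition disc_count :: "nat \<Rightarrow> real \<Rightarrow> real" where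
  "disc_count N s = lattice_op N (lattice_op N (\<lambda>v. if v \<le> s then 1 else 0)) 0"

lemma lattice_op_twice:
  "lattice_op N (lattice_op N f) 0 = (\<Sum>n\<in>{-int N..int N}. \<Sum>m\<in>{-int N..int N}. f ((of_int n)\<^sup>2 + (of_int m)\<^sup>2))"
  by (simp add: lattice_op_def)

lemma disc_count_mono: "s \<le> t \<Longrightarrow> disc_count N s \<le> disc_count N t"
  unfolding disc_count_def lattice_op_twice by (intro sum_mono) auto

lemma disc_count_nonneg: "0 \<le> disc_count N s"
  unfolding disc_count_def lattice_op_twice by (intro sum_nonneg) auto

text \<open>Partial summation: a lattice point of square norm v is counted for s \<ge> v and thus
  collects the integral of F over [v, q], which is G v.\<close>

lemma disc_count_weighted_integral:
  assumes F: "\<And>v. 0 \<le> v \<Longrightarrow> v \<le> q \<Longrightarrow> (F has_integral G v) {v..q}"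
    and G: "\<And>v. q < v \<Longrightarrow> G v = 0" and q: "0 \<le> q"
  shows "((\<lambda>s. F s * disc_count N s) has_integral lattice_op N (lattice_op N G) 0) {0..q}"
proof -
  have "((\<lambda>s. if v \<le> s then F s else 0) has_integral G v) {0..q}" if "0 \<le> v" for v
  proof (cases "v \<le> q")
    case True
    then show ?thesis using that by (intro has_integral_step F) auto
  next
    case False
    then have "((\<lambda>s. if v \<le> s then F s else 0) has_integral 0) {0..q}"
      by (intro has_integral_is_0) auto
    then show ?thesis using False G[of v] by simp
  qed
  then have "((\<lambda>s. \<Sum>n\<in>{-int N..int N}. \<Sum>m\<in>{-int N..int N}. if (of_int n)\<^sup>2 + (of_int m)\<^sup>2 \<le> s then F s else 0) has_integral
    (\<Sum>n\<in>{-int N..int N}. \<Sum>m\<in>{-int N..int N}. G ((of_int n)\<^sup>2 + (of_int m)\<^sup>2))) {0..q}"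
    by (intro has_integral_sum) auto
  moreover have "(\<Sum>n\<in>{-int N..int N}. \<Sum>m\<in>{-int N..int N}. if (of_int n)\<^sup>2 + (of_int m)\<^sup>2 \<le> s then F s else 0) = F s * disc_count N s" for s
    unfolding disc_count_def lattice_op_twice sum_distrib_left by (intro sum.cong refl) auto
  ultimately show ?thesis unfolding lattice_op_twice by simp
qed

lemma radial_class_tent: "s \<le> (real N)\<^sup>2 \<Longrightarrow> radial_class N (tent s)"
  unfolding radial_class_def using bdd_borel_tent by (auto simp: tent_def)

text \<open>The lattice part is the case F = 1 of partial summation, with G the tent.\<close>

lemma disc_error_integral:
  assumes "0 \<le> p" "p \<le> q" "q \<le> (real N)\<^sup>2"
  shows "((\<lambda>s. disc_count N s - pi * s) has_integral (circle_primitive N q - circle_primitive N p)) {p..q}"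
proof -
  have base: "((\<lambda>s. disc_count N s - pi * s) has_integral circle_primitive N q) {0..q}" if q: "0 \<le> q" "q \<le> (real N)\<^sup>2" for q
  proof -
    have A: "((\<lambda>s. 1 * disc_count N s) has_integral lattice_op N (lattice_op N (tent q)) 0) {0..q}"
    proof (rule disc_count_weighted_integral)
      fix v :: real assume "0 \<le> v" "v \<le> q"
      then show "((\<lambda>_. 1) has_integral tent q v) {v..q}"
        using has_integral_const_real[of "1::real" v q] by (simp add: tent_def)
    qed (use q in \<open>auto simp: tent_def\<close>)
    have B: "((\<lambda>s. pi * s) has_integral integral_op N (integral_op N (tent q)) 0) {0..q}"
    proof -
      have lin: "((\<lambda>s. s) has_integral (q\<^sup>2 / 2 - 0\<^sup>2 / 2)) {0..q}"
        using q by (intro fundamental_theorem_of_calculus)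
           (auto intro!: derivative_eq_intros simp: has_real_derivative_iff_has_vector_derivative[symmetric])
      have "((\<lambda>s. q - s) has_integral (q * (q - 0) - (q\<^sup>2 / 2 - 0\<^sup>2 / 2))) {0..q}"
        using has_integral_diff[OF has_integral_const_real[of q 0 q] lin] q by (simp add: mult.commute)
      then have "((\<lambda>s. q - s) has_integral (q\<^sup>2 / 2)) {0..q}"
        by (simp add: power2_eq_square)
      then have "(tent q has_integral (q\<^sup>2 / 2)) {0..q}"
        by (rule has_integral_eq[rotated]) (auto simp: tent_def)
      then have eq: "integral_op N (integral_op N (tent q)) 0 = pi * (q\<^sup>2 / 2)"
        using q by (intro integral_op_twice_has_integral[where X = q] radial_class_tent) (auto simp: tent_def)
      show ?thesis unfolding eq using has_integral_mult_right[OF lin, of pi] by simp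
    qed
    show ?thesis
      unfolding circle_primitive_def using has_integral_diff[OF A B] by simp
  qed
  have int: "(\<lambda>s. disc_count N s - pi * s) integrable_on {0..q}"
    using base[of q] assms by (auto simp: has_integral_iff)
  have "integral {0..p} (\<lambda>s. disc_count N s - pi * s) + integral {p..q} (\<lambda>s. disc_count N s - pi * s)
     = integral {0..q} (\<lambda>s. disc_count N s - pi * s)"
    using assms int by (intro Henstock_Kurzweil_Integration.integral_combine) auto
  moreover have "(\<lambda>s. disc_count N s - pi * s) integrable_on {p..q}"
    using int by (rule integrable_subinterval_real) (use assms in auto)
  ultimately show ?thesis
    using base[of q] base[of p] assms by (auto simp: has_integral_iff)
qed

text \<open>Intervals shorter than 1 are treated by comparing both ends with c - 1, which may be
  negative; the tent is then 0.\<close>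

lemma circle_primitive_diff_le':
  assumes R: "1 \<le> R" and s: "c \<le> d" "d \<le> R\<^sup>2" and N: "R \<le> real N" "real N \<le> 2 * R"
  shows "\<bar>circle_primitive N d - circle_primitive N c\<bar> \<le> 200000 * R * sqrt (d - c + 1)"
proof -
  have "\<bar>circle_primitive N d - circle_primitive N (c - 1)\<bar> \<le> 80000 * R * sqrt (d - c + 1)"
    using circle_primitive_diff_le[of R "c - 1" d N] assms by (simp add: algebra_simps)
  moreover have "\<bar>circle_primitive N c - circle_primitive N (c - 1)\<bar> \<le> 80000 * R * 1"
    using circle_primitive_diff_le[of R "c - 1" c N] assms by simp
  moreover have "R * 1 \<le> R * sqrt (d - c + 1)" using R s by (intro mult_left_mono) auto
  ultimately show ?thesis by argo
qed

text \<open>The length h with sqrt (X h) = h^2: averaging the error over length h costs sqrt (X/h),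
  and the term \<pi> s drifts by \<pi> h meanwhile.\<close>

definition smoothing_scale :: "real \<Rightarrow> real" where "smoothing_scale X = X powr (1/3)"

text \<open>A piece at distance h from the edge contributes X^(3/2 - 1/a) h^(1/a - 1/2). The two
  exponents are those at h = X and at h = X^(1/3).\<close>

definition disc_exponent :: "real \<Rightarrow> real" where "disc_exponent a = max 1 (4/3 - 2 / (3 * a))"

context
  fixes X :: real and N :: nat
  assumes X: "X \<ge> 1" and N: "sqrt (2 * X) \<le> real N" "real N \<le> 2 * sqrt (2 * X)"
begin

abbreviation (input) \<eta> where "\<eta> \<equiv> smoothing_scale X"

lemma eta: "1 \<le> \<eta>" "\<eta> \<le> X" "sqrt X = \<eta> * sqrt \<eta>"
proof -
  show "1 \<le> \<eta>" using X by (simp add: smoothing_scale_def ge_one_powr_ge_zero)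
  show "\<eta> \<le> X" using X powr_mono[of "1/3" 1 X] by (simp add: smoothing_scale_def)
  have "sqrt X = X powr (1/2)" using X by (simp add: powr_half_sqrt)
  also have "\<dots> = X powr (1/3) * (X powr (1/3)) powr (1/2)"
    using X by (simp add: powr_powr powr_add[symmetric])
  finally show "sqrt X = \<eta> * sqrt \<eta>" by (simp add: smoothing_scale_def powr_half_sqrt)
qed

lemma two_X_le: "2 * X \<le> (real N)\<^sup>2"
  using power_mono[OF N(1), of 2] X by simp

lemma disc_error_integral_le:
  assumes "0 \<le> c" "c \<le> d" "d \<le> 2 * X"
  shows "\<bar>integral {c..d} (\<lambda>s. disc_count N s - pi * s)\<bar> \<le> 300000 * sqrt X * sqrt (d - c + 1)"
proof -
  have "integral {c..d} (\<lambda>s. disc_count N s - pi * s) = circle_primitive N d - circle_primitive N c"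
    using assms two_X_le by (intro integral_unique disc_error_integral) auto
  also have "\<bar>\<dots>\<bar> \<le> 200000 * sqrt (2 * X) * sqrt (d - c + 1)"
    using assms X N by (intro circle_primitive_diff_le') auto
  also have "\<dots> \<le> 200000 * (3/2 * sqrt X) * sqrt (d - c + 1)"
  proof -
    have "sqrt (2 * X) \<le> 3/2 * sqrt X"
      using X by (intro real_le_lsqrt) (auto simp: power_mult_distrib power2_eq_square)
    then show ?thesis using assms by (intro mult_right_mono mult_left_mono) auto
  qed
  finally show ?thesis by simp
qed

text \<open>The count increases, so on [s, s + \<eta>] the error never falls more than \<pi> \<eta>
  below its value at s, and that value exceeds the average by at most 4 \<eta>. The average is
  O(\<eta>) by \<open>disc_error_integral_le\<close>. The lower bound uses [s - \<eta>, s], or the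
  trivial bound when s < \<eta>.\<close>

lemma disc_error_le:
  assumes s: "0 \<le> s" "s \<le> X"
  shows "\<bar>disc_count N s - pi * s\<bar> \<le> 600004 * \<eta>"
proof -
  let ?E = "\<lambda>s. disc_count N s - pi * s"
  have int: "?E integrable_on {c..d}" if "0 \<le> c" "c \<le> d" "d \<le> 2 * X" for c d
    using disc_error_integral[of c d N] two_X_le that by (auto simp: has_integral_iff)
  have I: "\<bar>integral {c..c + \<eta>} ?E\<bar> \<le> 600000 * \<eta> * \<eta>" if "0 \<le> c" "c + \<eta> \<le> 2 * X" for c
  proof -
    have "\<bar>integral {c..c + \<eta>} ?E\<bar> \<le> 300000 * sqrt X * sqrt (c + \<eta> - c + 1)"
      using that eta by (intro disc_error_integral_le) auto
    also have "\<dots> \<le> 300000 * sqrt X * (2 * sqrt \<eta>)"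
    proof (intro mult_left_mono)
      have "\<eta> + 1 \<le> (2 * sqrt \<eta>)\<^sup>2" using eta(1) by (simp add: power_mult_distrib)
      then show "sqrt (c + \<eta> - c + 1) \<le> 2 * sqrt \<eta>" using eta(1) by (intro real_le_lsqrt) auto
    qed (use X in auto)
    also have "\<dots> = 600000 * \<eta> * (sqrt \<eta> * sqrt \<eta>)" unfolding eta(3) by simp
    finally show ?thesis using eta(1) by simp
  qed
  have pi4: "pi * t \<le> 4 * t" if "0 \<le> t" for t using that pi_less_4 by (intro mult_right_mono) auto
  have up: "?E s \<le> 600004 * \<eta>"
  proof -
    have "((\<lambda>_. ?E s - 4 * \<eta>) has_integral (s + \<eta> - s) *\<^sub>R (?E s - 4 * \<eta>)) {s..s + \<eta>}"
      using eta(1) has_integral_const_real[of "?E s - 4 * \<eta>" s "s + \<eta>"] by simp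
    moreover have "(?E has_integral integral {s..s + \<eta>} ?E) {s..s + \<eta>}"
      using s eta by (intro integrable_integral int) auto
    ultimately have "(s + \<eta> - s) *\<^sub>R (?E s - 4 * \<eta>) \<le> integral {s..s + \<eta>} ?E"
    proof (rule has_integral_le)
      fix t assume t: "t \<in> {s..s + \<eta>}"
      then have "pi * (t - s) \<le> 4 * \<eta>" using pi4[of "t - s"] by auto
      then show "?E s - 4 * \<eta> \<le> ?E t"
        using disc_count_mono[of s t N] t by (simp add: algebra_simps)
    qed
    also have "\<dots> \<le> 600000 * \<eta> * \<eta>" using I[of s] s eta by auto
    finally have "\<eta> * ?E s \<le> \<eta> * (600004 * \<eta>)" by (simp add: algebra_simps)
    then show ?thesis by (rule mult_left_le_imp_le) (use eta in auto)
  qed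
  have down: "- (600004 * \<eta>) \<le> ?E s"
  proof (cases "\<eta> \<le> s")
    case False
    then have "pi * s \<le> 4 * \<eta>" using pi4[of s] s by auto
    then show ?thesis using disc_count_nonneg[of N s] eta(1) by linarith
  next
    case True
    define c where "c = s - \<eta>"
    have c: "0 \<le> c" "s = c + \<eta>" using True by (auto simp: c_def)
    have "(?E has_integral integral {c..c + \<eta>} ?E) {c..c + \<eta>}"
      using s eta c by (intro integrable_integral int) auto
    moreover have "((\<lambda>_. ?E s + 4 * \<eta>) has_integral (c + \<eta> - c) *\<^sub>R (?E s + 4 * \<eta>)) {c..c + \<eta>}"
      using eta(1) has_integral_const_real[of "?E s + 4 * \<eta>" c "c + \<eta>"] by simp
    ultimately have "integral {c..c + \<eta>} ?E \<le> (c + \<eta> - c) *\<^sub>R (?E s + 4 * \<eta>)"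
    proof (rule has_integral_le)
      fix t assume t: "t \<in> {c..c + \<eta>}"
      then have "pi * (s - t) \<le> 4 * \<eta>" using pi4[of "s - t"] c by auto
      then show "?E t \<le> ?E s + 4 * \<eta>"
        using disc_count_mono[of t s N] t c by (simp add: algebra_simps)
    qed
    moreover have "- (600000 * \<eta> * \<eta>) \<le> integral {c..c + \<eta>} ?E" using I[of c] s eta c by auto
    ultimately have "\<eta> * (- (600004 * \<eta>)) \<le> \<eta> * ?E s" by (simp add: algebra_simps)
    then show ?thesis by (rule mult_left_le_imp_le) (use eta in auto)
  qed
  from up down show ?thesis by auto
qed

context
  fixes a :: real
  assumes a: "a > 1"
begin

text \<open>The lattice sum is partial summation with F the kernel, and the integral is \<pi> times
  the first moment of the kernel with w = 0.\<close>

lemma profile_disc_error_integral: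
  "((\<lambda>s. profile_kernel a X s * (disc_count N s - pi * s)) has_integral
     (lattice_op N (lattice_op N (profile a X)) 0 - integral_op N (integral_op N (profile a X)) 0)) {0..X}"
proof -
  have a0: "a > 0" using a by simp
  note prof = a0 X
  have "((\<lambda>s. profile_kernel a X s * disc_count N s) has_integral lattice_op N (lattice_op N (profile a X)) 0) {0..X}"
    using profile_kernel_integral[OF prof, of _ X] profile_X[OF prof] X
    by (intro disc_count_weighted_integral) (auto simp: profile_def)
  moreover have "((\<lambda>s. profile_kernel a X s * (pi * s)) has_integral integral_op N (integral_op N (profile a X)) 0) {0..X}"
  proof -
    have "(profile a X has_integral integral {0..X} (profile a X)) {0..X}"
      by (intro integrable_integral integrable_continuous_real continuous_on_profile[OF prof])
    then have "integral_op N (integral_op N (profile a X)) 0 = pi * integral {0..X} (profile a X)"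
      using X two_X_le bdd_borel_profile[OF prof] profile_nonneg
      by (intro integral_op_twice_has_integral[where X = X]) (auto simp: radial_class_def profile_def)
    then show ?thesis
      using has_integral_mult_right[OF profile_kernel_moment1[OF prof, of 0], of pi] X by (simp add: mult_ac)
  qed
  ultimately show ?thesis
    unfolding right_diff_distrib by (rule has_integral_diff)
qed

text \<open>The point X is excluded: \<open>0 powr (1 / a - 1)\<close> is 0 there, although the
  kernel tends to infinity.\<close>

lemma profile_kernel_mono: "mono_on {0..<X} (profile_kernel a X)"
proof (rule mono_onI)
  fix s t assume st: "s \<in> {0..<X}" "t \<in> {0..<X}" "s \<le> t"
  have "0 < X powr a - t powr a" using st a by (simp add: powr_less_mono2)
  moreover have "s powr a \<le> t powr a" using st a by (intro powr_mono2) auto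
  ultimately have "(X powr a - s powr a) powr (1 / a - 1) \<le> (X powr a - t powr a) powr (1 / a - 1)"
    using a by (intro powr_mono2') auto
  moreover have "s powr (a - 1) \<le> t powr (a - 1)" using st a by (intro powr_mono2) auto
  ultimately show "profile_kernel a X s \<le> profile_kernel a X t"
    unfolding profile_kernel_def by (intro mult_mono) auto
qed

text \<open>As 1/a - 1 is negative, the lower bound \<open>powr_gap_ge\<close> for the gap becomes
  an upper bound; the factor s^(a - 1) is at most X^(a - 1).\<close>

lemma profile_kernel_le:
  assumes "0 < h" "h \<le> X"
  shows "profile_kernel a X (X - h) \<le> X powr (1 - 1 / a) * h powr (1 / a - 1)"
proof -
  have a0: "a > 0" using a by simp
  have "(X powr a - (X - h) powr a) powr (1 / a - 1) \<le> (X powr (a - 1) * h) powr (1 / a - 1)"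
    using powr_gap_ge[OF a0 X, of h] a assms X by (intro powr_mono2') auto
  also have "\<dots> = X powr ((a - 1) * (1 / a - 1)) * h powr (1 / a - 1)"
    using assms X by (simp add: powr_mult powr_powr)
  finally have 1: "(X powr a - (X - h) powr a) powr (1 / a - 1) \<le> X powr ((a - 1) * (1 / a - 1)) * h powr (1 / a - 1)" .
  have "profile_kernel a X (X - h) \<le> (X powr ((a - 1) * (1 / a - 1)) * h powr (1 / a - 1)) * X powr (a - 1)"
    unfolding profile_kernel_def using 1 assms a by (intro mult_mono powr_mono2) auto
  also have "\<dots> = X powr ((a - 1) * (1 / a - 1) + (a - 1)) * h powr (1 / a - 1)"
    by (simp add: powr_add)
  also have "(a - 1) * (1 / a - 1) + (a - 1) = 1 - 1 / a"
    using a by (simp add: field_simps)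
  finally show ?thesis .
qed

text \<open>At distance between h and 2h from the edge the kernel is monotone of size X^(1 - 1/a)
  h^(1/a - 1), and integrals of the error are O(sqrt (X h)). In the product h has exponent 1/a -
  1/2, so the worst case is h = X for a \<le> 2 and h = \<eta> for a > 2.\<close>

lemma dyadic_piece_le:
  assumes h: "\<eta> \<le> h" "h \<le> X" and p: "0 \<le> p" "X - 2 * h \<le> p" "p \<le> X - h"
  shows "\<bar>integral {p..X - h} (\<lambda>s. profile_kernel a X s * (disc_count N s - pi * s))\<bar> \<le> 1200000 * X powr disc_exponent a"
proof -
  let ?E = "\<lambda>s. disc_count N s - pi * s"
  have h1: "h \<ge> 1" using h eta by simp
  have "\<bar>integral {p..X - h} (\<lambda>s. profile_kernel a X s * ?E s)\<bar>
      \<le> 2 * (X powr (1 - 1 / a) * h powr (1 / a - 1)) * (600000 * sqrt X * sqrt h)"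
  proof (rule second_mean_value_bound(2))
    show "?E integrable_on {p..X - h}"
      using disc_error_integral[of p "X - h" N] two_X_le p h h1 X by (auto simp: has_integral_iff)
    show "mono_on {p..X - h} (profile_kernel a X) \<or> antimono_on {p..X - h} (profile_kernel a X)"
    proof -
      have "{p..X - h} \<subseteq> {0..<X}" using p h1 by auto
      then show ?thesis using monotone_on_subset[OF profile_kernel_mono] by blast
    qed
    show "\<bar>profile_kernel a X s\<bar> \<le> X powr (1 - 1 / a) * h powr (1 / a - 1)" if "p \<le> s" "s \<le> X - h" for s
    proof -
      have "profile_kernel a X s \<le> profile_kernel a X (X - h)"
        using that p h1 by (intro mono_onD[OF profile_kernel_mono]) auto
      also have "\<dots> \<le> X powr (1 - 1 / a) * h powr (1 / a - 1)"
        using h h1 by (intro profile_kernel_le) auto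
      finally show ?thesis by (simp add: profile_kernel_def)
    qed
    fix c d assume cd: "p \<le> c" "c \<le> d" "d \<le> X - h"
    have "\<bar>integral {c..d} ?E\<bar> \<le> 300000 * sqrt X * sqrt (d - c + 1)"
      using cd p h h1 X by (intro disc_error_integral_le) auto
    also have "\<dots> \<le> 300000 * sqrt X * (2 * sqrt h)"
    proof (intro mult_left_mono)
      have "d - c + 1 \<le> (2 * sqrt h)\<^sup>2" using cd p h1 by (simp add: power_mult_distrib)
      then show "sqrt (d - c + 1) \<le> 2 * sqrt h" using h1 by (intro real_le_lsqrt) auto
    qed (use X in auto)
    finally show "\<bar>integral {c..d} ?E\<bar> \<le> 600000 * sqrt X * sqrt h" by simp
  qed (use p in auto)
  also have "\<dots> = 1200000 * (X powr (1 - 1 / a + 1/2) * h powr (1 / a - 1 + 1/2))"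
  proof -
    have "X powr (1 - 1 / a + 1/2) = X powr (1 - 1 / a) * sqrt X"
      using X by (simp only: powr_add) (simp add: powr_half_sqrt)
    moreover have "h powr (1 / a - 1 + 1/2) = h powr (1 / a - 1) * sqrt h"
      using h1 by (simp only: powr_add) (simp add: powr_half_sqrt)
    ultimately show ?thesis by (simp only: mult_ac)
  qed
  also have "X powr (1 - 1 / a + 1/2) * h powr (1 / a - 1 + 1/2) \<le> X powr disc_exponent a"
  proof (cases "1 / a - 1 + 1/2 \<ge> 0")
    case True
    then have "X powr (1 - 1 / a + 1/2) * h powr (1 / a - 1 + 1/2) \<le> X powr (1 - 1 / a + 1/2) * X powr (1 / a - 1 + 1/2)"
      using h h1 by (intro mult_left_mono powr_mono2) auto
    also have "\<dots> = X powr 1" by (simp add: powr_add[symmetric])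
    also have "\<dots> \<le> X powr disc_exponent a" using X by (intro powr_mono) (auto simp: disc_exponent_def)
    finally show ?thesis .
  next
    case False
    then have "X powr (1 - 1 / a + 1/2) * h powr (1 / a - 1 + 1/2) \<le> X powr (1 - 1 / a + 1/2) * \<eta> powr (1 / a - 1 + 1/2)"
      using h eta by (intro mult_left_mono powr_mono2') auto
    also have "\<dots> = X powr (1 - 1 / a + 1/2 + 1/3 * (1 / a - 1 + 1/2))"
      unfolding smoothing_scale_def by (simp add: powr_powr powr_add[symmetric])
    also have "1 - 1 / a + 1/2 + 1/3 * (1 / a - 1 + 1/2) = 4/3 - 2 / (3 * a)"
      using a by (simp add: field_simps)
    also have "X powr (4/3 - 2 / (3 * a)) \<le> X powr disc_exponent a" using X by (intro powr_mono) (auto simp: disc_exponent_def)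
    finally show ?thesis .
  qed
  finally show ?thesis by simp
qed

lemma last_piece_le:
  "\<bar>integral {X - \<eta>..X} (\<lambda>s. profile_kernel a X s * (disc_count N s - pi * s))\<bar> \<le> 600004 * a * X powr disc_exponent a"
proof -
  have a0: "a > 0" using a by simp
  note prof = a0 X
  let ?E = "\<lambda>s. disc_count N s - pi * s"
  have K: "(profile_kernel a X has_integral profile a X (X - \<eta>)) {X - \<eta>..X}"
    using profile_kernel_integral[OF prof, of "X - \<eta>" X] profile_X[OF prof] eta by simp
  have "norm (integral {X - \<eta>..X} (\<lambda>s. profile_kernel a X s * ?E s)) \<le> integral {X - \<eta>..X} (\<lambda>s. 600004 * \<eta> * profile_kernel a X s)"
  proof (rule integral_norm_bound_integral)
    show "(\<lambda>s. profile_kernel a X s * ?E s) integrable_on {X - \<eta>..X}"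
      using profile_disc_error_integral integrable_subinterval_real[of _ 0 X "X - \<eta>" X] eta
      by (auto simp: has_integral_iff)
    show "(\<lambda>s. 600004 * \<eta> * profile_kernel a X s) integrable_on {X - \<eta>..X}"
      using K by (intro integrable_on_mult_right) (auto simp: has_integral_iff)
    fix s assume "s \<in> {X - \<eta>..X}"
    then have "\<bar>?E s\<bar> \<le> 600004 * \<eta>" using eta by (intro disc_error_le) auto
    then have "profile_kernel a X s * \<bar>?E s\<bar> \<le> profile_kernel a X s * (600004 * \<eta>)"
      by (intro mult_left_mono) (auto simp: profile_kernel_def)
    then show "norm (profile_kernel a X s * ?E s) \<le> 600004 * \<eta> * profile_kernel a X s"
      by (simp add: abs_mult profile_kernel_def mult_ac)
  qed
  also have "\<dots> = 600004 * \<eta> * profile a X (X - \<eta>)"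
    using K by (simp add: integral_unique)
  also have "profile a X (X - \<eta>) \<le> (a * X powr (a - 1) * \<eta>) powr (1 / a)"
    unfolding profile_def using powr_gap_le[OF prof, of \<eta>] powr_gap_nonneg[OF prof, of "X - \<eta>"] eta a
    by (auto intro!: powr_mono2 simp: max_def)
  also have "(a * X powr (a - 1) * \<eta>) powr (1 / a) = a powr (1 / a) * X powr ((a - 1) / a) * \<eta> powr (1 / a)"
    using a by (simp add: powr_mult powr_powr smoothing_scale_def)
  also have "\<dots> \<le> a * X powr ((a - 1) / a) * \<eta> powr (1 / a)"
    using a powr_mono[of "1 / a" 1 a] by (intro mult_right_mono) auto
  finally have "norm (integral {X - \<eta>..X} (\<lambda>s. profile_kernel a X s * ?E s))
      \<le> 600004 * \<eta> * (a * X powr ((a - 1) / a) * \<eta> powr (1 / a))"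
    using eta by simp
  also have "\<dots> = 600004 * a * (X powr (1/3) * X powr ((a - 1) / a) * X powr (1/3 * (1 / a)))"
    by (simp add: smoothing_scale_def powr_powr)
  also have "X powr (1/3) * X powr ((a - 1) / a) * X powr (1/3 * (1 / a)) = X powr (1/3 + (a - 1) / a + 1/3 * (1 / a))"
    by (simp add: powr_add)
  also have "1/3 + (a - 1) / a + 1/3 * (1 / a) = 4/3 - 2 / (3 * a)"
    using a by (simp add: field_simps)
  also have "600004 * a * X powr (4/3 - 2 / (3 * a)) \<le> 600004 * a * X powr disc_exponent a"
    using X a by (intro mult_left_mono powr_mono) (auto simp: disc_exponent_def)
  finally show ?thesis by simp
qed

text \<open>Truncation at 0 makes all pieces beyond the left end empty, so that J may
  overshoot.\<close>

lemma dyadic_pieces_le: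
  "\<bar>integral {max 0 (X - 2 ^ J * \<eta>)..X - \<eta>} (\<lambda>s. profile_kernel a X s * (disc_count N s - pi * s))\<bar>
     \<le> real J * (1200000 * X powr disc_exponent a)"
proof (induction J)
  case 0
  then show ?case using eta by simp
next
  case (Suc J)
  let ?F = "\<lambda>s. profile_kernel a X s * (disc_count N s - pi * s)"
  define q where "q = max 0 (X - 2 ^ J * \<eta>)"
  define p where "p = max 0 (X - 2 ^ Suc J * \<eta>)"
  have e0: "1 * \<eta> \<le> 2 ^ J * \<eta>" using eta by (intro mult_right_mono) auto
  have "0 \<le> 2 ^ J * \<eta>" using e0 eta by linarith
  then have pq: "0 \<le> p" "p \<le> q" "q \<le> X - \<eta>"
    using e0 eta by (auto simp: p_def q_def le_max_iff_disj mult.assoc)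
  have int: "?F integrable_on {p..X - \<eta>}"
    using profile_disc_error_integral integrable_subinterval_real[of _ 0 X p "X - \<eta>"] eta pq
    by (auto simp: has_integral_iff)
  have "integral {p..X - \<eta>} ?F = integral {p..q} ?F + integral {q..X - \<eta>} ?F"
    using Henstock_Kurzweil_Integration.integral_combine[OF pq(2,3) int] by simp
  moreover have "\<bar>integral {p..q} ?F\<bar> \<le> 1200000 * X powr disc_exponent a"
  proof (cases "2 ^ J * \<eta> \<le> X")
    case True
    then have "q = X - 2 ^ J * \<eta>" by (simp add: q_def)
    then show ?thesis
      using dyadic_piece_le[of "2 ^ J * \<eta>" p] True e0 pq by (simp add: p_def)
  next
    case False
    then have "q = 0" "p = 0" using pq by (auto simp: q_def)
    then show ?thesis by simp
  qed
  ultimately show ?case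
    using Suc.IH abs_triangle_ineq[of "integral {p..q} ?F" "integral {q..X - \<eta>} ?F"]
    unfolding p_def[symmetric] q_def[symmetric] by (simp add: algebra_simps)
qed

lemma lattice_minus_integral_plane_profile:
  assumes X2: "X \<ge> 2"
  shows "\<bar>lattice_op N (lattice_op N (profile a X)) 0 - integral_op N (integral_op N (profile a X)) 0\<bar>
     \<le> 6000000 * a * X powr disc_exponent a * ln X"
proof -
  let ?F = "\<lambda>s. profile_kernel a X s * (disc_count N s - pi * s)"
  \<comment> \<open>Enough dyadic pieces to reach 0, because \<eta> \<ge> 1. Their number is the
    source of the logarithm.\<close>
  define J where "J = nat \<lceil>log 2 X\<rceil>"
  have l0: "0 \<le> log 2 X" using X by simp
  have "X = 2 powr (log 2 X)" using X by simp
  also have "\<dots> \<le> 2 powr (real J)" unfolding J_def using l0 by (intro powr_mono) linarith+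
  also have "\<dots> = 2 ^ J" by (simp add: powr_realpow)
  finally have "X * 1 \<le> 2 ^ J * \<eta>" using eta X by (intro mult_mono) auto
  then have m0: "max 0 (X - 2 ^ J * \<eta>) = 0" by simp
  have int: "?F integrable_on {0..X}" using profile_disc_error_integral by (auto simp: has_integral_iff)
  have "lattice_op N (lattice_op N (profile a X)) 0 - integral_op N (integral_op N (profile a X)) 0 = integral {0..X} ?F"
    using profile_disc_error_integral by (simp add: integral_unique)
  also have "\<dots> = integral {0..X - \<eta>} ?F + integral {X - \<eta>..X} ?F"
    using Henstock_Kurzweil_Integration.integral_combine[OF _ _ int, of "X - \<eta>"] eta by simp
  finally have "\<bar>lattice_op N (lattice_op N (profile a X)) 0 - integral_op N (integral_op N (profile a X)) 0\<bar>
      \<le> real J * (1200000 * X powr disc_exponent a) + 600004 * a * X powr disc_exponent a"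
    using dyadic_pieces_le[of J] last_piece_le abs_triangle_ineq[of "integral {0..X - \<eta>} ?F" "integral {X - \<eta>..X} ?F"]
    unfolding m0 by linarith
  also have "\<dots> \<le> (3 * ln X) * (1200000 * a * X powr disc_exponent a) + 600004 * a * X powr disc_exponent a * (2 * ln X)"
  proof (rule add_mono)
    have ln2: "ln 2 \<ge> (1/2::real)" using ln2_ge_two_thirds by simp
    have lnX: "ln 2 \<le> ln X" using X2 by simp
    have "real J \<le> log 2 X + 1" unfolding J_def using l0 by linarith
    also have "log 2 X = ln X / ln 2" by (simp add: log_def)
    also have "ln X / ln 2 \<le> 3/2 * ln X"
    proof -
      have "ln X * 1 \<le> ln X * (3/2 * ln 2)" using ln2_ge_two_thirds lnX ln2 by (intro mult_left_mono) auto
      then show ?thesis using ln2 by (simp add: divide_le_eq mult_ac)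
    qed
    also have "3/2 * ln X + 1 \<le> 3 * ln X" using ln2_ge_two_thirds lnX by linarith
    finally have J: "real J \<le> 3 * ln X" by simp
    have "1200000 * X powr disc_exponent a \<le> 1200000 * a * X powr disc_exponent a"
      using a mult_right_mono[of 1 a "X powr disc_exponent a"] by simp
    with J show "real J * (1200000 * X powr disc_exponent a) \<le> (3 * ln X) * (1200000 * a * X powr disc_exponent a)"
      using X by (intro mult_mono) auto
    have "600004 * a * X powr disc_exponent a * 1 \<le> 600004 * a * X powr disc_exponent a * (2 * ln X)"
      using a ln2 lnX by (intro mult_left_mono) auto
    then show "600004 * a * X powr disc_exponent a \<le> 600004 * a * X powr disc_exponent a * (2 * ln X)" by simp
  qed
  also have "\<dots> \<le> 6000000 * a * X powr disc_exponent a * ln X"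
  proof -
    have "0 \<le> a * X powr disc_exponent a * ln X" using a X by simp
    then show ?thesis by (simp add: mult_ac)
  qed
  finally show ?thesis .
qed

end
end

section \<open>Profiles in four dimensions\<close>

lemma lattice_op_four_rep4:
  assumes f: "\<And>v. (real N)\<^sup>2 < v \<Longrightarrow> f v = 0" and w: "0 \<le> w"
  shows "(lattice_op N ^^ 4) f w = (\<Sum>n\<in>{0..int N ^ 2}. real (card (rep4 n)) * f (w + of_int n))"
proof -
  let ?S = "{-int N..int N}"
  let ?T = "?S \<times> ?S \<times> ?S \<times> ?S"
  let ?M = "int N ^ 2"
  define s where "s = (\<lambda>(x::int, y::int, z::int, t::int). x\<^sup>2 + y\<^sup>2 + z\<^sup>2 + t\<^sup>2)"
  have s0: "0 \<le> s p" for p by (cases p) (simp add: s_def)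
  have box: "x \<in> ?S" if "x\<^sup>2 \<le> ?M" for x
    using that abs_le_square_iff[of x "int N"] by auto
  have fib: "{p \<in> {p \<in> ?T. s p \<le> ?M}. s p = n} = rep4 n" if n: "n \<in> {0..?M}" for n
  proof -
    have "x \<in> ?S \<and> y \<in> ?S \<and> z \<in> ?S \<and> t \<in> ?S" if "x\<^sup>2 + y\<^sup>2 + z\<^sup>2 + t\<^sup>2 = n" for x y z t
    proof -
      have "0 \<le> x\<^sup>2" "0 \<le> y\<^sup>2" "0 \<le> z\<^sup>2" "0 \<le> t\<^sup>2" by simp_all
      then have "x\<^sup>2 \<le> ?M" "y\<^sup>2 \<le> ?M" "z\<^sup>2 \<le> ?M" "t\<^sup>2 \<le> ?M"
        using that n unfolding atLeastAtMost_iff by linarith+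
      then show ?thesis using box by blast
    qed
    then show ?thesis using n unfolding rep4_def s_def by auto
  qed
  have "(lattice_op N ^^ 4) f w = (\<Sum>p\<in>?T. f (w + of_int (s p)))"
    by (simp add: eval_nat_numeral lattice_op_def sum.cartesian_product split_def s_def add_ac)
  also have "\<dots> = (\<Sum>p | p \<in> ?T \<and> s p \<le> ?M. f (w + of_int (s p)))"
  proof (rule sum.mono_neutral_right)
    show "\<forall>p\<in>?T - {p. p \<in> ?T \<and> s p \<le> ?M}. f (w + of_int (s p)) = 0"
    proof
      fix p assume "p \<in> ?T - {p. p \<in> ?T \<and> s p \<le> ?M}"
      then have "?M < s p" by auto
      then have "real_of_int ?M < of_int (s p)" by (simp only: of_int_less_iff)
      then show "f (w + of_int (s p)) = 0" using w by (intro f) simp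
    qed
  qed auto
  also have "\<dots> = (\<Sum>n\<in>{0..?M}. \<Sum>p | p \<in> {p. p \<in> ?T \<and> s p \<le> ?M} \<and> s p = n. f (w + of_int (s p)))"
    by (rule sum.group[symmetric]) (auto simp: s0)
  also have "\<dots> = (\<Sum>n\<in>{0..?M}. real (card (rep4 n)) * f (w + of_int n))"
  proof (rule sum.cong[OF refl])
    fix n assume n: "n \<in> {0..?M}"
    have "(\<Sum>p | p \<in> {p. p \<in> ?T \<and> s p \<le> ?M} \<and> s p = n. f (w + of_int (s p))) = (\<Sum>p\<in>rep4 n. f (w + of_int (s p)))"
      by (simp only: fib[OF n])
    also have "\<dots> = (\<Sum>p\<in>rep4 n. f (w + of_int n))"
      by (rule sum.cong) (auto simp: rep4_def s_def)
    finally show "(\<Sum>p | p \<in> {p. p \<in> ?T \<and> s p \<le> ?M} \<and> s p = n. f (w + of_int (s p))) = real (card (rep4 n)) * f (w + of_int n)"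
      by simp
  qed
  finally show ?thesis .
qed

text \<open>Sorting the pairs by e turns divisor sums into sums over progressions of step k e with
  weight d. As f vanishes beyond M, both variables may run freely up to M.\<close>

lemma sum_divisor_pairs:
  fixes f :: "real \<Rightarrow> real" and k :: int
  assumes f: "\<And>v. of_int M < v \<Longrightarrow> f v = 0" and w: "0 \<le> w" and k: "k > 0"
  shows "(\<Sum>n\<in>{1..M}. of_int (\<Sum>(d, e)\<in>{(d, e). d > 0 \<and> e > 0 \<and> k * d * e = n}. d) * f (w + of_int n))
     = (\<Sum>e\<in>{1..M}. \<Sum>d\<in>{1..M}. of_int d * f (w + of_int (k * e) * of_int d))"
proof -
  define P where "P n = {(d, e). d > 0 \<and> e > 0 \<and> k * d * e = n}" for n
  have dvd: "d \<in> {1..n} \<and> e \<in> {1..n}" if "d > 0" "e > 0" "k * d * e = n" for d e n :: int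
  proof -
    have kd: "1 * d \<le> k * d" "1 * e \<le> k * e" using k that by (intro mult_right_mono; simp)+
    have "k * d * 1 \<le> k * d * e" "k * e * 1 \<le> k * e * d"
      using that k by (intro mult_left_mono; simp)+
    moreover have "k * e * d = n" using that(3) by (simp only: mult_ac)
    ultimately have "d \<le> n" "e \<le> n" using kd that(3) by linarith+
    then show ?thesis using that by simp
  qed
  have finP: "finite (P n)" for n
    by (rule finite_subset[of _ "{1..n} \<times> {1..n}"]) (use dvd in \<open>auto simp: P_def\<close>)
  have "(\<Sum>n\<in>{1..M}. of_int (\<Sum>(d, e)\<in>P n. d) * f (w + of_int n))
     = (\<Sum>n\<in>{1..M}. \<Sum>p\<in>P n. of_int (fst p) * f (w + of_int (k * fst p * snd p)))"
    by (intro sum.cong refl) (auto simp: sum_distrib_right P_def split_def intro!: sum.cong)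
  also have "\<dots> = (\<Sum>q\<in>Sigma {1..M} P. of_int (fst (snd q)) * f (w + of_int (k * fst (snd q) * snd (snd q))))"
    by (subst sum.Sigma) (auto simp: finP split_def)
  also have "\<dots> = (\<Sum>(d, e)\<in>{p \<in> {1..M} \<times> {1..M}. k * fst p * snd p \<le> M}. of_int d * f (w + of_int (k * e) * of_int d))"
  proof (rule sum.reindex_bij_witness[of _ "\<lambda>(d, e). (k * d * e, d, e)" snd])
    fix q assume q: "q \<in> Sigma {1..M} P"
    obtain n d e where nde: "q = (n, d, e)" by (cases q)
    then have "d > 0" "e > 0" "k * d * e = n" "n \<le> M" using q by (auto simp: P_def)
    then show "snd q \<in> {p \<in> {1..M} \<times> {1..M}. k * fst p * snd p \<le> M}"
      using dvd[of d e n] nde by auto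
  next
    fix p assume p: "p \<in> {p \<in> {1..M} \<times> {1..M}. k * fst p * snd p \<le> M}"
    then show "(case p of (d, e) \<Rightarrow> (k * d * e, d, e)) \<in> Sigma {1..M} P"
      using k by (auto simp: P_def intro!: mult_pos_pos) (smt (verit) mult_pos_pos)
  qed (auto simp: P_def mult_ac)
  also have "\<dots> = (\<Sum>(d, e)\<in>{1..M} \<times> {1..M}. of_int d * f (w + of_int (k * e) * of_int d))"
  proof (rule sum.mono_neutral_left)
    show "\<forall>p\<in>{1..M} \<times> {1..M} - {p \<in> {1..M} \<times> {1..M}. k * fst p * snd p \<le> M}.
        (case p of (d, e) \<Rightarrow> of_int d * f (w + of_int (k * e) * of_int d)) = 0"
    proof
      fix p assume p: "p \<in> {1..M} \<times> {1..M} - {p \<in> {1..M} \<times> {1..M}. k * fst p * snd p \<le> M}"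
      obtain d e where de: "p = (d, e)" by (cases p)
      have "M < k * e * d" using p de by (auto simp: mult_ac)
      then have "real_of_int M < of_int (k * e * d)" by (simp only: of_int_less_iff)
      then have "f (w + of_int (k * e) * of_int d) = 0" using w by (intro f) simp
      then show "(case p of (d, e) \<Rightarrow> of_int d * f (w + of_int (k * e) * of_int d)) = 0" by (simp add: de)
    qed
  qed auto
  also have "\<dots> = (\<Sum>e\<in>{1..M}. \<Sum>d\<in>{1..M}. of_int d * f (w + of_int (k * e) * of_int d))"
    by (subst sum.cartesian_product[symmetric]) (rule sum.swap)
  finally show ?thesis unfolding P_def .
qed

section \<open>Weighted sums over arithmetic progressions\<close>

definition weighted_progression :: "int \<Rightarrow> (real \<Rightarrow> real) \<Rightarrow> real \<Rightarrow> real \<Rightarrow> real" where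
  "weighted_progression M f w q = (\<Sum>d\<in>{1..M}. of_int d * f (w + q * of_int d))"

text \<open>The steps e and 4 e come from 8 sigma(n) and 32 sigma(n/4) in \<open>jacobi4_eq\<close>,
  and f w is the term of n = 0.\<close>

lemma lattice_op_four:
  assumes f: "\<And>v. (real N)\<^sup>2 < v \<Longrightarrow> f v = 0" and w: "0 \<le> w"
  defines "M \<equiv> int N ^ 2"
  shows "(lattice_op N ^^ 4) f w = f w + 8 * (\<Sum>e\<in>{1..M}. weighted_progression M f w (of_int e) - 4 * weighted_progression M f w (4 * of_int e))"
proof -
  have f': "f v = 0" if "of_int M < v" for v
    using that by (intro f) (simp add: M_def)
  have M0: "0 \<le> M" by (simp add: M_def)
  have split: "{0..M} = insert 0 {1..M}" using M0 by auto
  let ?A = "\<lambda>n. \<Sum>(d, e)\<in>{(d, e). d > 0 \<and> e > 0 \<and> 1 * d * e = n}. d :: int"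
  let ?B = "\<lambda>n. \<Sum>(d, e)\<in>{(d, e). d > 0 \<and> e > 0 \<and> 4 * d * e = n}. d :: int"
  have "(lattice_op N ^^ 4) f w = (\<Sum>n\<in>{0..M}. real (card (rep4 n)) * f (w + of_int n))"
    unfolding M_def by (rule lattice_op_four_rep4[OF f w])
  also have "\<dots> = (\<Sum>n\<in>{0..M}. of_int (jacobi4 n) * f (w + of_int n))"
  proof (intro sum.cong refl)
    fix n assume "n \<in> {0..M}"
    then have "real (card (rep4 n)) = of_int (jacobi4 n)"
      using jacobi_four_squares[of n] by (metis atLeastAtMost_iff of_int_of_nat_eq)
    then show "real (card (rep4 n)) * f (w + of_int n) = of_int (jacobi4 n) * f (w + of_int n)" by simp
  qed
  also have "\<dots> = f w + (\<Sum>n\<in>{1..M}. of_int (jacobi4 n) * f (w + of_int n))"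
    unfolding split by (subst sum.insert) (auto simp: jacobi4_def)
  also have "(\<Sum>n\<in>{1..M}. of_int (jacobi4 n) * f (w + of_int n))
     = (\<Sum>n\<in>{1..M}. 8 * (of_int (?A n) * f (w + of_int n)) - 32 * (of_int (?B n) * f (w + of_int n)))"
  proof (intro sum.cong refl)
    fix n assume "n \<in> {1..M}"
    then have "jacobi4 n = 8 * ?A n - 32 * ?B n"
      using jacobi4_eq[of n] by (simp add: divpairs_def)
    then show "of_int (jacobi4 n) * f (w + of_int n) = 8 * (of_int (?A n) * f (w + of_int n)) - 32 * (of_int (?B n) * f (w + of_int n))"
      by (simp only: of_int_diff of_int_mult of_int_numeral left_diff_distrib mult.assoc)
  qed
  also have "\<dots> = 8 * (\<Sum>n\<in>{1..M}. of_int (?A n) * f (w + of_int n)) - 32 * (\<Sum>n\<in>{1..M}. of_int (?B n) * f (w + of_int n))"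
    by (simp only: sum_subtractf sum_distrib_left)
  also have "\<dots> = 8 * (\<Sum>e\<in>{1..M}. weighted_progression M f w (of_int e)) - 32 * (\<Sum>e\<in>{1..M}. weighted_progression M f w (4 * of_int e))"
    using sum_divisor_pairs[of M f w 1, OF f' w] sum_divisor_pairs[of M f w 4, OF f' w]
    by (simp add: weighted_progression_def)
  finally show ?thesis
    by (simp add: sum_subtractf sum_distrib_left)
qed

text \<open>The sawtooth has mean 0 over each period. Its primitive from w on is q (f - f^2) / 2
  with f the fractional part of (s - w) / q, which lies between 0 and q/8; it is computed by writing
  the floor as a sum of unit steps.\<close>

lemma sawtooth_integral_le:
  fixes q w :: real
  assumes q: "q > 0" and cd: "w \<le> c" "c \<le> d"
  shows "(\<lambda>s. 1/2 - frac ((s - w) / q)) integrable_on {c..d}"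
    "\<bar>integral {c..d} (\<lambda>s. 1/2 - frac ((s - w) / q))\<bar> \<le> q / 4"
proof -
  let ?E = "\<lambda>s. 1/2 - frac ((s - w) / q)"
  have base: "(?E has_integral q * ((frac ((d - w) / q) - (frac ((d - w) / q))\<^sup>2) / 2)) {w..d}" if d: "w \<le> d" for d
  proof -
    define y where "y = (d - w) / q"
    define n where "n = nat \<lfloor>y\<rfloor>"
    have y0: "0 \<le> y" using d q by (simp add: y_def)
    have n: "real n = y - frac y" using y0 by (simp add: n_def frac_def)
    have "((\<lambda>s. \<Sum>j=1..n. if w + q * real j \<le> s then 1 else 0 :: real) has_integral (\<Sum>j=1..n. d - (w + q * real j))) {w..d}"
    proof (intro has_integral_sum has_integral_step)
      fix j assume j: "j \<in> {1..n}"
      then have "real j \<le> y" using n y0 frac_ge_0[of y] by (smt (verit) atLeastAtMost_iff of_nat_le_iff)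
      then have "w + q * real j \<le> d" using q by (simp add: y_def field_simps)
      then show "((\<lambda>_. 1) has_integral d - (w + q * real j)) {w + q * real j..d}"
        using has_integral_const_real[of "1::real" "w + q * real j" d] by simp
    qed (use q in auto)
    then have A: "((\<lambda>s. of_int \<lfloor>(s - w) / q\<rfloor> :: real) has_integral (\<Sum>j=1..n. d - (w + q * real j))) {w..d}"
    proof (rule has_integral_eq[rotated])
      fix s assume s: "s \<in> {w..d}"
      define m where "m = nat \<lfloor>(s - w) / q\<rfloor>"
      have m0: "0 \<le> (s - w) / q" using s q by simp
      have "(s - w) / q \<le> y" using s q by (simp add: y_def divide_right_mono)
      then have mn: "m \<le> n" unfolding m_def n_def by (intro nat_mono floor_mono)
      have iff: "w + q * real j \<le> s \<longleftrightarrow> j \<le> m" for j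
      proof -
        have "w + q * real j \<le> s \<longleftrightarrow> real j \<le> (s - w) / q" using q by (simp add: field_simps)
        also have "\<dots> \<longleftrightarrow> j \<le> m" unfolding m_def using m0 by (simp add: le_nat_iff le_floor_iff)
        finally show ?thesis .
      qed
      have "(\<Sum>j=1..n. if w + q * real j \<le> s then 1 else 0) = (\<Sum>j\<in>{1..n} \<inter> {j. j \<le> m}. 1 :: real)"
        unfolding iff by (simp add: sum.If_cases)
      also have "{1..n} \<inter> {j. j \<le> m} = {1..m}" using mn by auto
      finally show "(\<Sum>j=1..n. if w + q * real j \<le> s then 1 else 0 :: real) = of_int \<lfloor>(s - w) / q\<rfloor>"
        using m0 by (simp add: m_def)
    qed
    have B: "((\<lambda>s. (s - w) / q) has_integral (d - w)\<^sup>2 / (2 * q) - (w - w)\<^sup>2 / (2 * q)) {w..d}"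
      using d q by (intro fundamental_theorem_of_calculus)
         (auto intro!: derivative_eq_intros simp: has_real_derivative_iff_has_vector_derivative[symmetric] field_simps)
    have C: "((\<lambda>s. 1/2) has_integral (d - w) * (1/2)) {w..d}"
      using has_integral_const_real[of "1/2::real" w d] d by simp
    have S: "(\<Sum>j=1..n. d - (w + q * real j)) = q * (real n * y - real n * (real n + 1) / 2)"
    proof -
      have "(\<Sum>j=1..n. real j) = real n * (real n + 1) / 2"
        by (induction n) (auto simp: field_simps)
      moreover have "(\<Sum>j=1..n. d - (w + q * real j)) = real n * (d - w) - q * (\<Sum>j=1..n. real j)"
        by (simp add: sum_subtractf sum_distrib_left sum.distrib algebra_simps)
      moreover have "d - w = q * y" using q by (simp add: y_def)
      ultimately have "(\<Sum>j=1..n. d - (w + q * real j)) = real n * (q * y) - q * (real n * (real n + 1) / 2)"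
        by (simp only:)
      then show ?thesis by (simp only: right_diff_distrib mult.left_commute)
    qed
    have dw: "d - w = q * y" using q by (simp add: y_def)
    have "((\<lambda>s. 1/2 - (s - w) / q + of_int \<lfloor>(s - w) / q\<rfloor>) has_integral
       ((d - w) * (1/2) - ((d - w)\<^sup>2 / (2 * q) - (w - w)\<^sup>2 / (2 * q)) + (\<Sum>j=1..n. d - (w + q * real j)))) {w..d}"
      by (intro has_integral_add has_integral_diff A B C)
    also have "(d - w) * (1/2) - ((d - w)\<^sup>2 / (2 * q) - (w - w)\<^sup>2 / (2 * q)) + (\<Sum>j=1..n. d - (w + q * real j))
        = q * ((frac y - (frac y)\<^sup>2) / 2)"
      unfolding S n dw using q by (simp add: field_simps power2_eq_square)
    finally show ?thesis unfolding y_def frac_def by (simp add: algebra_simps)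
  qed
  have b: "0 \<le> q * ((frac y - (frac y)\<^sup>2) / 2) \<and> q * ((frac y - (frac y)\<^sup>2) / 2) \<le> q / 8" for y :: real
  proof -
    have "0 \<le> frac y * (1 - frac y)" using frac_lt_1[of y] by (intro mult_nonneg_nonneg) auto
    then have "0 \<le> frac y - (frac y)\<^sup>2" by (simp add: power2_eq_square algebra_simps)
    moreover have "frac y - (frac y)\<^sup>2 \<le> 1/4"
      using zero_le_power2[of "frac y - 1/2"] by (simp add: power2_eq_square algebra_simps)
    ultimately show ?thesis using q mult_left_mono[of "(frac y - (frac y)\<^sup>2) / 2" "1/8" q] by auto
  qed
  have int: "?E integrable_on {w..d}" using base[of d] cd by (auto simp: has_integral_iff)
  then show "?E integrable_on {c..d}" by (rule integrable_subinterval_real) (use cd in auto)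
  have "integral {w..c} ?E + integral {c..d} ?E = integral {w..d} ?E"
    using cd int by (intro Henstock_Kurzweil_Integration.integral_combine) auto
  then have "integral {c..d} ?E = q * ((frac ((d - w) / q) - (frac ((d - w) / q))\<^sup>2) / 2) - q * ((frac ((c - w) / q) - (frac ((c - w) / q))\<^sup>2) / 2)"
    using integral_unique[OF base[of c]] integral_unique[OF base[of d]] cd by linarith
  then show "\<bar>integral {c..d} ?E\<bar> \<le> q / 4"
    using b[of "(d - w) / q"] b[of "(c - w) / q"] q by argo
qed

text \<open>The order of the singularity of \<open>profile_kernel\<close> at X, which is present
  only for a > 1. Being below 1, it lets the errors of all progressions sum without a
  logarithm.\<close>

definition progression_exponent :: "real \<Rightarrow> real" where
  "progression_exponent a = max 0 (1 - 1 / a)"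

context
  fixes a X w :: real
  assumes a: "a > 0" and X: "X \<ge> 1" and w: "0 \<le> w" "w \<le> X"
begin

lemma powr_quotient: "(x / y) powr k = x powr k * y powr (- k)" for x y k :: real
  by (simp add: powr_divide powr_minus_divide)

lemma weighted_progression_integral:
  assumes q: "1 \<le> q" and M: "X \<le> of_int M"
  shows "((\<lambda>s. profile_kernel a X s * (of_int \<lfloor>(s - w) / q\<rfloor> * (of_int \<lfloor>(s - w) / q\<rfloor> + 1) / 2)) has_integral
     weighted_progression M (profile a X) w q) {w..X}"
proof -
  have step: "((\<lambda>s. if w + q * of_int d \<le> s then profile_kernel a X s else 0) has_integral profile a X (w + q * of_int d)) {w..X}"
    if d: "1 \<le> d" for d :: int
  proof (cases "w + q * of_int d \<le> X")
    case True
    have "0 \<le> q * of_int d" using q d by simp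
    then show ?thesis
      using True w profile_kernel_integral[OF a X, of "w + q * of_int d" X] profile_X[OF a X]
      by (intro has_integral_step) auto
  next
    case False
    then have "((\<lambda>s. if w + q * of_int d \<le> s then profile_kernel a X s else 0) has_integral 0) {w..X}"
      by (intro has_integral_is_0) auto
    then show ?thesis using False by (simp add: profile_def)
  qed
  have "((\<lambda>s. \<Sum>d\<in>{1..M}. of_int d * (if w + q * of_int d \<le> s then profile_kernel a X s else 0)) has_integral
     weighted_progression M (profile a X) w q) {w..X}"
    unfolding weighted_progression_def by (intro has_integral_sum has_integral_mult_right step) auto
  then show ?thesis
  proof (rule has_integral_eq[rotated])
    fix s assume s: "s \<in> {w..X}"
    define y where "y = (s - w) / q"
    define m where "m = nat \<lfloor>y\<rfloor>"
    have y0: "0 \<le> y" using s q by (simp add: y_def)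
    have "y \<le> s - w" unfolding y_def using s q by (simp add: divide_le_eq mult_le_cancel_left1)
    then have yM: "\<lfloor>y\<rfloor> \<le> M" using s w M by (simp add: floor_le_iff)
    have m: "int m = \<lfloor>y\<rfloor>" using y0 by (simp add: m_def)
    have iff: "w + q * of_int d \<le> s \<longleftrightarrow> d \<le> int m" for d
    proof -
      have "w + q * of_int d \<le> s \<longleftrightarrow> of_int d \<le> y" using q by (simp add: y_def field_simps)
      then show ?thesis unfolding m by (simp add: le_floor_iff)
    qed
    have "(\<Sum>d\<in>{1..M}. of_int d * (if w + q * of_int d \<le> s then profile_kernel a X s else 0))
       = (\<Sum>d\<in>{1..int m}. of_int d * profile_kernel a X s)"
      unfolding iff using yM m by (intro sum.mono_neutral_cong_right) auto
    also have "\<dots> = profile_kernel a X s * (\<Sum>d\<in>{1..int m}. of_int d)"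
      by (simp add: sum_distrib_left mult.commute)
    also have "(\<Sum>d\<in>{1..int m}. of_int d :: real) = real m * (real m + 1) / 2"
    proof (induction m)
      case (Suc m)
      have "{1..int (Suc m)} = insert (int (Suc m)) {1..int m}" by auto
      then show ?case using Suc by (simp add: field_simps)
    qed simp
    also have "real m = of_int \<lfloor>y\<rfloor>" using m by (metis of_int_of_nat_eq)
    finally show "(\<Sum>d\<in>{1..M}. of_int d * (if w + q * of_int d \<le> s then profile_kernel a X s else 0))
       = profile_kernel a X s * (of_int \<lfloor>(s - w) / q\<rfloor> * (of_int \<lfloor>(s - w) / q\<rfloor> + 1) / 2)"
      unfolding y_def .
  qed
qed

text \<open>For a < 1 the factor s^(a - 1) decreases, but the product is also (1 - w/s) s^a, in
  which both factors increase.\<close>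

lemma shifted_power_mono:
  assumes "w \<le> s" "s \<le> t"
  shows "(s - w) * s powr (a - 1) \<le> (t - w) * t powr (a - 1)"
proof (cases "s = 0")
  case False
  then have s: "0 < s" using assms w by simp
  then have t: "0 < t" using assms by simp
  have e: "(x - w) * x powr (a - 1) = (1 - w / x) * x powr a" if "0 < x" for x
    using that powr_mult_base[of x "a - 1"] by (simp add: field_simps)
  have "(1 - w / s) * s powr a \<le> (1 - w / t) * t powr a"
  proof (rule mult_mono)
    show "1 - w / s \<le> 1 - w / t" using assms s w by (simp add: frac_le)
    show "s powr a \<le> t powr a" using assms s a by (intro powr_mono2) auto
    show "0 \<le> 1 - w / t" using assms t w by simp
  qed simp
  then show ?thesis using e[OF s] e[OF t] by simp
qed (use assms w in simp)

text \<open>Up to X - q: for a \<ge> 1 the exponent 1/a - 1 is nonpositive and the gap at least X^(a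
  - 1) q, for a < 1 the exponent is positive and the gap at most X^a.\<close>

lemma gap_power_bound:
  assumes q: "1 \<le> q" "q \<le> X - w" and s: "w \<le> s" "s \<le> X - q"
  shows "(X powr a - s powr a) powr (1 / a - 1) * X powr a \<le> X * (X / q) powr progression_exponent a"
proof (cases "a \<ge> 1")
  case True
  have k: "progression_exponent a = 1 - 1 / a" using True by (simp add: progression_exponent_def)
  have gap: "X powr (a - 1) * q \<le> X powr a - s powr a"
  proof -
    have "X powr (a - 1) * q \<le> X powr a - (X - q) powr a"
      using powr_gap_ge[OF a X True, of q] q w by simp
    moreover have "s powr a \<le> (X - q) powr a" using s w a by (intro powr_mono2) auto
    ultimately show ?thesis by linarith
  qed
  have "(X powr a - s powr a) powr (1 / a - 1) \<le> (X powr (a - 1) * q) powr (1 / a - 1)"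
    using gap X q True by (intro powr_mono2') auto
  also have "\<dots> = X powr ((a - 1) * (1 / a - 1)) * q powr (1 / a - 1)"
    using X q by (simp add: powr_mult powr_powr)
  finally have "(X powr a - s powr a) powr (1 / a - 1) * X powr a \<le> X powr ((a - 1) * (1 / a - 1)) * q powr (1 / a - 1) * X powr a"
    by (rule mult_right_mono) simp
  also have "\<dots> = X powr ((a - 1) * (1 / a - 1) + a) * q powr (1 / a - 1)"
    by (simp add: powr_add)
  also have "(a - 1) * (1 / a - 1) + a = 1 + (1 - 1 / a)" using a by (simp add: field_simps)
  also have "X powr (1 + (1 - 1 / a)) * q powr (1 / a - 1) = X * (X / q) powr (1 - 1 / a)"
  proof -
    have "X powr (1 + (1 - 1 / a)) = X * X powr (1 - 1 / a)" using X by (simp only: powr_add) simp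
    moreover have "(X / q) powr (1 - 1 / a) = X powr (1 - 1 / a) * q powr (- (1 - 1 / a))"
      by (rule powr_quotient)
    ultimately show ?thesis by simp
  qed
  finally show ?thesis unfolding k .
next
  case False
  then have k: "progression_exponent a = 0" using a by (simp add: progression_exponent_def field_simps)
  have "(X powr a - s powr a) powr (1 / a - 1) \<le> (X powr a) powr (1 / a - 1)"
    using False a powr_gap_nonneg[OF a X, of s] s w q by (intro powr_mono2) (auto simp: field_simps)
  then have "(X powr a - s powr a) powr (1 / a - 1) * X powr a \<le> (X powr a) powr (1 / a - 1) * X powr a"
    by (rule mult_right_mono) simp
  also have "\<dots> = X powr (a * (1 / a - 1) + a)" by (simp add: powr_powr powr_add)
  also have "a * (1 / a - 1) + a = 1" using a by (simp add: field_simps)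
  finally show ?thesis unfolding k using X q by simp
qed

text \<open>The kernel mass over the last step of length q, times the bound X/q for the counting
  error there. The result matches the bound for the rest of the range.\<close>

lemma profile_near_edge:
  assumes q: "1 \<le> q" "q \<le> X" and s: "X - q \<le> s" "0 \<le> s"
  shows "X / q * profile a X s \<le> max 1 a powr (1 / a) * (X * (X / q) powr progression_exponent a)"
proof -
  have "profile a X s \<le> profile a X (X - q)"
    using profile_antimono[OF a X, of "X - q" s] s q by simp
  also have "\<dots> \<le> (max 1 a * X powr (a - 1) * q) powr (1 / a)"
    unfolding profile_def using powr_gap_le[OF a X, of q] powr_gap_nonneg[OF a X, of "X - q"] q a
    by (auto intro!: powr_mono2)
  finally have "X / q * profile a X s \<le> X / q * (max 1 a * X powr (a - 1) * q) powr (1 / a)"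
    using X q by (intro mult_left_mono) auto
  also have "(max 1 a * X powr (a - 1) * q) powr (1 / a) = max 1 a powr (1 / a) * (X powr ((a - 1) * (1 / a)) * q powr (1 / a))"
    using q by (simp add: powr_mult powr_powr mult.assoc)
  also have "X powr ((a - 1) * (1 / a)) * q powr (1 / a) = q * (X / q) powr (1 - 1 / a)"
  proof -
    have "(a - 1) * (1 / a) = 1 - 1 / a" using a by (simp add: field_simps)
    moreover have "q powr (1 / a) = q powr 1 * q powr (- (1 - 1 / a))" using a by (simp only: powr_add[symmetric]) simp
    moreover have "(X / q) powr (1 - 1 / a) = X powr (1 - 1 / a) * q powr (- (1 - 1 / a))"
      by (rule powr_quotient)
    ultimately show ?thesis using q by simp
  qed
  also have "X / q * (max 1 a powr (1 / a) * (q * (X / q) powr (1 - 1 / a))) = max 1 a powr (1 / a) * (X * (X / q) powr (1 - 1 / a))"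
    using q by simp
  also have "\<dots> \<le> max 1 a powr (1 / a) * (X * (X / q) powr progression_exponent a)"
    using q X by (intro mult_left_mono powr_mono) (auto simp: progression_exponent_def)
  finally show ?thesis .
qed

text \<open>The sum of the weights d \<le> y is the triangular number of the floor. It differs from
  y^2 / 2 by y times a sawtooth of mean zero, up to a bounded term.\<close>

lemma triangular_floor_split:
  fixes y :: real
  shows "of_int \<lfloor>y\<rfloor> * (of_int \<lfloor>y\<rfloor> + 1) / 2 - y\<^sup>2 / 2 = y * (1/2 - frac y) + ((frac y)\<^sup>2 - frac y) / 2"
proof -
  have n: "of_int \<lfloor>y\<rfloor> = y - frac y" by (simp add: frac_def)
  show ?thesis unfolding n by (simp add: field_simps power2_eq_square)
qed

lemma frac_quadratic_le: "\<bar>((frac y)\<^sup>2 - frac y) / 2\<bar> \<le> (1/8::real)"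
proof -
  have "0 \<le> frac y * (1 - frac y)" using frac_lt_1[of y] by (intro mult_nonneg_nonneg) auto
  then have "0 \<le> frac y - (frac y)\<^sup>2" by (simp add: power2_eq_square algebra_simps)
  moreover have "frac y - (frac y)\<^sup>2 \<le> 1/4"
    using zero_le_power2[of "frac y - 1/2"] by (simp add: power2_eq_square algebra_simps)
  ultimately show ?thesis by argo
qed

text \<open>The error is the integral of the kernel against D. On the last step before X absolute
  values suffice. Before that, the kernel times y is u1 u2 / q, where each factor is monotone while
  the product need not be. The second mean value theorem is applied first to u2 and the sawtooth,
  then to u1, which gives (1/q) 2 C (2 X^a q/4) = C X^a.\<close>

lemma weighted_progression_error:
  assumes q: "1 \<le> q" "q \<le> X" and M: "X \<le> of_int M"
  shows "\<bar>weighted_progression M (profile a X) w q - integral {w..X} (\<lambda>s. (s - w) * profile a X s) / q\<^sup>2\<bar>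
     \<le> (2 + max 1 a powr (1 / a)) * (X * (X / q) powr progression_exponent a)"
proof -
  define I where "I = integral {w..X} (\<lambda>s. (s - w) * profile a X s)"
  define y where "y s = (s - w) / q" for s
  define D where "D s = of_int \<lfloor>y s\<rfloor> * (of_int \<lfloor>y s\<rfloor> + 1) / 2 - (y s)\<^sup>2 / 2" for s
  let ?K = "profile_kernel a X"
  define B where "B = X * (X / q) powr progression_exponent a"
  have K0: "0 \<le> ?K s" for s by (simp add: profile_kernel_def)
  have XB: "X \<le> B"
  proof -
    have "1 \<le> (X / q) powr progression_exponent a"
      using q by (intro ge_one_powr_ge_zero) (auto simp: progression_exponent_def)
    then show ?thesis using X by (simp add: B_def)
  qed
  have KD: "((\<lambda>s. ?K s * D s) has_integral (weighted_progression M (profile a X) w q - I / q\<^sup>2)) {w..X}"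
  proof -
    have "((\<lambda>s. ?K s * (of_int \<lfloor>y s\<rfloor> * (of_int \<lfloor>y s\<rfloor> + 1) / 2) - (1 / (2 * q\<^sup>2)) * (?K s * (s - w)\<^sup>2)) has_integral
       (weighted_progression M (profile a X) w q - (1 / (2 * q\<^sup>2)) * (2 * I))) {w..X}"
      unfolding y_def I_def
      by (intro has_integral_diff has_integral_mult_right weighted_progression_integral profile_kernel_moment2 a X w q M)
    moreover have "?K s * (of_int \<lfloor>y s\<rfloor> * (of_int \<lfloor>y s\<rfloor> + 1) / 2) - (1 / (2 * q\<^sup>2)) * (?K s * (s - w)\<^sup>2) = ?K s * D s" for s
      by (simp add: D_def y_def power_divide right_diff_distrib)
    moreover have "(1 / (2 * q\<^sup>2)) * (2 * I) = I / q\<^sup>2" by simp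
    ultimately show ?thesis by (simp only:)
  qed
  have intKD: "(\<lambda>s. ?K s * D s) integrable_on {w..X}" using KD by (auto simp: has_integral_iff)
  define m where "m = max w (X - q)"
  have m: "w \<le> m" "m \<le> X" "X - q \<le> m" "0 \<le> m" using w q by (auto simp: m_def)
  have intK: "(?K has_integral (profile a X c - profile a X d)) {c..d}" if "w \<le> c" "c \<le> d" "d \<le> X" for c d
    using that w by (intro profile_kernel_integral a X) auto
  have upper: "\<bar>integral {m..X} (\<lambda>s. ?K s * D s)\<bar> \<le> max 1 a powr (1 / a) * B"
  proof -
    have "norm (integral {m..X} (\<lambda>s. ?K s * D s)) \<le> integral {m..X} (\<lambda>s. X / q * ?K s)"
    proof (rule integral_norm_bound_integral)
      show "(\<lambda>s. ?K s * D s) integrable_on {m..X}"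
        using intKD by (rule integrable_subinterval_real) (use m in auto)
      show "(\<lambda>s. X / q * ?K s) integrable_on {m..X}"
        using intK[of m X] m by (intro integrable_on_mult_right) (auto simp: has_integral_iff)
      fix s assume s: "s \<in> {m..X}"
      have y0: "0 \<le> y s" using s m q by (simp add: y_def)
      have yX: "y s \<le> X / q" using s w q by (simp add: y_def divide_right_mono)
      have f: "0 \<le> frac (y s)" "frac (y s) < 1" by (auto simp: frac_lt_1)
      have "\<bar>1/2 - frac (y s)\<bar> \<le> 1/2" using f by linarith
      then have "\<bar>y s * (1/2 - frac (y s))\<bar> \<le> y s * (1/2)"
        unfolding abs_mult using y0 by (intro mult_mono) auto
      then have "\<bar>D s\<bar> \<le> y s * (1/2) + 1/8"
        unfolding D_def triangular_floor_split using frac_quadratic_le[of "y s"] by linarith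
      also have "\<dots> \<le> X / q"
      proof -
        have "1 \<le> X / q" using q by simp
        then show ?thesis using yX by argo
      qed
      finally have "?K s * \<bar>D s\<bar> \<le> ?K s * (X / q)" using K0 by (intro mult_left_mono)
      then show "norm (?K s * D s) \<le> X / q * ?K s" using K0[of s] by (simp add: abs_mult mult.commute)
    qed
    also have "\<dots> = X / q * profile a X m"
      using intK[of m X] m profile_X[OF a X] by (simp add: integral_unique)
    also have "\<dots> \<le> max 1 a powr (1 / a) * B"
      unfolding B_def using m q by (intro profile_near_edge) auto
    finally show ?thesis by simp
  qed
  have lower: "\<bar>integral {w..m} (\<lambda>s. ?K s * D s)\<bar> \<le> 2 * B"
  proof (cases "w \<le> X - q")
    case False
    then have "m = w" by (simp add: m_def)
    then show ?thesis using XB X by simp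
  next
    case True
    then have mq: "m = X - q" "q \<le> X - w" by (auto simp: m_def)
    define E where "E s = 1/2 - frac (y s)" for s
    define u1 where "u1 s = (X powr a - s powr a) powr (1 / a - 1)" for s
    define u2 where "u2 s = (s - w) * s powr (a - 1)" for s
    define \<rho> where "\<rho> s = ((frac (y s))\<^sup>2 - frac (y s)) / 2" for s
    define C where "C = B / X powr a"
    \<comment> \<open>Stated for all subintervals, because this product takes the place of E when u1
      is the weight.\<close>
    have u2E: "(\<lambda>s. u2 s * E s) integrable_on {c..d}" "\<bar>integral {c..d} (\<lambda>s. u2 s * E s)\<bar> \<le> 2 * X powr a * (q / 4)"
      if cd: "w \<le> c" "c \<le> d" "d \<le> m" for c d
    proof -
      have mono: "mono_on {c..d} u2 \<or> antimono_on {c..d} u2"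
        using shifted_power_mono cd by (auto simp: u2_def mono_on_def)
      have le: "\<bar>u2 s\<bar> \<le> X powr a" if "c \<le> s" "s \<le> d" for s
      proof -
        have s: "w \<le> s" "s \<le> X" "0 \<le> s" using that cd m w by auto
        have "u2 s \<le> s * s powr (a - 1)" unfolding u2_def using w by (intro mult_right_mono) auto
        also have "\<dots> = s powr a" using s a by (cases "s = 0") (auto simp: powr_mult_base)
        also have "\<dots> \<le> X powr a" using s a by (intro powr_mono2) auto
        finally show ?thesis using s by (simp add: u2_def)
      qed
      have E: "E integrable_on {c..d}" "\<And>c' d'. c \<le> c' \<Longrightarrow> c' \<le> d' \<Longrightarrow> d' \<le> d \<Longrightarrow> \<bar>integral {c'..d'} E\<bar> \<le> q / 4"
        unfolding E_def[abs_def] y_def using q cd by (intro sawtooth_integral_le; simp)+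
      show "(\<lambda>s. u2 s * E s) integrable_on {c..d}" "\<bar>integral {c..d} (\<lambda>s. u2 s * E s)\<bar> \<le> 2 * X powr a * (q / 4)"
        using second_mean_value_bound[OF cd(2) E mono le] by auto
    qed
    have u1: "mono_on {w..m} u1 \<or> antimono_on {w..m} u1"
    proof (cases "a \<ge> 1")
      case True
      have "mono_on {w..m} u1"
      proof (rule mono_onI)
        fix s t assume st: "s \<in> {w..m}" "t \<in> {w..m}" "s \<le> t"
        have "t powr a < X powr a" using st mq q w a by (intro powr_less_mono2) auto
        moreover have "s powr a \<le> t powr a" using st w a by (intro powr_mono2) auto
        ultimately show "u1 s \<le> u1 t" unfolding u1_def using True by (intro powr_mono2') auto
      qed
      then show ?thesis by blast
    next
      case False
      have "antimono_on {w..m} u1"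
      proof (rule monotone_onI)
        fix s t assume st: "s \<in> {w..m}" "t \<in> {w..m}" "s \<le> t"
        have "t powr a \<le> X powr a" using st m w a by (intro powr_mono2) auto
        moreover have "s powr a \<le> t powr a" using st w a by (intro powr_mono2) auto
        ultimately show "u1 t \<le> u1 s" unfolding u1_def using False a by (intro powr_mono2) (auto simp: field_simps)
      qed
      then show ?thesis by blast
    qed
    have u1C: "\<bar>u1 s\<bar> \<le> C" if "w \<le> s" "s \<le> m" for s
    proof -
      have "u1 s * X powr a \<le> B"
        unfolding u1_def B_def using that mq q by (intro gap_power_bound) auto
      then show ?thesis using X by (simp add: C_def pos_le_divide_eq u1_def)
    qed
    have main: "(\<lambda>s. u1 s * (u2 s * E s)) integrable_on {w..m}"
      "\<bar>integral {w..m} (\<lambda>s. u1 s * (u2 s * E s))\<bar> \<le> 2 * C * (2 * X powr a * (q / 4))"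
      using second_mean_value_bound[OF m(1) u2E(1)[OF order.refl m(1) order.refl] u2E(2) u1 u1C] by auto
    have D: "?K s * D s = (1 / q) * (u1 s * (u2 s * E s)) + ?K s * \<rho> s" for s
      unfolding D_def triangular_floor_split \<rho>_def profile_kernel_def u1_def u2_def E_def y_def
      using q by (simp add: field_simps)
    have intKDm: "(\<lambda>s. ?K s * D s) integrable_on {w..m}"
      using intKD by (rule integrable_subinterval_real) (use m in auto)
    have intu: "(\<lambda>s. (1 / q) * (u1 s * (u2 s * E s))) integrable_on {w..m}"
      using main(1) by (rule integrable_on_mult_right)
    have "(\<lambda>s. ?K s * D s - (1 / q) * (u1 s * (u2 s * E s))) integrable_on {w..m}"
      using intKDm intu by (rule integrable_diff)
    then have int\<rho>: "(\<lambda>s. ?K s * \<rho> s) integrable_on {w..m}" unfolding D by simp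
    \<comment> \<open>The bounded part of D costs at most 1/8 of the kernel mass, and that mass is
      at most X.\<close>
    have rho: "\<bar>integral {w..m} (\<lambda>s. ?K s * \<rho> s)\<bar> \<le> X / 8"
    proof -
      have "norm (integral {w..m} (\<lambda>s. ?K s * \<rho> s)) \<le> integral {w..m} (\<lambda>s. 1/8 * ?K s)"
      proof (rule integral_norm_bound_integral[OF int\<rho>])
        show "(\<lambda>s. 1/8 * ?K s) integrable_on {w..m}"
          using intK[of w m] m by (intro integrable_on_mult_right) (auto simp: has_integral_iff)
        fix s
        have "?K s * \<bar>\<rho> s\<bar> \<le> ?K s * (1/8)"
          unfolding \<rho>_def using K0 frac_quadratic_le by (intro mult_left_mono)
        then show "norm (?K s * \<rho> s) \<le> 1/8 * ?K s" using K0[of s] by (simp add: abs_mult)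
      qed
      also have "\<dots> = 1/8 * (profile a X w - profile a X m)"
        using intK[of w m] m by (simp add: integral_unique)
      also have "\<dots> \<le> 1/8 * X"
        using profile_le[OF a X, of w] profile_nonneg[OF a X, of m] by simp
      finally show ?thesis by simp
    qed
    have "integral {w..m} (\<lambda>s. ?K s * D s) = integral {w..m} (\<lambda>s. (1 / q) * (u1 s * (u2 s * E s))) + integral {w..m} (\<lambda>s. ?K s * \<rho> s)"
      unfolding D by (rule Henstock_Kurzweil_Integration.integral_add[OF intu int\<rho>])
    also have "integral {w..m} (\<lambda>s. (1 / q) * (u1 s * (u2 s * E s))) = (1 / q) * integral {w..m} (\<lambda>s. u1 s * (u2 s * E s))"
      by (rule integral_mult_right)
    finally have "\<bar>integral {w..m} (\<lambda>s. ?K s * D s)\<bar> \<le> \<bar>(1 / q) * integral {w..m} (\<lambda>s. u1 s * (u2 s * E s))\<bar> + X / 8"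
      using rho by linarith
    also have "\<bar>(1 / q) * integral {w..m} (\<lambda>s. u1 s * (u2 s * E s))\<bar> \<le> (1 / q) * (2 * C * (2 * X powr a * (q / 4)))"
      unfolding abs_mult using main(2) q by (intro mult_mono) auto
    also have "(1 / q) * (2 * C * (2 * X powr a * (q / 4))) = C * X powr a" using q by simp
    also have "C * X powr a = B" using X by (simp add: C_def)
    finally show ?thesis using XB X by linarith
  qed
  have "integral {w..m} (\<lambda>s. ?K s * D s) + integral {m..X} (\<lambda>s. ?K s * D s) = weighted_progression M (profile a X) w q - I / q\<^sup>2"
    using Henstock_Kurzweil_Integration.integral_combine[OF m(1,2) intKD] KD by (simp add: integral_unique)
  then have "\<bar>weighted_progression M (profile a X) w q - I / q\<^sup>2\<bar> \<le> 2 * B + max 1 a powr (1 / a) * B"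
    using upper lower by linarith
  then show ?thesis unfolding I_def B_def by (simp add: algebra_simps)
qed

end

section \<open>Sums over the steps of the progressions\<close>

lemma sum_inverse_power_le:
  fixes \<kappa> :: real
  assumes \<kappa>: "0 \<le> \<kappa>" "\<kappa> < 1"
  shows "(\<Sum>e\<in>{1..int m}. of_int e powr (- \<kappa>)) \<le> real m powr (1 - \<kappa>) / (1 - \<kappa>)"
proof (induction m)
  case (Suc m)
  have "{1..int (Suc m)} = insert (int (Suc m)) {1..int m}" by auto
  then have S: "(\<Sum>e\<in>{1..int (Suc m)}. of_int e powr (- \<kappa>)) = (\<Sum>e\<in>{1..int m}. of_int e powr (- \<kappa>)) + real (Suc m) powr (- \<kappa>)"
    by simp
  have "real (Suc m) powr (- \<kappa>) * (1 - \<kappa>) \<le> real (Suc m) powr (1 - \<kappa>) - real m powr (1 - \<kappa>)"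
  proof (cases "m = 0")
    case True
    then show ?thesis using \<kappa> by simp
  next
    case False
    have "\<exists>z>real m. z < real (Suc m) \<and> real (Suc m) powr (1 - \<kappa>) - real m powr (1 - \<kappa>) = (real (Suc m) - real m) * ((1 - \<kappa>) * z powr ((1 - \<kappa>) - 1))"
    proof (rule MVT2)
      fix x assume "real m \<le> x"
      then have "0 < x" using False by linarith
      then show "((\<lambda>x. x powr (1 - \<kappa>)) has_real_derivative (1 - \<kappa>) * x powr ((1 - \<kappa>) - 1)) (at x)"
        by (auto intro!: derivative_eq_intros)
    qed simp
    then obtain z where z: "real m < z" "z < real (Suc m)"
      "real (Suc m) powr (1 - \<kappa>) - real m powr (1 - \<kappa>) = (1 - \<kappa>) * z powr (- \<kappa>)"
      by auto
    have "real (Suc m) powr (- \<kappa>) \<le> z powr (- \<kappa>)"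
      using z \<kappa> False by (intro powr_mono2') auto
    then show ?thesis unfolding z(3) using \<kappa> by (simp add: mult.commute mult_left_mono)
  qed
  then have "real (Suc m) powr (- \<kappa>) \<le> (real (Suc m) powr (1 - \<kappa>) - real m powr (1 - \<kappa>)) / (1 - \<kappa>)"
    using \<kappa> by (simp add: pos_le_divide_eq)
  then show ?case unfolding S using Suc by (simp add: diff_divide_distrib)
qed simp

lemma inverse_squares_tail:
  assumes "m > 0"
  shows "\<bar>(\<Sum>e\<in>{1..int m}. 1 / (of_int e)\<^sup>2) - pi\<^sup>2 / 6\<bar> \<le> 1 / real m"
proof -
  have sums: "(\<lambda>k. 1 / (real k + 1)\<^sup>2) sums (pi\<^sup>2 / 6)" by (rule inverse_squares_sums')
  have eq: "(\<Sum>e\<in>{1..int m}. 1 / (of_int e)\<^sup>2) = (\<Sum>k<m. 1 / (real k + 1)\<^sup>2)"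
  proof (induction m)
    case (Suc m)
    have "{1..int (Suc m)} = insert (int (Suc m)) {1..int m}" by auto
    then show ?case using Suc by (simp add: add.commute)
  qed simp
  have tail: "(\<lambda>k. 1 / (real (k + m) + 1)\<^sup>2) sums (pi\<^sup>2 / 6 - (\<Sum>k<m. 1 / (real k + 1)\<^sup>2))"
    using sums_split_initial_segment[OF sums, of m] by simp
  have "(\<lambda>k. 1 / (real k + real m)) \<longlonglongrightarrow> 0" by real_asymp
  then have tel: "(\<lambda>k. 1 / (real k + real m) - 1 / (real (Suc k) + real m)) sums (1 / (real 0 + real m) - 0)"
    by (rule telescope_sums')
  have "pi\<^sup>2 / 6 - (\<Sum>k<m. 1 / (real k + 1)\<^sup>2) \<le> 1 / (real 0 + real m) - 0"
  proof (rule sums_le[OF _ tail tel])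
    fix k
    have p: "0 < real k + real m" using assms by simp
    have "1 / (real (k + m) + 1)\<^sup>2 \<le> 1 / ((real k + real m) * (real k + real m + 1))"
      using p by (intro divide_left_mono) (auto simp: power2_eq_square intro!: mult_right_mono mult_pos_pos)
    also have "\<dots> = 1 / (real k + real m) - 1 / (real (Suc k) + real m)"
      using p by (simp add: field_simps)
    finally show "1 / (real (k + m) + 1)\<^sup>2 \<le> 1 / (real k + real m) - 1 / (real (Suc k) + real m)" .
  qed
  moreover have "0 \<le> pi\<^sup>2 / 6 - (\<Sum>k<m. 1 / (real k + 1)\<^sup>2)"
    by (rule sums_le[OF _ sums_zero tail]) simp
  ultimately show ?thesis unfolding eq by simp
qed

section \<open>Tail integrals of the profile and the four-dimensional comparison\<close>

definition profile_tail :: "real \<Rightarrow> real \<Rightarrow> real \<Rightarrow> real" where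
  "profile_tail a X c = integral {c..X} (profile a X)"

context
  fixes a X :: real
  assumes a: "a > 0" and X: "X \<ge> 1"
begin

lemma continuous_on_profile_sub: "0 \<le> c \<Longrightarrow> continuous_on {c..X} (profile a X)"
  by (rule continuous_on_subset[OF continuous_on_profile[OF a X]]) auto

lemma profile_tail_diff:
  assumes "0 \<le> c" "c \<le> d" "d \<le> X"
  shows "profile_tail a X c - profile_tail a X d = integral {c..d} (profile a X)"
  unfolding profile_tail_def
  using Henstock_Kurzweil_Integration.integral_combine[OF assms(2,3) integrable_continuous_real[OF continuous_on_profile_sub[OF assms(1)]]]
  by simp

lemma integral_profile_bounds:
  assumes "0 \<le> c" "c \<le> d" "d \<le> X"
  shows "0 \<le> integral {c..d} (profile a X)" "integral {c..d} (profile a X) \<le> X * (d - c)"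
proof -
  have int: "profile a X integrable_on {c..d}"
    using integrable_continuous_real[OF continuous_on_subset[OF continuous_on_profile_sub[OF assms(1)]], of c d] assms by auto
  show "0 \<le> integral {c..d} (profile a X)"
    by (rule integral_nonneg[OF int]) (simp add: profile_nonneg[OF a X])
  have "integral {c..d} (profile a X) \<le> integral {c..d} (\<lambda>_. X)"
    using profile_le[OF a X] by (intro integral_le int) auto
  then show "integral {c..d} (profile a X) \<le> X * (d - c)" using assms by (simp add: mult.commute)
qed

lemma profile_tail_has_derivative:
  assumes "0 < c" "c < X"
  shows "(profile_tail a X has_real_derivative - profile a X c) (at c)"
proof -
  have "((\<lambda>u. integral {0..u} (profile a X)) has_real_derivative profile a X c) (at c within {0..X})"
    using assms continuous_on_profile[OF a X] by (intro integral_has_real_derivative) auto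
  then have "((\<lambda>u. integral {0..u} (profile a X)) has_real_derivative profile a X c) (at c)"
    using assms at_within_Icc_at[of 0 c X] by simp
  then have "((\<lambda>u. profile_tail a X 0 - integral {0..u} (profile a X)) has_real_derivative - profile a X c) (at c)"
    by (auto intro!: derivative_eq_intros)
  then show ?thesis
  proof (rule has_field_derivative_transform_within_open[where S = "{0<..<X}"])
    fix u assume "u \<in> {0<..<X}"
    then show "profile_tail a X 0 - integral {0..u} (profile a X) = profile_tail a X u"
      using profile_tail_diff[of 0 u] by simp
  qed (use assms in auto)
qed

lemma continuous_on_profile_tail: "continuous_on {0..X} (profile_tail a X)"
proof -
  have "continuous_on {0..X} (\<lambda>u. profile_tail a X 0 - integral {0..u} (profile a X))"
    by (intro continuous_intros indefinite_integral_continuous_1 integrable_continuous_real continuous_on_profile a X)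
  then show ?thesis
    by (rule continuous_on_eq) (auto simp: profile_tail_diff[of 0, symmetric])
qed

text \<open>Cauchy's formula for repeated integration.\<close>

lemma profile_tail_integral:
  assumes w: "0 \<le> w" "w \<le> X"
  shows "(profile_tail a X has_integral integral {w..X} (\<lambda>s. (s - w) * profile a X s)) {w..X}"
proof -
  have c1: "continuous_on {w..X} (profile_tail a X)"
    using continuous_on_profile_tail by (rule continuous_on_subset) (use w in auto)
  have c2: "continuous_on {w..X} (profile a X)" using w by (intro continuous_on_profile_sub)
  have "((\<lambda>s. profile_tail a X s - (s - w) * profile a X s) has_integral
     (X - w) * profile_tail a X X - (w - w) * profile_tail a X w) {w..X}"
  proof (rule fundamental_theorem_of_calculus_interior)
    show "continuous_on {w..X} (\<lambda>s. (s - w) * profile_tail a X s)"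
      using c1 by (intro continuous_intros)
    fix s assume s: "s \<in> {w<..<X}"
    have "((\<lambda>s. (s - w) * profile_tail a X s) has_real_derivative profile_tail a X s - (s - w) * profile a X s) (at s)"
      using profile_tail_has_derivative[of s] s w by (auto intro!: derivative_eq_intros)
    then show "((\<lambda>s. (s - w) * profile_tail a X s) has_vector_derivative profile_tail a X s - (s - w) * profile a X s) (at s)"
      by (simp add: has_real_derivative_iff_has_vector_derivative)
  qed (use w in auto)
  then have z: "((\<lambda>s. profile_tail a X s - (s - w) * profile a X s) has_integral 0) {w..X}"
    by (simp add: profile_tail_def)
  have "((\<lambda>s. (s - w) * profile a X s) has_integral integral {w..X} (\<lambda>s. (s - w) * profile a X s)) {w..X}"
    using c2 by (intro integrable_integral integrable_continuous_real continuous_intros)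
  from has_integral_add[OF z this] show ?thesis by simp
qed

context
  fixes N :: nat
  assumes N: "X \<le> (real N)\<^sup>2"
begin

lemma radial_class_profile: "radial_class N (profile a X)"
  using bdd_borel_profile[OF a X] profile_nonneg N by (auto simp: radial_class_def profile_def)

lemma integral_op_above:
  assumes f: "\<And>v. X < v \<Longrightarrow> f v = 0" and c: "X < c"
  shows "integral_op N f c = 0" "lattice_op N f c = 0"
proof -
  have "f (c + x\<^sup>2) = 0" for x
    using f[of "c + x\<^sup>2"] c zero_le_power2[of x] by linarith
  then show "integral_op N f c = 0" "lattice_op N f c = 0"
    by (simp_all add: integral_op_def lattice_op_def)
qed

lemma integral_op_profile_twice:
  assumes "0 \<le> c" "c \<le> X"
  shows "integral_op N (integral_op N (profile a X)) c = pi * profile_tail a X c"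
proof (rule integral_op_twice_has_integral[OF radial_class_profile assms])
  show "(profile a X has_integral profile_tail a X c) {c..X}"
    unfolding profile_tail_def using assms
    by (intro integrable_integral integrable_continuous_real continuous_on_profile_sub)
qed (simp add: profile_def)

lemma integral_op_profile_four:
  assumes w: "0 \<le> w" "w \<le> X"
  shows "(integral_op N ^^ 4) (profile a X) w = pi\<^sup>2 * integral {w..X} (\<lambda>s. (s - w) * profile a X s)"
proof -
  define F where "F = integral_op N (integral_op N (profile a X))"
  have "((\<lambda>s. pi * profile_tail a X s) has_integral pi * integral {w..X} (\<lambda>s. (s - w) * profile a X s)) {w..X}"
    by (intro has_integral_mult_right profile_tail_integral w)
  then have int: "(F has_integral pi * integral {w..X} (\<lambda>s. (s - w) * profile a X s)) {w..X}"
    by (rule has_integral_eq[rotated]) (use integral_op_profile_twice w in \<open>auto simp: F_def\<close>)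
  have supp: "F v = 0" if "X < v" for v
    unfolding F_def using that by (intro integral_op_above) (auto simp: profile_def intro!: integral_op_above)
  have "radial_class N F" unfolding F_def by (intro radial_class_integral_op radial_class_profile)
  then have "integral_op N (integral_op N F) w = pi * (pi * integral {w..X} (\<lambda>s. (s - w) * profile a X s))"
    using w supp int by (rule integral_op_twice_has_integral)
  then show ?thesis by (simp add: eval_nat_numeral F_def)
qed

text \<open>A progression of step q has main term I / q^2, so the steps e and 4 e together leave
  (3/4) I / e^2. With the factor 8 this sums to 6 I times the sum of inverse squares, that is to
  \<pi>^2 I, the integral over four coordinates. The errors X (X/e)^\<kappa> sum to O(X^2) over e
  \<le> 16 X.\<close>

lemma lattice_minus_integral_op_four:
  assumes N': "(real N)\<^sup>2 \<le> 16 * X" and w: "0 \<le> w"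
  shows "\<bar>(lattice_op N ^^ 4) (profile a X) w - (integral_op N ^^ 4) (profile a X) w\<bar>
     \<le> (7 + 40 * (16 * (2 + max 1 a powr (1 / a)) * (16 / (1 - progression_exponent a)))) * X\<^sup>2"
proof (cases "w \<le> X")
  case False
  have z: "(lattice_op N ^^ 4) (profile a X) w = 0 \<and> (integral_op N ^^ 4) (profile a X) w = 0"
  proof -
    have "(lattice_op N ^^ k) (profile a X) c = 0 \<and> (integral_op N ^^ k) (profile a X) c = 0" if "X < c" for k c
      using that
    proof (induction k arbitrary: c)
      case 0
      then show ?case by (simp add: profile_def)
    next
      case (Suc k)
      then show ?case by (auto intro!: integral_op_above)
    qed
    then show ?thesis using False by simp
  qed
  have "progression_exponent a < 1" using a by (simp add: progression_exponent_def)
  then show ?thesis using z by simp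
next
  case True
  note w = w True
  define \<kappa> where "\<kappa> = progression_exponent a"
  have \<kappa>: "0 \<le> \<kappa>" "\<kappa> < 1" using a by (auto simp: \<kappa>_def progression_exponent_def)
  define C where "C = 2 + max 1 a powr (1 / a)"
  have C: "2 \<le> C" by (simp add: C_def)
  define I where "I = integral {w..X} (\<lambda>s. (s - w) * profile a X s)"
  define M where "M = int N ^ 2"
  define m where "m = N\<^sup>2"
  have Mm: "M = int m" by (simp add: M_def m_def)
  have XM: "X \<le> real m" "real m \<le> 16 * X" using N N' by (auto simp: m_def)
  have m0: "m > 0" using XM X by (cases m) auto
  let ?\<Phi> = "weighted_progression M (profile a X) w"
  have I: "0 \<le> I" "I \<le> X ^ 3"
  proof -
    have c2: "continuous_on {w..X} (profile a X)" using w by (intro continuous_on_profile_sub)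
    have int: "(\<lambda>s. (s - w) * profile a X s) integrable_on {w..X}"
      using c2 by (intro integrable_continuous_real continuous_intros)
    show "0 \<le> I" unfolding I_def using profile_nonneg[OF a X] by (intro integral_nonneg int) auto
    have "I \<le> integral {w..X} (\<lambda>_. X * X)"
      unfolding I_def using profile_nonneg[OF a X] profile_le[OF a X] w X
      by (intro integral_le int mult_mono) auto
    also have "\<dots> = (X - w) * (X * X)" using w by simp
    also have "\<dots> \<le> X * (X * X)" using w X by (intro mult_right_mono) auto
    finally show "I \<le> X ^ 3" by (simp add: power3_eq_cube)
  qed
  \<comment> \<open>The bound is expressed through e for both q = e and q = 4 e, so that the two
    errors can be summed together. If q > X the progression is empty and I / q^2 \<le> X; then e
    \<le> 16 X gives (X/e)^\<kappa> \<ge> 1/16, whence the factor 16.\<close>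
  have err: "\<bar>?\<Phi> q - I / q\<^sup>2\<bar> \<le> 16 * C * (X * (X / e) powr \<kappa>)" if q: "1 \<le> e" "e \<le> q" "e \<le> 16 * X" "1 \<le> q" for q e :: real
  proof (cases "q \<le> X")
    case True
    have "\<bar>?\<Phi> q - I / q\<^sup>2\<bar> \<le> C * (X * (X / q) powr \<kappa>)"
      unfolding I_def C_def \<kappa>_def using True q XM
      by (intro weighted_progression_error a X w) (auto simp: Mm)
    also have "\<dots> \<le> 16 * C * (X * (X / e) powr \<kappa>)"
      using q X \<kappa> C by (intro mult_mono powr_mono2 divide_left_mono) auto
    finally show ?thesis .
  next
    case False
    have "?\<Phi> q = 0"
      unfolding weighted_progression_def
    proof (intro sum.neutral ballI)
      fix d assume "d \<in> {1..M}"
      then have "q * 1 \<le> q * of_int d" using q by (intro mult_left_mono) auto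
      then have "X < w + q * of_int d" using False w by linarith
      then show "of_int d * profile a X (w + q * of_int d) = 0" by (simp add: profile_def)
    qed
    moreover have "\<bar>I / q\<^sup>2\<bar> \<le> X"
    proof -
      have "\<bar>I / q\<^sup>2\<bar> = I / q\<^sup>2" using I by simp
      also have "\<dots> \<le> X ^ 3 / X\<^sup>2"
        using I False X by (intro frac_le power_mono) auto
      finally show ?thesis using X by (simp add: power2_eq_square power3_eq_cube)
    qed
    moreover have "X \<le> 16 * C * (X * (X / e) powr \<kappa>)"
    proof -
      have "1 / 16 \<le> (1 / 16) powr \<kappa>" using \<kappa> powr_mono'[of \<kappa> 1 "1 / 16"] by simp
      also have "\<dots> \<le> (X / e) powr \<kappa>"
        using q X \<kappa> by (intro powr_mono2) (auto simp: field_simps)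
      finally have "1 \<le> 16 * (X / e) powr \<kappa>" by simp
      moreover have "16 * (X / e) powr \<kappa> * 1 \<le> 16 * (X / e) powr \<kappa> * C"
        using C by (intro mult_left_mono) auto
      ultimately have "X * 1 \<le> X * (16 * (X / e) powr \<kappa> * C)" using X by (intro mult_left_mono) auto
      then show ?thesis by (simp only: mult_ac mult_1_right)
    qed
    ultimately show ?thesis by simp
  qed
  define S where "S = (\<Sum>e\<in>{1..M}. 1 / (of_int e :: real)\<^sup>2)"
  define \<Delta> where "\<Delta> e = (?\<Phi> (of_int e) - I / (of_int e)\<^sup>2) - 4 * (?\<Phi> (4 * of_int e) - I / (4 * of_int e)\<^sup>2)" for e :: int
  have sumerr: "\<bar>\<Sum>e\<in>{1..M}. \<Delta> e\<bar> \<le> 5 * (16 * C * (16 / (1 - \<kappa>)) * X\<^sup>2)"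
  proof -
    have "\<bar>\<Sum>e\<in>{1..M}. \<Delta> e\<bar> \<le> (\<Sum>e\<in>{1..M}. 5 * (16 * C * (X * (X / of_int e) powr \<kappa>)))"
    proof (rule order.trans[OF sum_abs sum_mono])
      fix e assume "e \<in> {1..M}"
      then have e: "1 \<le> real_of_int e" "real_of_int e \<le> 16 * X" using XM by (auto simp: Mm)
      show "\<bar>\<Delta> e\<bar> \<le> 5 * (16 * C * (X * (X / of_int e) powr \<kappa>))"
        proof -
        have "\<bar>?\<Phi> (of_int e) - I / (of_int e)\<^sup>2\<bar> \<le> 16 * C * (X * (X / of_int e) powr \<kappa>)"
          using e by (intro err) auto
        moreover have "\<bar>?\<Phi> (4 * of_int e) - I / (4 * of_int e)\<^sup>2\<bar> \<le> 16 * C * (X * (X / of_int e) powr \<kappa>)"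
          using e by (intro err) auto
        moreover have "\<bar>p - 4 * q\<bar> \<le> 5 * r" if "\<bar>p\<bar> \<le> r" "\<bar>q\<bar> \<le> r" for p q r :: real
          using that by linarith
        ultimately show ?thesis unfolding \<Delta>_def by blast
      qed
    qed
    also have "\<dots> = 5 * (16 * C * (X powr (1 + \<kappa>) * (\<Sum>e\<in>{1..int m}. of_int e powr (- \<kappa>))))"
      unfolding sum_distrib_left Mm
    proof (rule sum.cong)
      fix e assume "e \<in> {1..int m}"
      have "(X / of_int e) powr \<kappa> = X powr \<kappa> * of_int e powr (- \<kappa>)"
        by (simp add: powr_divide powr_minus_divide)
      then show "5 * (16 * C * (X * (X / of_int e) powr \<kappa>)) = 5 * (16 * C * (X powr (1 + \<kappa>) * of_int e powr (- \<kappa>)))"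
        using X by (simp add: powr_add)
    qed simp
    also have "(\<Sum>e\<in>{1..int m}. real_of_int e powr (- \<kappa>)) \<le> real m powr (1 - \<kappa>) / (1 - \<kappa>)"
      by (rule sum_inverse_power_le[OF \<kappa>])
    also have "\<dots> \<le> (16 * X) powr (1 - \<kappa>) / (1 - \<kappa>)"
      using XM \<kappa> by (intro divide_right_mono powr_mono2) auto
    also have "\<dots> \<le> 16 * X powr (1 - \<kappa>) / (1 - \<kappa>)"
    proof (intro divide_right_mono)
      have "(16::real) powr (1 - \<kappa>) \<le> 16 powr 1" using \<kappa> by (intro powr_mono) auto
      then show "(16 * X) powr (1 - \<kappa>) \<le> 16 * X powr (1 - \<kappa>)"
        by (simp add: powr_mult mult_right_mono)
    qed (use \<kappa> in simp)
    also have "5 * (16 * C * (X powr (1 + \<kappa>) * (16 * X powr (1 - \<kappa>) / (1 - \<kappa>))))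
        = 5 * (16 * C * (16 / (1 - \<kappa>)) * X\<^sup>2)"
    proof -
      have "X powr (1 + \<kappa>) * X powr (1 - \<kappa>) = X\<^sup>2"
        using X by (simp add: powr_add[symmetric] powr_numeral)
      then show ?thesis by (simp add: algebra_simps)
    qed
    finally show ?thesis using C X by (simp add: mult_left_mono)
  qed
  \<comment> \<open>Truncating the sum of inverse squares at m \<ge> X costs at most 1/X, and 6 I
    \<le> 6 X^3.\<close>
  have main: "\<bar>6 * I * S - pi\<^sup>2 * I\<bar> \<le> 6 * X\<^sup>2"
  proof -
    have "\<bar>S - pi\<^sup>2 / 6\<bar> \<le> 1 / real m"
      unfolding S_def Mm by (rule inverse_squares_tail[OF m0])
    also have "\<dots> \<le> 1 / X" using XM X by (intro divide_left_mono) auto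
    finally have "6 * I * \<bar>S - pi\<^sup>2 / 6\<bar> \<le> 6 * X ^ 3 * (1 / X)"
      using I X by (intro mult_mono) auto
    moreover have "6 * I * \<bar>S - pi\<^sup>2 / 6\<bar> = \<bar>6 * I * S - pi\<^sup>2 * I\<bar>"
    proof -
      have "6 * I * S - pi\<^sup>2 * I = 6 * I * (S - pi\<^sup>2 / 6)" by (simp add: algebra_simps)
      then show ?thesis using I by (simp only: abs_mult abs_of_nonneg)
    qed
    ultimately show ?thesis using X by (simp add: power2_eq_square power3_eq_cube)
  qed
  have "(\<Sum>e\<in>{1..M}. ?\<Phi> (of_int e) - 4 * ?\<Phi> (4 * of_int e)) = (\<Sum>e\<in>{1..M}. \<Delta> e + 3/4 * I * (1 / (of_int e)\<^sup>2))"
    by (intro sum.cong refl) (auto simp: \<Delta>_def field_simps power_mult_distrib)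
  also have "\<dots> = (\<Sum>e\<in>{1..M}. \<Delta> e) + 3/4 * I * S"
    by (simp only: sum.distrib S_def sum_distrib_left)
  finally have "(lattice_op N ^^ 4) (profile a X) w - (integral_op N ^^ 4) (profile a X) w
      = profile a X w + 8 * (\<Sum>e\<in>{1..M}. \<Delta> e) + (6 * I * S - pi\<^sup>2 * I)"
    unfolding integral_op_profile_four[OF w] I_def[symmetric]
    using lattice_op_four[of N "profile a X" w] N w by (simp add: profile_def M_def)
  moreover have "\<bar>profile a X w\<bar> \<le> X\<^sup>2"
  proof -
    have "X * 1 \<le> X * X" using X by (intro mult_left_mono) auto
    then show ?thesis using profile_le[OF a X, of w] profile_nonneg[OF a X, of w] by (simp add: power2_eq_square)
  qed
  ultimately have "\<bar>(lattice_op N ^^ 4) (profile a X) w - (integral_op N ^^ 4) (profile a X) w\<bar>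
      \<le> X\<^sup>2 + 8 * (5 * (16 * C * (16 / (1 - \<kappa>)) * X\<^sup>2)) + 6 * X\<^sup>2"
    using sumerr main by linarith
  then show ?thesis unfolding C_def \<kappa>_def by (simp add: algebra_simps)
qed

end

end

section \<open>Profiles in higher dimensions\<close>

lemma bdd_borel_funpow:
  assumes "bdd_borel f"
  shows "bdd_borel ((integral_op N ^^ k) f)" "bdd_borel ((lattice_op N ^^ k) f)"
  using assms by (induction k) auto

lemma integral_op_funpow_le:
  assumes "bdd_borel f" "\<And>c. 0 \<le> c \<Longrightarrow> \<bar>f c\<bar> \<le> B" "0 \<le> c"
  shows "\<bar>(integral_op N ^^ k) f c\<bar> \<le> (2 * real N + 1) ^ k * B"
  using assms(3)
proof (induction k arbitrary: c)
  case (Suc k)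
  have "\<bar>integral_op N ((integral_op N ^^ k) f) c\<bar> \<le> (2 * real N + 1) * ((2 * real N + 1) ^ k * B)"
    using Suc by (intro integral_op_abs_le bdd_borel_funpow assms) auto
  then show ?case by (simp add: mult.assoc)
qed (use assms in simp)

lemma lattice_op_abs_le:
  assumes "\<And>c. 0 \<le> c \<Longrightarrow> \<bar>f c\<bar> \<le> B" "0 \<le> c"
  shows "\<bar>lattice_op N f c\<bar> \<le> (2 * real N + 1) * B"
proof -
  have "\<bar>lattice_op N f c\<bar> \<le> (\<Sum>n\<in>{-int N..int N}. B)"
    unfolding lattice_op_def using assms by (intro order.trans[OF sum_abs sum_mono]) auto
  then show ?thesis by simp
qed

lemma lattice_op_funpow_le:
  assumes "\<And>c. 0 \<le> c \<Longrightarrow> \<bar>f c\<bar> \<le> B" "0 \<le> c"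
  shows "\<bar>(lattice_op N ^^ k) f c\<bar> \<le> (2 * real N + 1) ^ k * B"
  using assms(2)
proof (induction k arbitrary: c)
  case (Suc k)
  have "\<bar>lattice_op N ((lattice_op N ^^ k) f) c\<bar> \<le> (2 * real N + 1) * ((2 * real N + 1) ^ k * B)"
    using Suc by (intro lattice_op_abs_le) auto
  then show ?case by (simp add: mult.assoc)
qed (use assms in simp)

lemma lattice_op_funpow_diff:
  "(lattice_op N ^^ k) (\<lambda>x. f x - g x) = (\<lambda>c. (lattice_op N ^^ k) f c - (lattice_op N ^^ k) g c)"
proof (induction k)
  case (Suc k)
  show ?case unfolding funpow.simps o_def Suc by (intro ext lattice_op_diff)
qed simp

lemma integral_op_funpow_diff:
  assumes "bdd_borel f" "bdd_borel g"
  shows "(integral_op N ^^ k) (\<lambda>x. f x - g x) = (\<lambda>c. (integral_op N ^^ k) f c - (integral_op N ^^ k) g c)"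
proof (induction k)
  case (Suc k)
  show ?case unfolding funpow.simps o_def Suc
    by (intro ext integral_op_diff bdd_borel_funpow assms)
qed simp

lemma lattice_integral_op_funpow_commute:
  assumes "bdd_borel f"
  shows "lattice_op N ((integral_op N ^^ k) f) = (integral_op N ^^ k) (lattice_op N f)"
proof (induction k)
  case (Suc k)
  have "lattice_op N ((integral_op N ^^ Suc k) f) = integral_op N (lattice_op N ((integral_op N ^^ k) f))"
    using assms by (simp add: lattice_integral_op_commute bdd_borel_funpow)
  then show ?case by (simp add: Suc)
qed simp

text \<open>Telescoping \<open>L\<^sup>k - J\<^sup>k = L (L\<^bsup>k-1\<^esup> - J\<^bsup>k-1\<^esup>) + J\<^bsup>k-1\<^esup> (L - J)\<close>.\<close>

lemma lattice_minus_integral_op_funpow_le: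
  assumes h: "bdd_borel h" and B: "\<And>c. 0 \<le> c \<Longrightarrow> \<bar>lattice_op N h c - integral_op N h c\<bar> \<le> B" and c: "0 \<le> c"
  shows "\<bar>(lattice_op N ^^ k) h c - (integral_op N ^^ k) h c\<bar> \<le> real k * ((2 * real N + 1) ^ (k - 1) * B)"
  using c
proof (induction k arbitrary: c)
  case (Suc k)
  let ?P = "2 * real N + 1"
  let ?L = "(lattice_op N ^^ k) h" and ?J = "(integral_op N ^^ k) h"
  have "lattice_op N ?J c = (integral_op N ^^ k) (lattice_op N h) c"
    by (simp add: lattice_integral_op_funpow_commute[OF h])
  moreover have "integral_op N ?J c = (integral_op N ^^ k) (integral_op N h) c"
    by (simp add: funpow_swap1)
  ultimately have "(lattice_op N ^^ Suc k) h c - (integral_op N ^^ Suc k) h c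
      = lattice_op N (\<lambda>c. ?L c - ?J c) c + (integral_op N ^^ k) (\<lambda>c. lattice_op N h c - integral_op N h c) c"
    using h by (simp add: lattice_op_diff integral_op_funpow_diff bdd_borel_lattice_op bdd_borel_integral_op)
  moreover have "\<bar>lattice_op N (\<lambda>c. ?L c - ?J c) c\<bar> \<le> ?P * (real k * (?P ^ (k - 1) * B))"
    using Suc by (intro lattice_op_abs_le) auto
  moreover have "?P * (real k * (?P ^ (k - 1) * B)) = real k * (?P ^ k * B)"
    by (cases k) (auto simp: algebra_simps)
  moreover have "\<bar>(integral_op N ^^ k) (\<lambda>c. lattice_op N h c - integral_op N h c) c\<bar> \<le> ?P ^ k * B"
    using h B Suc.prems by (intro integral_op_funpow_le) auto
  ultimately show ?case by (simp add: algebra_simps)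
qed simp

definition plane_tail :: "real \<Rightarrow> real \<Rightarrow> real \<Rightarrow> real" where
  "plane_tail a X c = (if c \<le> X then pi * profile_tail a X c else 0)"

definition solid_tail :: "real \<Rightarrow> real \<Rightarrow> nat \<Rightarrow> real \<Rightarrow> real" where
  "solid_tail a X N = integral_op N (integral_op N (integral_op N (integral_op N (profile a X))))"

context
  fixes a X :: real and N :: nat
  assumes a: "a > 0" and X: "X \<ge> 1" and N: "X \<le> (real N)\<^sup>2"
begin

text \<open>\<open>J\<^sup>4\<close> smooths the profile: its radial derivative is the Lipschitz function \<open>-\<pi> J\<^sup>2\<close>, so that the
  midpoint rule applies.\<close>

lemma integral_op_twice_plane_tail: "0 \<le> c \<Longrightarrow> integral_op N (integral_op N (profile a X)) c = plane_tail a X c"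
  using integral_op_profile_twice[OF a X N, of c] integral_op_above[OF a X N, of "integral_op N (profile a X)" c]
    integral_op_above[OF a X N, of "profile a X"]
  by (auto simp: plane_tail_def profile_def)

text \<open>The profile takes values in [0, X], so its tail integral decreases and has Lipschitz
  constant X, also across the point X.\<close>

lemma plane_tail_bounds:
  assumes "0 \<le> c" "c \<le> d"
  shows "0 \<le> plane_tail a X c - plane_tail a X d" "plane_tail a X c - plane_tail a X d \<le> pi * X * (d - c)"
proof -
  have *: "0 \<le> profile_tail a X c - profile_tail a X d" "profile_tail a X c - profile_tail a X d \<le> X * (d - c)"
    if "0 \<le> c" "c \<le> d" "d \<le> X" for c d
    using profile_tail_diff[OF a X that] integral_profile_bounds[OF a X that] by auto
  have z: "profile_tail a X X = 0" by (simp add: profile_tail_def)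
  have "0 \<le> plane_tail a X c - plane_tail a X d \<and> plane_tail a X c - plane_tail a X d \<le> pi * (X * (d - c))"
  proof -
    consider "d \<le> X" | "c \<le> X" "X < d" | "X < c" "X < d" using assms by linarith
    then show ?thesis
    proof cases
      case 1
      then show ?thesis using *[of c d] assms by (simp add: plane_tail_def right_diff_distrib[symmetric])
    next
      case 2
      have "X * (X - c) \<le> X * (d - c)" using 2 X by (intro mult_left_mono) auto
      then have "pi * profile_tail a X c \<le> pi * (X * (d - c))"
        using *[of c X] 2 assms z by (intro mult_left_mono) auto
      then show ?thesis using *[of c X] 2 assms z by (simp add: plane_tail_def)
    next
      case 3
      then show ?thesis using assms X by (simp add: plane_tail_def)
    qed
  qed
  then show "0 \<le> plane_tail a X c - plane_tail a X d" "plane_tail a X c - plane_tail a X d \<le> pi * X * (d - c)"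
    by (auto simp: mult.assoc)
qed

lemma plane_tail_le: "0 \<le> c \<Longrightarrow> 0 \<le> plane_tail a X c \<and> plane_tail a X c \<le> pi * X\<^sup>2"
proof -
  assume c: "0 \<le> c"
  show ?thesis
  proof (cases "c \<le> X")
    case True
    have X0: "plane_tail a X X = 0" by (simp add: plane_tail_def profile_tail_def)
    have "pi * X * (X - c) \<le> pi * X * X" using X c by (intro mult_left_mono) auto
    then have "plane_tail a X c \<le> pi * X * X" using plane_tail_bounds[OF c True] X0 by linarith
    then show ?thesis using plane_tail_bounds[OF c True] X0 by (simp add: power2_eq_square)
  next
    case False
    then show ?thesis by (simp add: plane_tail_def)
  qed
qed

lemma continuous_on_plane_tail: "0 \<le> c \<Longrightarrow> continuous_on {c..d} (plane_tail a X)"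
proof -
  assume c: "0 \<le> c"
  have "(pi * X)-lipschitz_on {c..d} (plane_tail a X)"
  proof (rule lipschitz_onI)
    fix x y assume "x \<in> {c..d}" "y \<in> {c..d}"
    then show "dist (plane_tail a X x) (plane_tail a X y) \<le> pi * X * dist x y"
      using plane_tail_bounds[of x y] plane_tail_bounds[of y x] c
      by (cases "x \<le> y") (auto simp: dist_real_def abs_if)
  qed (use X in simp)
  then show ?thesis by (rule lipschitz_on_continuous_on)
qed

text \<open>The upper limit is free beyond X, where the integrand vanishes; this allows
  differentiation at X and above it.\<close>

lemma solid_tail_eq:
  assumes c: "0 \<le> c" "c \<le> Y" and Y: "X \<le> Y"
  shows "solid_tail a X N c = pi * integral {c..Y} (plane_tail a X)"
proof -
  define F where "F = integral_op N (integral_op N (profile a X))"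
  have FG: "F s = plane_tail a X s" if "0 \<le> s" for s unfolding F_def by (rule integral_op_twice_plane_tail[OF that])
  have "(plane_tail a X has_integral integral {c..Y} (plane_tail a X)) {c..Y}"
    using c by (intro integrable_integral integrable_continuous_real continuous_on_plane_tail)
  then have int: "(F has_integral integral {c..Y} (plane_tail a X)) {c..Y}"
    by (rule has_integral_eq[rotated]) (use FG c in auto)
  have rc: "radial_class N F"
    unfolding F_def by (intro radial_class_integral_op radial_class_profile a X N)
  have supp: "F v = 0" if "Y < v" for v
    using FG[of v] that X Y by (simp add: plane_tail_def)
  show ?thesis
    unfolding solid_tail_def F_def[symmetric] using rc c supp int by (rule integral_op_twice_has_integral)
qed

lemma solid_tail_has_derivative:
  assumes c: "0 \<le> c"
  shows "((\<lambda>y. solid_tail a X N (c + y\<^sup>2)) has_real_derivative - (2 * pi * y * plane_tail a X (c + y\<^sup>2))) (at y)"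
proof -
  \<comment> \<open>Exceeds X as well as c + z^2 for all z in the neighbourhood A of y.\<close>
  define Y where "Y = X + (c + (\<bar>y\<bar> + 1)\<^sup>2)"
  have cont: "continuous_on {0..Y} (plane_tail a X)" by (rule continuous_on_plane_tail) simp
  have int: "plane_tail a X integrable_on {0..Y}" using cont by (rule integrable_continuous_real)
  have eq: "solid_tail a X N v = pi * (integral {0..Y} (plane_tail a X) - integral {0..v} (plane_tail a X))" if "0 \<le> v" "v \<le> Y" for v
    using solid_tail_eq[of v Y] that X c Henstock_Kurzweil_Integration.integral_combine[OF that int]
    by (simp add: Y_def)
  have D: "((\<lambda>v. integral {0..v} (plane_tail a X)) has_real_derivative plane_tail a X (c + y\<^sup>2)) (at (c + y\<^sup>2) within {0..Y})"
  proof (rule integral_has_real_derivative[OF cont])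
    have "y\<^sup>2 \<le> (\<bar>y\<bar> + 1)\<^sup>2" by (simp add: abs_le_square_iff[symmetric])
    then show "c + y\<^sup>2 \<in> {0..Y}" using c X by (simp add: Y_def)
  qed
  define A where "A = {z. \<bar>z\<bar> < \<bar>y\<bar> + 1}"
  have A: "open A" "y \<in> A" unfolding A_def by (auto intro!: open_Collect_less continuous_intros)
  have AY: "c + z\<^sup>2 \<in> {0..Y}" if "z \<in> A" for z
  proof -
    have "\<bar>z\<bar>\<^sup>2 \<le> (\<bar>y\<bar> + 1)\<^sup>2" using that by (intro power_mono) (auto simp: A_def)
    then show ?thesis using c X by (simp add: Y_def)
  qed
  have sq: "((\<lambda>z. c + z\<^sup>2) has_real_derivative 2 * y) (at y within A)"
    by (auto intro!: derivative_eq_intros)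
  \<comment> \<open>If c = y = 0 only the one-sided derivative is available. It suffices, since the
    image of A lies in {0..Y}.\<close>
  have D': "((\<lambda>v. integral {0..v} (plane_tail a X)) has_real_derivative plane_tail a X (c + y\<^sup>2)) (at (c + y\<^sup>2) within (\<lambda>z. c + z\<^sup>2) ` A)"
    using D by (rule DERIV_subset) (use AY in auto)
  have "((\<lambda>v. integral {0..v} (plane_tail a X)) \<circ> (\<lambda>z. c + z\<^sup>2) has_real_derivative plane_tail a X (c + y\<^sup>2) * (2 * y)) (at y within A)"
    by (rule DERIV_image_chain[OF D' sq])
  then have "((\<lambda>z. integral {0..c + z\<^sup>2} (plane_tail a X)) has_real_derivative plane_tail a X (c + y\<^sup>2) * (2 * y)) (at y)"
    unfolding at_within_open[OF A(2) A(1)] o_def .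
  from DERIV_cmult[OF DERIV_diff[OF DERIV_const this], of pi "integral {0..Y} (plane_tail a X)"]
  have "((\<lambda>z. pi * (integral {0..Y} (plane_tail a X) - integral {0..c + z\<^sup>2} (plane_tail a X))) has_real_derivative - (2 * pi * y * plane_tail a X (c + y\<^sup>2))) (at y)"
    by (simp add: mult_ac)
  then show ?thesis
  proof (rule has_field_derivative_transform_within_open[OF _ A])
    show "pi * (integral {0..Y} (plane_tail a X) - integral {0..c + z\<^sup>2} (plane_tail a X)) = solid_tail a X N (c + z\<^sup>2)" if "z \<in> A" for z
      using eq[of "c + z\<^sup>2"] AY[OF that] by simp
  qed
qed

text \<open>Here \<bar>y\<bar> \<le> N = O(sqrt X), the plane tail is O(X^2) and its Lipschitz
  constant O(X). Splitting the difference as in the product rule, each part is O(X^2) times \<bar>z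
  - y\<bar>.\<close>

lemma slope_difference_le:
  assumes c: "0 \<le> c" and N': "(real N)\<^sup>2 \<le> 16 * X" and y: "\<bar>y\<bar> \<le> real N" "\<bar>z - y\<bar> \<le> 1/2"
  shows "\<bar>2 * pi * z * plane_tail a X (c + z\<^sup>2) - 2 * pi * y * plane_tail a X (c + y\<^sup>2)\<bar> \<le> 4000 * X\<^sup>2 * \<bar>z - y\<bar>"
proof -
  have pi2: "pi * pi \<le> 16" using pi_less_4 mult_mono[of pi 4 pi 4] by simp
  have N1: "1 \<le> real N"
  proof -
    have "N \<noteq> 0" using N X by (cases "N = 0") auto
    then show ?thesis by simp
  qed
  have lip: "\<bar>plane_tail a X (c + z\<^sup>2) - plane_tail a X (c + y\<^sup>2)\<bar> \<le> pi * X * \<bar>z\<^sup>2 - y\<^sup>2\<bar>"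
    using plane_tail_bounds[of "c + z\<^sup>2" "c + y\<^sup>2"] plane_tail_bounds[of "c + y\<^sup>2" "c + z\<^sup>2"] c
    by (cases "z\<^sup>2 \<le> y\<^sup>2") (auto simp: abs_if)
  have zN: "\<bar>z\<bar> \<le> 2 * real N" using y N1 by linarith
  have "\<bar>z\<^sup>2 - y\<^sup>2\<bar> = \<bar>z - y\<bar> * \<bar>z + y\<bar>"
    by (simp add: abs_mult[symmetric] power2_eq_square algebra_simps)
  also have "\<dots> \<le> \<bar>z - y\<bar> * (3 * real N)"
    using zN y by (intro mult_left_mono) auto
  finally have sq: "\<bar>z\<^sup>2 - y\<^sup>2\<bar> \<le> \<bar>z - y\<bar> * (3 * real N)" .
  have "2 * pi * z * plane_tail a X (c + z\<^sup>2) - 2 * pi * y * plane_tail a X (c + y\<^sup>2)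
     = 2 * pi * ((z - y) * plane_tail a X (c + y\<^sup>2)) + 2 * pi * (z * (plane_tail a X (c + z\<^sup>2) - plane_tail a X (c + y\<^sup>2)))"
    by (simp add: algebra_simps)
  then have "\<bar>2 * pi * z * plane_tail a X (c + z\<^sup>2) - 2 * pi * y * plane_tail a X (c + y\<^sup>2)\<bar>
     \<le> \<bar>2 * pi * ((z - y) * plane_tail a X (c + y\<^sup>2))\<bar> + \<bar>2 * pi * (z * (plane_tail a X (c + z\<^sup>2) - plane_tail a X (c + y\<^sup>2)))\<bar>"
    by (simp only: abs_triangle_ineq)
  also have "\<dots> \<le> 2 * pi * (\<bar>z - y\<bar> * (pi * X\<^sup>2)) + 2 * pi * (2 * real N * (pi * X * (\<bar>z - y\<bar> * (3 * real N))))"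
  proof (rule add_mono)
    show "\<bar>2 * pi * ((z - y) * plane_tail a X (c + y\<^sup>2))\<bar> \<le> 2 * pi * (\<bar>z - y\<bar> * (pi * X\<^sup>2))"
      unfolding abs_mult using plane_tail_le[of "c + y\<^sup>2"] c by (intro mult_mono) auto
    have "pi * X * \<bar>z\<^sup>2 - y\<^sup>2\<bar> \<le> pi * X * (\<bar>z - y\<bar> * (3 * real N))"
      using sq X by (intro mult_left_mono) auto
    then have "\<bar>plane_tail a X (c + z\<^sup>2) - plane_tail a X (c + y\<^sup>2)\<bar> \<le> pi * X * (\<bar>z - y\<bar> * (3 * real N))"
      using lip by linarith
    then show "\<bar>2 * pi * (z * (plane_tail a X (c + z\<^sup>2) - plane_tail a X (c + y\<^sup>2)))\<bar> \<le> 2 * pi * (2 * real N * (pi * X * (\<bar>z - y\<bar> * (3 * real N))))"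
      unfolding abs_mult using zN by (intro mult_mono) auto
  qed
  also have "2 * pi * (\<bar>z - y\<bar> * (pi * X\<^sup>2)) + 2 * pi * (2 * real N * (pi * X * (\<bar>z - y\<bar> * (3 * real N))))
     = (pi * pi) * (2 * X\<^sup>2 + 12 * X * (real N)\<^sup>2) * \<bar>z - y\<bar>"
    by (simp add: power2_eq_square algebra_simps)
  also have "\<dots> \<le> 16 * (2 * X\<^sup>2 + 12 * X * (16 * X)) * \<bar>z - y\<bar>"
    using pi2 N' X by (intro mult_mono add_mono mult_left_mono) auto
  also have "\<dots> = 3104 * X\<^sup>2 * \<bar>z - y\<bar>" by (simp add: power2_eq_square)
  also have "\<dots> \<le> 4000 * X\<^sup>2 * \<bar>z - y\<bar>" by (intro mult_right_mono) auto
  finally show ?thesis .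
qed

text \<open>On each unit cell the linear Taylor term integrates to 0 by symmetry, and the slope
  varies by at most 4000 X^2 / 2. There are 2 N + 1 cells.\<close>

lemma midpoint_solid_tail:
  assumes c: "0 \<le> c" and N': "(real N)\<^sup>2 \<le> 16 * X"
  shows "\<bar>lattice_op N (solid_tail a X N) c - integral_op N (solid_tail a X N) c\<bar> \<le> (2 * real N + 1) * (2000 * X\<^sup>2)"
proof -
  define f where "f y = solid_tail a X N (c + y\<^sup>2)" for y
  define g where "g y = 2 * pi * y * plane_tail a X (c + y\<^sup>2)" for y
  have f': "(f has_real_derivative - g y) (at y)" for y
    unfolding f_def g_def by (rule solid_tail_has_derivative[OF c])
  have bs: "bdd_borel (solid_tail a X N)"
    unfolding solid_tail_def using bdd_borel_profile[OF a X] by auto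
  have taylor: "\<bar>f y - f (y + \<theta>) - g y * \<theta>\<bar> \<le> 2000 * X\<^sup>2" if y: "\<bar>y\<bar> \<le> real N" and \<theta>: "\<theta> \<in> {-1/2..<1/2}" for y \<theta>
  proof (cases "\<theta> = 0")
    case False
    have D: "((\<lambda>t. f t + g y * t) has_real_derivative (- g t + g y)) (at t)" for t
      using f' by (auto intro!: derivative_eq_intros)
    define l u where "l = min y (y + \<theta>)" and "u = max y (y + \<theta>)"
    have lu: "l < u" "u - l = \<bar>\<theta>\<bar>" "{l, u} = {y, y + \<theta>}" using False by (auto simp: l_def u_def)
    have "\<exists>z>l. z < u \<and> (f u + g y * u) - (f l + g y * l) = (u - l) * (- g z + g y)"
      using lu D by (intro MVT2) auto
    then obtain z where z: "l < z" "z < u" "(f u + g y * u) - (f l + g y * l) = (u - l) * (- g z + g y)" by blast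
    have zy: "\<bar>z - y\<bar> \<le> 1/2" using z(1,2) \<theta> unfolding l_def u_def atLeastLessThan_iff by linarith
    have "\<bar>f y - f (y + \<theta>) - g y * \<theta>\<bar> = \<bar>(f u + g y * u) - (f l + g y * l)\<bar>"
      by (cases "\<theta> > 0") (auto simp: l_def u_def algebra_simps abs_if)
    also have "\<dots> = \<bar>\<theta>\<bar> * \<bar>g z - g y\<bar>"
      unfolding z(3) lu(2) by (simp add: abs_mult abs_minus_commute)
    also have "\<dots> \<le> 1 * (4000 * X\<^sup>2 * \<bar>z - y\<bar>)"
      unfolding g_def using \<theta> y zy by (intro mult_mono slope_difference_le c N') auto
    also have "\<dots> \<le> 1 * (4000 * X\<^sup>2 * (1/2))"
      using zy by (intro mult_left_mono) auto
    finally show ?thesis by simp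
  qed simp
  let ?ind = "indicator {-1/2..<1/2::real} :: real \<Rightarrow> real"
  have bI: "bounded {-1/2..<1/2::real}"
    by (rule bounded_subset[OF bounded_closed_interval[of "-1/2::real" "1/2"]]) auto
  have int_id: "(\<integral>\<theta>. ?ind \<theta> * \<theta> \<partial>lborel) = 0"
  proof -
    have "(\<integral>\<theta>. ?ind \<theta> * \<theta> \<partial>lborel) = (\<integral>\<theta>. \<theta> * indicator {-1/2..1/2::real} \<theta> \<partial>lborel)"
      by (rule integral_cong_AE) (auto intro!: AE_I[where N = "{1/2}"] simp: indicator_def)
    also have "\<dots> = (1/2)\<^sup>2 / 2 - (-1/2)\<^sup>2 / 2"
      by (rule integral_FTC_Icc_real) (auto intro!: derivative_eq_intros)
    finally show ?thesis by (simp add: power2_eq_square)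
  qed
  have id_integrable: "integrable lborel (\<lambda>\<theta>. ?ind \<theta> * \<theta>)"
  proof -
    have "bdd_borel (\<lambda>\<theta>. if \<bar>\<theta>\<bar> \<le> 1 then \<theta> else 0)" unfolding bdd_borel_def
      by (intro conjI exI[of _ 1]) auto
    from integrable_bdd_borel[OF this, of "\<lambda>x. x" "{-1/2..<1/2}"] bI
    have "integrable lborel (\<lambda>\<theta>. ?ind \<theta> * (if \<bar>\<theta>\<bar> \<le> 1 then \<theta> else 0))" by simp
    then show ?thesis by (rule Bochner_Integration.integrable_cong[THEN iffD1, rotated 2]) (auto simp: indicator_def)
  qed
  have f_integrable: "integrable lborel (\<lambda>\<theta>. ?ind \<theta> * f (y + \<theta>))" for y
    unfolding f_def by (rule integrable_bdd_borel[OF bs]) (auto simp: bI)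
  define S where "S \<theta> = (\<Sum>n\<in>{-int N..int N}. f (of_int n) - f (of_int n + \<theta>) - g (of_int n) * \<theta>)" for \<theta>
  have S_integrable: "integrable lborel (\<lambda>\<theta>. ?ind \<theta> * S \<theta>)"
  proof -
    have "integrable lborel (\<lambda>\<theta>. \<Sum>n\<in>{-int N..int N}. ?ind \<theta> * f (of_int n) - ?ind \<theta> * f (of_int n + \<theta>) - g (of_int n) * (?ind \<theta> * \<theta>))"
      by (intro Bochner_Integration.integrable_sum Bochner_Integration.integrable_diff f_integrable integrable_mult_right id_integrable integrable_mult_left integrable_real_indicator) auto
    then show ?thesis unfolding S_def sum_distrib_left by (simp add: algebra_simps)
  qed
  have "(\<integral>\<theta>. ?ind \<theta> * S \<theta> \<partial>lborel) = lattice_op N (solid_tail a X N) c - integral_op N (solid_tail a X N) c"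
  proof -
    have fs_integrable: "integrable lborel (\<lambda>\<theta>. ?ind \<theta> * (\<Sum>n\<in>{-int N..int N}. f (of_int n + \<theta>)))"
      unfolding sum_distrib_left by (intro Bochner_Integration.integrable_sum f_integrable)
    have "(\<lambda>\<theta>. ?ind \<theta> * S \<theta>) = (\<lambda>\<theta>. lattice_op N (solid_tail a X N) c * ?ind \<theta> - ?ind \<theta> * (\<Sum>n\<in>{-int N..int N}. f (of_int n + \<theta>)) - (\<Sum>n\<in>{-int N..int N}. g (of_int n)) * (?ind \<theta> * \<theta>))"
      unfolding S_def sum_subtractf lattice_op_def f_def sum_distrib_right[symmetric]
      by (rule ext) (simp add: algebra_simps)
    then have "(\<integral>\<theta>. ?ind \<theta> * S \<theta> \<partial>lborel) = (\<integral>\<theta>. lattice_op N (solid_tail a X N) c * ?ind \<theta> - ?ind \<theta> * (\<Sum>n\<in>{-int N..int N}. f (of_int n + \<theta>)) - (\<Sum>n\<in>{-int N..int N}. g (of_int n)) * (?ind \<theta> * \<theta>) \<partial>lborel)"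
      by (simp only:)
    also have "\<dots> = (\<integral>\<theta>. lattice_op N (solid_tail a X N) c * ?ind \<theta> \<partial>lborel) - (\<integral>\<theta>. ?ind \<theta> * (\<Sum>n\<in>{-int N..int N}. f (of_int n + \<theta>)) \<partial>lborel) - (\<integral>\<theta>. (\<Sum>n\<in>{-int N..int N}. g (of_int n)) * (?ind \<theta> * \<theta>) \<partial>lborel)"
    proof -
      have "integrable lborel (\<lambda>\<theta>. lattice_op N (solid_tail a X N) c * ?ind \<theta>)"
        by (intro integrable_mult_right integrable_real_indicator) auto
      moreover have "integrable lborel (\<lambda>\<theta>. (\<Sum>n\<in>{-int N..int N}. g (of_int n)) * (?ind \<theta> * \<theta>))"
        by (intro integrable_mult_right id_integrable)
      ultimately show ?thesis
        using fs_integrable by (simp only: Bochner_Integration.integral_diff Bochner_Integration.integrable_diff)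
    qed
    also have "\<dots> = lattice_op N (solid_tail a X N) c - integral_op N (solid_tail a X N) c"
      unfolding integral_op_cells[OF bs] f_def using int_id by simp
    finally show ?thesis .
  qed
  moreover have "\<bar>\<integral>\<theta>. ?ind \<theta> * S \<theta> \<partial>lborel\<bar> \<le> (2 * real N + 1) * (2000 * X\<^sup>2)"
  proof (rule integral_unit_cell_abs_le[OF S_integrable])
    fix \<theta> :: real assume \<theta>: "\<theta> \<in> {-1/2..<1/2}"
    have "\<bar>S \<theta>\<bar> \<le> (\<Sum>n\<in>{-int N..int N}. 2000 * X\<^sup>2)"
      unfolding S_def using \<theta> by (intro order.trans[OF sum_abs sum_mono] taylor) auto
    then show "\<bar>S \<theta>\<bar> \<le> (2 * real N + 1) * (2000 * X\<^sup>2)" by simp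
  qed
  ultimately show ?thesis by simp
qed

end

text \<open>With m = k - 4, L^k - J^k = L^m (L^4 - J^4) + (L^m - J^m) J^4. The four-dimensional
  comparison bounds the first part and the midpoint rule the second. Each further coordinate costs a
  factor O(N), and X^2 \<le> N^4.\<close>

theorem lattice_minus_integral_op_profile:
  fixes a :: real
  assumes a: "a > 0" and k: "k \<ge> 4"
  shows "\<exists>C\<ge>0. \<forall>X N. 1 \<le> X \<longrightarrow> X \<le> (real N)\<^sup>2 \<longrightarrow> (real N)\<^sup>2 \<le> 16 * X \<longrightarrow>
     \<bar>(lattice_op N ^^ k) (profile a X) 0 - (integral_op N ^^ k) (profile a X) 0\<bar> \<le> C * real N ^ k"
proof -
  define C4 where "C4 = 7 + 40 * (16 * (2 + max 1 a powr (1 / a)) * (16 / (1 - progression_exponent a)))"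
  have "progression_exponent a < 1" using a by (simp add: progression_exponent_def)
  then have C4: "0 \<le> C4" by (simp add: C4_def)
  define m where "m = k - 4"
  have km: "k = m + 4" using k by (simp add: m_def)
  show ?thesis
  proof (intro exI[of _ "3 ^ m * C4 + real m * (3 ^ m * 2000)"] conjI allI impI)
    show "0 \<le> 3 ^ m * C4 + real m * (3 ^ m * 2000)" using C4 by simp
    fix X :: real and N :: nat
    assume X: "1 \<le> X" and N: "X \<le> (real N)\<^sup>2" "(real N)\<^sup>2 \<le> 16 * X"
    let ?g = "profile a X"
    have g: "bdd_borel ?g" by (rule bdd_borel_profile[OF a X])
    define h where "h = (integral_op N ^^ 4) ?g"
    have hs: "h = solid_tail a X N" unfolding h_def solid_tail_def by (simp add: eval_nat_numeral)
    have h: "bdd_borel h" unfolding h_def using g by (rule bdd_borel_funpow)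
    have N1: "1 \<le> real N"
    proof -
      have "N \<noteq> 0" using N X by (cases "N = 0") auto
      then show ?thesis by simp
    qed
    have P: "2 * real N + 1 \<le> 3 * real N" using N1 by simp
    have X2: "X\<^sup>2 \<le> real N ^ 4"
      using power_mono[OF N(1), of 2] X by (simp add: power_mult[symmetric])
    have "(lattice_op N ^^ k) ?g 0 - (integral_op N ^^ k) ?g 0
       = (lattice_op N ^^ m) (\<lambda>c. (lattice_op N ^^ 4) ?g c - h c) 0 + ((lattice_op N ^^ m) h 0 - (integral_op N ^^ m) h 0)"
      unfolding km funpow_add o_def lattice_op_funpow_diff h_def by simp
    moreover have "\<bar>(lattice_op N ^^ m) (\<lambda>c. (lattice_op N ^^ 4) ?g c - h c) 0\<bar> \<le> 3 ^ m * C4 * real N ^ k"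
    proof -
      have "\<bar>(lattice_op N ^^ m) (\<lambda>c. (lattice_op N ^^ 4) ?g c - h c) 0\<bar> \<le> (2 * real N + 1) ^ m * (C4 * X\<^sup>2)"
        unfolding h_def C4_def by (intro lattice_op_funpow_le lattice_minus_integral_op_four a X N) auto
      also have "\<dots> \<le> (3 * real N) ^ m * (C4 * real N ^ 4)"
        using P X2 C4 by (intro mult_mono power_mono) auto
      finally show ?thesis by (simp add: km power_mult_distrib power_add mult_ac)
    qed
    moreover have "\<bar>(lattice_op N ^^ m) h 0 - (integral_op N ^^ m) h 0\<bar> \<le> real m * (3 ^ m * 2000) * real N ^ k"
    proof (cases "m = 0")
      case False
      have "\<bar>(lattice_op N ^^ m) h 0 - (integral_op N ^^ m) h 0\<bar> \<le> real m * ((2 * real N + 1) ^ (m - 1) * ((2 * real N + 1) * (2000 * X\<^sup>2)))"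
        by (intro lattice_minus_integral_op_funpow_le h) (auto simp: hs intro!: midpoint_solid_tail a X N)
      also have "\<dots> = real m * ((2 * real N + 1) ^ m * (2000 * X\<^sup>2))"
        using False by (cases m) (auto simp: mult_ac)
      also have "\<dots> \<le> real m * ((3 * real N) ^ m * (2000 * real N ^ 4))"
        using P X2 by (intro mult_mono power_mono) auto
      finally show ?thesis by (simp add: km power_mult_distrib power_add mult_ac)
    qed simp
    ultimately show "\<bar>(lattice_op N ^^ k) ?g 0 - (integral_op N ^^ k) ?g 0\<bar> \<le> (3 ^ m * C4 + real m * (3 ^ m * 2000)) * real N ^ k"
      by (simp add: distrib_right)
  qed
qed

section \<open>Balls in the Heisenberg group\<close>

lemma square_powr: "0 \<le> x \<Longrightarrow> (x\<^sup>2) powr a = x powr (2 * a)" for x a :: real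
  by (cases "x = 0") (auto simp: powr_powr simp flip: powr_numeral)

lemma powr_le_iff_le_powr_inverse:
  fixes x y a :: real
  assumes "0 \<le> x" "0 \<le> y" "0 < a"
  shows "x powr a \<le> y \<longleftrightarrow> x \<le> y powr (1 / a)"
proof
  assume "x powr a \<le> y"
  then have "(x powr a) powr (1 / a) \<le> y powr (1 / a)" using assms by (intro powr_mono2) auto
  then show "x \<le> y powr (1 / a)" using assms by (simp add: powr_powr)
next
  assume "x \<le> y powr (1 / a)"
  then have "x powr a \<le> (y powr (1 / a)) powr a" using assms by (intro powr_mono2) auto
  then show "x powr a \<le> y" using assms by (simp add: powr_powr)
qed

lemma powr_le_powr_iff:
  fixes x y a :: real
  assumes "0 \<le> x" "0 \<le> y" "0 < a"
  shows "x powr a \<le> y powr a \<longleftrightarrow> x \<le> y"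
  using assms by (simp add: powr_le_iff_le_powr_inverse powr_powr)

lemma integer_points_Basis:
  "(z, t) \<in> (integer_points :: 'n::finite heisenberg set) \<longleftrightarrow> (\<forall>b\<in>Basis. z \<bullet> b \<in> \<int>) \<and> t \<in> \<int>"
  by (auto simp: integer_points_def Basis_vec_def inner_axis Basis_complex_def inner_complex_def)

lemma heis_ball_iff:
  assumes "0 < A" "0 < \<alpha>" "0 \<le> R"
  shows "(z, t) \<in> heis_ball \<alpha> A R \<longleftrightarrow>
    (norm z)\<^sup>2 \<le> R\<^sup>2 \<and> \<bar>t\<bar> \<le> A powr (- 2 / \<alpha>) * profile (\<alpha> / 2) (R\<^sup>2) ((norm z)\<^sup>2)"
proof -
  have eq: "norm z powr \<alpha> = ((norm z)\<^sup>2) powr (\<alpha> / 2)" "R powr \<alpha> = (R\<^sup>2) powr (\<alpha> / 2)"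
    using assms by (simp_all add: square_powr)
  have nn: "0 \<le> A * \<bar>t\<bar> powr (\<alpha> / 2)" using assms by simp
  show ?thesis
  proof (cases "(norm z)\<^sup>2 \<le> R\<^sup>2")
    case True
    define D where "D = (R\<^sup>2) powr (\<alpha> / 2) - ((norm z)\<^sup>2) powr (\<alpha> / 2)"
    have D: "0 \<le> D" unfolding D_def using True assms by (simp add: powr_mono2)
    have "(z, t) \<in> heis_ball \<alpha> A R \<longleftrightarrow> \<bar>t\<bar> powr (\<alpha> / 2) \<le> D / A"
      using assms unfolding heis_ball_def by (auto simp: eq D_def field_simps)
    also have "\<dots> \<longleftrightarrow> \<bar>t\<bar> \<le> (D / A) powr (1 / (\<alpha> / 2))"
      using assms D by (intro powr_le_iff_le_powr_inverse) auto
    also have "(D / A) powr (1 / (\<alpha> / 2)) = A powr (- 2 / \<alpha>) * D powr (1 / (\<alpha> / 2))"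
      by (simp add: powr_divide powr_minus_divide)
    also have "D powr (1 / (\<alpha> / 2)) = profile (\<alpha> / 2) (R\<^sup>2) ((norm z)\<^sup>2)"
      using True by (simp add: profile_def D_def)
    finally show ?thesis using True by simp
  next
    case False
    then have "\<not> norm z powr \<alpha> \<le> R powr \<alpha>"
      unfolding eq using assms by (simp add: powr_le_powr_iff)
    then show ?thesis using nn False by (auto simp: heis_ball_def)
  qed
qed

lemma card_integers_abs_le:
  fixes h :: real
  assumes "0 \<le> h"
  shows "finite {t \<in> \<int>. \<bar>t\<bar> \<le> h}" "\<bar>real (card {t \<in> \<int>. \<bar>t\<bar> \<le> h}) - 2 * h\<bar> \<le> 1"
proof -
  have "{t \<in> \<int>. \<bar>t\<bar> \<le> h} = of_int ` {-\<lfloor>h\<rfloor>..\<lfloor>h\<rfloor>}"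
  proof
    show "{t \<in> \<int>. \<bar>t\<bar> \<le> h} \<subseteq> of_int ` {-\<lfloor>h\<rfloor>..\<lfloor>h\<rfloor>}"
    proof
      fix t assume "t \<in> {t \<in> \<int>. \<bar>t\<bar> \<le> h}"
      then obtain k where k: "t = of_int k" "\<bar>real_of_int k\<bar> \<le> h" by (auto elim!: Ints_cases)
      then have "k \<le> \<lfloor>h\<rfloor>" "- k \<le> \<lfloor>h\<rfloor>" by (auto simp: le_floor_iff)
      then show "t \<in> of_int ` {-\<lfloor>h\<rfloor>..\<lfloor>h\<rfloor>}" using k by auto
    qed
    show "of_int ` {-\<lfloor>h\<rfloor>..\<lfloor>h\<rfloor>} \<subseteq> {t \<in> \<int>. \<bar>t\<bar> \<le> h}"
    proof clarify
      fix k assume "k \<in> {-\<lfloor>h\<rfloor>..\<lfloor>h\<rfloor>}"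
      then have "k \<le> \<lfloor>h\<rfloor>" "- k \<le> \<lfloor>h\<rfloor>" by auto
      then have "real_of_int k \<le> h" "real_of_int (- k) \<le> h" by (simp_all only: le_floor_iff)
      then show "real_of_int k \<in> \<int> \<and> \<bar>real_of_int k\<bar> \<le> h" by auto
    qed
  qed
  moreover have "inj_on real_of_int {-\<lfloor>h\<rfloor>..\<lfloor>h\<rfloor>}" by (auto intro: inj_onI)
  moreover have "0 \<le> \<lfloor>h\<rfloor>" using assms by simp
  ultimately have *: "finite {t \<in> \<int>. \<bar>t\<bar> \<le> h}" "real (card {t \<in> \<int>. \<bar>t\<bar> \<le> h}) = 2 * of_int \<lfloor>h\<rfloor> + 1"
    by (simp_all add: card_image)
  then show "finite {t \<in> \<int>. \<bar>t\<bar> \<le> h}" by simp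
  show "\<bar>real (card {t \<in> \<int>. \<bar>t\<bar> \<le> h}) - 2 * h\<bar> \<le> 1"
    unfolding *(2) by linarith
qed

lemma card_integer_points_heis_ball:
  fixes A \<alpha> R :: real
  assumes A: "0 < A" and \<alpha>: "0 < \<alpha>" and R: "1 \<le> R" and N: "R\<^sup>2 \<le> (real N)\<^sup>2"
  shows "\<bar>real (card (integer_points \<inter> (heis_ball \<alpha> A R :: 'n::finite heisenberg set)))
      - 2 * A powr (- 2 / \<alpha>) * (lattice_op N ^^ (2 * CARD('n))) (profile (\<alpha> / 2) (R\<^sup>2)) 0\<bar>
    \<le> (2 * real N + 1) ^ (2 * CARD('n))"
proof -
  let ?g = "profile (\<alpha> / 2) (R\<^sup>2)"
  define h where "h z = A powr (- 2 / \<alpha>) * ?g ((norm z)\<^sup>2)" for z :: "complex ^ 'n"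
  define Z where "Z = {z :: complex ^ 'n. (\<forall>b\<in>Basis. z \<bullet> b \<in> \<int>) \<and> (norm z)\<^sup>2 \<le> R\<^sup>2}"
  let ?S = "integer_points \<inter> (heis_ball \<alpha> A R :: 'n heisenberg set)"
  have h0: "0 \<le> h z" for z unfolding h_def by (simp add: profile_def)
  have S: "?S = Sigma Z (\<lambda>z. {t \<in> \<int>. \<bar>t\<bar> \<le> h z})"
    using A \<alpha> R by (auto simp: Z_def h_def heis_ball_iff integer_points_Basis)
  have "finite ?S"
    using A \<alpha> by (intro finite_integer_points compact_imp_bounded compact_heis_ball)
  moreover have "Z \<subseteq> fst ` ?S"
    unfolding S using h0 by force
  ultimately have finZ: "finite Z" by (meson finite_imageI finite_subset)
  have "card ?S = (\<Sum>z\<in>Z. card {t \<in> \<int>. \<bar>t\<bar> \<le> h z})"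
    unfolding S using finZ card_integers_abs_le[OF h0] by (subst card_SigmaI) auto
  then have "\<bar>real (card ?S) - (\<Sum>z\<in>Z. 2 * h z)\<bar> = \<bar>\<Sum>z\<in>Z. real (card {t \<in> \<int>. \<bar>t\<bar> \<le> h z}) - 2 * h z\<bar>"
    by (simp add: sum_subtractf)
  also have "\<dots> \<le> (\<Sum>z\<in>Z. 1)"
    using card_integers_abs_le[OF h0] by (intro order.trans[OF sum_abs sum_mono]) auto
  also have "\<dots> = (lattice_op N ^^ (2 * CARD('n))) (\<lambda>v. if v \<le> R\<^sup>2 then 1 else 0) 0"
    using sum_integer_points_radial[where 'a = "complex ^ 'n", OF N, of "\<lambda>_. 1"] by (simp add: Z_def mult.commute)
  also have "\<dots> \<le> \<bar>\<dots>\<bar>" by (rule abs_ge_self)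
  also have "\<dots> \<le> (2 * real N + 1) ^ (2 * CARD('n)) * 1"
    by (intro lattice_op_funpow_le) auto
  finally have "\<bar>real (card ?S) - (\<Sum>z\<in>Z. 2 * h z)\<bar> \<le> (2 * real N + 1) ^ (2 * CARD('n))" by simp
  moreover have "(\<Sum>z\<in>Z. 2 * h z) = 2 * A powr (- 2 / \<alpha>) * (\<Sum>z\<in>Z. ?g ((norm z)\<^sup>2))"
    by (simp add: h_def sum_distrib_left mult.assoc)
  moreover have "(\<Sum>z\<in>Z. ?g ((norm z)\<^sup>2)) = (lattice_op N ^^ (2 * CARD('n))) ?g 0"
  proof -
    have "(\<lambda>v. if v \<le> R\<^sup>2 then ?g v else 0) = ?g" by (auto simp: profile_def)
    then show ?thesis
      using sum_integer_points_radial[where 'a = "complex ^ 'n", OF N, of ?g] by (simp add: Z_def mult.commute)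
  qed
  ultimately show ?thesis by simp
qed

lemma measure_lebesgue_heis_ball:
  fixes A \<alpha> R :: real
  assumes "0 < A" "0 < \<alpha>"
  shows "(heis_ball \<alpha> A R :: 'n::finite heisenberg set) \<in> sets borel"
    "measure lebesgue (heis_ball \<alpha> A R :: 'n heisenberg set) = measure lborel (heis_ball \<alpha> A R :: 'n heisenberg set)"
proof -
  let ?B = "heis_ball \<alpha> A R :: 'n heisenberg set"
  show "?B \<in> sets borel"
    using assms by (intro borel_closed compact_imp_closed compact_heis_ball)
  then show "measure lebesgue ?B = measure lborel ?B"
    by (intro measure_completion) simp
qed

lemma measure_heis_ball:
  fixes A \<alpha> R :: real
  assumes A: "0 < A" and \<alpha>: "0 < \<alpha>" and R: "1 \<le> R" and N: "R\<^sup>2 \<le> (real N)\<^sup>2"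
  shows "measure lebesgue (heis_ball \<alpha> A R :: 'n::finite heisenberg set)
    = 2 * A powr (- 2 / \<alpha>) * (integral_op N ^^ (2 * CARD('n))) (profile (\<alpha> / 2) (R\<^sup>2)) 0"
proof -
  let ?g = "profile (\<alpha> / 2) (R\<^sup>2)" and ?B = "heis_ball \<alpha> A R :: 'n heisenberg set"
  let ?c = "2 * A powr (- 2 / \<alpha>)"
  have rc: "radial_class N ?g"
    using \<alpha> R N by (intro radial_class_profile) (auto simp: one_le_power)
  have g0: "0 \<le> ?g v" for v by (simp add: profile_def)
  have gm [measurable]: "?g \<in> borel_measurable borel" using rc by (simp add: radial_class_def bdd_borel_def)
  have J0: "0 \<le> (integral_op N ^^ k) ?g v" for k v
    by (induction k arbitrary: v) (auto intro!: integral_op_nonneg g0)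
  have sB: "?B \<in> sets (lborel \<Otimes>\<^sub>M lborel)"
    using measure_lebesgue_heis_ball(1)[where ?'n = 'n, OF A \<alpha>, of R] by (simp only: lborel_prod) simp
  have "emeasure lborel ?B = emeasure (lborel \<Otimes>\<^sub>M lborel) ?B" by (simp only: lborel_prod)
  also have "\<dots> = (\<integral>\<^sup>+z. emeasure lborel (Pair z -` ?B) \<partial>lborel)"
    by (rule lborel.emeasure_pair_measure_alt[OF sB])
  also have "\<dots> = (\<integral>\<^sup>+z. ennreal ?c * ennreal (?g ((norm (z :: complex ^ 'n))\<^sup>2)) \<partial>lborel)"
  proof (rule nn_integral_cong)
    fix z :: "complex ^ 'n"
    define h where "h = A powr (- 2 / \<alpha>) * ?g ((norm z)\<^sup>2)"
    have h0: "0 \<le> h" unfolding h_def by (simp add: profile_def)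
    have mem: "t \<in> Pair z -` ?B \<longleftrightarrow> (norm z)\<^sup>2 \<le> R\<^sup>2 \<and> \<bar>t\<bar> \<le> h" for t
      using A \<alpha> R by (simp add: heis_ball_iff h_def)
    have "emeasure lborel (Pair z -` ?B) = ennreal (2 * h)"
    proof (cases "(norm z)\<^sup>2 \<le> R\<^sup>2")
      case True
      then have "Pair z -` ?B = {-h..h}" using mem by (auto simp: abs_le_iff)
      then show ?thesis using h0 by simp
    next
      case False
      then have "Pair z -` ?B = {}" "h = 0" using mem by (auto simp: h_def profile_def)
      then show ?thesis by simp
    qed
    also have "\<dots> = ennreal ?c * ennreal (?g ((norm z)\<^sup>2))"
      unfolding h_def by (simp add: ennreal_mult[symmetric] g0 mult.assoc)
    finally show "emeasure lborel (Pair z -` ?B) = ennreal ?c * ennreal (?g ((norm z)\<^sup>2))" .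
  qed
  also have "\<dots> = ennreal ?c * (\<integral>\<^sup>+z. ennreal (?g ((norm (z :: complex ^ 'n))\<^sup>2)) \<partial>lborel)"
    by (rule nn_integral_cmult) measurable
  also have "\<dots> = ennreal ?c * ennreal ((integral_op N ^^ (2 * CARD('n))) ?g 0)"
    by (simp add: nn_integral_euclidean_radial[OF rc] mult.commute)
  also have "\<dots> = ennreal (?c * (integral_op N ^^ (2 * CARD('n))) ?g 0)"
    using J0 by (simp add: ennreal_mult)
  finally have "measure lborel ?B = ?c * (integral_op N ^^ (2 * CARD('n))) ?g 0"
    using J0 by (simp add: measure_def)
  then show ?thesis using measure_lebesgue_heis_ball(2)[where ?'n = 'n, OF A \<alpha>, of R] by simp
qed

section \<open>Upper bounds for the discrepancy\<close>

lemma discrepancy_heis_ball_le: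
  fixes A \<alpha> R :: real
  assumes A: "0 < A" and \<alpha>: "0 < \<alpha>" and R: "1 \<le> R" and N: "R\<^sup>2 \<le> (real N)\<^sup>2"
  shows "\<bar>discrepancy (heis_ball \<alpha> A R :: 'n::finite heisenberg set)\<bar>
    \<le> 2 * A powr (- 2 / \<alpha>) * \<bar>(lattice_op N ^^ (2 * CARD('n))) (profile (\<alpha> / 2) (R\<^sup>2)) 0
        - (integral_op N ^^ (2 * CARD('n))) (profile (\<alpha> / 2) (R\<^sup>2)) 0\<bar> + (2 * real N + 1) ^ (2 * CARD('n))"
proof -
  let ?L = "(lattice_op N ^^ (2 * CARD('n))) (profile (\<alpha> / 2) (R\<^sup>2)) 0"
  let ?J = "(integral_op N ^^ (2 * CARD('n))) (profile (\<alpha> / 2) (R\<^sup>2)) 0"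
  let ?c = "2 * A powr (- 2 / \<alpha>)"
  have "\<bar>?c * (?L - ?J)\<bar> = ?c * \<bar>?L - ?J\<bar>" by (simp add: abs_mult)
  then have "\<bar>?c * ?L - ?c * ?J\<bar> = ?c * \<bar>?L - ?J\<bar>" by (simp only: right_diff_distrib)
  then show ?thesis
    using card_integer_points_heis_ball[where ?'n = 'n, OF assms] measure_heis_ball[where ?'n = 'n, OF assms]
    unfolding discrepancy_def by linarith
qed

text \<open>The factor sqrt 2 keeps discs with s up to 2 R^2 inside the box, as averaging the circle
  error uses values of s beyond R^2.\<close>

definition radius_bound :: "real \<Rightarrow> nat" where
  "radius_bound R = nat \<lceil>sqrt 2 * R\<rceil>"

lemma radius_bounds:
  assumes R: "1 \<le> R"
  shows "sqrt 2 * R \<le> real (radius_bound R)" "real (radius_bound R) \<le> 2 * (sqrt 2 * R)"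
    "R\<^sup>2 \<le> (real (radius_bound R))\<^sup>2" "(real (radius_bound R))\<^sup>2 \<le> 16 * R\<^sup>2"
    "real (radius_bound R) \<le> 3 * R" "2 * real (radius_bound R) + 1 \<le> 9 * R"
proof -
  have s: "1 \<le> sqrt (2::real)" "sqrt 2 \<le> 3 / (2::real)"
    by (simp, rule real_le_lsqrt) (auto simp: power2_eq_square)
  have sR: "1 * R \<le> sqrt 2 * R" "sqrt 2 * R \<le> 3 / 2 * R"
    using R s by (auto intro!: mult_right_mono)
  have p: "0 \<le> sqrt 2 * R" using R by simp
  show l: "sqrt 2 * R \<le> real (radius_bound R)" unfolding radius_bound_def by linarith
  have "real (radius_bound R) \<le> sqrt 2 * R + 1" unfolding radius_bound_def using p by linarith
  then show u: "real (radius_bound R) \<le> 2 * (sqrt 2 * R)" using sR R by linarith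
  show r3: "real (radius_bound R) \<le> 3 * R" using u sR by linarith
  then show "2 * real (radius_bound R) + 1 \<le> 9 * R" using R by linarith
  have "R \<le> real (radius_bound R)" using l sR by linarith
  then show "R\<^sup>2 \<le> (real (radius_bound R))\<^sup>2" using R by (intro power_mono) auto
  have "(real (radius_bound R))\<^sup>2 \<le> (4 * R)\<^sup>2" using r3 R by (intro power_mono) auto
  then show "(real (radius_bound R))\<^sup>2 \<le> 16 * R\<^sup>2" by (simp add: power_mult_distrib)
qed

lemma discrepancy_radius_bound_le:
  fixes A \<alpha> R :: real
  assumes A: "0 < A" and \<alpha>: "0 < \<alpha>" and R: "1 \<le> R" and N: "N = radius_bound R"
    and E: "\<bar>(lattice_op N ^^ (2 * CARD('n))) (profile (\<alpha> / 2) (R\<^sup>2)) 0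
        - (integral_op N ^^ (2 * CARD('n))) (profile (\<alpha> / 2) (R\<^sup>2)) 0\<bar> \<le> E"
  shows "\<bar>discrepancy (heis_ball \<alpha> A R :: 'n::finite heisenberg set)\<bar>
    \<le> 2 * A powr (- 2 / \<alpha>) * E + 9 ^ (2 * CARD('n)) * R ^ (2 * CARD('n))"
proof -
  have "(2 * real N + 1) ^ (2 * CARD('n)) \<le> (9 * R) ^ (2 * CARD('n))"
    unfolding N using radius_bounds[OF R] by (intro power_mono) auto
  moreover have "2 * A powr (- 2 / \<alpha>) * \<bar>(lattice_op N ^^ (2 * CARD('n))) (profile (\<alpha> / 2) (R\<^sup>2)) 0
        - (integral_op N ^^ (2 * CARD('n))) (profile (\<alpha> / 2) (R\<^sup>2)) 0\<bar> \<le> 2 * A powr (- 2 / \<alpha>) * E"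
    using E by (intro mult_left_mono) auto
  moreover have "R\<^sup>2 \<le> (real N)\<^sup>2" unfolding N by (rule radius_bounds(3)[OF R])
  ultimately show ?thesis
    using discrepancy_heis_ball_le[where ?'n = 'n, OF A \<alpha> R, of N] unfolding power_mult_distrib[of 9 R] by linarith
qed

lemma discrepancy_bigo_high_dimension:
  assumes A: "0 < A" and \<alpha>: "0 < \<alpha>" and d: "2 \<le> CARD('n)"
  shows "(\<lambda>R. \<bar>discrepancy (heis_ball \<alpha> A R :: 'n::finite heisenberg set)\<bar>) \<in> O[at_top](\<lambda>R. R ^ (2 * CARD('n)))"
proof -
  let ?k = "2 * CARD('n)"
  obtain C where C: "0 \<le> C" "\<And>X N. 1 \<le> X \<Longrightarrow> X \<le> (real N)\<^sup>2 \<Longrightarrow> (real N)\<^sup>2 \<le> 16 * X \<Longrightarrow>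
     \<bar>(lattice_op N ^^ ?k) (profile (\<alpha> / 2) X) 0 - (integral_op N ^^ ?k) (profile (\<alpha> / 2) X) 0\<bar> \<le> C * real N ^ ?k"
    using lattice_minus_integral_op_profile[of "\<alpha> / 2" ?k] \<alpha> d by auto
  show ?thesis
  proof (rule bigoI, rule eventually_at_top_linorderI)
    fix R :: real assume R: "1 \<le> R"
    note rb = radius_bounds[OF R]
    have "\<bar>(lattice_op (radius_bound R) ^^ ?k) (profile (\<alpha> / 2) (R\<^sup>2)) 0 - (integral_op (radius_bound R) ^^ ?k) (profile (\<alpha> / 2) (R\<^sup>2)) 0\<bar>
        \<le> C * real (radius_bound R) ^ ?k"
      using R rb by (intro C) (auto simp: one_le_power)
    also have "\<dots> \<le> C * (3 * R) ^ ?k"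
      using rb C by (intro mult_left_mono power_mono) auto
    finally have "\<bar>discrepancy (heis_ball \<alpha> A R :: 'n heisenberg set)\<bar>
        \<le> 2 * A powr (- 2 / \<alpha>) * (C * (3 * R) ^ ?k) + 9 ^ ?k * R ^ ?k"
      using A \<alpha> R by (intro discrepancy_radius_bound_le) auto
    also have "\<dots> = (2 * A powr (- 2 / \<alpha>) * (C * 3 ^ ?k) + 9 ^ ?k) * R ^ ?k"
      unfolding power_mult_distrib by (simp add: algebra_simps)
    finally show "norm \<bar>discrepancy (heis_ball \<alpha> A R :: 'n heisenberg set)\<bar>
        \<le> (2 * A powr (- 2 / \<alpha>) * (C * 3 ^ ?k) + 9 ^ ?k) * norm (R ^ ?k)"
      using R by simp
  qed
qed

text \<open>For \<alpha> = 2 the profile is the tent, so the difference of sum and integral is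
  \<open>circle_primitive\<close> itself.\<close>

lemma discrepancy_bigo_one_dimension:
  assumes A: "0 < A" and d: "CARD('n) = 1"
  shows "(\<lambda>R. \<bar>discrepancy (heis_ball 2 A R :: 'n::finite heisenberg set)\<bar>) \<in> O[at_top](\<lambda>R. R ^ (2 * CARD('n)))"
proof (rule bigoI, rule eventually_at_top_linorderI)
  fix R :: real assume R: "1 \<le> R"
  note rb = radius_bounds[OF R]
  have s: "1 * 1 \<le> sqrt 2 * R" using R by (intro mult_mono) auto
  have two: "(F ^^ (2 * CARD('n))) f = F (F f)" for F :: "(real \<Rightarrow> real) \<Rightarrow> real \<Rightarrow> real" and f
    by (simp add: d numeral_2_eq_2)
  have tent: "profile 1 X = tent X" for X
    by (auto simp: profile_def tent_def fun_eq_iff)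
  have "\<bar>circle_primitive (radius_bound R) (R\<^sup>2)\<bar> \<le> 50 * (sqrt 2 * R)\<^sup>2"
    using s rb by (intro circle_primitive_le) (auto simp: power_mult_distrib)
  then have "\<bar>(lattice_op (radius_bound R) ^^ (2 * CARD('n))) (profile (2 / 2) (R\<^sup>2)) 0
      - (integral_op (radius_bound R) ^^ (2 * CARD('n))) (profile (2 / 2) (R\<^sup>2)) 0\<bar> \<le> 100 * R\<^sup>2"
    unfolding two by (simp add: tent circle_primitive_def power_mult_distrib)
  then have "\<bar>discrepancy (heis_ball 2 A R :: 'n heisenberg set)\<bar>
      \<le> 2 * A powr (- 2 / 2) * (100 * R\<^sup>2) + 9 ^ (2 * CARD('n)) * R ^ (2 * CARD('n))"
    using A R by (intro discrepancy_radius_bound_le) auto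
  then show "norm \<bar>discrepancy (heis_ball 2 A R :: 'n heisenberg set)\<bar>
      \<le> (2 * A powr (- 2 / 2) * 100 + 9 ^ 2) * norm (R ^ (2 * CARD('n)))"
    by (simp add: d power2_eq_square algebra_simps)
qed

text \<open>For a > 2 the exponent obtained is 2 + 2 (a - 2) / (3 a), which is below the stated 2 +
  2 (a - 2) / (3 a - 2). For a \<le> 2 both are 2.\<close>

lemma disc_exponent_le: "1 < a \<Longrightarrow> 2 * disc_exponent a \<le> 2 + max 0 (\<delta> (2 * a))"
proof -
  assume a: "1 < a"
  have \<delta>: "\<delta> (2 * a) = 2 * ((a - 2) / (3 * a - 2))"
    using a by (simp add: \<delta>_def field_simps)
  have eq: "4 / 3 - 2 / (3 * a) = 1 + (a - 2) / (3 * a)" using a by (simp add: field_simps)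
  have "(a - 2) / (3 * a) \<le> (a - 2) / (3 * a - 2) \<or> (a - 2) / (3 * a) \<le> 0"
  proof (cases "2 \<le> a")
    case True
    then show ?thesis by (intro disjI1 divide_left_mono) auto
  next
    case False
    then show ?thesis using a by (intro disjI2 divide_nonpos_pos) auto
  qed
  moreover have "2 * max 1 (1 + u) \<le> 2 + max 0 (2 * v)" if "u \<le> v \<or> u \<le> 0" for u v :: real
    using that by (auto simp: max_def)
  ultimately show ?thesis unfolding disc_exponent_def \<delta> eq by blast
qed

lemma discrepancy_bigo_plane:
  assumes A: "0 < A" and \<alpha>: "2 < \<alpha>" and d: "CARD('n) = 1"
  shows "(\<lambda>R. \<bar>discrepancy (heis_ball \<alpha> A R :: 'n::finite heisenberg set)\<bar>)
          \<in> O[at_top](\<lambda>R. R powr (2 + max 0 (\<delta> \<alpha>)) * ln R)"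
proof (rule bigoI, rule eventually_at_top_linorderI)
  let ?e = "2 + max 0 (\<delta> \<alpha>)" and ?c = "2 * A powr (- 2 / \<alpha>)"
  \<comment> \<open>From 3 on ln R \<ge> 1, so that the term R^2 is absorbed.\<close>
  fix R :: real assume R3: "3 \<le> R"
  then have R: "1 \<le> R" by simp
  note rb = radius_bounds[OF R]
  let ?N = "radius_bound R"
  have two: "(F ^^ (2 * CARD('n))) f = F (F f)" for F :: "(real \<Rightarrow> real) \<Rightarrow> real \<Rightarrow> real" and f
    by (simp add: d numeral_2_eq_2)
  have R2: "2 \<le> R\<^sup>2" using power_mono[of 3 R 2] R3 by simp
  have "exp 1 \<le> R" using exp_le R3 by linarith
  then have ln1: "1 \<le> ln R" using R ln_ge_iff[of R 1] by simp
  have s: "sqrt (2 * R\<^sup>2) = sqrt 2 * R" using R by (simp add: real_sqrt_mult)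
  have "\<bar>lattice_op ?N (lattice_op ?N (profile (\<alpha> / 2) (R\<^sup>2))) 0 - integral_op ?N (integral_op ?N (profile (\<alpha> / 2) (R\<^sup>2))) 0\<bar>
     \<le> 6000000 * (\<alpha> / 2) * (R\<^sup>2) powr disc_exponent (\<alpha> / 2) * ln (R\<^sup>2)"
    using rb R2 \<alpha> by (intro lattice_minus_integral_plane_profile) (auto simp: s)
  then have E: "\<bar>(lattice_op ?N ^^ (2 * CARD('n))) (profile (\<alpha> / 2) (R\<^sup>2)) 0
      - (integral_op ?N ^^ (2 * CARD('n))) (profile (\<alpha> / 2) (R\<^sup>2)) 0\<bar> \<le> 6000000 * \<alpha> * R powr (2 * disc_exponent (\<alpha> / 2)) * ln R"
    unfolding two using R by (simp add: square_powr ln_realpow)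
  have "6000000 * \<alpha> * R powr (2 * disc_exponent (\<alpha> / 2)) * ln R \<le> 6000000 * \<alpha> * R powr ?e * ln R"
    using disc_exponent_le[of "\<alpha> / 2"] \<alpha> R ln1 by (intro mult_right_mono mult_left_mono powr_mono) auto
  note E' = order.trans[OF E this]
  have "\<bar>discrepancy (heis_ball \<alpha> A R :: 'n heisenberg set)\<bar>
      \<le> ?c * (6000000 * \<alpha> * R powr ?e * ln R) + 9 ^ (2 * CARD('n)) * R ^ (2 * CARD('n))"
    by (rule discrepancy_radius_bound_le[OF A _ R refl E']) (use \<alpha> in simp)
  moreover have "R ^ (2 * CARD('n)) \<le> R powr ?e * ln R"
  proof -
    have "R powr 2 * 1 \<le> R powr ?e * ln R" using R ln1 by (intro mult_mono powr_mono) auto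
    then show ?thesis using R by (simp add: d powr_numeral)
  qed
  ultimately have "\<bar>discrepancy (heis_ball \<alpha> A R :: 'n heisenberg set)\<bar>
      \<le> (?c * (6000000 * \<alpha>) + 81) * (R powr ?e * ln R)"
    by (simp add: d algebra_simps)
  then show "norm \<bar>discrepancy (heis_ball \<alpha> A R :: 'n heisenberg set)\<bar>
      \<le> (?c * (6000000 * \<alpha>) + 81) * norm (R powr ?e * ln R)"
    using ln1 by simp
qed

section \<open>Scaling of the volume, and optimality for \<alpha> = 2\<close>

lemma measure_heis_ball_scaling:
  fixes A \<alpha> R :: real
  assumes A: "0 < A" and \<alpha>: "0 < \<alpha>" and R: "0 < R"
  shows "measure lebesgue (heis_ball \<alpha> A R :: 'n::finite heisenberg set)
    = R ^ (2 * CARD('n) + 2) * measure lebesgue (heis_ball \<alpha> A 1 :: 'n heisenberg set)"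
proof -
  \<comment> \<open>The Heisenberg dilation: the basis vector whose z-part vanishes is that of t,
    which scales by R^2.\<close>
  define c :: "'n heisenberg \<Rightarrow> real" where "c j = (if fst j = 0 then R\<^sup>2 else R)" for j
  define T :: "'n heisenberg \<Rightarrow> 'n heisenberg" where "T x = (R *\<^sub>R fst x, R\<^sup>2 * snd x)" for x
  have c0: "c j \<noteq> 0" for j using R by (simp add: c_def)
  have Basis: "(Basis :: 'n heisenberg set) = (\<lambda>u. (u, 0)) ` Basis \<union> {(0, 1)}"
    by (simp add: Basis_prod_def)
  have disj: "(\<lambda>u. (u, 0)) ` (Basis :: (complex ^ 'n) set) \<inter> {(0, 1 :: real)} = {}" by auto
  have inj: "inj_on (\<lambda>u. (u, 0 :: real)) (Basis :: (complex ^ 'n) set)" by (auto intro: inj_onI)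
  have cB: "c (u, 0) = R" if "u \<in> Basis" for u using that nonzero_Basis by (auto simp: c_def)
  have T: "(\<lambda>x. 0 + (\<Sum>j\<in>Basis. (c j * (x \<bullet> j)) *\<^sub>R j)) = T"
  proof
    fix x :: "'n heisenberg"
    have "(\<Sum>j\<in>Basis. (c j * (x \<bullet> j)) *\<^sub>R j)
        = (\<Sum>u\<in>Basis. (c (u, 0) * (x \<bullet> (u, 0))) *\<^sub>R (u, 0)) + (c (0, 1) * (x \<bullet> (0, 1))) *\<^sub>R (0, 1)"
      unfolding Basis using disj by (subst sum.union_disjoint) (auto simp: sum.reindex[OF inj])
    also have "(\<Sum>u\<in>Basis. (c (u, 0) * (x \<bullet> (u, 0))) *\<^sub>R (u, 0 :: real)) = (\<Sum>u\<in>Basis. (R * (fst x \<bullet> u)) *\<^sub>R (u, 0))"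
      by (intro sum.cong refl) (simp add: cB inner_prod_def)
    also have "\<dots> = (R *\<^sub>R fst x, 0)"
    proof (rule prod_eqI)
      have "(\<Sum>u\<in>Basis. (R * (fst x \<bullet> u)) *\<^sub>R u) = R *\<^sub>R (\<Sum>u\<in>Basis. (fst x \<bullet> u) *\<^sub>R u)"
        by (simp add: scaleR_sum_right)
      then show "fst (\<Sum>u\<in>Basis. (R * (fst x \<bullet> u)) *\<^sub>R (u, 0 :: real)) = fst (R *\<^sub>R fst x, 0 :: real)"
        by (simp add: fst_sum euclidean_representation)
    qed (simp add: snd_sum)
    finally show "0 + (\<Sum>j\<in>Basis. (c j * (x \<bullet> j)) *\<^sub>R j) = T x"
      by (simp add: T_def c_def inner_prod_def)
  qed
  have "(\<Prod>j\<in>Basis. \<bar>c j\<bar>) = (\<Prod>u\<in>(Basis :: (complex ^ 'n) set). \<bar>c (u, 0)\<bar>) * \<bar>c (0, 1)\<bar>"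
    unfolding Basis using disj by (subst prod.union_disjoint) (auto simp: prod.reindex[OF inj])
  also have "(\<Prod>u\<in>(Basis :: (complex ^ 'n) set). \<bar>c (u, 0)\<bar>) = (\<Prod>u\<in>(Basis :: (complex ^ 'n) set). R)"
    using R by (intro prod.cong refl) (simp add: cB)
  also have "\<dots> * \<bar>c (0, 1)\<bar> = R ^ (2 * CARD('n) + 2)"
    by (simp add: c_def power_add power2_eq_square mult_ac)
  finally have P: "(\<Prod>j\<in>Basis. \<bar>c j\<bar>) = R ^ (2 * CARD('n) + 2)" .
  let ?B = "heis_ball \<alpha> A R :: 'n heisenberg set" and ?B1 = "heis_ball \<alpha> A 1 :: 'n heisenberg set"
  have B: "?B \<in> sets borel" by (rule measure_lebesgue_heis_ball(1)[OF A \<alpha>])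
  have Tm: "T \<in> borel_measurable borel"
    unfolding T_def by (intro borel_measurable_continuous_onI continuous_intros)
  have pre: "T -` ?B = ?B1"
  proof -
    have "T (z, t) \<in> ?B \<longleftrightarrow> (z, t) \<in> ?B1" for z t
    proof -
      have "\<bar>R\<^sup>2 * t\<bar> powr (\<alpha> / 2) = R powr \<alpha> * \<bar>t\<bar> powr (\<alpha> / 2)"
        using R by (simp add: abs_mult powr_mult square_powr)
      then have "norm (R *\<^sub>R z) powr \<alpha> + A * \<bar>R\<^sup>2 * t\<bar> powr (\<alpha> / 2)
         = R powr \<alpha> * (norm z powr \<alpha> + A * \<bar>t\<bar> powr (\<alpha> / 2))"
        using R by (simp only:) (simp add: powr_mult algebra_simps)
      then show ?thesis using R by (simp add: T_def heis_ball_def)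
    qed
    then have "p \<in> T -` ?B \<longleftrightarrow> p \<in> ?B1" for p by (cases p) simp
    then show ?thesis by (rule set_eqI)
  qed
  have "emeasure lborel ?B = emeasure (density (distr lborel borel T) (\<lambda>_. ennreal (\<Prod>j\<in>Basis. \<bar>c j\<bar>))) ?B"
    using lborel_affine_euclidean[of c 0] c0 unfolding T by simp
  also have "\<dots> = ennreal (R ^ (2 * CARD('n) + 2)) * emeasure (distr lborel borel T) ?B"
    unfolding P using B by (simp add: emeasure_density_const)
  also have "emeasure (distr lborel borel T) ?B = emeasure lborel ?B1"
    using B Tm by (simp add: emeasure_distr pre)
  finally have "measure lborel ?B = R ^ (2 * CARD('n) + 2) * measure lborel ?B1"
    using R by (simp add: measure_def enn2real_mult)
  then show ?thesis by (simp add: measure_lebesgue_heis_ball(2)[OF A \<alpha>])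
qed

text \<open>The strict inequality defines an open set that contains 0.\<close>

lemma measure_heis_ball_pos:
  assumes A: "0 < A" and \<alpha>: "0 < \<alpha>"
  shows "0 < measure lebesgue (heis_ball \<alpha> A 1 :: 'n::finite heisenberg set)"
proof (rule ccontr)
  let ?B = "heis_ball \<alpha> A 1 :: 'n heisenberg set"
  assume "\<not> 0 < measure lebesgue ?B"
  then have "measure lebesgue ?B = 0" using measure_nonneg[of lebesgue ?B] by linarith
  moreover have "?B \<in> lmeasurable" using A \<alpha> by (intro lmeasurable_compact compact_heis_ball)
  ultimately have "negligible ?B" by (simp add: negligible_iff_measure)
  let ?U = "{p :: 'n heisenberg. norm (fst p) powr \<alpha> + A * \<bar>snd p\<bar> powr (\<alpha> / 2) < 1}"
  have "?U \<subseteq> ?B" by (auto simp: heis_ball_def)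
  with \<open>negligible ?B\<close> have "negligible ?U" by (rule negligible_subset)
  moreover have "open ?U"
    using \<alpha> by (intro open_Collect_less continuous_intros continuous_on_powr') auto
  moreover have "0 \<in> ?U" using \<alpha> by simp
  ultimately show False using open_not_negligible by blast
qed

text \<open>For rational \<open>A = p / q\<close> the form \<open>\<bar>z\<bar>\<^sup>2 + A \<bar>t\<bar>\<close> takes values in \<open>\<int> / q\<close> at the integer points, so that
  the number of integer points is constant for \<open>j / q \<le> R\<^sup>2 \<le> (j + 1/2) / q\<close> while the volume grows.\<close>

lemma discrepancy_not_smallo:
  assumes A: "0 < A" and rat: "A \<in> \<rat>"
  shows "(\<lambda>R. discrepancy (heis_ball 2 A R :: 'n::finite heisenberg set)) \<notin> o[at_top](\<lambda>R. R ^ (2 * CARD('n)))"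
proof
  let ?d = "CARD('n)"
  let ?B = "\<lambda>R. heis_ball 2 A R :: 'n heisenberg set"
  assume o: "(\<lambda>R. discrepancy (?B R)) \<in> o[at_top](\<lambda>R. R ^ (2 * ?d))"
  obtain p q :: int where q: "0 < q" and Apq: "A = of_int p / of_int q"
    using rat by (auto elim!: Rats_cases')
  define V where "V = measure lebesgue (?B 1)"
  have V: "0 < V" unfolding V_def by (rule measure_heis_ball_pos[OF A]) simp
  \<comment> \<open>Makes the two discrepancies together at most V x^d / (4 q), half of the lower
    bound V x^d / (2 q) for the growth of the volume; the factor 2^d allows for y \<le> 2 x.\<close>
  define \<epsilon> where "\<epsilon> = V / (of_int q * 2 ^ (?d + 3))"
  have \<epsilon>: "0 < \<epsilon>" using V q by (simp add: \<epsilon>_def)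
  obtain R0 where R0: "\<And>R. R0 \<le> R \<Longrightarrow> \<bar>discrepancy (?B R)\<bar> \<le> \<epsilon> * \<bar>R ^ (2 * ?d)\<bar>"
    using landau_o.smallD[OF o \<epsilon>] unfolding eventually_at_top_linorder by auto
  define j :: nat where "j = nat \<lceil>of_int q * (max R0 1)\<^sup>2\<rceil> + 1"
  define r where "r s = sqrt (s / of_int q)" for s :: real
  have rpow: "r s ^ (2 * k) = (s / of_int q) ^ k" if "0 \<le> s" for s k
    using that q by (simp add: r_def power_mult)
  have j1: "1 \<le> real j" by (simp add: j_def)
  have "of_int q * (max R0 1)\<^sup>2 \<le> real j" unfolding j_def by linarith
  then have "(max R0 1)\<^sup>2 \<le> real j / of_int q" using q by (simp add: field_simps)
  then have "max R0 1 \<le> r (real j)" unfolding r_def by (intro real_le_rsqrt)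
  moreover have "r (real j) \<le> r (real j + 1/2)" unfolding r_def using q by (simp add: divide_right_mono)
  ultimately have rR: "R0 \<le> r (real j)" "R0 \<le> r (real j + 1/2)" "0 < r (real j)" "0 < r (real j + 1/2)"
    by auto
  have count: "integer_points \<inter> ?B (r (real j)) = integer_points \<inter> ?B (r (real j + 1/2))"
  proof -
    have "(z, t) \<in> ?B (r (real j)) \<longleftrightarrow> (z, t) \<in> ?B (r (real j + 1/2))" if int: "(z, t) \<in> integer_points" for z t
    proof -
      have norm2: "(norm z)\<^sup>2 = (\<Sum>b\<in>Basis. (z \<bullet> b)\<^sup>2)"
        unfolding power2_norm_eq_inner by (subst euclidean_inner) (simp add: power2_eq_square)
      have "of_int q * ((norm z)\<^sup>2 + A * \<bar>t\<bar>) = of_int q * (\<Sum>b\<in>Basis. (z \<bullet> b)\<^sup>2) + of_int p * \<bar>t\<bar>"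
        using q by (simp add: Apq norm2 field_simps)
      also have "\<dots> \<in> \<int>"
        using int unfolding integer_points_Basis by (intro Ints_add Ints_mult Ints_sum Ints_power Ints_abs) auto
      finally obtain m where m: "of_int q * ((norm z)\<^sup>2 + A * \<bar>t\<bar>) = of_int m" by (auto elim: Ints_cases)
      have "(z, t) \<in> ?B (r s) \<longleftrightarrow> of_int m \<le> s" if "0 < s" for s
      proof -
        have "(r s)\<^sup>2 = s / of_int q" using that q by (simp add: r_def)
        moreover have "0 < r s" using that q by (simp add: r_def)
        ultimately have "(z, t) \<in> ?B (r s) \<longleftrightarrow> (norm z)\<^sup>2 + A * \<bar>t\<bar> \<le> s / of_int q"
          by (simp add: heis_ball_def powr_numeral)
        also have "\<dots> \<longleftrightarrow> of_int q * ((norm z)\<^sup>2 + A * \<bar>t\<bar>) \<le> s"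
          using q by (simp add: pos_le_divide_eq mult.commute)
        finally show ?thesis unfolding m .
      qed
      \<comment> \<open>No integer lies in (j, j + 1/2].\<close>
      moreover have "real_of_int m \<le> real j \<longleftrightarrow> real_of_int m \<le> real j + 1/2"
      proof
        assume "real_of_int m \<le> real j + 1/2"
        then have "real_of_int m < real_of_int (int j + 1)" by simp
        then have "m \<le> int j" by (simp only: of_int_less_iff)
        then show "real_of_int m \<le> real j" by linarith
      qed simp
      ultimately show ?thesis using j1 by simp
    qed
    then show ?thesis by auto
  qed
  have meas: "measure lebesgue (?B (r s)) = V * (s / of_int q) ^ (?d + 1)" if "0 < s" for s
  proof -
    have "0 < r s" using that q by (simp add: r_def)
    then have "measure lebesgue (?B (r s)) = r s ^ (2 * (?d + 1)) * V"
      unfolding V_def using measure_heis_ball_scaling[OF A, of 2 "r s", where ?'n = 'n] by simp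
    then show ?thesis using that rpow[of s "?d + 1"] by simp
  qed
  define x where "x = real j / of_int q"
  define y where "y = (real j + 1/2) / of_int q"
  have xy: "0 < x" "x \<le> y" "y - x = 1 / (2 * of_int q)" "y \<le> 2 * x"
    using j1 q by (auto simp: x_def y_def field_simps)
  have "V * y ^ (?d + 1) - V * x ^ (?d + 1) = discrepancy (?B (r (real j))) - discrepancy (?B (r (real j + 1/2)))"
    using meas[of "real j"] meas[of "real j + 1/2"] j1 by (simp add: discrepancy_def count x_def y_def)
  also have "\<dots> \<le> \<bar>discrepancy (?B (r (real j)))\<bar> + \<bar>discrepancy (?B (r (real j + 1/2)))\<bar>" by linarith
  also have "\<dots> \<le> \<epsilon> * x ^ ?d + \<epsilon> * y ^ ?d"
    using R0[OF rR(1)] R0[OF rR(2)] rpow[of "real j" ?d] rpow[of "real j + 1/2" ?d] xy by (simp add: x_def y_def)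
  also have "\<dots> \<le> \<epsilon> * (2 * x) ^ ?d + \<epsilon> * (2 * x) ^ ?d"
    using xy \<epsilon> by (intro add_mono mult_left_mono power_mono) auto
  also have "\<dots> = V / (4 * of_int q) * x ^ ?d"
    using q by (simp add: \<epsilon>_def power_add power_mult_distrib)
  finally have "V * y ^ (?d + 1) - V * x ^ (?d + 1) \<le> V / (4 * of_int q) * x ^ ?d" .
  moreover have "V * (y - x) * x ^ ?d \<le> V * y ^ (?d + 1) - V * x ^ (?d + 1)"
  proof -
    have "y * x ^ ?d \<le> y * y ^ ?d" using xy by (intro mult_left_mono power_mono) auto
    then have "V * (y * x ^ ?d) \<le> V * (y * y ^ ?d)" using V by (rule mult_left_mono[OF _ less_imp_le])
    then show ?thesis by (simp add: algebra_simps)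
  qed
  moreover have "V / (4 * of_int q) * x ^ ?d < V * (y - x) * x ^ ?d"
    unfolding xy(3) using V q xy by (intro mult_strict_right_mono) (auto simp: field_simps)
  ultimately show False by linarith
qed

lemma delta_nonpos: "2 < \<alpha> \<Longrightarrow> \<alpha> \<le> 4 \<Longrightarrow> max 0 (\<delta> \<alpha>) = 0"
  unfolding \<delta>_def by (intro max_absorb1 divide_nonpos_pos) (auto simp: field_simps)

text \<open>The bound proved for d = 2 carries no logarithm; this weakens it to the stated
  form.\<close>

lemma power_bigo_mult_ln: "(\<lambda>R::real. R ^ 4) \<in> O[at_top](\<lambda>R. R ^ 4 * ln R powr (2 / 3))"
proof (rule bigoI, rule eventually_at_top_linorderI)
  fix R :: real assume R: "3 \<le> R"
  have "exp 1 \<le> R" using exp_le R by linarith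
  then have "1 \<le> ln R" using R ln_ge_iff[of R 1] by simp
  then have "1 \<le> ln R powr (2 / 3)" by (intro ge_one_powr_ge_zero) auto
  then have "R ^ 4 * 1 \<le> R ^ 4 * ln R powr (2 / 3)" using R by (intro mult_left_mono) auto
  then show "norm (R ^ 4) \<le> 1 * norm (R ^ 4 * ln R powr (2 / 3))" using R by simp
qed

theorem theorem1p1:
  fixes A :: real
  assumes "A > 0"
  shows
    "(\<forall>\<alpha>>0. \<forall>R>0. measure lebesgue (heis_ball \<alpha> A R :: 'n::finite heisenberg set) =
        R ^ (2 * CARD('n) + 2) * measure lebesgue (heis_ball \<alpha> A 1 :: 'n heisenberg set))
   \<and> (\<lambda>R. \<bar>discrepancy (heis_ball 2 A R :: 'n heisenberg set)\<bar>) \<in> O[at_top](\<lambda>R. R ^ (2 * CARD('n)))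
   \<and> (A \<in> \<rat> \<longrightarrow>
        (\<lambda>R. discrepancy (heis_ball 2 A R :: 'n heisenberg set)) \<notin> o[at_top](\<lambda>R. R ^ (2 * CARD('n))))
   \<and> (CARD('n) = 1 \<longrightarrow> (\<forall>\<alpha>>2.
        (\<lambda>R. \<bar>discrepancy (heis_ball \<alpha> A R :: 'n heisenberg set)\<bar>)
          \<in> O[at_top](\<lambda>R. R powr (2 + max 0 (\<delta> \<alpha>)) * ln R)))
   \<and> (\<forall>\<alpha>. 2 < \<alpha> \<and> \<alpha> \<le> 4 \<longrightarrow> max 0 (\<delta> \<alpha>) = 0)
   \<and> (CARD('n) \<ge> 2 \<longrightarrow> (\<forall>\<alpha>>0.
        (\<lambda>R. \<bar>discrepancy (heis_ball \<alpha> A R :: 'n heisenberg set)\<bar>)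
          \<in> O[at_top](\<lambda>R. if CARD('n) = 2 then R ^ 4 * ln R powr (2 / 3) else R ^ (2 * CARD('n)))))"
proof (intro conjI allI impI)
  show "(\<lambda>R. \<bar>discrepancy (heis_ball 2 A R :: 'n heisenberg set)\<bar>) \<in> O[at_top](\<lambda>R. R ^ (2 * CARD('n)))"
  proof (cases "CARD('n) = 1")
    case True
    then show ?thesis by (rule discrepancy_bigo_one_dimension[OF assms])
  next
    case False
    then have "2 \<le> CARD('n)" using zero_less_card_finite[where ?'a = 'n] by linarith
    then show ?thesis by (intro discrepancy_bigo_high_dimension assms) auto
  qed
next
  fix \<alpha> :: real assume "CARD('n) \<ge> 2" "\<alpha> > 0"
  then have *: "(\<lambda>R. \<bar>discrepancy (heis_ball \<alpha> A R :: 'n heisenberg set)\<bar>) \<in> O[at_top](\<lambda>R. R ^ (2 * CARD('n)))"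
    by (intro discrepancy_bigo_high_dimension assms)
  show "(\<lambda>R. \<bar>discrepancy (heis_ball \<alpha> A R :: 'n heisenberg set)\<bar>)
      \<in> O[at_top](\<lambda>R. if CARD('n) = 2 then R ^ 4 * ln R powr (2 / 3) else R ^ (2 * CARD('n)))"
  proof (cases "CARD('n) = 2")
    case True
    then show ?thesis using landau_o.big_trans[OF _ power_bigo_mult_ln] * by simp
  next
    case False
    then show ?thesis using * by simp
  qed
next
  show "measure lebesgue (heis_ball \<alpha> A R :: 'n::finite heisenberg set) =
      R ^ (2 * CARD('n) + 2) * measure lebesgue (heis_ball \<alpha> A 1 :: 'n heisenberg set)" if "0 < \<alpha>" "0 < R" for \<alpha> R
    by (rule measure_heis_ball_scaling[OF assms that])
next
  show "(\<lambda>R. discrepancy (heis_ball 2 A R :: 'n heisenberg set)) \<notin> o[at_top](\<lambda>R. R ^ (2 * CARD('n)))" if "A \<in> \<rat>"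
    by (rule discrepancy_not_smallo[OF assms that])
next
  show "(\<lambda>R. \<bar>discrepancy (heis_ball \<alpha> A R :: 'n heisenberg set)\<bar>)
      \<in> O[at_top](\<lambda>R. R powr (2 + max 0 (\<delta> \<alpha>)) * ln R)" if "CARD('n) = 1" "2 < \<alpha>" for \<alpha>
    by (rule discrepancy_bigo_plane[OF assms that(2,1)])
qed (simp add: delta_nonpos)

end
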